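(* Let $R$ be a Noetherian ring and let $M$ be a finitely generated $R$-module. Suppose that at least one of the following holds: (i) $R$ is torsion free over $\mathbb{Z}$; or (ii) $R$ is unmixed and generically Gorenstein; or (iii) $M$ is free locally at each associated prime of $R$ (that is, $M_Q$ is a free $R_Q$-module for every associated prime $Q$ of $R$). Then for any embedding (injective $R$-linear map) $g: M\to G$ of $M$ into a free $R$-module $G$ one has $\mathcal{R}(M)\cong\mathcal{R}(g)$ as graded $R$-algebras.
   Context: All rings are commutative with identity. $\mathrm{Sym}(M)$ is the symmetric algebra of the $R$-module $M$; an $R$-linear map $g:M\to N$ induces a graded $R$-algebra map $\mathrm{Sym}(g):\mathrm{Sym}(M)\to\mathrm{Sym}(N)$. The Rees algebra of the map $g$, denoted $\mathcal{R}(g)$, is the graded $R$-algebra which is the image of $\mathrm{Sym}(g)$. The Rees algebra of the module $M$ is $\mathcal{R}(M)=\mathrm{Sym}(M)/\bigcap_g L_g$, where the intersection is over all $R$-linear maps $g$ from $M$ to free $R$-modules and $L_g=\ker \mathrm{Sym}(g)$. "$R$ is torsion free over $\mathbb{Z}$" means that every nonzero integer acts as a nonzerodivisor on $R$. "Unmixed" means that every associated prime of $R$ is a minimal prime; "generically Gorenstein" means that $R_Q$ is Gorenstein for every minimal prime $Q$ of $R$. *)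

theory Defs
  imports "HOL-Algebra.Algebra" "HOL-Library.Infinite_Typeclass"
begin

section \<open>Modules\<close>

definition linear_maps ::
    "('a, 'r) ring_scheme \<Rightarrow> ('a, 'm, 's) module_scheme \<Rightarrow> ('a, 'n, 't) module_scheme \<Rightarrow> ('m \<Rightarrow> 'n) set"
  where "linear_maps R M N = {f \<in> carrier M \<rightarrow> carrier N.
    (\<forall>x\<in>carrier M. \<forall>y\<in>carrier M. f (x \<oplus>\<^bsub>M\<^esub> y) = f x \<oplus>\<^bsub>N\<^esub> f y) \<and>
    (\<forall>r\<in>carrier R. \<forall>x\<in>carrier M. f (r \<odot>\<^bsub>M\<^esub> x) = r \<odot>\<^bsub>N\<^esub> f x)}"

definition finitely_generated_module :: "('a, 'r) ring_scheme \<Rightarrow> ('a, 'm, 's) module_scheme \<Rightarrow> bool"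
  where "finitely_generated_module R M \<longleftrightarrow> module R M \<and>
    (\<exists>B. finite B \<and> B \<subseteq> carrier M \<and>
      (\<forall>x\<in>carrier M. \<exists>c\<in>B \<rightarrow> carrier R. x = (\<Oplus>\<^bsub>M\<^esub>b\<in>B. c b \<odot>\<^bsub>M\<^esub> b)))"

definition free_module :: "('a, 'r) ring_scheme \<Rightarrow> ('a, 'm, 's) module_scheme \<Rightarrow> bool"
  where "free_module R M \<longleftrightarrow> module R M \<and>
    (\<exists>B\<subseteq>carrier M. \<forall>x\<in>carrier M.
      \<exists>!c. c \<in> B \<rightarrow> carrier R \<and> (\<forall>b. b \<notin> B \<longrightarrow> c b = \<zero>\<^bsub>R\<^esub>) \<and>
           finite {b \<in> B. c b \<noteq> \<zero>\<^bsub>R\<^esub>} \<and>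
           x = (\<Oplus>\<^bsub>M\<^esub>b\<in>{b \<in> B. c b \<noteq> \<zero>\<^bsub>R\<^esub>}. c b \<odot>\<^bsub>M\<^esub> b))"

definition self_module :: "('a, 'r) ring_scheme \<Rightarrow> ('a, 'a) module"
  where "self_module R =
    \<lparr>carrier = carrier R, monoid.mult = monoid.mult R, one = one R,
     ring.zero = ring.zero R, ring.add = ring.add R, smult = monoid.mult R\<rparr>"


section \<open>Localization\<close>

text \<open>The fraction \<open>m / s\<close>, as an equivalence class of pairs. The operations on fractions below
  are given, as for \<^const>\<open>rcoset_mult\<close>, by the union of the (equal) classes obtained from
  all choices of representatives.\<close>

definition fraction ::
    "('a, 'r) ring_scheme \<Rightarrow> 'a set \<Rightarrow> ('a, 'm, 's) module_scheme \<Rightarrow> 'm \<Rightarrow> 'a \<Rightarrow> ('m \<times> 'a) set"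
  where "fraction R S M m s = {(n, t). n \<in> carrier M \<and> t \<in> S \<and>
    (\<exists>u\<in>S. u \<odot>\<^bsub>M\<^esub> (t \<odot>\<^bsub>M\<^esub> m) = u \<odot>\<^bsub>M\<^esub> (s \<odot>\<^bsub>M\<^esub> n))}"

text \<open>The fields \<^const>\<open>monoid.mult\<close> and \<^const>\<open>one\<close> of a module record play no role for modules.\<close>

definition localized_module ::
    "('a, 'r) ring_scheme \<Rightarrow> 'a set \<Rightarrow> ('a, 'm, 's) module_scheme \<Rightarrow> (('a \<times> 'a) set, ('m \<times> 'a) set) module"
  where "localized_module R S M =
    \<lparr>carrier = {fraction R S M m s | m s. m \<in> carrier M \<and> s \<in> S},
     monoid.mult = undefined,
     one = undefined,
     ring.zero = fraction R S M \<zero>\<^bsub>M\<^esub> \<one>\<^bsub>R\<^esub>,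
     ring.add = (\<lambda>V W. \<Union>(m, s)\<in>V. \<Union>(n, t)\<in>W.
       fraction R S M (t \<odot>\<^bsub>M\<^esub> m \<oplus>\<^bsub>M\<^esub> s \<odot>\<^bsub>M\<^esub> n) (s \<otimes>\<^bsub>R\<^esub> t)),
     smult = (\<lambda>A V. \<Union>(a, t)\<in>A. \<Union>(m, s)\<in>V. fraction R S M (a \<odot>\<^bsub>M\<^esub> m) (t \<otimes>\<^bsub>R\<^esub> s))\<rparr>"

definition localized_ring :: "('a, 'r) ring_scheme \<Rightarrow> 'a set \<Rightarrow> ('a \<times> 'a) set ring"
  where "localized_ring R S = (let L = localized_module R S (self_module R) in
    \<lparr>carrier = carrier L, monoid.mult = smult L, one = fraction R S (self_module R) \<one>\<^bsub>R\<^esub> \<one>\<^bsub>R\<^esub>,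
     ring.zero = ring.zero L, ring.add = ring.add L\<rparr>)"

abbreviation ring_at :: "('a, 'r) ring_scheme \<Rightarrow> 'a set \<Rightarrow> ('a \<times> 'a) set ring"
  where "ring_at R Q \<equiv> localized_ring R (carrier R - Q)"

abbreviation module_at ::
    "('a, 'r) ring_scheme \<Rightarrow> 'a set \<Rightarrow> ('a, 'm, 's) module_scheme \<Rightarrow> (('a \<times> 'a) set, ('m \<times> 'a) set) module"
  where "module_at R Q M \<equiv> localized_module R (carrier R - Q) M"


section \<open>Conditions on the ring\<close>

definition torsion_free_over_int :: "('a, 'r) ring_scheme \<Rightarrow> bool"
  where "torsion_free_over_int R \<longleftrightarrow>
    (\<forall>k::int. k \<noteq> 0 \<longrightarrow> (\<forall>x\<in>carrier R. [k] \<cdot>\<^bsub>R\<^esub> x = \<zero>\<^bsub>R\<^esub> \<longrightarrow> x = \<zero>\<^bsub>R\<^esub>))"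

definition associated_prime :: "('a, 'r) ring_scheme \<Rightarrow> 'a set \<Rightarrow> bool"
  where "associated_prime R Q \<longleftrightarrow> primeideal Q R \<and>
    (\<exists>x\<in>carrier R. Q = {r \<in> carrier R. r \<otimes>\<^bsub>R\<^esub> x = \<zero>\<^bsub>R\<^esub>})"

definition minimal_prime :: "('a, 'r) ring_scheme \<Rightarrow> 'a set \<Rightarrow> bool"
  where "minimal_prime R Q \<longleftrightarrow> primeideal Q R \<and> (\<forall>P. primeideal P R \<and> P \<subseteq> Q \<longrightarrow> P = Q)"

definition unmixed :: "('a, 'r) ring_scheme \<Rightarrow> bool"
  where "unmixed R \<longleftrightarrow> (\<forall>Q. associated_prime R Q \<longrightarrow> minimal_prime R Q)"

text \<open>The modules \<open>N\<close> and \<open>N'\<close> against which \<open>E\<close> is tested range over all modules carried by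
  the type \<^typ>\<open>'a + 'e\<close>. This type contains copies of \<open>A\<close> and of its ideals, so that, by Baer's
  criterion, allowing further carrier types would not change the notion.\<close>

definition injective_module :: "('a, 'r) ring_scheme \<Rightarrow> ('a, 'e) module \<Rightarrow> bool"
  where "injective_module A E \<longleftrightarrow> module A E \<and>
    (\<forall>(N :: ('a, 'a + 'e) module) (N' :: ('a, 'a + 'e) module).
      module A N \<and> module A N' \<longrightarrow>
      (\<forall>f\<in>linear_maps A N N'. inj_on f (carrier N) \<longrightarrow>
        (\<forall>h\<in>linear_maps A N E. \<exists>k\<in>linear_maps A N' E. \<forall>x\<in>carrier N. k (f x) = h x)))"

text \<open>Existence of a finite injective resolution
  \<open>0 \<rightarrow> N \<rightarrow> E 0 \<rightarrow> E 1 \<rightarrow> \<dots> \<rightarrow> E n \<rightarrow> 0\<close>; it is padded with zero modules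
  beyond \<open>n\<close>. As there is no quantification over types, the type \<^typ>\<open>'e\<close> that carries the
  modules of the resolution is a parameter. A theorem with such a hypothesis for an arbitrary
  \<^typ>\<open>'e\<close> covers resolutions by modules of any size.\<close>

definition finite_injective_dimension ::
    "'e itself \<Rightarrow> ('a, 'r) ring_scheme \<Rightarrow> ('a, 'm, 's) module_scheme \<Rightarrow> bool"
  where "finite_injective_dimension U A N \<longleftrightarrow>
    (\<exists>(E :: nat \<Rightarrow> ('a, 'e) module) \<epsilon> d n.
      (\<forall>i. injective_module A (E i)) \<and>
      (\<forall>i>n. carrier (E i) = {\<zero>\<^bsub>E i\<^esub>}) \<and>
      \<epsilon> \<in> linear_maps A N (E 0) \<and> inj_on \<epsilon> (carrier N) \<and>
      (\<forall>i. d i \<in> linear_maps A (E i) (E (Suc i))) \<and>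
      a_kernel (E 0) (E (Suc 0)) (d 0) = \<epsilon> ` carrier N \<and>
      (\<forall>i. a_kernel (E (Suc i)) (E (Suc (Suc i))) (d (Suc i)) = d i ` carrier (E i)))"

definition local_ring :: "('a, 'r) ring_scheme \<Rightarrow> bool"
  where "local_ring A \<longleftrightarrow> cring A \<and> (\<exists>!m. maximalideal m A)"

definition gorenstein_local_ring :: "'e itself \<Rightarrow> ('a, 'r) ring_scheme \<Rightarrow> bool"
  where "gorenstein_local_ring U A \<longleftrightarrow>
    local_ring A \<and> noetherian_ring A \<and> finite_injective_dimension U A (self_module A)"

definition generically_gorenstein :: "'e itself \<Rightarrow> ('a, 'r) ring_scheme \<Rightarrow> bool"
  where "generically_gorenstein U R \<longleftrightarrow>
    (\<forall>Q. minimal_prime R Q \<longrightarrow> gorenstein_local_ring U (ring_at R Q))"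


section \<open>Graded algebras\<close>

record ('a, 'b) graded_algebra = "('a, 'b) module" +
  component :: "nat \<Rightarrow> 'b set"

definition quotient_graded_algebra ::
    "('a, 'b, 's) graded_algebra_scheme \<Rightarrow> 'b set \<Rightarrow> ('a, 'b set) graded_algebra"
  where "quotient_graded_algebra A I =
    \<lparr>carrier = carrier (A Quot I), monoid.mult = monoid.mult (A Quot I), one = one (A Quot I),
     ring.zero = ring.zero (A Quot I), ring.add = ring.add (A Quot I),
     smult = (\<lambda>r V. \<Union>x\<in>V. I +>\<^bsub>A\<^esub> (r \<odot>\<^bsub>A\<^esub> x)),
     component = (\<lambda>i. (\<lambda>x. I +>\<^bsub>A\<^esub> x) ` component A i)\<rparr>"

definition graded_algebra_isos ::
    "('a, 'r) ring_scheme \<Rightarrow> ('a, 'b, 's) graded_algebra_scheme \<Rightarrow> ('a, 'c, 't) graded_algebra_scheme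
      \<Rightarrow> ('b \<Rightarrow> 'c) set"
  where "graded_algebra_isos R A B = {\<phi> \<in> ring_iso A B.
    (\<forall>r\<in>carrier R. \<forall>x\<in>carrier A. \<phi> (r \<odot>\<^bsub>A\<^esub> x) = r \<odot>\<^bsub>B\<^esub> \<phi> x) \<and>
    (\<forall>i. \<phi> ` component A i = component B i)}"


section \<open>Symmetric algebras\<close>

text \<open>The polynomial algebra \<open>R[X\<^sub>i | i \<in> I]\<close>, graded by total degree, on the indexed
  polynomials of the library, which are not equipped with a multiplication there.\<close>

definition polynomial_algebra ::
    "('a, 'r) ring_scheme \<Rightarrow> 'i set \<Rightarrow> ('a, 'i multiset \<Rightarrow> 'a) graded_algebra"
  where "polynomial_algebra R I =
    \<lparr>carrier = ring.indexed_pset R I (carrier R),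
     monoid.mult = (\<lambda>p q w. \<Oplus>\<^bsub>R\<^esub>u\<in>{u. u \<subseteq># w}. p u \<otimes>\<^bsub>R\<^esub> q (w - u)),
     one = ring.indexed_const R \<one>\<^bsub>R\<^esub>,
     ring.zero = ring.indexed_const R \<zero>\<^bsub>R\<^esub>,
     ring.add = ring.indexed_padd R,
     smult = (\<lambda>r p w. r \<otimes>\<^bsub>R\<^esub> p w),
     component = (\<lambda>n. {p \<in> ring.indexed_pset R I (carrier R). \<forall>w. p w \<noteq> \<zero>\<^bsub>R\<^esub> \<longrightarrow> size w = n})\<rparr>"

text \<open>\<open>Sym(M)\<close> is the commutative \<open>R\<close>-algebra generated by the elements of \<open>M\<close> subject to the
  relations that make the map \<open>x \<mapsto> X\<^sub>x\<close> \<open>R\<close>-linear.\<close>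

definition linearity_relations ::
    "('a, 'r) ring_scheme \<Rightarrow> ('a, 'm, 's) module_scheme \<Rightarrow> ('m multiset \<Rightarrow> 'a) set"
  where "linearity_relations R M =
    (let P = polynomial_algebra R (carrier M); var = ring.indexed_var R in
      {var (x \<oplus>\<^bsub>M\<^esub> y) \<ominus>\<^bsub>P\<^esub> (var x \<oplus>\<^bsub>P\<^esub> var y) | x y. x \<in> carrier M \<and> y \<in> carrier M} \<union>
      {var (r \<odot>\<^bsub>M\<^esub> x) \<ominus>\<^bsub>P\<^esub> r \<odot>\<^bsub>P\<^esub> var x | r x. r \<in> carrier R \<and> x \<in> carrier M})"

definition sym_ideal ::
    "('a, 'r) ring_scheme \<Rightarrow> ('a, 'm, 's) module_scheme \<Rightarrow> ('m multiset \<Rightarrow> 'a) set"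
  where "sym_ideal R M = Idl\<^bsub>polynomial_algebra R (carrier M)\<^esub> (linearity_relations R M)"

definition Sym ::
    "('a, 'r) ring_scheme \<Rightarrow> ('a, 'm, 's) module_scheme \<Rightarrow> ('a, ('m multiset \<Rightarrow> 'a) set) graded_algebra"
  where "Sym R M = quotient_graded_algebra (polynomial_algebra R (carrier M)) (sym_ideal R M)"

text \<open>The substitution \<open>X\<^sub>x \<mapsto> X\<^bsub>g x\<^esub>\<close>.\<close>

definition rename_variables ::
    "('a, 'r) ring_scheme \<Rightarrow> ('m \<Rightarrow> 'n) \<Rightarrow> ('m multiset \<Rightarrow> 'a) \<Rightarrow> ('n multiset \<Rightarrow> 'a)"
  where "rename_variables R g p =
    (\<lambda>w. \<Oplus>\<^bsub>R\<^esub>u\<in>{u. p u \<noteq> \<zero>\<^bsub>R\<^esub> \<and> image_mset g u = w}. p u)"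

text \<open>The algebra map \<open>Sym(g)\<close> sends the class of \<open>p\<close> to the class of
  \<^term>\<open>rename_variables R g p\<close>; the classes in the union coincide for all \<open>p \<in> Y\<close>.\<close>

definition Sym_map ::
    "('a, 'r) ring_scheme \<Rightarrow> ('a, 'm, 's) module_scheme \<Rightarrow> ('a, 'n, 't) module_scheme \<Rightarrow> ('m \<Rightarrow> 'n)
      \<Rightarrow> ('m multiset \<Rightarrow> 'a) set \<Rightarrow> ('n multiset \<Rightarrow> 'a) set"
  where "Sym_map R M N g Y =
    (\<Union>p\<in>Y. sym_ideal R N +>\<^bsub>polynomial_algebra R (carrier N)\<^esub> rename_variables R g p)"


section \<open>Rees algebras\<close>

definition rees_algebra_map ::
    "('a, 'r) ring_scheme \<Rightarrow> ('a, 'm, 's) module_scheme \<Rightarrow> ('a, 'n, 't) module_scheme \<Rightarrow> ('m \<Rightarrow> 'n)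
      \<Rightarrow> ('a, ('n multiset \<Rightarrow> 'a) set) graded_algebra"
  where "rees_algebra_map R M N g = (Sym R N)
    \<lparr>carrier := Sym_map R M N g ` carrier (Sym R M),
     component := (\<lambda>i. Sym_map R M N g ` component (Sym R M) i)\<rparr>"

definition rees_kernel ::
    "('a, 'r) ring_scheme \<Rightarrow> ('a, 'm, 's) module_scheme \<Rightarrow> ('a, 'n, 't) module_scheme \<Rightarrow> ('m \<Rightarrow> 'n)
      \<Rightarrow> ('m multiset \<Rightarrow> 'a) set set"
  where "rees_kernel R M N g = a_kernel (Sym R M) (Sym R N) (Sym_map R M N g)"

text \<open>The intersection ranges over the maps to all free modules carried by the type \<^typ>\<open>'u\<close>.
  For \<open>'u = ('i \<Rightarrow> 'a)\<close> and an index type \<open>'i\<close> these include, up to isomorphism,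
  the free modules of all ranks up to the cardinality of \<open>'i\<close>. If \<open>M\<close> is finitely
  generated, then every map to a free module lands in a direct summand of finite rank, so all
  infinite \<open>'i\<close> give the same intersection as the unrestricted one.\<close>

definition rees_algebra ::
    "'u itself \<Rightarrow> ('a, 'r) ring_scheme \<Rightarrow> ('a, 'm, 's) module_scheme
      \<Rightarrow> ('a, ('m multiset \<Rightarrow> 'a) set set) graded_algebra"
  where "rees_algebra U R M = quotient_graded_algebra (Sym R M)
    (\<Inter>{rees_kernel R M F g | (F :: ('a, 'u) module) g. free_module R F \<and> g \<in> linear_maps R M F})"

end

theory Submission
  imports Defs
begin

text \<open>For linear maps into free modules, \<open>Sym(g)\<close> substitutes linear forms for the variables of a
  polynomial. So the claim is that a polynomial \<open>z\<close> that is killed by substituting the coordinates of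
  the embedding \<open>g\<close> is killed by substituting any functionals \<open>h\<close> of \<open>M\<close>; then \<open>ker Sym(g)\<close> is the
  intersection of all \<open>L\<^sub>h\<close>, and the first isomorphism theorem applies.

  In cases (ii) and (iii) it suffices to show, for each associated prime \<open>Q\<close> of \<open>R\<close>, that for some
  \<open>t \<notin> Q\<close> the functionals \<open>t h\<close> are combinations of the coordinates of \<open>g\<close>: then powers of such
  \<open>t\<close> kill every coefficient of \<open>Sym(h)(z)\<close>, and a nonzero element is annihilated by no element
  outside a suitable associated prime. In case (ii) \<open>R\<^sub>Q\<close> is self-injective, being Artinian with
  finite injective dimension over itself, so functionals extend along the embedding \<open>M\<^sub>Q \<rightarrow> G\<^sub>Q\<close>. In
  case (iii) this embedding splits: \<open>Q\<close> is the annihilator of an element, so linear independence of the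
  images of a basis of \<open>M\<^sub>Q\<close> persists modulo \<open>Q\<close>.

  In case (i) let \<open>z\<close> be homogeneous of degree \<open>n\<close>. All \<open>n\<close>-fold derivatives of \<open>z\<close> along coordinates
  of \<open>g\<close> vanish. After \<open>n - 1\<close> derivatives an element of \<open>M\<close> is left; all coordinates of \<open>g\<close> kill
  it, so it is zero and every functional kills it. Hence the coordinates can be exchanged one at a time for
  the functionals \<open>h\<close>, and torsion freeness recovers \<open>Sym(h)(z)\<close> from its derivatives.\<close>

section \<open>Polynomial algebras\<close>

text \<open>The intersection ranges over free modules on one fixed type, to which \<open>G\<close>
  need not belong. So even the inclusion of the intersection in \<open>ker Sym(g)\<close> takes an
  argument: \<open>g\<close> is factored through a free module of functions on a finite set, which
  does occur in the intersection. For the other inclusion, ideal membership has to become an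
  equation. The relations of \<open>Sym\<close> of a free module are exactly the kernel of the
  substitution that replaces a variable \<open>X_y\<close> by the linear form of the coordinates of
  \<open>y\<close>, so everything can be checked on coefficients. Polynomial rings are never
  localized: what holds after localization is brought back to \<open>R\<close> by clearing finitely
  many denominators. In case (ii) the local ring has one prime \<open>m\<close>, the annihilator of
  a single element \<open>x\<close>. If Baer's criterion holds for the image of a map, an element of
  the image killed by \<open>m\<close> is a multiple of \<open>x\<close>, and hence lifts to an
  element killed by \<open>m\<close>. Extensions can thus be corrected so that they take values in
  the kernel; this carries injectivity from the end of a finite resolution to the ring.\<close>

lemma finite_submultisets: "finite {u. u \<subseteq># w}"
proof (induction w)
  case (add x w)
  have "{u. u \<subseteq># add_mset x w} \<subseteq> {u. u \<subseteq># w} \<union> add_mset x ` {u. u \<subseteq># w}"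
  proof
    fix u assume u: "u \<in> {u. u \<subseteq># add_mset x w}"
    show "u \<in> {u. u \<subseteq># w} \<union> add_mset x ` {u. u \<subseteq># w}"
    proof (cases "x \<in># u")
      case True
      then obtain v where "u = add_mset x v" by (meson multi_member_split)
      then show ?thesis using u by auto
    next
      case False
      then have "u \<subseteq># w"
        using u by (metis diff_single_trivial mem_Collect_eq subset_eq_diff_conv add_mset_add_single)
      then show ?thesis by simp
    qed
  qed
  with add show ?case by (meson finite_Un finite_imageI finite_subset)
qed simp

text \<open>Transports ring structure between record types:
  \<open>quotient_graded_algebra A I\<close> shares the ring fields of \<open>A Quot I\<close> but
  is a different kind of record.\<close>

lemma cring_cong:
  assumes "cring A" "carrier B = carrier A" "monoid.mult B = monoid.mult A" "one B = one A"
    "ring.zero B = ring.zero A" "ring.add B = ring.add A"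
  shows "cring B"
proof -
  interpret cring A by fact
  show ?thesis
    using assms(2-)
    by (intro cringI abelian_groupI comm_monoidI) (auto simp: a_assoc m_assoc l_distr intro: a_comm m_comm add.l_inv_ex)
qed

context cring
begin

abbreviation polys :: "'i set \<Rightarrow> ('i multiset \<Rightarrow> 'a) set"
  where "polys I \<equiv> indexed_pset I (carrier R)"

lemma polys_coeff [simp, intro]: "p \<in> polys I \<Longrightarrow> p w \<in> carrier R"
  using indexed_pset_in_carrier[OF subset_refl] unfolding carrier_coeff_def by blast

lemma polys_finite_support: "p \<in> polys I \<Longrightarrow> finite {w. p w \<noteq> \<zero>}"
proof (induction rule: indexed_pset.induct)
  case (indexed_const k)
  then show ?case
    by (auto simp: indexed_const_def intro: finite_subset[of _ "{{#}}"])
next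
  case (indexed_padd p q)
  then show ?case
    by (auto simp: indexed_padd_def intro!: finite_subset[of _ "{w. p w \<noteq> \<zero>} \<union> {w. q w \<noteq> \<zero>}"])
next
  case (indexed_pmult p i)
  have "{w. indexed_pmult p i w \<noteq> \<zero>} \<subseteq> add_mset i ` {w. p w \<noteq> \<zero>}"
    by (auto simp: indexed_pmult_def image_iff split: if_splits) (metis insert_DiffM)
  then show ?case using indexed_pmult by (meson finite_surj)
qed

lemma polys_support: "p \<in> polys I \<Longrightarrow> p w \<noteq> \<zero> \<Longrightarrow> set_mset w \<subseteq> I"
proof (induction arbitrary: w rule: indexed_pset.induct)
  case (indexed_const k)
  then show ?case by (auto simp: indexed_const_def split: if_splits)
next
  case (indexed_padd p q)
  then show ?case by (auto simp: indexed_padd_def) (metis l_zero subsetD zero_closed)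
next
  case (indexed_pmult p i)
  show ?case
  proof (cases "i \<in># w")
    case True
    then obtain v where "w = add_mset i v" by (meson multi_member_split)
    then show ?thesis using indexed_pmult by (auto simp: indexed_pmult_def)
  qed (use indexed_pmult in \<open>simp add: indexed_pmult_def\<close>)
qed

lemma indexed_pmult_add_mset [simp]: "indexed_pmult p i (add_mset i w) = p w"
  by (simp add: indexed_pmult_def)

text \<open>Folded name for the anonymous product in \<open>polynomial_algebra\<close>. Multisets
  are monomials, so the sum runs over the divisors \<open>u\<close> of the monomial
  \<open>w\<close>.\<close>

definition pconv :: "('i multiset \<Rightarrow> 'a) \<Rightarrow> ('i multiset \<Rightarrow> 'a) \<Rightarrow> 'i multiset \<Rightarrow> 'a"
  where "pconv p q = (\<lambda>w. \<Oplus>u\<in>{u. u \<subseteq># w}. p u \<otimes> q (w - u))"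

definition pscale :: "'a \<Rightarrow> ('i multiset \<Rightarrow> 'a) \<Rightarrow> 'i multiset \<Rightarrow> 'a"
  where "pscale r p = (\<lambda>w. r \<otimes> p w)"

lemma polynomial_algebra_simps [simp]:
  "carrier (polynomial_algebra R I) = polys I"
  "monoid.mult (polynomial_algebra R I) = pconv"
  "one (polynomial_algebra R I) = indexed_const \<one>"
  "ring.zero (polynomial_algebra R I) = indexed_const \<zero>"
  "ring.add (polynomial_algebra R I) = indexed_padd"
  "smult (polynomial_algebra R I) = pscale"
  by (simp_all add: polynomial_algebra_def pconv_def[abs_def] pscale_def[abs_def])

lemma indexed_const_closed [simp, intro]: "k \<in> carrier R \<Longrightarrow> indexed_const k \<in> polys I"
  by (rule indexed_pset.indexed_const)

lemma indexed_padd_closed [simp, intro]: "p \<in> polys I \<Longrightarrow> q \<in> polys I \<Longrightarrow> indexed_padd p q \<in> polys I"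
  by (rule indexed_pset.indexed_padd)

lemma indexed_pmult_closed [simp, intro]: "p \<in> polys I \<Longrightarrow> i \<in> I \<Longrightarrow> indexed_pmult p i \<in> polys I"
  by (rule indexed_pset.indexed_pmult)

lemma indexed_var_closed [simp, intro]: "i \<in> I \<Longrightarrow> indexed_var i \<in> polys I"
  unfolding indexed_var_def by simp

lemma pscale_const: "k \<in> carrier R \<Longrightarrow> r \<in> carrier R \<Longrightarrow> pscale r (indexed_const k) = indexed_const (r \<otimes> k)"
  by (auto simp: pscale_def indexed_const_def)

lemma pscale_pmult: "r \<in> carrier R \<Longrightarrow> pscale r (indexed_pmult p i) = indexed_pmult (pscale r p) i"
  by (auto simp: pscale_def indexed_pmult_def)

lemma pscale_padd: "r \<in> carrier R \<Longrightarrow> p \<in> polys I \<Longrightarrow> q \<in> polys I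
    \<Longrightarrow> pscale r (indexed_padd p q) = indexed_padd (pscale r p) (pscale r q)"
  by (auto simp: pscale_def indexed_padd_def r_distr fun_eq_iff)

lemma pscale_closed [simp, intro]: "p \<in> polys I \<Longrightarrow> r \<in> carrier R \<Longrightarrow> pscale r p \<in> polys I"
  by (induction rule: indexed_pset.induct) (simp_all add: pscale_const pscale_pmult pscale_padd)

text \<open>The map \<open>u \<mapsto> w - u\<close> exchanges complementary divisors of
  \<open>w\<close>, hence reindexes the sum.\<close>

lemma pconv_comm:
  fixes p q :: "'i multiset \<Rightarrow> 'a"
  assumes "p \<in> polys I" "q \<in> polys I"
  shows "pconv p q = pconv q p"
proof
  fix w :: "'i multiset"
  have dd: "w - (w - u) = u" if "u \<subseteq># w" for u
    using that by (simp add: multiset_eq_iff subseteq_mset_def)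
  have inj: "inj_on (\<lambda>u. w - u) {u. u \<subseteq># w}"
    by (rule inj_onI) (metis mem_Collect_eq dd)
  have img: "(\<lambda>u. w - u) ` {u. u \<subseteq># w} = {u. u \<subseteq># w}"
    by (auto simp: image_iff) (metis dd diff_subset_eq_self)
  have "pconv p q w = (\<Oplus>u\<in>(\<lambda>u. w - u) ` {u. u \<subseteq># w}. p u \<otimes> q (w - u))"
    by (simp add: pconv_def img)
  also have "\<dots> = (\<Oplus>u\<in>{u. u \<subseteq># w}. p (w - u) \<otimes> q (w - (w - u)))"
    using assms by (intro finsum_reindex inj) auto
  also have "\<dots> = pconv q p w"
    unfolding pconv_def using assms[THEN polys_coeff]
    by (intro finsum_cong') (auto simp: m_comm dd)
  finally show "pconv p q w = pconv q p w" .
qed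

lemma pconv_const: "k \<in> carrier R \<Longrightarrow> q \<in> polys I \<Longrightarrow> pconv (indexed_const k) q = pscale k q"
proof
  fix w assume k: "k \<in> carrier R" and q: "q \<in> polys I"
  have "pconv (indexed_const k) q w = (\<Oplus>u\<in>{{#}}. k \<otimes> q (w - u))"
    unfolding pconv_def using k q
    by (intro add.finprod_mono_neutral_cong_right) (auto simp: finite_submultisets indexed_const_def polys_coeff[OF q])
  then show "pconv (indexed_const k) q w = pscale k q w"
    using k q by (simp add: pscale_def polys_coeff[OF q])
qed

lemma pconv_padd: "p \<in> polys I \<Longrightarrow> p' \<in> polys I \<Longrightarrow> q \<in> polys I
    \<Longrightarrow> pconv (indexed_padd p p') q = indexed_padd (pconv p q) (pconv p' q)"
proof
  fix w assume a: "p \<in> polys I" "p' \<in> polys I" "q \<in> polys I"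
  note c = a[THEN polys_coeff]
  show "pconv (indexed_padd p p') q w = indexed_padd (pconv p q) (pconv p' q) w"
    unfolding pconv_def indexed_padd_def using c
    by (subst finsum_addf[symmetric]) (auto simp: l_distr intro!: finsum_cong')
qed

text \<open>Only divisors containing \<open>i\<close> contribute, and removing one \<open>i\<close>
  from each reindexes the sum. With \<open>pconv_const\<close> and \<open>pconv_padd\<close> this
  computes products along the generation of \<open>polys I\<close> by constants, sums and variables;
  closure, associativity and multiplicativity of evaluation follow by that induction, without double
  sums.\<close>

lemma pconv_pmult: "p \<in> polys I \<Longrightarrow> q \<in> polys I
    \<Longrightarrow> pconv (indexed_pmult p i) q = indexed_pmult (pconv p q) i"
proof
  fix w assume a: "p \<in> polys I" "q \<in> polys I"
  note c = a[THEN polys_coeff]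
  show "pconv (indexed_pmult p i) q w = indexed_pmult (pconv p q) i w"
  proof (cases "i \<in># w")
    case True
    then obtain v where w: "w = add_mset i v" by (meson multi_member_split)
    have sub: "add_mset i ` {u. u \<subseteq># v} \<subseteq> {u. u \<subseteq># w}" using w by auto
    have z: "indexed_pmult p i u = \<zero>" if "u \<in> {u. u \<subseteq># w} - add_mset i ` {u. u \<subseteq># v}" for u
    proof -
      have "i \<notin># u"
        using that w by (auto simp: image_iff) (metis insert_DiffM mset_subset_eq_add_mset_cancel)
      then show ?thesis by (simp add: indexed_pmult_def)
    qed
    have pc: "indexed_pmult p i u \<in> carrier R" for u
      using c by (simp add: indexed_pmult_def)
    have "pconv (indexed_pmult p i) q w = (\<Oplus>u\<in>add_mset i ` {u. u \<subseteq># v}. indexed_pmult p i u \<otimes> q (w - u))"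
      unfolding pconv_def using sub z c pc
      by (intro add.finprod_mono_neutral_cong_right) (auto simp: finite_submultisets)
    also have "\<dots> = (\<Oplus>u\<in>{u. u \<subseteq># v}. indexed_pmult p i (add_mset i u) \<otimes> q (w - add_mset i u))"
      using c pc by (intro finsum_reindex) (auto simp: inj_on_def)
    also have "\<dots> = pconv p q v" unfolding pconv_def w by simp
    finally show ?thesis by (simp add: w)
  next
    case False
    have "indexed_pmult p i u = \<zero>" if "u \<subseteq># w" for u
      using False that by (auto simp: indexed_pmult_def dest: mset_subset_eqD)
    then have "pconv (indexed_pmult p i) q w = (\<Oplus>u\<in>{u. u \<subseteq># w}. \<zero>)"
      unfolding pconv_def using c by (intro finsum_cong') auto
    then show ?thesis using False by (simp add: indexed_pmult_def)
  qed
qed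

lemma pconv_closed [simp, intro]: "p \<in> polys I \<Longrightarrow> q \<in> polys I \<Longrightarrow> pconv p q \<in> polys I"
  by (induction rule: indexed_pset.induct) (simp_all add: pconv_const pconv_padd pconv_pmult)

lemma pconv_assoc: "p \<in> polys I \<Longrightarrow> q \<in> polys I \<Longrightarrow> r \<in> polys I \<Longrightarrow> pconv (pconv p q) r = pconv p (pconv q r)"
proof (induction rule: indexed_pset.induct)
  case (indexed_const k)
  have "pconv (pscale k q) r = pscale k (pconv q r)"
    unfolding pconv_def pscale_def fun_eq_iff
    using indexed_const polys_coeff[OF indexed_const(2)] polys_coeff[OF indexed_const(3)]
    by (subst finsum_rdistr) (auto simp: finite_submultisets m_assoc intro!: finsum_cong')
  with indexed_const show ?case by (simp add: pconv_const[OF _ pconv_closed] pconv_const)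
next
  case (indexed_padd p p')
  then show ?case by (simp add: pconv_padd[of _ I] pconv_padd[of "pconv p q" I "pconv p' q"])
next
  case (indexed_pmult p i)
  then show ?case by (simp add: pconv_pmult[of _ I] pconv_pmult[of "pconv p q" I])
qed

lemma polynomial_algebra_cring: "cring (polynomial_algebra R I)"
proof (rule cringI)
  show "abelian_group (polynomial_algebra R I)"
  proof (rule abelian_groupI; simp)
    \<comment> \<open>The negative is taken as the multiple by \<open>\<ominus> \<one>\<close>,
      because \<open>polys I\<close> is known to be closed under scalar multiples.\<close>
    show "\<exists>y\<in>polys I. indexed_padd y x = indexed_const \<zero>" if x: "x \<in> polys I" for x
      using x polys_coeff[OF x] pscale_closed[OF x, of "\<ominus> \<one>"]
      by (intro bexI[of _ "pscale (\<ominus> \<one>) x"])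
        (auto simp: indexed_padd_def pscale_def fun_eq_iff indexed_const_def l_minus l_neg)
  qed (auto simp: indexed_padd_def fun_eq_iff indexed_const_def polys_coeff intro!: a_assoc a_comm)
next
  show "comm_monoid (polynomial_algebra R I)"
    by (rule comm_monoidI; simp)
      (auto simp: pconv_assoc pconv_const pscale_def polys_coeff intro: pconv_comm)
qed (simp add: pconv_padd)

lemma indexed_pmult_eq_pconv:
  "p \<in> polys I \<Longrightarrow> i \<in> I \<Longrightarrow> indexed_pmult p i = pconv (indexed_var i) p"
proof -
  assume p: "p \<in> polys I" "i \<in> I"
  have "pscale \<one> p = p" using polys_coeff[OF p(1)] by (simp add: pscale_def)
  with p show ?thesis by (simp add: indexed_var_def pconv_pmult pconv_const)
qed

lemma pscale_eq_pconv: "r \<in> carrier R \<Longrightarrow> p \<in> polys I \<Longrightarrow> pscale r p = pconv (indexed_const r) p"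
  by (simp add: pconv_const)

end

section \<open>Evaluation of polynomials in an algebra\<close>

context ring_hom_cring
begin

definition monomial_value :: "('i \<Rightarrow> 'c) \<Rightarrow> 'i multiset \<Rightarrow> 'c"
  where "monomial_value \<tau> w = (\<Otimes>\<^bsub>S\<^esub>x\<in>set_mset w. \<tau> x [^]\<^bsub>S\<^esub> count w x)"

text \<open>The universal map out of a polynomial ring: \<open>h\<close> acts on coefficients and
  \<open>\<tau>\<close> on variables. Later \<open>h\<close> is the inclusion of the constants in
  another polynomial algebra.\<close>

definition evaluate :: "('i \<Rightarrow> 'c) \<Rightarrow> ('i multiset \<Rightarrow> 'a) \<Rightarrow> 'c"
  where "evaluate \<tau> p = (\<Oplus>\<^bsub>S\<^esub>w\<in>{w. p w \<noteq> \<zero>}. h (p w) \<otimes>\<^bsub>S\<^esub> monomial_value \<tau> w)"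

lemma monomial_value_closed [simp]:
  "\<tau> \<in> set_mset w \<rightarrow> carrier S \<Longrightarrow> monomial_value \<tau> w \<in> carrier S"
  unfolding monomial_value_def by (intro S.finprod_closed) auto

lemma monomial_value_empty [simp]: "monomial_value \<tau> {#} = \<one>\<^bsub>S\<^esub>"
  by (simp add: monomial_value_def)

text \<open>The cases of a new and of an old variable \<open>x\<close> are treated at once by taking
  products over the larger support, where a new \<open>x\<close> has exponent 0 in
  \<open>w\<close>.\<close>

lemma monomial_value_add_mset:
  assumes \<tau>: "\<tau> \<in> set_mset (add_mset x w) \<rightarrow> carrier S"
  shows "monomial_value \<tau> (add_mset x w) = \<tau> x \<otimes>\<^bsub>S\<^esub> monomial_value \<tau> w"
proof -
  let ?A = "set_mset (add_mset x w)"
  have c: "\<tau> y \<in> carrier S" if "y \<in> ?A" for y using \<tau> that by auto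
  have "monomial_value \<tau> w = (\<Otimes>\<^bsub>S\<^esub>y\<in>?A. \<tau> y [^]\<^bsub>S\<^esub> count w y)"
    unfolding monomial_value_def
  proof (intro S.finprod_mono_neutral_cong_left funcsetI S.nat_pow_closed c)
    fix y assume "y \<in> ?A - set_mset w"
    then have "count w y = 0" by (simp add: not_in_iff)
    then show "\<tau> y [^]\<^bsub>S\<^esub> count w y = \<one>\<^bsub>S\<^esub>" by simp
  qed auto
  moreover have "\<tau> x = (\<Otimes>\<^bsub>S\<^esub>y\<in>?A. if y = x then \<tau> y else \<one>\<^bsub>S\<^esub>)"
    by (intro S.finprod_singleton_swap[symmetric] funcsetI c) simp_all
  ultimately have "\<tau> x \<otimes>\<^bsub>S\<^esub> monomial_value \<tau> w
      = (\<Otimes>\<^bsub>S\<^esub>y\<in>?A. if y = x then \<tau> y else \<one>\<^bsub>S\<^esub>) \<otimes>\<^bsub>S\<^esub> (\<Otimes>\<^bsub>S\<^esub>y\<in>?A. \<tau> y [^]\<^bsub>S\<^esub> count w y)"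
    by (rule arg_cong2[where f = "monoid.mult S", rotated])
  also have "\<dots> = (\<Otimes>\<^bsub>S\<^esub>y\<in>?A. (if y = x then \<tau> y else \<one>\<^bsub>S\<^esub>) \<otimes>\<^bsub>S\<^esub> \<tau> y [^]\<^bsub>S\<^esub> count w y)"
  proof (intro S.finprod_multf[symmetric] funcsetI)
    fix y assume y: "y \<in> ?A"
    show "(if y = x then \<tau> y else \<one>\<^bsub>S\<^esub>) \<in> carrier S" using c[OF y] by (cases "y = x") simp_all
    show "\<tau> y [^]\<^bsub>S\<^esub> count w y \<in> carrier S" by (rule S.nat_pow_closed[OF c[OF y]])
  qed
  also have "\<dots> = monomial_value \<tau> (add_mset x w)"
    unfolding monomial_value_def
  proof (intro S.finprod_cong' refl funcsetI)
    fix y assume y: "y \<in> ?A"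
    show "(if y = x then \<tau> y else \<one>\<^bsub>S\<^esub>) \<otimes>\<^bsub>S\<^esub> \<tau> y [^]\<^bsub>S\<^esub> count w y
        = \<tau> y [^]\<^bsub>S\<^esub> count (add_mset x w) y"
      using c[OF y] by (cases "y = x") (simp_all add: S.m_comm)
  qed (rule S.nat_pow_closed[OF c])
  finally show ?thesis by (rule sym)
qed

text \<open>Supports change under sums and products; a common finite index set lets evaluations be
  compared term by term.\<close>

lemma evaluate_superset:
  assumes p: "p \<in> R.polys I" and \<tau>: "\<tau> \<in> I \<rightarrow> carrier S"
    and W: "finite W" "{w. p w \<noteq> \<zero>} \<subseteq> W" "\<And>w. w \<in> W \<Longrightarrow> set_mset w \<subseteq> I"
  shows "evaluate \<tau> p = (\<Oplus>\<^bsub>S\<^esub>w\<in>W. h (p w) \<otimes>\<^bsub>S\<^esub> monomial_value \<tau> w)"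
proof -
  have mv: "monomial_value \<tau> w \<in> carrier S" if "w \<in> W" for w
    using W(3)[OF that] \<tau> by (intro monomial_value_closed) auto
  show ?thesis
    unfolding evaluate_def using W mv R.polys_coeff[OF p]
    by (intro S.add.finprod_mono_neutral_cong_left) auto
qed

lemma evaluate_closed [simp]:
  assumes "p \<in> R.polys I" "\<tau> \<in> I \<rightarrow> carrier S"
  shows "evaluate \<tau> p \<in> carrier S"
  unfolding evaluate_def
proof (intro S.finsum_closed funcsetI S.m_closed)
  fix w assume "w \<in> {w. p w \<noteq> \<zero>}"
  then have "set_mset w \<subseteq> I" using R.polys_support[OF assms(1)] by blast
  then show "monomial_value \<tau> w \<in> carrier S" using assms(2) by (intro monomial_value_closed) auto
qed (use R.polys_coeff[OF assms(1)] in auto)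

lemma evaluate_const [simp]:
  assumes "k \<in> carrier R"
  shows "evaluate \<tau> (R.indexed_const k) = h k"
proof -
  have "evaluate \<tau> (R.indexed_const k)
      = (\<Oplus>\<^bsub>S\<^esub>w\<in>{{#}}. h (R.indexed_const k w) \<otimes>\<^bsub>S\<^esub> monomial_value \<tau> w)"
    using assms R.indexed_const_closed[OF assms, of "{}"]
    by (intro evaluate_superset[of _ "{}"]) (auto simp: R.indexed_const_def)
  then show ?thesis using assms by (simp add: R.indexed_const_def)
qed

lemma evaluate_padd:
  assumes p: "p \<in> R.polys I" and q: "q \<in> R.polys I" and \<tau>: "\<tau> \<in> I \<rightarrow> carrier S"
  shows "evaluate \<tau> (R.indexed_padd p q) = evaluate \<tau> p \<oplus>\<^bsub>S\<^esub> evaluate \<tau> q"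
proof -
  let ?W = "{w. p w \<noteq> \<zero>} \<union> {w. q w \<noteq> \<zero>}"
  have W: "finite ?W" "\<And>w. w \<in> ?W \<Longrightarrow> set_mset w \<subseteq> I"
    using R.polys_finite_support[OF p] R.polys_finite_support[OF q]
      R.polys_support[OF p] R.polys_support[OF q] by auto
  have mv: "monomial_value \<tau> w \<in> carrier S" if "w \<in> ?W" for w
    using W(2)[OF that] \<tau> by (intro monomial_value_closed) auto
  have pq: "R.indexed_padd p q \<in> R.polys I" using p q by simp
  note c = R.polys_coeff[OF p] R.polys_coeff[OF q]
  have "evaluate \<tau> (R.indexed_padd p q)
      = (\<Oplus>\<^bsub>S\<^esub>w\<in>?W. h (R.indexed_padd p q w) \<otimes>\<^bsub>S\<^esub> monomial_value \<tau> w)"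
    by (rule evaluate_superset[OF pq \<tau> W(1) _ W(2)]) (auto simp: R.indexed_padd_def)
  also have "\<dots> = (\<Oplus>\<^bsub>S\<^esub>w\<in>?W. h (p w) \<otimes>\<^bsub>S\<^esub> monomial_value \<tau> w \<oplus>\<^bsub>S\<^esub> h (q w) \<otimes>\<^bsub>S\<^esub> monomial_value \<tau> w)"
    using mv c by (intro S.finsum_cong') (auto simp: R.indexed_padd_def S.l_distr)
  also have "\<dots> = (\<Oplus>\<^bsub>S\<^esub>w\<in>?W. h (p w) \<otimes>\<^bsub>S\<^esub> monomial_value \<tau> w) \<oplus>\<^bsub>S\<^esub> (\<Oplus>\<^bsub>S\<^esub>w\<in>?W. h (q w) \<otimes>\<^bsub>S\<^esub> monomial_value \<tau> w)"
    using mv c by (intro S.finsum_addf) auto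
  also have "\<dots> = evaluate \<tau> p \<oplus>\<^bsub>S\<^esub> evaluate \<tau> q"
    using evaluate_superset[OF p \<tau> W(1) _ W(2)] evaluate_superset[OF q \<tau> W(1) _ W(2)] by simp
  finally show ?thesis .
qed

lemma evaluate_pmult:
  assumes p: "p \<in> R.polys I" and i: "i \<in> I" and \<tau>: "\<tau> \<in> I \<rightarrow> carrier S"
  shows "evaluate \<tau> (R.indexed_pmult p i) = \<tau> i \<otimes>\<^bsub>S\<^esub> evaluate \<tau> p"
proof -
  let ?W = "{w. p w \<noteq> \<zero>}"
  have W: "finite ?W" "\<And>w. w \<in> ?W \<Longrightarrow> set_mset w \<subseteq> I"
    using R.polys_finite_support[OF p] R.polys_support[OF p] by auto
  have mv: "monomial_value \<tau> w \<in> carrier S" if "w \<in> ?W" for w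
    using W(2)[OF that] \<tau> by (intro monomial_value_closed) auto
  have \<tau>w: "\<tau> \<in> set_mset (add_mset i w) \<rightarrow> carrier S" if "w \<in> ?W" for w
    using W(2)[OF that] \<tau> i by auto
  have \<tau>i: "\<tau> i \<in> carrier S" using i \<tau> by auto
  have pi: "R.indexed_pmult p i \<in> R.polys I" using p i by simp
  note c = R.polys_coeff[OF p]
  have W': "set_mset v \<subseteq> I" if v: "v \<in> add_mset i ` ?W" for v
  proof -
    from v obtain w where "w \<in> ?W" "v = add_mset i w" by blast
    then show ?thesis using W(2)[of w] i by simp
  qed
  have sup: "{w. R.indexed_pmult p i w \<noteq> \<zero>} \<subseteq> add_mset i ` ?W"
    by (auto simp: R.indexed_pmult_def image_iff split: if_splits) (metis insert_DiffM)
  have "evaluate \<tau> (R.indexed_pmult p i)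
      = (\<Oplus>\<^bsub>S\<^esub>w\<in>add_mset i ` ?W. h (R.indexed_pmult p i w) \<otimes>\<^bsub>S\<^esub> monomial_value \<tau> w)"
    using W(1) by (intro evaluate_superset[OF pi \<tau> _ sup] W') auto
  also have "\<dots> = (\<Oplus>\<^bsub>S\<^esub>w\<in>?W. h (R.indexed_pmult p i (add_mset i w)) \<otimes>\<^bsub>S\<^esub> monomial_value \<tau> (add_mset i w))"
    using c \<tau>w by (intro S.finsum_reindex) (auto simp: inj_on_def intro!: monomial_value_closed)
  also have "\<dots> = (\<Oplus>\<^bsub>S\<^esub>w\<in>?W. \<tau> i \<otimes>\<^bsub>S\<^esub> (h (p w) \<otimes>\<^bsub>S\<^esub> monomial_value \<tau> w))"
    using mv c \<tau>i by (intro S.finsum_cong') (auto simp: monomial_value_add_mset[OF \<tau>w] S.m_lcomm)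
  also have "\<dots> = \<tau> i \<otimes>\<^bsub>S\<^esub> evaluate \<tau> p"
    unfolding evaluate_def using mv c \<tau>i W(1) by (intro S.finsum_rdistr[symmetric]) auto
  finally show ?thesis .
qed

lemma evaluate_var:
  assumes "i \<in> I" "\<tau> \<in> I \<rightarrow> carrier S"
  shows "evaluate \<tau> (R.indexed_var i) = \<tau> i"
  using assms evaluate_pmult[of "R.indexed_const \<one>" I i \<tau>] unfolding R.indexed_var_def by (auto simp: Pi_iff)

lemma evaluate_pscale:
  assumes "p \<in> R.polys I" "r \<in> carrier R" "\<tau> \<in> I \<rightarrow> carrier S"
  shows "evaluate \<tau> (R.pscale r p) = h r \<otimes>\<^bsub>S\<^esub> evaluate \<tau> p"
  using assms
proof (induction rule: R.indexed_pset.induct)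
  case (indexed_pmult p i)
  then have "\<tau> i \<in> carrier S" by auto
  then show ?case using indexed_pmult
    by (simp add: R.pscale_pmult evaluate_pmult[of _ I] S.m_lcomm)
qed (auto simp: R.pscale_const R.pscale_padd[of _ _ I] evaluate_padd[of _ I] S.r_distr)

lemma evaluate_pconv:
  assumes "p \<in> R.polys I" "q \<in> R.polys I" "\<tau> \<in> I \<rightarrow> carrier S"
  shows "evaluate \<tau> (R.pconv p q) = evaluate \<tau> p \<otimes>\<^bsub>S\<^esub> evaluate \<tau> q"
  using assms
proof (induction rule: R.indexed_pset.induct)
  case (indexed_const k)
  then show ?case by (simp add: R.pconv_const[of _ _ I] evaluate_pscale[of _ I])
next
  case (indexed_padd p p')
  then show ?case
    by (simp add: R.pconv_padd[of _ I] evaluate_padd[of _ I] S.l_distr)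
next
  case (indexed_pmult p i)
  then have "\<tau> i \<in> carrier S" by auto
  then show ?case using indexed_pmult
    by (simp add: R.pconv_pmult[of _ I] evaluate_pmult[of _ I] S.m_assoc)
qed

lemma evaluate_hom:
  assumes "\<tau> \<in> I \<rightarrow> carrier S"
  shows "evaluate \<tau> \<in> ring_hom (polynomial_algebra R I) S"
  using assms by (intro ring_hom_memI) (auto simp: evaluate_pconv[of _ I] evaluate_padd[of _ I])

end

section \<open>Renaming of variables\<close>

context cring
begin

lemma const_hom: "ring_hom_cring R (polynomial_algebra R I) indexed_const"
  using polynomial_algebra_cring
  by (intro ring_hom_cring.intro ring_hom_cring_axioms.intro is_cring ring_hom_memI)
    (auto simp: pconv_const[of _ _ I] pscale_const indexed_padd_const)

lemma rename_variables_const: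
  fixes g :: "'c \<Rightarrow> 'd"
  assumes "k \<in> carrier R"
  shows "rename_variables R g (indexed_const k) = indexed_const k"
proof
  fix w
  have "rename_variables R g (indexed_const k) w
    = (\<Oplus>u\<in>(if w = {#} then {{#}} else {}). indexed_const k (u :: 'c multiset))"
    unfolding rename_variables_def using assms
    by (intro add.finprod_mono_neutral_cong) (auto simp: indexed_const_def split: if_splits)
  then show "rename_variables R g (indexed_const k) w = indexed_const k w"
    using assms by (auto simp: indexed_const_def)
qed

lemma rename_variables_padd:
  assumes p: "p \<in> polys I" and q: "q \<in> polys I"
  shows "rename_variables R g (indexed_padd p q)
    = indexed_padd (rename_variables R g p) (rename_variables R g q)"
proof
  fix w
  let ?W = "{u. (p u \<noteq> \<zero> \<or> q u \<noteq> \<zero>) \<and> image_mset g u = w}"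
  have fin: "finite ?W"
    using polys_finite_support[OF p] polys_finite_support[OF q]
    by (rule_tac finite_subset[of _ "{u. p u \<noteq> \<zero>} \<union> {u. q u \<noteq> \<zero>}"]) auto
  note c = polys_coeff[OF p] polys_coeff[OF q]
  have "rename_variables R g (indexed_padd p q) w = (\<Oplus>u\<in>?W. indexed_padd p q u)"
    unfolding rename_variables_def using fin c
    by (intro add.finprod_mono_neutral_cong_left) (auto simp: indexed_padd_def)
  also have "\<dots> = (\<Oplus>u\<in>?W. p u) \<oplus> (\<Oplus>u\<in>?W. q u)"
    unfolding indexed_padd_def using c by (intro finsum_addf) auto
  also have "(\<Oplus>u\<in>?W. p u) = rename_variables R g p w"
    unfolding rename_variables_def using fin c
    by (intro add.finprod_mono_neutral_cong_right) auto
  also have "(\<Oplus>u\<in>?W. q u) = rename_variables R g q w"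
    unfolding rename_variables_def using fin c
    by (intro add.finprod_mono_neutral_cong_right) auto
  finally show "rename_variables R g (indexed_padd p q) w
    = indexed_padd (rename_variables R g p) (rename_variables R g q) w"
    by (simp add: indexed_padd_def)
qed

lemma rename_variables_pmult:
  assumes p: "p \<in> polys I"
  shows "rename_variables R g (indexed_pmult p i) = indexed_pmult (rename_variables R g p) (g i)"
proof
  fix w
  let ?U = "{u. p u \<noteq> \<zero> \<and> image_mset g (add_mset i u) = w}"
  note c = polys_coeff[OF p]
  have "{u. indexed_pmult p i u \<noteq> \<zero> \<and> image_mset g u = w} = add_mset i ` ?U"
    by (auto simp: image_iff indexed_pmult_def split: if_splits) (metis insert_DiffM image_mset_add_mset)
  then have "rename_variables R g (indexed_pmult p i) w = (\<Oplus>u\<in>add_mset i ` ?U. indexed_pmult p i u)"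
    by (simp add: rename_variables_def)
  also have "\<dots> = (\<Oplus>u\<in>?U. p u)"
    using c by (subst finsum_reindex) (auto simp: inj_on_def)
  also have "\<dots> = indexed_pmult (rename_variables R g p) (g i) w"
  proof (cases "g i \<in># w")
    case True
    then obtain v where w: "w = add_mset (g i) v" by (meson multi_member_split)
    then show ?thesis by (simp add: rename_variables_def)
  next
    case False
    then have "?U = {}" by auto
    then show ?thesis using False by (simp only: indexed_pmult_def) simp
  qed
  finally show "rename_variables R g (indexed_pmult p i) w
    = indexed_pmult (rename_variables R g p) (g i) w" .
qed

lemma rename_variables_closed [simp]:
  assumes "p \<in> polys I" "g \<in> I \<rightarrow> J"
  shows "rename_variables R g p \<in> polys J"
  using assms
  by (induction rule: indexed_pset.induct)
    (auto simp: rename_variables_const rename_variables_padd[of _ I] rename_variables_pmult[of _ I])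

lemma rename_variables_var: "rename_variables R g (indexed_var i) = indexed_var (g i)"
  unfolding indexed_var_def
  by (simp add: rename_variables_pmult[OF indexed_const_closed] rename_variables_const)

lemma rename_variables_pscale:
  assumes "p \<in> polys I" "r \<in> carrier R"
  shows "rename_variables R g (pscale r p) = pscale r (rename_variables R g p)"
proof
  fix w
  have "rename_variables R g (pscale r p) w = (\<Oplus>u\<in>{u. p u \<noteq> \<zero> \<and> image_mset g u = w}. r \<otimes> p u)"
    unfolding rename_variables_def pscale_def
    using polys_coeff[OF assms(1)] assms(2) polys_finite_support[OF assms(1)]
    by (intro add.finprod_mono_neutral_cong_left) auto
  then show "rename_variables R g (pscale r p) w = pscale r (rename_variables R g p) w"
    unfolding rename_variables_def pscale_def
    using polys_coeff[OF assms(1)] assms(2) polys_finite_support[OF assms(1)]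
    by (subst finsum_rdistr) auto
qed

lemma rename_variables_pconv:
  assumes "p \<in> polys I" "q \<in> polys I" "g \<in> I \<rightarrow> J"
  shows "rename_variables R g (pconv p q) = pconv (rename_variables R g p) (rename_variables R g q)"
  using assms
proof (induction rule: indexed_pset.induct)
  case (indexed_const k)
  have "rename_variables R g q \<in> polys J" using indexed_const by auto
  with indexed_const show ?case
    by (simp add: pconv_const[of _ _ I] rename_variables_pscale[of _ I] rename_variables_const pconv_const[of _ _ J])
next
  case (indexed_padd p p')
  have "rename_variables R g p \<in> polys J" "rename_variables R g p' \<in> polys J"
    "rename_variables R g q \<in> polys J" using indexed_padd by auto
  with indexed_padd show ?case
    by (simp add: pconv_padd[of _ I] pconv_padd[of _ J] rename_variables_padd[of _ I])
next
  case (indexed_pmult p i)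
  have "rename_variables R g p \<in> polys J" "rename_variables R g q \<in> polys J"
    using indexed_pmult by auto
  with indexed_pmult show ?case
    by (simp add: pconv_pmult[of _ I] pconv_pmult[of _ J] rename_variables_pmult[of _ I])
qed

lemma rename_variables_hom:
  assumes "g \<in> I \<rightarrow> J"
  shows "ring_hom_ring (polynomial_algebra R I) (polynomial_algebra R J) (rename_variables R g)"
  using assms polynomial_algebra_cring[of I] polynomial_algebra_cring[of J]
  by (intro ring_hom_ringI2 ring_hom_memI)
    (auto simp: cring_def rename_variables_pconv[of _ I _ _ J] rename_variables_padd[of _ I] rename_variables_const)

end

lemma (in ring_hom_cring) evaluate_rename:
  assumes "p \<in> R.polys I" "g \<in> I \<rightarrow> J" "\<tau> \<in> J \<rightarrow> carrier S"
  shows "evaluate \<tau> (rename_variables R g p) = evaluate (\<lambda>i. \<tau> (g i)) p"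
  using assms
proof (induction rule: R.indexed_pset.induct)
  case (indexed_const k)
  then show ?case by (simp add: R.rename_variables_const)
next
  case (indexed_padd p q)
  then have "R.indexed_padd p q \<in> R.polys I" "rename_variables R g p \<in> R.polys J"
    "rename_variables R g q \<in> R.polys J" "(\<lambda>i. \<tau> (g i)) \<in> I \<rightarrow> carrier S" by auto
  with indexed_padd show ?case
    by (simp add: R.rename_variables_padd[of _ I] evaluate_padd[of _ I "_" "(\<lambda>i. \<tau> (g i))"] evaluate_padd[of _ J])
next
  case (indexed_pmult p i)
  then have "rename_variables R g p \<in> R.polys J" "(\<lambda>i. \<tau> (g i)) \<in> I \<rightarrow> carrier S" "g i \<in> J" by auto
  with indexed_pmult show ?case
    by (simp add: R.rename_variables_pmult[of _ I] evaluate_pmult[of _ I] evaluate_pmult[of _ J])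
qed

section \<open>Coordinates with respect to a basis\<close>

text \<open>\<open>free_module\<close> with the basis fixed. Coefficient functions vanish outside
  \<open>B\<close>, so uniqueness concerns the function on the whole type and \<open>coord x\<close>
  can be compared as a function.\<close>

locale module_basis = module +
  fixes B
  assumes basis_subset: "B \<subseteq> carrier M"
    and basis_unique: "x \<in> carrier M \<Longrightarrow>
      \<exists>!c. c \<in> B \<rightarrow> carrier R \<and> (\<forall>b. b \<notin> B \<longrightarrow> c b = \<zero>) \<and> finite {b \<in> B. c b \<noteq> \<zero>} \<and>
           x = (\<Oplus>\<^bsub>M\<^esub>b\<in>{b \<in> B. c b \<noteq> \<zero>}. c b \<odot>\<^bsub>M\<^esub> b)"
begin

definition coord :: "'c \<Rightarrow> 'c \<Rightarrow> 'a"
  where "coord x = (THE c. c \<in> B \<rightarrow> carrier R \<and> (\<forall>b. b \<notin> B \<longrightarrow> c b = \<zero>) \<and> finite {b \<in> B. c b \<noteq> \<zero>} \<and>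
           x = (\<Oplus>\<^bsub>M\<^esub>b\<in>{b \<in> B. c b \<noteq> \<zero>}. c b \<odot>\<^bsub>M\<^esub> b))"

lemma coord_props:
  assumes "x \<in> carrier M"
  shows "coord x \<in> B \<rightarrow> carrier R \<and> (\<forall>b. b \<notin> B \<longrightarrow> coord x b = \<zero>) \<and> finite {b \<in> B. coord x b \<noteq> \<zero>} \<and>
           x = (\<Oplus>\<^bsub>M\<^esub>b\<in>{b \<in> B. coord x b \<noteq> \<zero>}. coord x b \<odot>\<^bsub>M\<^esub> b)"
  unfolding coord_def by (rule theI'[OF basis_unique[OF assms]])

lemma coord_outside: "x \<in> carrier M \<Longrightarrow> b \<notin> B \<Longrightarrow> coord x b = \<zero>"
  using coord_props by blast

lemma coord_closed [simp]: "x \<in> carrier M \<Longrightarrow> coord x b \<in> carrier R"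
  using coord_props[of x] coord_outside[of x b] by (cases "b \<in> B") auto

lemma coord_support_subset: "x \<in> carrier M \<Longrightarrow> {b. coord x b \<noteq> \<zero>} \<subseteq> B"
  using coord_outside by blast

lemma coord_finite: "x \<in> carrier M \<Longrightarrow> finite {b. coord x b \<noteq> \<zero>}"
proof -
  assume x: "x \<in> carrier M"
  then have "{b. coord x b \<noteq> \<zero>} = {b \<in> B. coord x b \<noteq> \<zero>}" using coord_outside by blast
  then show ?thesis using coord_props[OF x] by simp
qed

lemma coord_sum:
  assumes x: "x \<in> carrier M" and C: "finite C" "C \<subseteq> B" "{b. coord x b \<noteq> \<zero>} \<subseteq> C"
  shows "x = (\<Oplus>\<^bsub>M\<^esub>b\<in>C. coord x b \<odot>\<^bsub>M\<^esub> b)"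
proof -
  have "x = (\<Oplus>\<^bsub>M\<^esub>b\<in>{b \<in> B. coord x b \<noteq> \<zero>}. coord x b \<odot>\<^bsub>M\<^esub> b)" using coord_props[OF x] by blast
  also have "\<dots> = (\<Oplus>\<^bsub>M\<^esub>b\<in>C. coord x b \<odot>\<^bsub>M\<^esub> b)"
    using C x basis_subset by (intro M.add.finprod_mono_neutral_cong_left) auto
  finally show ?thesis .
qed

text \<open>The way in which coordinates are computed below: exhibit one finite expansion, whose
  index set \<open>C\<close> may exceed the support. Linearity of coordinates and, for
  localizations, linear independence are obtained from it.\<close>

lemma coord_eqI:
  assumes C: "finite C" "C \<subseteq> B" and c: "c \<in> C \<rightarrow> carrier R" "\<And>b. b \<notin> C \<Longrightarrow> c b = \<zero>"
    and x: "x = (\<Oplus>\<^bsub>M\<^esub>b\<in>C. c b \<odot>\<^bsub>M\<^esub> b)"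
  shows "coord x = c"
proof -
  have cB: "b \<in> carrier M" if "b \<in> C" for b using that C basis_subset by auto
  have xM: "x \<in> carrier M" unfolding x using c cB by (intro M.finsum_closed) auto
  have sub: "{b \<in> B. c b \<noteq> \<zero>} \<subseteq> C" using c(2) by blast
  have "x = (\<Oplus>\<^bsub>M\<^esub>b\<in>{b \<in> B. c b \<noteq> \<zero>}. c b \<odot>\<^bsub>M\<^esub> b)"
    unfolding x using C c cB sub by (intro M.add.finprod_mono_neutral_cong_right) auto
  moreover have "c b \<in> carrier R" for b using c by (cases "b \<in> C") auto
  then have "c \<in> B \<rightarrow> carrier R" by blast
  moreover have "\<forall>b. b \<notin> B \<longrightarrow> c b = \<zero>" using c(2) C(2) by blast
  moreover have "finite {b \<in> B. c b \<noteq> \<zero>}" using sub C(1) by (rule finite_subset)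
  ultimately have "c \<in> B \<rightarrow> carrier R \<and> (\<forall>b. b \<notin> B \<longrightarrow> c b = \<zero>) \<and> finite {b \<in> B. c b \<noteq> \<zero>} \<and>
           x = (\<Oplus>\<^bsub>M\<^esub>b\<in>{b \<in> B. c b \<noteq> \<zero>}. c b \<odot>\<^bsub>M\<^esub> b)"
    by blast
  then show ?thesis unfolding coord_def by (rule the1_equality[OF basis_unique[OF xM]])
qed

lemma coord_add:
  assumes x: "x \<in> carrier M" and y: "y \<in> carrier M"
  shows "coord (x \<oplus>\<^bsub>M\<^esub> y) b = coord x b \<oplus> coord y b"
proof -
  let ?C = "{b. coord x b \<noteq> \<zero>} \<union> {b. coord y b \<noteq> \<zero>}"
  have C: "finite ?C" "?C \<subseteq> B" using x y coord_finite coord_support_subset by auto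
  have cM: "b \<in> carrier M" if "b \<in> ?C" for b using C(2) basis_subset that by blast
  have "x \<oplus>\<^bsub>M\<^esub> y = (\<Oplus>\<^bsub>M\<^esub>b\<in>?C. coord x b \<odot>\<^bsub>M\<^esub> b) \<oplus>\<^bsub>M\<^esub> (\<Oplus>\<^bsub>M\<^esub>b\<in>?C. coord y b \<odot>\<^bsub>M\<^esub> b)"
    using coord_sum[OF x C] coord_sum[OF y C] by simp
  also have "\<dots> = (\<Oplus>\<^bsub>M\<^esub>b\<in>?C. coord x b \<odot>\<^bsub>M\<^esub> b \<oplus>\<^bsub>M\<^esub> coord y b \<odot>\<^bsub>M\<^esub> b)"
    using x y cM by (intro M.finsum_addf[symmetric]) auto
  also have "\<dots> = (\<Oplus>\<^bsub>M\<^esub>b\<in>?C. (coord x b \<oplus> coord y b) \<odot>\<^bsub>M\<^esub> b)"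
    using x y cM by (intro M.finsum_cong') (auto simp: smult_l_distr)
  finally have "coord (x \<oplus>\<^bsub>M\<^esub> y) = (\<lambda>b. coord x b \<oplus> coord y b)"
    using x y by (intro coord_eqI[OF C]) auto
  then show ?thesis by simp
qed

lemma coord_smult:
  assumes x: "x \<in> carrier M" and r: "r \<in> carrier R"
  shows "coord (r \<odot>\<^bsub>M\<^esub> x) b = r \<otimes> coord x b"
proof -
  let ?C = "{b. coord x b \<noteq> \<zero>}"
  have C: "finite ?C" "?C \<subseteq> B" using x coord_finite coord_support_subset by auto
  have cM: "b \<in> carrier M" if "b \<in> ?C" for b using C(2) basis_subset that by blast
  have "r \<odot>\<^bsub>M\<^esub> x = r \<odot>\<^bsub>M\<^esub> (\<Oplus>\<^bsub>M\<^esub>b\<in>?C. coord x b \<odot>\<^bsub>M\<^esub> b)"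
    using coord_sum[OF x C] by simp
  also have "\<dots> = (\<Oplus>\<^bsub>M\<^esub>b\<in>?C. r \<odot>\<^bsub>M\<^esub> (coord x b \<odot>\<^bsub>M\<^esub> b))"
    using x r cM C by (intro finsum_smult_ldistr) auto
  also have "\<dots> = (\<Oplus>\<^bsub>M\<^esub>b\<in>?C. (r \<otimes> coord x b) \<odot>\<^bsub>M\<^esub> b)"
    using x r cM by (intro M.finsum_cong') (auto simp: smult_assoc1)
  finally have "coord (r \<odot>\<^bsub>M\<^esub> x) = (\<lambda>b. r \<otimes> coord x b)"
    using x r by (intro coord_eqI[OF C]) auto
  then show ?thesis by simp
qed

lemma coord_inject:
  assumes "x \<in> carrier M" "y \<in> carrier M" "\<And>b. coord x b = coord y b"
  shows "x = y"
proof -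
  have "coord x = coord y" using assms(3) by blast
  have "x = (\<Oplus>\<^bsub>M\<^esub>b\<in>{b \<in> B. c b \<noteq> \<zero>}. c b \<odot>\<^bsub>M\<^esub> b)" if "c = coord x" for c
    unfolding that by (rule coord_props[OF assms(1), THEN conjunct2, THEN conjunct2, THEN conjunct2])
  from this[OF \<open>coord x = coord y\<close>[symmetric]]
  have "x = (\<Oplus>\<^bsub>M\<^esub>b\<in>{b \<in> B. coord y b \<noteq> \<zero>}. coord y b \<odot>\<^bsub>M\<^esub> b)" .
  also have "\<dots> = y"
    by (rule coord_props[OF assms(2), THEN conjunct2, THEN conjunct2, THEN conjunct2, symmetric])
  finally show ?thesis .
qed

end

lemma free_module_basis:
  assumes "free_module R M"
  obtains B where "module_basis R M B"
proof -
  from assms obtain B where "module R M" "B \<subseteq> carrier M" "\<forall>x\<in>carrier M.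
      \<exists>!c. c \<in> B \<rightarrow> carrier R \<and> (\<forall>b. b \<notin> B \<longrightarrow> c b = \<zero>\<^bsub>R\<^esub>) \<and>
           finite {b \<in> B. c b \<noteq> \<zero>\<^bsub>R\<^esub>} \<and>
           x = (\<Oplus>\<^bsub>M\<^esub>b\<in>{b \<in> B. c b \<noteq> \<zero>\<^bsub>R\<^esub>}. c b \<odot>\<^bsub>M\<^esub> b)"
    unfolding free_module_def by (elim conjE exE)
  then show thesis
    by (intro that module_basis.intro module_basis_axioms.intro) (assumption | erule (1) bspec)+
qed

section \<open>Linear forms\<close>

context cring
begin

text \<open>The linear form with coefficients \<open>c\<close>: multisets of size 1 are the
  variables. It belongs to \<open>polys\<close> when \<open>c\<close> has finite support, hence the
  support conditions that accompany it throughout.\<close>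

definition lform :: "('i \<Rightarrow> 'a) \<Rightarrow> 'i multiset \<Rightarrow> 'a"
  where "lform c w = (if size w = 1 then c (the_elem (set_mset w)) else \<zero>)"

lemma lform_single [simp]: "lform c {#i#} = c i"
  by (simp add: lform_def)

lemma lform_not_single: "size w \<noteq> 1 \<Longrightarrow> lform c w = \<zero>"
  by (simp add: lform_def)

lemma lform_zero: "lform (\<lambda>_. \<zero>) = indexed_const \<zero>"
  by (auto simp: lform_def indexed_const_def)

lemma indexed_var_apply: "indexed_var i w = (if w = {#i#} then \<one> else \<zero>)"
  by (auto simp: indexed_var_def indexed_pmult_def indexed_const_def)
    (metis insert_DiffM)+

text \<open>Splits off one term of a linear form; this drives the inductions over its
  support.\<close>

lemma lform_update:
  assumes "\<And>i. c i \<in> carrier R"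
  shows "lform c = indexed_padd (pscale (c i) (indexed_var i)) (lform (c(i := \<zero>)))"
proof
  fix w
  show "lform c w = indexed_padd (pscale (c i) (indexed_var i)) (lform (c(i := \<zero>))) w"
  proof (cases "size w = 1")
    case True
    then obtain j where "w = {#j#}" using size_1_singleton_mset by blast
    then show ?thesis using assms by (auto simp: indexed_padd_def pscale_def indexed_var_apply)
  next
    case False
    then show ?thesis using assms
      by (auto simp: indexed_padd_def pscale_def indexed_var_apply lform_not_single)
  qed
qed

lemma lform_closed:
  assumes "\<And>i. c i \<in> carrier R" "finite {i. c i \<noteq> \<zero>}" "{i. c i \<noteq> \<zero>} \<subseteq> I"
  shows "lform c \<in> polys I"
  using assms(2,1,3)
proof (induction "{i. c i \<noteq> \<zero>}" arbitrary: c rule: finite_induct)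
  case empty
  then have "c = (\<lambda>_. \<zero>)" by auto
  then show ?case by (simp add: lform_zero)
next
  case (insert i F)
  have F: "F = {j. (c(i := \<zero>)) j \<noteq> \<zero>}" using insert(2,4) by auto
  have "i \<in> I" using insert by auto
  moreover have "lform (c(i := \<zero>)) \<in> polys I"
    using insert F by (intro insert(3)) (auto split: if_splits)
  ultimately show ?case
    using insert(5) by (subst lform_update[of c i]) auto
qed

lemma lform_add: "indexed_padd (lform c) (lform c') = lform (\<lambda>i. c i \<oplus> c' i)"
  by (auto simp: lform_def indexed_padd_def)

lemma lform_pscale: "r \<in> carrier R \<Longrightarrow> pscale r (lform c) = lform (\<lambda>i. r \<otimes> c i)"
  by (auto simp: lform_def pscale_def)

end

lemma (in ring_hom_cring) evaluate_lform:
  assumes "\<And>i. c i \<in> carrier R" "finite C" "{i. c i \<noteq> \<zero>} \<subseteq> C" "\<tau> \<in> C \<rightarrow> carrier S"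
  shows "evaluate \<tau> (R.lform c) = (\<Oplus>\<^bsub>S\<^esub>i\<in>C. h (c i) \<otimes>\<^bsub>S\<^esub> \<tau> i)"
  using assms(2,1,3,4)
proof (induction C arbitrary: c rule: finite_induct)
  case empty
  then have "c = (\<lambda>_. \<zero>)" by auto
  then show ?case by (simp add: R.lform_zero)
next
  case (insert i C)
  have \<tau>: "\<tau> \<in> insert i C \<rightarrow> carrier S" "\<tau> i \<in> carrier S" "\<tau> \<in> C \<rightarrow> carrier S"
    using insert by auto
  have sub: "{j. (c(i := \<zero>)) j \<noteq> \<zero>} \<subseteq> C" using insert(5) by auto
  have cl: "R.lform (c(i := \<zero>)) \<in> R.polys (insert i C)"
    using insert(4) finite_subset[OF sub insert(1)] subset_insertI2[OF sub]
    by (intro R.lform_closed) auto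
  have var: "R.indexed_var i \<in> R.polys (insert i C)" by simp
  have "evaluate \<tau> (R.lform c) = evaluate \<tau> (R.indexed_padd (R.pscale (c i) (R.indexed_var i)) (R.lform (c(i := \<zero>))))"
    using R.lform_update[of c i] insert(4) by simp
  also have "\<dots> = h (c i) \<otimes>\<^bsub>S\<^esub> \<tau> i \<oplus>\<^bsub>S\<^esub> evaluate \<tau> (R.lform (c(i := \<zero>)))"
    using evaluate_padd[OF R.pscale_closed[OF var] cl \<tau>(1)] evaluate_pscale[OF var _ \<tau>(1)]
      evaluate_var[of i "insert i C" \<tau>] insert(4) \<tau>(1) by simp
  also have "evaluate \<tau> (R.lform (c(i := \<zero>))) = (\<Oplus>\<^bsub>S\<^esub>j\<in>C. h ((c(i := \<zero>)) j) \<otimes>\<^bsub>S\<^esub> \<tau> j)"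
    using insert(4) sub \<tau> by (intro insert(3)) auto
  also have "\<dots> = (\<Oplus>\<^bsub>S\<^esub>j\<in>C. h (c j) \<otimes>\<^bsub>S\<^esub> \<tau> j)"
    using insert(2,4) \<tau> by (intro S.finsum_cong') auto
  finally show ?case
    using insert(1,2,4) \<tau> by (subst S.finsum_insert) auto
qed

section \<open>Quotient algebras\<close>

lemma quotient_graded_algebra_simps:
  "carrier (quotient_graded_algebra A I) = carrier (A Quot I)"
  "monoid.mult (quotient_graded_algebra A I) = monoid.mult (A Quot I)"
  "one (quotient_graded_algebra A I) = one (A Quot I)"
  "ring.zero (quotient_graded_algebra A I) = ring.zero (A Quot I)"
  "ring.add (quotient_graded_algebra A I) = ring.add (A Quot I)"
  "component (quotient_graded_algebra A I) i = (\<lambda>x. I +>\<^bsub>A\<^esub> x) ` component A i"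
  "smult (quotient_graded_algebra A I) r V = (\<Union>x\<in>V. I +>\<^bsub>A\<^esub> (r \<odot>\<^bsub>A\<^esub> x))"
  by (simp_all add: quotient_graded_algebra_def)

lemma quotient_graded_algebra_cring:
  assumes "cring A" "ideal I A"
  shows "cring (quotient_graded_algebra A I)"
  by (rule cring_cong[OF ideal.quotient_is_cring[OF assms(2,1)]])
    (simp_all add: quotient_graded_algebra_simps)

lemma quotient_map_hom:
  assumes "cring A" "ideal I A"
  shows "ring_hom_ring A (quotient_graded_algebra A I) (\<lambda>x. I +>\<^bsub>A\<^esub> x)"
proof -
  interpret q: ring_hom_ring A "A Quot I" "\<lambda>x. I +>\<^bsub>A\<^esub> x"
    by (rule ideal.rcos_ring_hom_ring[OF assms(2)])
  interpret Q: cring "quotient_graded_algebra A I"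
    by (rule quotient_graded_algebra_cring[OF assms])
  show ?thesis
    by (intro ring_hom_ringI2 ring_hom_memI)
      (simp_all add: quotient_graded_algebra_simps q.R.ring_axioms Q.ring_axioms)
qed

lemma quotient_carrier:
  "carrier (quotient_graded_algebra A I) = (\<lambda>x. I +>\<^bsub>A\<^esub> x) ` carrier A"
  by (auto simp: quotient_graded_algebra_simps FactRing_def A_RCOSETS_def' a_r_coset_def')

text \<open>Scalar multiplication on quotients and \<open>Sym_map\<close> are unions over all
  representatives. This collapses such a union once independence of the representative is
  shown.\<close>

lemma union_constant:
  assumes "x \<in> V" "\<And>y. y \<in> V \<Longrightarrow> f y = f x"
  shows "(\<Union>y\<in>V. f y) = f x"
  using assms by blast

lemma quotient_class_eqI:
  assumes "ring A" "ideal I A" "y \<in> I +>\<^bsub>A\<^esub> x" "x \<in> carrier A"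
  shows "I +>\<^bsub>A\<^esub> y = I +>\<^bsub>A\<^esub> x"
  using assms by (metis abelian_subgroup.a_repr_independence' abelian_subgroupI3 ideal.axioms(1) ring.is_abelian_group)

lemma quotient_class_mem:
  assumes "ring A" "ideal I A" "y \<in> I +>\<^bsub>A\<^esub> x" "x \<in> carrier A"
  shows "y \<in> carrier A"
  using assms by (metis abelian_subgroup.a_elemrcos_carrier abelian_subgroupI3 ideal.axioms(1) ring.is_abelian_group)

lemma quotient_self_mem:
  assumes "ring A" "ideal I A" "x \<in> carrier A"
  shows "x \<in> I +>\<^bsub>A\<^esub> x"
  using assms by (metis abelian_subgroup.a_rcos_self abelian_subgroupI3 ideal.axioms(1) ring.is_abelian_group)

lemma quotient_class_zero_iff:
  assumes "ring A" "ideal I A" "x \<in> carrier A"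
  shows "I +>\<^bsub>A\<^esub> x = I \<longleftrightarrow> x \<in> I"
  using assms by (metis abelian_subgroup.a_rcos_const abelian_subgroupI3 ideal.axioms(1)
      quotient_self_mem ring.is_abelian_group)

text \<open>Scalar multiplication of an algebra is multiplication by the image of the scalar; this is what makes
  it compatible with the passage to a quotient by an ideal.\<close>

definition algebra_via :: "('a, 'r) ring_scheme \<Rightarrow> ('a, 'b, 's) module_scheme \<Rightarrow> ('a \<Rightarrow> 'b) \<Rightarrow> bool"
  where "algebra_via R A \<iota> \<longleftrightarrow> cring A \<and> \<iota> \<in> carrier R \<rightarrow> carrier A \<and>
    (\<forall>r\<in>carrier R. \<forall>x\<in>carrier A. r \<odot>\<^bsub>A\<^esub> x = \<iota> r \<otimes>\<^bsub>A\<^esub> x)"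

lemma algebra_via_quotient:
  assumes "algebra_via R A \<iota>" "ideal I A"
  shows "algebra_via R (quotient_graded_algebra A I) (\<lambda>r. I +>\<^bsub>A\<^esub> \<iota> r)"
    and "r \<in> carrier R \<Longrightarrow> x \<in> carrier A \<Longrightarrow>
      r \<odot>\<^bsub>quotient_graded_algebra A I\<^esub> (I +>\<^bsub>A\<^esub> x) = I +>\<^bsub>A\<^esub> (r \<odot>\<^bsub>A\<^esub> x)"
proof -
  let ?Q = "quotient_graded_algebra A I"
  have A: "cring A" and \<iota>: "\<And>r. r \<in> carrier R \<Longrightarrow> \<iota> r \<in> carrier A"
    and sm: "\<And>r x. r \<in> carrier R \<Longrightarrow> x \<in> carrier A \<Longrightarrow> r \<odot>\<^bsub>A\<^esub> x = \<iota> r \<otimes>\<^bsub>A\<^esub> x"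
    using assms(1) by (auto simp: algebra_via_def)
  interpret A: cring A by (rule A)
  interpret q: ring_hom_ring A ?Q "\<lambda>x. I +>\<^bsub>A\<^esub> x"
    by (rule quotient_map_hom[OF A assms(2)])
  show eq: "r \<odot>\<^bsub>?Q\<^esub> (I +>\<^bsub>A\<^esub> x) = I +>\<^bsub>A\<^esub> (r \<odot>\<^bsub>A\<^esub> x)"
    if r: "r \<in> carrier R" and x: "x \<in> carrier A" for r x
    unfolding quotient_graded_algebra_simps
  proof (rule union_constant)
    show "x \<in> I +>\<^bsub>A\<^esub> x" by (rule quotient_self_mem[OF A.ring_axioms assms(2) x])
    fix y assume y: "y \<in> I +>\<^bsub>A\<^esub> x"
    have yA: "y \<in> carrier A" by (rule quotient_class_mem[OF A.ring_axioms assms(2) y x])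
    have "I +>\<^bsub>A\<^esub> (\<iota> r \<otimes>\<^bsub>A\<^esub> y) = I +>\<^bsub>A\<^esub> (\<iota> r \<otimes>\<^bsub>A\<^esub> x)"
      using q.hom_mult[OF \<iota>[OF r] yA] q.hom_mult[OF \<iota>[OF r] x]
        quotient_class_eqI[OF A.ring_axioms assms(2) y x] by simp
    then show "I +>\<^bsub>A\<^esub> (r \<odot>\<^bsub>A\<^esub> y) = I +>\<^bsub>A\<^esub> (r \<odot>\<^bsub>A\<^esub> x)"
      using r x yA by (simp add: sm)
  qed
  show "algebra_via R ?Q (\<lambda>r. I +>\<^bsub>A\<^esub> \<iota> r)"
    unfolding algebra_via_def
  proof (intro conjI ballI funcsetI)
    show "cring ?Q" by (rule quotient_graded_algebra_cring[OF A assms(2)])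
    show "I +>\<^bsub>A\<^esub> \<iota> r \<in> carrier ?Q" if "r \<in> carrier R" for r using \<iota>[OF that] by simp
    fix r V assume r: "r \<in> carrier R" and "V \<in> carrier ?Q"
    then obtain x where x: "x \<in> carrier A" "V = I +>\<^bsub>A\<^esub> x" unfolding quotient_carrier by blast
    show "r \<odot>\<^bsub>?Q\<^esub> V = (I +>\<^bsub>A\<^esub> \<iota> r) \<otimes>\<^bsub>?Q\<^esub> V"
      using eq[OF r x(1)] q.hom_mult[OF \<iota>[OF r] x(1)] x r sm by simp
  qed
qed

section \<open>Symmetric algebras\<close>

context cring
begin

abbreviation sym_class :: "('a, 'm, 's) module_scheme \<Rightarrow> ('m multiset \<Rightarrow> 'a) \<Rightarrow> ('m multiset \<Rightarrow> 'a) set"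
  where "sym_class M p \<equiv> sym_ideal R M +>\<^bsub>polynomial_algebra R (carrier M)\<^esub> p"

lemma linearity_relations_subset:
  assumes "module R M"
  shows "linearity_relations R M \<subseteq> polys (carrier M)"
proof -
  interpret M: module R M by fact
  interpret P: cring "polynomial_algebra R (carrier M)" by (rule polynomial_algebra_cring)
  have v: "indexed_var x \<in> carrier (polynomial_algebra R (carrier M))" if "x \<in> carrier M" for x
    using that by simp
  have s: "r \<odot>\<^bsub>polynomial_algebra R (carrier M)\<^esub> indexed_var x \<in> carrier (polynomial_algebra R (carrier M))"
    if "r \<in> carrier R" "x \<in> carrier M" for r x
    using that by auto
  have "linearity_relations R M \<subseteq> carrier (polynomial_algebra R (carrier M))"
    unfolding linearity_relations_def Let_def
    using v s by (auto simp del: polynomial_algebra_simps)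
  then show ?thesis by simp
qed

lemma sym_ideal_ideal:
  assumes "module R M"
  shows "ideal (sym_ideal R M) (polynomial_algebra R (carrier M))"
proof -
  interpret P: cring "polynomial_algebra R (carrier M)" by (rule polynomial_algebra_cring)
  show ?thesis
    unfolding sym_ideal_def using linearity_relations_subset[OF assms]
    by (intro P.genideal_ideal) simp
qed

lemma Sym_algebra:
  assumes "module R M"
  shows "algebra_via R (Sym R M) (\<lambda>r. sym_class M (indexed_const r))"
  unfolding Sym_def
  by (rule algebra_via_quotient[OF _ sym_ideal_ideal[OF assms]])
    (auto simp: algebra_via_def polynomial_algebra_cring pscale_eq_pconv)

lemma sym_class_hom:
  assumes "module R M"
  shows "ring_hom_ring (polynomial_algebra R (carrier M)) (Sym R M) (sym_class M)"
  unfolding Sym_def by (rule quotient_map_hom[OF polynomial_algebra_cring sym_ideal_ideal[OF assms]])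

lemma Sym_carrier: "carrier (Sym R M) = sym_class M ` polys (carrier M)"
  unfolding Sym_def quotient_carrier by simp

lemma sym_class_eq_zero_iff:
  assumes "module R M" "p \<in> polys (carrier M)"
  shows "sym_class M p = \<zero>\<^bsub>Sym R M\<^esub> \<longleftrightarrow> p \<in> sym_ideal R M"
proof -
  have "\<zero>\<^bsub>Sym R M\<^esub> = sym_ideal R M"
    by (simp add: Sym_def quotient_graded_algebra_simps FactRing_def)
  then show ?thesis
    using quotient_class_zero_iff[OF cring.axioms(1)[OF polynomial_algebra_cring] sym_ideal_ideal[OF assms(1)]] assms(2)
    by simp
qed

text \<open>Ideal-theoretic universal property of \<open>Sym\<close>: it suffices to check the generating relations.\<close>

lemma sym_ideal_vimage:
  assumes M: "module R M" and hom: "ring_hom_ring (polynomial_algebra R (carrier M)) T f"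
    and J: "ideal J T"
    and add: "\<And>x y. x \<in> carrier M \<Longrightarrow> y \<in> carrier M \<Longrightarrow>
      f (indexed_var (x \<oplus>\<^bsub>M\<^esub> y)) \<ominus>\<^bsub>T\<^esub> (f (indexed_var x) \<oplus>\<^bsub>T\<^esub> f (indexed_var y)) \<in> J"
    and smult: "\<And>r x. r \<in> carrier R \<Longrightarrow> x \<in> carrier M \<Longrightarrow>
      f (indexed_var (r \<odot>\<^bsub>M\<^esub> x)) \<ominus>\<^bsub>T\<^esub> f (pscale r (indexed_var x)) \<in> J"
    and p: "p \<in> sym_ideal R M"
  shows "f p \<in> J"
proof -
  let ?P = "polynomial_algebra R (carrier M)"
  interpret M: module R M by fact
  interpret P: cring ?P by (rule polynomial_algebra_cring)
  interpret f: ring_hom_ring ?P T f by fact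
  have minus: "f (a \<ominus>\<^bsub>?P\<^esub> b) = f a \<ominus>\<^bsub>T\<^esub> f b" if "a \<in> carrier ?P" "b \<in> carrier ?P" for a b
    using that by (simp add: a_minus_def del: polynomial_algebra_simps)
  have v: "indexed_var x \<in> carrier ?P" if "x \<in> carrier M" for x
    using that by simp
  have s: "pscale r (indexed_var x) \<in> carrier ?P" if "r \<in> carrier R" "x \<in> carrier M" for r x
    using that by auto
  have "ideal {a \<in> carrier ?P. f a \<in> J} ?P" using f.ideal_vimage[OF J] .
  moreover have "linearity_relations R M \<subseteq> {a \<in> carrier ?P. f a \<in> J}"
  proof
    fix q assume q: "q \<in> linearity_relations R M"
    then have "q \<in> carrier ?P" using linearity_relations_subset[OF M] by auto
    moreover from q consider
      x y where "x \<in> carrier M" "y \<in> carrier M"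
        "q = indexed_var (x \<oplus>\<^bsub>M\<^esub> y) \<ominus>\<^bsub>?P\<^esub> (indexed_var x \<oplus>\<^bsub>?P\<^esub> indexed_var y)"
      | r x where "r \<in> carrier R" "x \<in> carrier M"
        "q = indexed_var (r \<odot>\<^bsub>M\<^esub> x) \<ominus>\<^bsub>?P\<^esub> pscale r (indexed_var x)"
      unfolding linearity_relations_def Let_def by auto
    then have "f q \<in> J"
    proof cases
      case 1
      then show ?thesis using add[of x y] v
        by (simp add: minus del: polynomial_algebra_simps)
    next
      case 2
      then show ?thesis using smult[of r x] v s
        by (simp add: minus del: polynomial_algebra_simps)
    qed
    ultimately show "q \<in> {a \<in> carrier ?P. f a \<in> J}" by blast
  qed
  ultimately have "sym_ideal R M \<subseteq> {a \<in> carrier ?P. f a \<in> J}"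
    unfolding sym_ideal_def by (rule P.genideal_minimal)
  with p show ?thesis by blast
qed

text \<open>The second form, about the relation itself, is what \<open>sym_ideal_vimage\<close> asks
  for when the target ideal is again a \<open>sym_ideal\<close>; likewise in
  \<open>sym_class_smult\<close>.\<close>

lemma sym_class_add:
  assumes M: "module R M" "x \<in> carrier M" "y \<in> carrier M"
  shows "sym_class M (indexed_var (x \<oplus>\<^bsub>M\<^esub> y)) = sym_class M (indexed_var x) \<oplus>\<^bsub>Sym R M\<^esub> sym_class M (indexed_var y)"
    and "indexed_var (x \<oplus>\<^bsub>M\<^esub> y) \<ominus>\<^bsub>polynomial_algebra R (carrier M)\<^esub> (indexed_var x \<oplus>\<^bsub>polynomial_algebra R (carrier M)\<^esub> indexed_var y) \<in> sym_ideal R M"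
proof -
  let ?P = "polynomial_algebra R (carrier M)"
  interpret M: module R M by fact
  interpret P: cring ?P by (rule polynomial_algebra_cring)
  interpret c: ring_hom_ring ?P "Sym R M" "sym_class M" by (rule sym_class_hom[OF M(1)])
  have v: "indexed_var x \<in> carrier ?P" if "x \<in> carrier M" for x
    using that by simp
  show rel: "indexed_var (x \<oplus>\<^bsub>M\<^esub> y) \<ominus>\<^bsub>?P\<^esub> (indexed_var x \<oplus>\<^bsub>?P\<^esub> indexed_var y) \<in> sym_ideal R M"
    unfolding sym_ideal_def using linearity_relations_subset[OF M(1)] M(2,3)
    by (intro subsetD[OF P.genideal_self]) (auto simp: linearity_relations_def Let_def)
  then have "sym_class M (indexed_var (x \<oplus>\<^bsub>M\<^esub> y)) = sym_class M (indexed_var x \<oplus>\<^bsub>?P\<^esub> indexed_var y)"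
    using P.quotient_eq_iff_same_a_r_cos[OF sym_ideal_ideal[OF M(1)], of "indexed_var (x \<oplus>\<^bsub>M\<^esub> y)"
        "indexed_var x \<oplus>\<^bsub>?P\<^esub> indexed_var y"] v M(2,3) P.a_closed M.a_closed by metis
  then show "sym_class M (indexed_var (x \<oplus>\<^bsub>M\<^esub> y)) = sym_class M (indexed_var x) \<oplus>\<^bsub>Sym R M\<^esub> sym_class M (indexed_var y)"
    using c.hom_add[OF v v, OF M(2,3)] by simp
qed

lemma sym_class_smult:
  assumes M: "module R M" "x \<in> carrier M" "r \<in> carrier R"
  shows "sym_class M (indexed_var (r \<odot>\<^bsub>M\<^esub> x)) = sym_class M (pscale r (indexed_var x))"
    and "indexed_var (r \<odot>\<^bsub>M\<^esub> x) \<ominus>\<^bsub>polynomial_algebra R (carrier M)\<^esub> pscale r (indexed_var x) \<in> sym_ideal R M"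
proof -
  let ?P = "polynomial_algebra R (carrier M)"
  interpret M: module R M by fact
  interpret P: cring ?P by (rule polynomial_algebra_cring)
  show rel: "indexed_var (r \<odot>\<^bsub>M\<^esub> x) \<ominus>\<^bsub>?P\<^esub> pscale r (indexed_var x) \<in> sym_ideal R M"
    unfolding sym_ideal_def using linearity_relations_subset[OF M(1)] M(2,3)
    by (intro subsetD[OF P.genideal_self]) (auto simp: linearity_relations_def Let_def)
  have "indexed_var (r \<odot>\<^bsub>M\<^esub> x) \<in> carrier ?P" "pscale r (indexed_var x) \<in> carrier ?P"
    using M(2,3) by auto
  then show "sym_class M (indexed_var (r \<odot>\<^bsub>M\<^esub> x)) = sym_class M (pscale r (indexed_var x))"
    using P.quotient_eq_iff_same_a_r_cos[OF sym_ideal_ideal[OF M(1)]] rel by metis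
qed

text \<open>A linear map sends each linearity relation to a linearity relation. This is what makes
  \<open>Sym_map\<close> well defined.\<close>

lemma rename_sym_ideal:
  assumes M: "module R M" and N: "module R N" and g: "g \<in> linear_maps R M N"
    and p: "p \<in> sym_ideal R M"
  shows "rename_variables R g p \<in> sym_ideal R N"
proof (rule sym_ideal_vimage[OF M rename_variables_hom sym_ideal_ideal[OF N] _ _ p])
  show gf: "g \<in> carrier M \<rightarrow> carrier N" using g by (simp add: linear_maps_def)
  fix x assume x: "x \<in> carrier M"
  then have gx: "g x \<in> carrier N" using gf by blast
  show "rename_variables R g (indexed_var (x \<oplus>\<^bsub>M\<^esub> y)) \<ominus>\<^bsub>polynomial_algebra R (carrier N)\<^esub>
    (rename_variables R g (indexed_var x) \<oplus>\<^bsub>polynomial_algebra R (carrier N)\<^esub>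
    rename_variables R g (indexed_var y)) \<in> sym_ideal R N" if y: "y \<in> carrier M" for y
  proof -
    have "g (x \<oplus>\<^bsub>M\<^esub> y) = g x \<oplus>\<^bsub>N\<^esub> g y" "g y \<in> carrier N"
      using g gf x y by (auto simp: linear_maps_def)
    then show ?thesis using sym_class_add(2)[OF N gx] by (simp add: rename_variables_var)
  qed
  show "rename_variables R g (indexed_var (r \<odot>\<^bsub>M\<^esub> x)) \<ominus>\<^bsub>polynomial_algebra R (carrier N)\<^esub>
    rename_variables R g (pscale r (indexed_var x)) \<in> sym_ideal R N" if r: "r \<in> carrier R" for r
  proof -
    have "g (r \<odot>\<^bsub>M\<^esub> x) = r \<odot>\<^bsub>N\<^esub> g x"
      using g x r by (auto simp: linear_maps_def)
    then show ?thesis using sym_class_smult(2)[OF N gx r] x r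
      by (simp add: rename_variables_var rename_variables_pscale[OF indexed_var_closed[OF x]])
  qed
qed

text \<open>Representatives of one class differ by an element of \<open>sym_ideal R M\<close>, which
  renaming carries into \<open>sym_ideal R N\<close>; so all members of the union coincide.\<close>

lemma Sym_map_class:
  assumes M: "module R M" and N: "module R N" and g: "g \<in> linear_maps R M N"
    and p: "p \<in> polys (carrier M)"
  shows "Sym_map R M N g (sym_class M p) = sym_class N (rename_variables R g p)"
  unfolding Sym_map_def
proof (rule union_constant)
  let ?P = "polynomial_algebra R (carrier M)" and ?PN = "polynomial_algebra R (carrier N)"
  have gf: "g \<in> carrier M \<rightarrow> carrier N" using g by (simp add: linear_maps_def)
  interpret P: cring ?P by (rule polynomial_algebra_cring)
  interpret PN: cring ?PN by (rule polynomial_algebra_cring)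
  interpret f: ring_hom_ring ?P ?PN "rename_variables R g" by (rule rename_variables_hom[OF gf])
  have pP: "p \<in> carrier ?P" using p by simp
  show "p \<in> sym_class M p"
    using quotient_self_mem[OF P.ring_axioms sym_ideal_ideal[OF M] pP] .
  fix q assume q: "q \<in> sym_class M p"
  have qP: "q \<in> carrier ?P" using quotient_class_mem[OF P.ring_axioms sym_ideal_ideal[OF M] q pP] .
  have "sym_class M q = sym_class M p"
    using quotient_class_eqI[OF P.ring_axioms sym_ideal_ideal[OF M] q pP] .
  then have "q \<ominus>\<^bsub>?P\<^esub> p \<in> sym_ideal R M"
    using P.quotient_eq_iff_same_a_r_cos[OF sym_ideal_ideal[OF M] qP pP] by simp
  then have "rename_variables R g (q \<ominus>\<^bsub>?P\<^esub> p) \<in> sym_ideal R N"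
    by (rule rename_sym_ideal[OF M N g])
  moreover have "rename_variables R g (q \<ominus>\<^bsub>?P\<^esub> p) = rename_variables R g q \<ominus>\<^bsub>?PN\<^esub> rename_variables R g p"
    using pP qP by (simp add: a_minus_def del: polynomial_algebra_simps)
  ultimately show "sym_class N (rename_variables R g q) = sym_class N (rename_variables R g p)"
    using PN.quotient_eq_iff_same_a_r_cos[OF sym_ideal_ideal[OF N] f.hom_closed[OF qP] f.hom_closed[OF pP]]
    by simp
qed

lemma Sym_map_hom:
  assumes M: "module R M" and N: "module R N" and g: "g \<in> linear_maps R M N"
  shows "ring_hom_ring (Sym R M) (Sym R N) (Sym_map R M N g)"
proof -
  let ?P = "polynomial_algebra R (carrier M)" and ?PN = "polynomial_algebra R (carrier N)"
  have gf: "g \<in> carrier M \<rightarrow> carrier N" using g by (simp add: linear_maps_def)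
  interpret f: ring_hom_ring ?P ?PN "rename_variables R g" by (rule rename_variables_hom[OF gf])
  interpret c: ring_hom_ring ?P "Sym R M" "sym_class M" by (rule sym_class_hom[OF M])
  interpret d: ring_hom_ring ?PN "Sym R N" "sym_class N" by (rule sym_class_hom[OF N])
  note cls = Sym_map_class[OF M N g]
  have Pcl: "p \<otimes>\<^bsub>?P\<^esub> q \<in> polys (carrier M)" "p \<oplus>\<^bsub>?P\<^esub> q \<in> polys (carrier M)" "\<one>\<^bsub>?P\<^esub> \<in> polys (carrier M)"
    if "p \<in> polys (carrier M)" "q \<in> polys (carrier M)" for p q using that by auto
  show ?thesis
  proof (intro ring_hom_ringI2 ring_hom_memI c.S.ring_axioms d.S.ring_axioms)
    fix x assume "x \<in> carrier (Sym R M)"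
    then obtain p where p: "p \<in> polys (carrier M)" "x = sym_class M p" unfolding Sym_carrier by blast
    have p': "p \<in> carrier ?P" using p by simp
    show "Sym_map R M N g x \<in> carrier (Sym R N)"
      unfolding p(2) cls[OF p(1)] by (rule d.hom_closed[OF f.hom_closed[OF p']])
    fix y assume "y \<in> carrier (Sym R M)"
    then obtain q where q: "q \<in> polys (carrier M)" "y = sym_class M q" unfolding Sym_carrier by blast
    have q': "q \<in> carrier ?P" using q by simp
    show "Sym_map R M N g (x \<otimes>\<^bsub>Sym R M\<^esub> y) = Sym_map R M N g x \<otimes>\<^bsub>Sym R N\<^esub> Sym_map R M N g y"
      unfolding p(2) q(2) c.hom_mult[OF p' q', symmetric] cls[OF p(1)] cls[OF q(1)]
        cls[OF Pcl(1)[OF p(1) q(1)]] f.hom_mult[OF p' q']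
      by (rule d.hom_mult[OF f.hom_closed[OF p'] f.hom_closed[OF q']])
    show "Sym_map R M N g (x \<oplus>\<^bsub>Sym R M\<^esub> y) = Sym_map R M N g x \<oplus>\<^bsub>Sym R N\<^esub> Sym_map R M N g y"
      unfolding p(2) q(2) c.hom_add[OF p' q', symmetric] cls[OF p(1)] cls[OF q(1)]
        cls[OF Pcl(2)[OF p(1) q(1)]] f.hom_add[OF p' q']
      by (rule d.hom_add[OF f.hom_closed[OF p'] f.hom_closed[OF q']])
  next
    have "\<one>\<^bsub>?P\<^esub> \<in> polys (carrier M)" by simp
    then show "Sym_map R M N g \<one>\<^bsub>Sym R M\<^esub> = \<one>\<^bsub>Sym R N\<^esub>"
      unfolding c.hom_one[symmetric] by (simp only: cls f.hom_one d.hom_one)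
  qed
qed

lemma rees_kernel_iff:
  assumes M: "module R M" and N: "module R N" and g: "g \<in> linear_maps R M N"
    and p: "p \<in> polys (carrier M)"
  shows "sym_class M p \<in> rees_kernel R M N g \<longleftrightarrow> rename_variables R g p \<in> sym_ideal R N"
proof -
  have gf: "g \<in> carrier M \<rightarrow> carrier N" using g by (simp add: linear_maps_def)
  show ?thesis
    unfolding rees_kernel_def a_kernel_def'
    using p Sym_map_class[OF M N g p] sym_class_eq_zero_iff[OF N rename_variables_closed[OF p gf]]
    by (auto simp: Sym_carrier)
qed

lemma rees_kernel_ideal:
  assumes "module R M" "module R N" "g \<in> linear_maps R M N"
  shows "ideal (rees_kernel R M N g) (Sym R M)"
  unfolding rees_kernel_def by (rule ring_hom_ring.kernel_is_ideal[OF Sym_map_hom[OF assms]])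

end

text \<open>Uniqueness of maps out of a polynomial ring: both sides are homomorphisms with the same
  values on constants and variables. Its use is the composition of two substitutions,
  \<open>peval_peval\<close>.\<close>

lemma (in ring_hom_cring) hom_evaluate:
  assumes T: "ring_hom_cring S T f" and T': "ring_hom_cring R T h'"
    and eq: "\<And>r. r \<in> carrier R \<Longrightarrow> f (h r) = h' r"
    and p: "p \<in> R.polys I" and \<tau>: "\<tau> \<in> I \<rightarrow> carrier S"
  shows "f (evaluate \<tau> p) = ring_hom_cring.evaluate R T h' (\<lambda>i. f (\<tau> i)) p"
proof -
  interpret f: ring_hom_cring S T f by (rule T)
  interpret h': ring_hom_cring R T h' by (rule T')
  have f\<tau>: "(\<lambda>i. f (\<tau> i)) \<in> I \<rightarrow> carrier T" using \<tau> by auto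
  from p show ?thesis
  proof (induction rule: R.indexed_pset.induct)
    case (indexed_const k)
    then show ?case by (simp add: eq)
  next
    case (indexed_padd p q)
    then show ?case using \<tau> f\<tau>
      by (simp add: evaluate_padd[of _ I] h'.evaluate_padd[of _ I])
  next
    case (indexed_pmult p i)
    then have "\<tau> i \<in> carrier S" using \<tau> by auto
    then show ?case using \<tau> f\<tau> indexed_pmult
      by (simp add: evaluate_pmult[of _ I] h'.evaluate_pmult[of _ I])
  qed
qed

section \<open>Substitution of polynomials for variables\<close>

context cring
begin

abbreviation peval :: "'j set \<Rightarrow> ('i \<Rightarrow> 'j multiset \<Rightarrow> 'a) \<Rightarrow> ('i multiset \<Rightarrow> 'a) \<Rightarrow> 'j multiset \<Rightarrow> 'a"
  where "peval J \<equiv> ring_hom_cring.evaluate R (polynomial_algebra R J) indexed_const"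

lemma peval_hom:
  assumes "\<tau> \<in> I \<rightarrow> polys J"
  shows "ring_hom_cring (polynomial_algebra R I) (polynomial_algebra R J) (peval J \<tau>)"
  using ring_hom_cring.evaluate_hom[OF const_hom] assms
  by (intro ring_hom_cring.intro ring_hom_cring_axioms.intro polynomial_algebra_cring) simp

lemma peval_closed:
  assumes "p \<in> polys I" "\<tau> \<in> I \<rightarrow> polys J"
  shows "peval J \<tau> p \<in> polys J"
  using ring_hom_cring.evaluate_closed[OF const_hom] assms by simp

lemma peval_const: "k \<in> carrier R \<Longrightarrow> peval J \<tau> (indexed_const k) = indexed_const k"
  by (rule ring_hom_cring.evaluate_const[OF const_hom])

lemma peval_padd:
  assumes "\<tau> \<in> I \<rightarrow> polys J" "p \<in> polys I" "q \<in> polys I"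
  shows "peval J \<tau> (indexed_padd p q) = indexed_padd (peval J \<tau> p) (peval J \<tau> q)"
  using ring_hom_cring.evaluate_padd[OF const_hom] assms by simp

lemma peval_pmult:
  assumes "\<tau> \<in> I \<rightarrow> polys J" "p \<in> polys I" "i \<in> I"
  shows "peval J \<tau> (indexed_pmult p i) = pconv (\<tau> i) (peval J \<tau> p)"
  using ring_hom_cring.evaluate_pmult[OF const_hom] assms by simp

lemma peval_var:
  assumes "\<tau> \<in> I \<rightarrow> polys J" "i \<in> I"
  shows "peval J \<tau> (indexed_var i) = \<tau> i"
  using ring_hom_cring.evaluate_var[OF const_hom] assms by simp

lemma peval_pscale:
  assumes "\<tau> \<in> I \<rightarrow> polys J" "p \<in> polys I" "r \<in> carrier R"
  shows "peval J \<tau> (pscale r p) = pscale r (peval J \<tau> p)"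
  using ring_hom_cring.evaluate_pscale[OF const_hom, of p I r \<tau> J] assms
    pconv_const[OF assms(3) peval_closed[OF assms(2,1)]] by simp

lemma peval_peval:
  assumes p: "p \<in> polys I" and \<tau>: "\<tau> \<in> I \<rightarrow> polys J" and \<kappa>: "\<kappa> \<in> J \<rightarrow> polys K"
  shows "peval K \<kappa> (peval J \<tau> p) = peval K (\<lambda>i. peval K \<kappa> (\<tau> i)) p"
  by (rule ring_hom_cring.hom_evaluate[OF const_hom peval_hom[OF \<kappa>] const_hom _ p])
    (use \<tau> in \<open>simp_all add: peval_const\<close>)

text \<open>Origin of the powers of \<open>t\<close> in the local argument: a denominator common to
  all linear forms reaches a coefficient once for each variable of its monomial.\<close>

lemma peval_scale:
  assumes q: "q \<in> polys J" and t: "t \<in> carrier R"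
  shows "peval J (\<lambda>j. pscale t (indexed_var j)) q v = t [^] size v \<otimes> q v"
proof -
  have \<tau>: "(\<lambda>j. pscale t (indexed_var j)) \<in> J \<rightarrow> polys J"
    using t by auto
  from q show ?thesis
  proof (induction arbitrary: v rule: indexed_pset.induct)
    case (indexed_const k)
    then show ?case using t by (simp add: peval_const) (simp add: indexed_const_def)
  next
    case (indexed_padd p q)
    then show ?case using t polys_coeff[OF indexed_padd(1)] polys_coeff[OF indexed_padd(2)]
      by (simp add: peval_padd[OF \<tau>]) (simp add: indexed_padd_def r_distr)
  next
    case (indexed_pmult p i)
    let ?e = "peval J (\<lambda>j. pscale t (indexed_var j)) p"
    have e: "?e \<in> polys J" by (rule peval_closed[OF indexed_pmult(1) \<tau>])
    have "peval J (\<lambda>j. pscale t (indexed_var j)) (indexed_pmult p i)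
        = pconv (pscale t (indexed_var i)) ?e"
      by (rule peval_pmult[OF \<tau> indexed_pmult(1,2)])
    also have "\<dots> = pconv (indexed_pmult (indexed_const t) i) ?e"
      using t by (simp add: indexed_var_def pscale_pmult pscale_const)
    also have "\<dots> = indexed_pmult (pscale t ?e) i"
      using t e by (simp add: pconv_pmult[OF indexed_const_closed[OF t] e] pconv_const[OF t e])
    finally have eq: "peval J (\<lambda>j. pscale t (indexed_var j)) (indexed_pmult p i) = indexed_pmult (pscale t ?e) i" .
    show ?case
    proof (cases "i \<in># v")
      case True
      then obtain w where v: "v = add_mset i w" by (meson multi_member_split)
      have "t \<otimes> (t [^] size w \<otimes> p w) = t [^] size w \<otimes> t \<otimes> p w"
        using t polys_coeff[OF indexed_pmult(1)] by (metis m_assoc m_comm nat_pow_closed)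
      then show ?thesis unfolding eq v using indexed_pmult(3)[of w] by (simp add: pscale_def)
    next
      case False
      then show ?thesis unfolding eq using t by (simp add: indexed_pmult_def)
    qed
  qed
qed

lemma peval_lform:
  assumes "\<And>i. c i \<in> carrier R" "finite C" "{i. c i \<noteq> \<zero>} \<subseteq> C" "\<tau> \<in> C \<rightarrow> polys J"
  shows "peval J \<tau> (lform c) = (\<Oplus>\<^bsub>polynomial_algebra R J\<^esub>i\<in>C. pscale (c i) (\<tau> i))"
proof -
  interpret P: cring "polynomial_algebra R J" by (rule polynomial_algebra_cring)
  have \<tau>: "\<tau> i \<in> polys J" if "i \<in> C" for i using that assms(4) by auto
  have "peval J \<tau> (lform c) = (\<Oplus>\<^bsub>polynomial_algebra R J\<^esub>i\<in>C. indexed_const (c i) \<otimes>\<^bsub>polynomial_algebra R J\<^esub> \<tau> i)"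
    using assms by (intro ring_hom_cring.evaluate_lform[OF const_hom]) auto
  also have "\<dots> = (\<Oplus>\<^bsub>polynomial_algebra R J\<^esub>i\<in>C. pscale (c i) (\<tau> i))"
    using assms(1) \<tau> by (intro P.finsum_cong') (auto simp: pconv_const[of _ _ J])
  finally show ?thesis .
qed

text \<open>If the linear forms \<open>t c' x\<close> are obtained from the linear forms \<open>c x\<close> by one substitution, then
  substituting the \<open>c' x\<close> for the variables kills, up to powers of \<open>t\<close>, what substituting
  the \<open>c x\<close> kills.\<close>

lemma peval_factor:
  fixes c :: "'i \<Rightarrow> 'j \<Rightarrow> 'a" and c' :: "'i \<Rightarrow> 'k \<Rightarrow> 'a"
  assumes c: "\<And>x b. x \<in> I \<Longrightarrow> c x b \<in> carrier R" "\<And>x. x \<in> I \<Longrightarrow> finite {b. c x b \<noteq> \<zero>}"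
      "\<And>x. x \<in> I \<Longrightarrow> {b. c x b \<noteq> \<zero>} \<subseteq> J"
    and c': "\<And>x b. x \<in> I \<Longrightarrow> c' x b \<in> carrier R" "\<And>x. x \<in> I \<Longrightarrow> finite {b. c' x b \<noteq> \<zero>}"
      "\<And>x. x \<in> I \<Longrightarrow> {b. c' x b \<noteq> \<zero>} \<subseteq> K"
    and t: "t \<in> carrier R" and \<kappa>: "\<kappa> \<in> J \<rightarrow> polys K"
    and eq: "\<And>x. x \<in> I \<Longrightarrow>
      (\<Oplus>\<^bsub>polynomial_algebra R K\<^esub>b\<in>{b. c x b \<noteq> \<zero>}. pscale (c x b) (\<kappa> b)) = pscale t (lform (c' x))"
    and p: "p \<in> polys I" and zero: "peval J (\<lambda>x. lform (c x)) p = indexed_const \<zero>"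
  shows "t [^] size v \<otimes> peval K (\<lambda>x. lform (c' x)) p v = \<zero>"
proof -
  have l: "(\<lambda>x. lform (c x)) \<in> I \<rightarrow> polys J" by (intro funcsetI lform_closed c)
  have l': "(\<lambda>x. lform (c' x)) \<in> I \<rightarrow> polys K" by (intro funcsetI lform_closed c')
  have \<tau>: "(\<lambda>j. pscale t (indexed_var j)) \<in> K \<rightarrow> polys K" using t by auto
  have sc: "peval K (\<lambda>j. pscale t (indexed_var j)) (lform (c' x)) = pscale t (lform (c' x))" if x: "x \<in> I" for x
  proof
    fix w
    show "peval K (\<lambda>j. pscale t (indexed_var j)) (lform (c' x)) w = pscale t (lform (c' x)) w"
      using peval_scale[of "lform (c' x)" K t w] l' x t
      by (cases "size w = 1") (auto simp: pscale_def lform_not_single Pi_iff)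
  qed
  have ka: "peval K \<kappa> (lform (c x)) = pscale t (lform (c' x))" if x: "x \<in> I" for x
    using peval_lform[OF c(1)[OF x] c(2)[OF x] subset_refl, of \<kappa> K] c(3)[OF x] \<kappa> eq[OF x] by auto
  \<comment> \<open>\<open>sc\<close> and \<open>ka\<close> are known only on \<open>I\<close>, so
    the substitutions can be compared only on polynomials in the variables from
    \<open>I\<close>.\<close>
  have cong: "peval K \<alpha> p = peval K \<beta> p" if "\<And>x. x \<in> I \<Longrightarrow> \<alpha> x = \<beta> x" "\<alpha> \<in> I \<rightarrow> polys K" for \<alpha> \<beta>
  proof -
    have b: "\<beta> \<in> I \<rightarrow> polys K" using that(2) by (auto simp: that(1)[symmetric] Pi_iff)
    show ?thesis using p
      by (induction rule: indexed_pset.induct)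
        (simp_all add: that(1) peval_const peval_padd[OF that(2)] peval_padd[OF b]
          peval_pmult[OF that(2)] peval_pmult[OF b])
  qed
  \<comment> \<open>Scaling the variables after substituting \<open>c'\<close> amounts to
    substituting \<open>t c'\<close>, which by \<open>eq\<close> is the substitution of
    \<open>c\<close> followed by \<open>\<kappa>\<close>; and \<open>\<kappa>\<close> is then
    applied to zero.\<close>
  have "t [^] size v \<otimes> peval K (\<lambda>x. lform (c' x)) p v
      = peval K (\<lambda>j. pscale t (indexed_var j)) (peval K (\<lambda>x. lform (c' x)) p) v"
    by (rule peval_scale[symmetric, OF peval_closed[OF p l'] t])
  also have "\<dots> = peval K (\<lambda>x. peval K (\<lambda>j. pscale t (indexed_var j)) (lform (c' x))) p v"
    by (simp add: peval_peval[OF p l' \<tau>])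
  also have "peval K (\<lambda>x. peval K (\<lambda>j. pscale t (indexed_var j)) (lform (c' x))) p
      = peval K (\<lambda>x. peval K \<kappa> (lform (c x))) p"
    using l' t by (intro cong) (auto simp: sc ka Pi_iff)
  also have "\<dots> = peval K \<kappa> (peval J (\<lambda>x. lform (c x)) p)"
    by (rule peval_peval[symmetric, OF p l \<kappa>])
  also have "\<dots> = indexed_const \<zero>" unfolding zero by (simp add: peval_const)
  finally show ?thesis by (simp only: indexed_zero_def)
qed

subsection \<open>Symmetric algebras of free modules\<close>

text \<open>Iterates the two kinds of relations. Applied to an expansion in a basis, it rewrites
  every class of \<open>Sym\<close> in the basis variables.\<close>

lemma sym_class_linear_combination:
  assumes M: "module R M" and C: "finite C" "C \<subseteq> carrier M" "c \<in> C \<rightarrow> carrier R"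
  shows "sym_class M (indexed_var (\<Oplus>\<^bsub>M\<^esub>b\<in>C. c b \<odot>\<^bsub>M\<^esub> b)) = sym_class M (lform (\<lambda>b. if b \<in> C then c b else \<zero>))"
  using C
proof (induction C rule: finite_induct)
  case empty
  interpret M: module R M by fact
  \<comment> \<open>The variable named by zero has class zero, because zero is its own multiple by
    the scalar zero.\<close>
  have "sym_class M (indexed_var \<zero>\<^bsub>M\<^esub>) = sym_class M (indexed_var (\<zero> \<odot>\<^bsub>M\<^esub> \<zero>\<^bsub>M\<^esub>))" by simp
  also have "\<dots> = sym_class M (pscale \<zero> (indexed_var \<zero>\<^bsub>M\<^esub>))"
    by (rule sym_class_smult(1)[OF M]) simp_all
  also have "pscale \<zero> (indexed_var \<zero>\<^bsub>M\<^esub>) = indexed_const \<zero>"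
    by (auto simp: pscale_def indexed_var_apply indexed_const_def)
  finally show ?case by (simp add: lform_zero)
next
  case (insert x C)
  let ?P = "polynomial_algebra R (carrier M)"
  interpret M: module R M by fact
  interpret cl: ring_hom_ring ?P "Sym R M" "sym_class M" by (rule sym_class_hom[OF M])
  have xM: "x \<in> carrier M" and cx: "c x \<in> carrier R" and CM: "C \<subseteq> carrier M" and cC: "c \<in> C \<rightarrow> carrier R"
    using insert by auto
  let ?l = "lform (\<lambda>b. if b \<in> C then c b else \<zero>)"
  have cl: "\<And>b. (if b \<in> C then c b else \<zero>) \<in> carrier R" using cC by auto
  have lP: "?l \<in> polys (carrier M)"
    using insert(1) CM cl by (intro lform_closed) (auto intro: finite_subset[of _ C])
  have vP: "pscale (c x) (indexed_var x) \<in> polys (carrier M)" using xM cx by auto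
  have sM: "(\<Oplus>\<^bsub>M\<^esub>b\<in>C. c b \<odot>\<^bsub>M\<^esub> b) \<in> carrier M" using CM cC by (intro M.M.finsum_closed) auto
  have "(\<Oplus>\<^bsub>M\<^esub>b\<in>insert x C. c b \<odot>\<^bsub>M\<^esub> b) = c x \<odot>\<^bsub>M\<^esub> x \<oplus>\<^bsub>M\<^esub> (\<Oplus>\<^bsub>M\<^esub>b\<in>C. c b \<odot>\<^bsub>M\<^esub> b)"
    using insert(1,2) xM cx CM cC by (intro M.M.finsum_insert) auto
  then have "sym_class M (indexed_var (\<Oplus>\<^bsub>M\<^esub>b\<in>insert x C. c b \<odot>\<^bsub>M\<^esub> b))
      = sym_class M (indexed_var (c x \<odot>\<^bsub>M\<^esub> x)) \<oplus>\<^bsub>Sym R M\<^esub> sym_class M (indexed_var (\<Oplus>\<^bsub>M\<^esub>b\<in>C. c b \<odot>\<^bsub>M\<^esub> b))"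
    using sym_class_add(1)[OF M M.smult_closed[OF cx xM] sM] by simp
  also have "\<dots> = sym_class M (pscale (c x) (indexed_var x)) \<oplus>\<^bsub>Sym R M\<^esub> sym_class M ?l"
    using sym_class_smult(1)[OF M xM cx] insert(3)[OF CM cC] by simp
  also have "\<dots> = sym_class M (indexed_padd (pscale (c x) (indexed_var x)) ?l)"
    using cl.hom_add[of "pscale (c x) (indexed_var x)" ?l] lP vP by simp
  also have "indexed_padd (pscale (c x) (indexed_var x)) ?l = lform (\<lambda>b. if b \<in> insert x C then c b else \<zero>)"
  proof -
    have "(\<lambda>b. if b \<in> insert x C then c b else \<zero>)(x := \<zero>) = (\<lambda>b. if b \<in> C then c b else \<zero>)"
      using insert(2) by auto
    moreover have "\<And>b. (if b \<in> insert x C then c b else \<zero>) \<in> carrier R" using cC cx by auto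
    ultimately show ?thesis
      using lform_update[of "\<lambda>b. if b \<in> insert x C then c b else \<zero>" x] by simp
  qed
  finally show ?case .
qed

text \<open>The substitution \<open>?E\<close> kills the relations, because coordinates are linear.
  Conversely \<open>?E r\<close> and \<open>r\<close> always have the same class in
  \<open>Sym\<close>, so whatever \<open>?E\<close> kills is a relation. The target keeps
  \<open>carrier N\<close> as its set of variables; the basis variables, in which the result is
  written, are among them.\<close>

lemma sym_ideal_free_iff:
  assumes N: "module_basis R N B" and q: "q \<in> polys (carrier N)"
  shows "q \<in> sym_ideal R N \<longleftrightarrow>
    peval (carrier N) (\<lambda>y. lform (module_basis.coord R N B y)) q = indexed_const \<zero>"
proof -
  interpret N: module_basis R N B by (rule N)
  have M: "module R N" by (rule N.module_axioms)
  let ?P = "polynomial_algebra R (carrier N)"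
  let ?E = "peval (carrier N) (\<lambda>y. lform (N.coord y))"
  interpret P: cring ?P by (rule polynomial_algebra_cring)
  interpret cl: ring_hom_ring ?P "Sym R N" "sym_class N" by (rule sym_class_hom[OF M])
  have lcl: "lform (N.coord y) \<in> polys (carrier N)" if "y \<in> carrier N" for y
    using that N.coord_finite N.coord_support_subset N.basis_subset
    by (intro lform_closed) (auto dest: subsetD)
  then have l: "(\<lambda>y. lform (N.coord y)) \<in> carrier N \<rightarrow> polys (carrier N)" by blast
  have E: "ring_hom_ring ?P ?P ?E" by (intro ring_hom_ringI2 P.ring_axioms ring_hom_cring.homh[OF peval_hom[OF l]])
  have Ev: "?E (indexed_var y) = lform (N.coord y)" if "y \<in> carrier N" for y
    by (rule peval_var[OF l that])
  have minus0: "a \<ominus>\<^bsub>?P\<^esub> a = \<zero>\<^bsub>?P\<^esub>" if "a \<in> polys (carrier N)" for a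
    using that P.r_neg[of a] by (simp add: a_minus_def del: polynomial_algebra_simps) simp
  have clvar: "sym_class N (lform (N.coord y)) = sym_class N (indexed_var y)" if y: "y \<in> carrier N" for y
  proof -
    let ?C = "{b. N.coord y b \<noteq> \<zero>}"
    have C: "finite ?C" "?C \<subseteq> B" using N.coord_finite[OF y] N.coord_support_subset[OF y] by auto
    have "sym_class N (indexed_var (\<Oplus>\<^bsub>N\<^esub>b\<in>?C. N.coord y b \<odot>\<^bsub>N\<^esub> b))
        = sym_class N (lform (\<lambda>b. if b \<in> ?C then N.coord y b else \<zero>))"
      using C N.basis_subset y by (intro sym_class_linear_combination[OF M]) auto
    moreover have "(\<lambda>b. if b \<in> ?C then N.coord y b else \<zero>) = N.coord y" by auto
    ultimately show ?thesis using N.coord_sum[OF y C subset_refl] by simp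
  qed
  have clE: "sym_class N (?E r) = sym_class N r" if "r \<in> polys (carrier N)" for r
    using that
  proof (induction rule: indexed_pset.induct)
    case (indexed_const k)
    then show ?case by (simp add: peval_const)
  next
    case (indexed_padd r s)
    have "?E r \<in> polys (carrier N)" "?E s \<in> polys (carrier N)"
      using indexed_padd(1,2) peval_closed[OF _ l] by auto
    then show ?case
      using indexed_padd cl.hom_add[of r s] cl.hom_add[of "?E r" "?E s"]
      by (simp add: peval_padd[OF l])
  next
    case (indexed_pmult r y)
    have "?E r \<in> polys (carrier N)" using indexed_pmult(1) peval_closed[OF _ l] by auto
    then show ?case
      using indexed_pmult cl.hom_mult[of "indexed_var y" r] cl.hom_mult[of "lform (N.coord y)" "?E r"] lcl[of y]
      by (simp only: peval_pmult[OF l]) (simp add: indexed_pmult_eq_pconv[of r "carrier N" y] clvar)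
  qed
  show ?thesis
  proof
    assume "q \<in> sym_ideal R N"
    then have "?E q \<in> {\<zero>\<^bsub>?P\<^esub>}"
    proof (rule sym_ideal_vimage[OF M E P.zeroideal, rotated -1])
      fix x assume x: "x \<in> carrier N"
      show "?E (indexed_var (x \<oplus>\<^bsub>N\<^esub> y)) \<ominus>\<^bsub>?P\<^esub> (?E (indexed_var x) \<oplus>\<^bsub>?P\<^esub> ?E (indexed_var y)) \<in> {\<zero>\<^bsub>?P\<^esub>}"
        if y: "y \<in> carrier N" for y
      proof -
        have "lform (N.coord (x \<oplus>\<^bsub>N\<^esub> y)) = indexed_padd (lform (N.coord x)) (lform (N.coord y))"
          unfolding lform_add using N.coord_add[OF x y] by presburger
        then show ?thesis using x y lcl minus0 by (simp add: Ev)
      qed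
      show "?E (indexed_var (r \<odot>\<^bsub>N\<^esub> x)) \<ominus>\<^bsub>?P\<^esub> ?E (pscale r (indexed_var x)) \<in> {\<zero>\<^bsub>?P\<^esub>}"
        if r: "r \<in> carrier R" for r
      proof -
        have "N.coord (r \<odot>\<^bsub>N\<^esub> x) = (\<lambda>b. r \<otimes> N.coord x b)"
          using N.coord_smult[OF x r] by blast
        moreover have "?E (pscale r (indexed_var x)) = pscale r (lform (N.coord x))"
          using peval_pscale[OF l indexed_var_closed[OF x] r] Ev[OF x] by simp
        ultimately show ?thesis using x r lcl minus0 by (simp add: Ev lform_pscale[symmetric])
      qed
    qed
    then show "?E q = indexed_const \<zero>" by simp
  next
    assume "?E q = indexed_const \<zero>"
    then have "sym_class N q = sym_class N \<zero>\<^bsub>?P\<^esub>" using clE[OF q] by simp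
    also have "\<dots> = \<zero>\<^bsub>Sym R N\<^esub>" by (rule cl.hom_zero)
    finally show "q \<in> sym_ideal R N" using sym_class_eq_zero_iff[OF M q] by simp
  qed
qed

text \<open>Turns the kernel of \<open>Sym(g)\<close> into equations between coefficients, the form
  on which all three cases operate.\<close>

lemma rees_kernel_free_iff:
  assumes M: "module R M" and N: "module_basis R N B" and g: "g \<in> linear_maps R M N"
    and p: "p \<in> polys (carrier M)"
  shows "sym_class M p \<in> rees_kernel R M N g \<longleftrightarrow>
    peval (carrier N) (\<lambda>x. lform (module_basis.coord R N B (g x))) p = indexed_const \<zero>"
proof -
  interpret N: module_basis R N B by (rule N)
  have gf: "g \<in> carrier M \<rightarrow> carrier N" using g by (simp add: linear_maps_def)
  have lcl: "lform (N.coord y) \<in> polys (carrier N)" if "y \<in> carrier N" for y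
    using that N.coord_finite N.coord_support_subset N.basis_subset
    by (intro lform_closed) (auto dest: subsetD)
  then have l': "(\<lambda>y. lform (N.coord y)) \<in> carrier N \<rightarrow> carrier (polynomial_algebra R (carrier N))" by auto
  show ?thesis
    unfolding rees_kernel_iff[OF M N.module_axioms g p] sym_ideal_free_iff[OF N rename_variables_closed[OF p gf]]
      ring_hom_cring.evaluate_rename[OF const_hom p gf l'] ..
qed

subsection \<open>The first isomorphism theorem for Rees algebras\<close>

text \<open>The ring part is the first isomorphism theorem. Scalars are respected because they act
  on \<open>Sym\<close> as multiplication by classes of constants, which \<open>Sym_map\<close>
  preserves; degrees, because both gradings are images of the grading of
  \<open>Sym R M\<close>.\<close>

lemma rees_kernel_iso:
  assumes M: "module R M" and N: "module R N" and g: "g \<in> linear_maps R M N"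
  shows "(\<lambda>Y. the_elem (Sym_map R M N g ` Y)) \<in> graded_algebra_isos R
    (quotient_graded_algebra (Sym R M) (rees_kernel R M N g)) (rees_algebra_map R M N g)"
proof -
  let ?K = "rees_kernel R M N g" and ?\<phi> = "\<lambda>Y. the_elem (Sym_map R M N g ` Y)"
  let ?Q = "quotient_graded_algebra (Sym R M) ?K" and ?T = "rees_algebra_map R M N g"
  interpret s: ring_hom_ring "Sym R M" "Sym R N" "Sym_map R M N g"
    by (rule Sym_map_hom[OF M N g])
  have K: "?K = a_kernel (Sym R M) (Sym R N) (Sym_map R M N g)" by (simp add: rees_kernel_def)
  have \<phi>: "?\<phi> (?K +>\<^bsub>Sym R M\<^esub> x) = Sym_map R M N g x" if "x \<in> carrier (Sym R M)" for x
    unfolding K using that by simp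
  have gf: "g \<in> carrier M \<rightarrow> carrier N" using g by (simp add: linear_maps_def)
  have T: "carrier ?T = Sym_map R M N g ` carrier (Sym R M)" "monoid.mult ?T = monoid.mult (Sym R N)"
    "one ?T = one (Sym R N)" "ring.add ?T = ring.add (Sym R N)" "smult ?T = smult (Sym R N)"
    "component ?T i = Sym_map R M N g ` component (Sym R M) i" for i
    by (simp_all add: rees_algebra_map_def)
  have "?\<phi> \<in> ring_iso (Sym R M Quot ?K) ((Sym R N)\<lparr>carrier := Sym_map R M N g ` carrier (Sym R M)\<rparr>)"
    unfolding K by (rule s.FactRing_iso_set_aux)
  then have "?\<phi> \<in> ring_iso ?Q ?T"
    by (simp add: ring_iso_def ring_hom_def quotient_graded_algebra_simps T)
  moreover have "?\<phi> (r \<odot>\<^bsub>?Q\<^esub> V) = r \<odot>\<^bsub>?T\<^esub> ?\<phi> V" if r: "r \<in> carrier R" and "V \<in> carrier ?Q" for r V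
  proof -
    from that obtain x where x: "x \<in> carrier (Sym R M)" "V = ?K +>\<^bsub>Sym R M\<^esub> x"
      unfolding quotient_carrier by blast
    have sm: "r \<odot>\<^bsub>Sym R M\<^esub> x = sym_class M (indexed_const r) \<otimes>\<^bsub>Sym R M\<^esub> x"
      "r \<odot>\<^bsub>Sym R N\<^esub> Sym_map R M N g x = sym_class N (indexed_const r) \<otimes>\<^bsub>Sym R N\<^esub> Sym_map R M N g x"
      using Sym_algebra[OF M] Sym_algebra[OF N] r x(1) by (auto simp: algebra_via_def)
    have rc: "sym_class M (indexed_const r) \<in> carrier (Sym R M)" using r by (auto simp: Sym_carrier)
    have "?\<phi> (r \<odot>\<^bsub>?Q\<^esub> V) = Sym_map R M N g (r \<odot>\<^bsub>Sym R M\<^esub> x)"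
      using algebra_via_quotient(2)[OF Sym_algebra[OF M] rees_kernel_ideal[OF M N g] r x(1)] x rc sm
      by (simp add: \<phi>)
    also have "\<dots> = r \<odot>\<^bsub>Sym R N\<^esub> Sym_map R M N g x"
      unfolding sm using s.hom_mult[OF rc x(1)] Sym_map_class[OF M N g indexed_const_closed[OF r]]
        rename_variables_const[OF r, of g] by simp
    finally show ?thesis using \<phi>[OF x(1)] x(2) by (simp add: T)
  qed
  moreover have "?\<phi> ` component ?Q i = component ?T i" for i
  proof -
    have "component (Sym R M) i \<subseteq> carrier (Sym R M)"
      by (auto simp: Sym_def quotient_carrier quotient_graded_algebra_simps(6) polynomial_algebra_def)
    then show ?thesis
      unfolding T quotient_graded_algebra_simps image_image using \<phi> by (intro image_cong) auto
  qed
  ultimately show ?thesis by (simp add: graded_algebra_isos_def)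
qed

end

section \<open>Associated primes\<close>

text \<open>The ascending chain condition as a maximum principle: the union of a nonempty chain of
  ideals is itself a member of the chain, so it bounds the chain inside \<open>F\<close>.\<close>

lemma noetherian_maximal_ideal:
  assumes "noetherian_ring R" "F \<noteq> {}" "\<And>I. I \<in> F \<Longrightarrow> ideal I R"
  shows "\<exists>J\<in>F. \<forall>I\<in>F. J \<subseteq> I \<longrightarrow> I = J"
proof -
  interpret noetherian_ring R by fact
  show ?thesis
  proof (rule subset_Zorn)
    fix C assume ch: "subset.chain F C"
    show "\<exists>U\<in>F. \<forall>Y\<in>C. Y \<subseteq> U"
    proof (cases "C = {}")
      case True
      then show ?thesis using assms(2) by blast
    next
      case False
      have "subset.chain {I. ideal I R} C"
        using ch assms(3) unfolding pred_on.chain_def by blast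
      then have "\<Union>C \<in> C" using ideal_chain_is_trivial[OF False] by blast
      moreover have "C \<subseteq> F" using ch unfolding pred_on.chain_def by blast
      ultimately show ?thesis by (intro bexI[of _ "\<Union>C"]) blast+
    qed
  qed
qed

context cring
begin

text \<open>The colon ideal \<open>I : y\<close>, that is, the annihilator of the class of
  \<open>y\<close> modulo \<open>I\<close>.\<close>

definition colon :: "'a set \<Rightarrow> 'a \<Rightarrow> 'a set"
  where "colon I y = {a \<in> carrier R. a \<otimes> y \<in> I}"

lemma colon_ideal:
  assumes "ideal I R" "y \<in> carrier R"
  shows "ideal (colon I y) R"
proof -
  interpret I: ideal I R by fact
  show ?thesis
  proof (rule idealI)
    show "subgroup (colon I y) (add_monoid R)"
    proof (rule add.subgroupI)
      show "colon I y \<subseteq> carrier R" by (auto simp: colon_def)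
      have "\<zero> \<in> colon I y" using assms(2) by (simp add: colon_def)
      then show "colon I y \<noteq> {}" by blast
      show "\<ominus> a \<in> colon I y" if "a \<in> colon I y" for a
        using that assms(2) by (simp add: colon_def l_minus)
      show "a \<oplus> b \<in> colon I y" if "a \<in> colon I y" "b \<in> colon I y" for a b
        using that assms(2) by (simp add: colon_def l_distr)
    qed
    fix a x assume a: "a \<in> colon I y" and x: "x \<in> carrier R"
    then have "x \<otimes> (a \<otimes> y) \<in> I" "a \<in> carrier R" using I.I_l_closed by (auto simp: colon_def)
    then show "x \<otimes> a \<in> colon I y" "a \<otimes> x \<in> colon I y"
      using x assms(2) by (simp_all add: colon_def m_assoc m_comm[of a x])
  qed (rule ring_axioms)
qed

text \<open>A maximal member \<open>J\<close> among the annihilators of the nonzero multiples of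
  \<open>x\<close> modulo \<open>I\<close> is prime: if \<open>b \<notin> J\<close>, then
  \<open>b r x\<close> is again a nonzero multiple with annihilator containing \<open>J\<close>,
  hence equal to \<open>J\<close>, and \<open>a b \<in> J\<close> makes \<open>a\<close> kill it.
  Used with \<open>I\<close> zero to find associated primes, and with a proper ideal to enlarge the
  domain of a partial map.\<close>

lemma prime_colon_exists:
  assumes "noetherian_ring R" and I: "ideal I R" and x: "x \<in> carrier R" "x \<notin> I"
  obtains r where "r \<in> carrier R" "r \<otimes> x \<notin> I" "primeideal (colon I (r \<otimes> x)) R"
proof -
  interpret I: ideal I R by fact
  let ?A = "{colon I (r \<otimes> x) | r. r \<in> carrier R \<and> r \<otimes> x \<notin> I}"
  have "\<one> \<otimes> x \<notin> I" using x by simp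
  then have "colon I (\<one> \<otimes> x) \<in> ?A" using one_closed by blast
  then have ne: "?A \<noteq> {}" by blast
  have id: "ideal J R" if "J \<in> ?A" for J using colon_ideal[OF I] x that by auto
  have "\<exists>J\<in>?A. \<forall>K\<in>?A. J \<subseteq> K \<longrightarrow> K = J"
    by (rule noetherian_maximal_ideal[OF assms(1) ne]) (rule id)
  then obtain J where J: "J \<in> ?A" and J_max: "\<forall>K\<in>?A. J \<subseteq> K \<longrightarrow> K = J" by (elim bexE)
  from J obtain r where r: "r \<in> carrier R" "r \<otimes> x \<notin> I" "J = colon I (r \<otimes> x)" by blast
  have y: "r \<otimes> x \<in> carrier R" using r x by simp
  have "primeideal J R"
  proof (rule primeidealI)
    show "ideal J R" using colon_ideal[OF I y] r by simp
    show "cring R" by (rule is_cring)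
    have "\<one> \<notin> J" using r y by (simp add: colon_def)
    then show "carrier R \<noteq> J" using one_closed by blast
    fix a b assume ab: "a \<in> carrier R" "b \<in> carrier R" "a \<otimes> b \<in> J"
    show "a \<in> J \<or> b \<in> J"
    proof (rule disjCI)
      assume "b \<notin> J"
      then have nb: "(b \<otimes> r) \<otimes> x \<notin> I" using ab r x by (simp add: colon_def m_assoc)
      have "colon I ((b \<otimes> r) \<otimes> x) \<in> ?A" using nb ab r by blast
      moreover have "J \<subseteq> colon I ((b \<otimes> r) \<otimes> x)"
      proof
        fix c assume "c \<in> J"
        then have c: "c \<in> carrier R" "c \<otimes> (r \<otimes> x) \<in> I" using r by (auto simp: colon_def)
        have "c \<otimes> ((b \<otimes> r) \<otimes> x) = b \<otimes> (c \<otimes> (r \<otimes> x))"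
          using c ab r x by (simp add: m_assoc m_lcomm)
        then show "c \<in> colon I ((b \<otimes> r) \<otimes> x)"
          using I.I_l_closed[OF c(2) ab(2)] c(1) by (simp add: colon_def)
      qed
      ultimately have "colon I ((b \<otimes> r) \<otimes> x) = J" using J_max by blast
      moreover have "a \<in> colon I ((b \<otimes> r) \<otimes> x)"
        using ab r x by (simp add: colon_def m_assoc)
      ultimately show "a \<in> J" by simp
    qed
  qed
  with r that show thesis by blast
qed

text \<open>The exponent may depend on \<open>Q\<close>. Some multiple of a nonzero \<open>c\<close>
  has a prime annihilator \<open>Q\<close>; this contains \<open>t [^] n\<close>, and primality
  would put \<open>t\<close> itself into it.\<close>

lemma eq_zero_by_associated_primes:
  assumes noeth: "noetherian_ring R" and c: "c \<in> carrier R"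
    and loc: "\<And>Q. associated_prime R Q \<Longrightarrow> \<exists>t\<in>carrier R - Q. \<exists>n :: nat. t [^] n \<otimes> c = \<zero>"
  shows "c = \<zero>"
proof (rule ccontr)
  assume "c \<noteq> \<zero>"
  then have "c \<notin> {\<zero>}" by simp
  then obtain r where r: "r \<in> carrier R" "r \<otimes> c \<notin> {\<zero>}" "primeideal (colon {\<zero>} (r \<otimes> c)) R"
    by (rule prime_colon_exists[OF noeth zeroideal c])
  define Q where "Q = colon {\<zero>} (r \<otimes> c)"
  have mem: "a \<in> Q \<longleftrightarrow> a \<in> carrier R \<and> a \<otimes> (r \<otimes> c) = \<zero>" for a by (simp add: Q_def colon_def)
  have prime: "primeideal Q R" unfolding Q_def by (rule r(3))
  have rc: "r \<otimes> c \<in> carrier R" using r(1) c by (rule m_closed)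
  have "associated_prime R Q"
    unfolding associated_prime_def using prime rc mem by blast
  then obtain t and n :: nat where t: "t \<in> carrier R" "t \<notin> Q" "t [^] n \<otimes> c = \<zero>" using loc by blast
  have "t [^] n \<otimes> (r \<otimes> c) = r \<otimes> (t [^] n \<otimes> c)"
    by (rule m_lcomm[OF nat_pow_closed[OF t(1)] r(1) c])
  then have tn: "t [^] n \<in> Q" using t r(1) by (simp add: mem)
  have "t [^] k \<notin> Q" for k :: nat
  proof (induction k)
    case 0
    then show ?case using r(2) rc by (simp add: mem)
  next
    case (Suc k)
    then show ?case using primeideal.I_prime[OF prime nat_pow_closed[OF t(1), of k] t(1)] t(2) by auto
  qed
  with tn show False by blast
qed

section \<open>Linear systems over a residue field\<close>

definition dot :: "'l set \<Rightarrow> ('l \<Rightarrow> 'a) \<Rightarrow> ('l \<Rightarrow> 'a) \<Rightarrow> 'a"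
  where "dot L k v = (\<Oplus>l\<in>L. k l \<otimes> v l)"

lemma dot_closed [simp]: "k \<in> L \<rightarrow> carrier R \<Longrightarrow> v \<in> L \<rightarrow> carrier R \<Longrightarrow> dot L k v \<in> carrier R"
  unfolding dot_def by (intro finsum_closed) auto

lemma dot_add:
  assumes k: "k \<in> L \<rightarrow> carrier R" and v: "v \<in> L \<rightarrow> carrier R" and w: "w \<in> L \<rightarrow> carrier R"
  shows "dot L k (\<lambda>l. v l \<oplus> w l) = dot L k v \<oplus> dot L k w"
proof -
  have c: "k l \<in> carrier R" "v l \<in> carrier R" "w l \<in> carrier R" if "l \<in> L" for l using assms that by auto
  have "dot L k (\<lambda>l. v l \<oplus> w l) = (\<Oplus>l\<in>L. k l \<otimes> v l \<oplus> k l \<otimes> w l)"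
    unfolding dot_def using c by (intro finsum_cong') (auto simp: r_distr)
  also have "\<dots> = dot L k v \<oplus> dot L k w"
    unfolding dot_def using c by (intro finsum_addf) auto
  finally show ?thesis .
qed

lemma dot_scale:
  assumes L: "finite L" and k: "k \<in> L \<rightarrow> carrier R" and v: "v \<in> L \<rightarrow> carrier R" and a: "a \<in> carrier R"
  shows "dot L k (\<lambda>l. a \<otimes> v l) = a \<otimes> dot L k v"
proof -
  have c: "k l \<in> carrier R" "v l \<in> carrier R" if "l \<in> L" for l using assms that by auto
  have "dot L k (\<lambda>l. a \<otimes> v l) = (\<Oplus>l\<in>L. a \<otimes> (k l \<otimes> v l))"
    unfolding dot_def
  proof (intro finsum_cong' refl funcsetI)
    fix l assume l: "l \<in> L"
    show "k l \<otimes> (a \<otimes> v l) = a \<otimes> (k l \<otimes> v l)" by (rule m_lcomm[OF c(1)[OF l] a c(2)[OF l]])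
    show "a \<otimes> (k l \<otimes> v l) \<in> carrier R" using c[OF l] a by simp
  qed
  also have "\<dots> = a \<otimes> dot L k v"
    unfolding dot_def using c L a by (intro finsum_rdistr[symmetric]) auto
  finally show ?thesis .
qed

text \<open>Gaussian elimination modulo the prime ideal \<open>Q\<close>, without passing to the residue field: the pivot
  \<open>u\<close> of each step is collected in the factor \<open>t \<notin> Q\<close>.\<close>

lemma solve_system_modulo_prime:
  assumes Q: "primeideal Q R" and L: "finite L" and "finite V"
    and "\<And>i l. i \<in> V \<Longrightarrow> l \<in> L \<Longrightarrow> v i l \<in> carrier R"
    and "\<And>a. a \<in> V \<rightarrow> carrier R \<Longrightarrow> (\<And>l. l \<in> L \<Longrightarrow> (\<Oplus>i\<in>V. a i \<otimes> v i l) \<in> Q) \<Longrightarrow> \<forall>i\<in>V. a i \<in> Q"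
    and "b \<in> V \<rightarrow> carrier R"
  shows "\<exists>t\<in>carrier R - Q. \<exists>k\<in>L \<rightarrow> carrier R. \<forall>i\<in>V. dot L k (v i) = t \<otimes> b i"
  using assms(3-)
proof (induction V arbitrary: v b rule: finite_induct)
  case empty
  interpret Q: primeideal Q R by fact
  have "\<one> \<notin> Q" using Q.I_notcarr Q.one_imp_carrier by blast
  then show ?case by (intro bexI[of _ \<one>] bexI[of _ "\<lambda>_. \<zero>"]) auto
next
  case (insert j V)
  interpret Q: primeideal Q R by fact
  have one: "\<one> \<notin> Q" using Q.I_notcarr Q.one_imp_carrier by blast
  have vc: "v i l \<in> carrier R" if "i \<in> insert j V" "l \<in> L" for i l using insert(4) that by blast
  have bc: "b i \<in> carrier R" if "i \<in> insert j V" for i using insert(6) that by blast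
  \<comment> \<open>A pivot in row \<open>j\<close>: otherwise the relation with coefficient
    \<open>\<one>\<close> at \<open>j\<close> and zero elsewhere would hold modulo \<open>Q\<close>,
    against independence.\<close>
  have "\<exists>l\<in>L. v j l \<notin> Q"
  proof (rule ccontr)
    assume no: "\<not> (\<exists>l\<in>L. v j l \<notin> Q)"
    let ?a = "\<lambda>i. if i = j then \<one> else \<zero>"
    have "(\<Oplus>i\<in>insert j V. ?a i \<otimes> v i l) \<in> Q" if l: "l \<in> L" for l
    proof -
      have "(\<Oplus>i\<in>insert j V. ?a i \<otimes> v i l) = ?a j \<otimes> v j l \<oplus> (\<Oplus>i\<in>V. ?a i \<otimes> v i l)"
        using insert(1,2) vc l by (intro finsum_insert) auto
      also have "(\<Oplus>i\<in>V. ?a i \<otimes> v i l) = (\<Oplus>i\<in>V. \<zero>)"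
        using insert(2) vc l by (intro finsum_cong') auto
      finally show ?thesis using no l vc[of j l] by simp
    qed
    then have "\<forall>i\<in>insert j V. ?a i \<in> Q" by (intro insert(5)) auto
    then show False using one by simp
  qed
  then obtain m where m: "m \<in> L" "v j m \<notin> Q" by blast
  define u where "u = v j m"
  have u: "u \<in> carrier R" "u \<notin> Q" using m vc by (auto simp: u_def)
  \<comment> \<open>Elimination with the division by the pivot cleared: column \<open>m\<close> of
    each reduced row \<open>w i\<close> is zero. The right-hand side \<open>d\<close> is treated
    alike.\<close>
  define w where "w i l = u \<otimes> v i l \<ominus> v i m \<otimes> v j l" for i l
  define d where "d i = u \<otimes> b i \<ominus> v i m \<otimes> b j" for i
  have wc: "w i l \<in> carrier R" if "i \<in> V" "l \<in> L" for i l
    using that vc u m by (simp add: w_def)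
  have "\<exists>t\<in>carrier R - Q. \<exists>k\<in>L \<rightarrow> carrier R. \<forall>i\<in>V. dot L k (w i) = t \<otimes> d i"
  proof (rule insert(3))
    show "d \<in> V \<rightarrow> carrier R" using u bc vc m by (auto simp: d_def)
    fix a assume a: "a \<in> V \<rightarrow> carrier R" and aw: "\<And>l. l \<in> L \<Longrightarrow> (\<Oplus>i\<in>V. a i \<otimes> w i l) \<in> Q"
    have ac: "a i \<in> carrier R" if "i \<in> V" for i using a that by auto
    let ?s = "\<Oplus>i\<in>V. a i \<otimes> v i m"
    have s: "?s \<in> carrier R" using ac vc m by (intro finsum_closed) auto
    \<comment> \<open>A relation among the reduced rows is lifted to the original ones: the
      coefficient at \<open>j\<close> cancels all multiples of row \<open>j\<close> that the
      reduction brought in. The other coefficients carry a factor \<open>u \<notin> Q\<close>, which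
      primality removes at the end.\<close>
    let ?a = "\<lambda>i. if i = j then \<ominus> ?s else a i \<otimes> u"
    have "(\<Oplus>i\<in>insert j V. ?a i \<otimes> v i l) \<in> Q" if l: "l \<in> L" for l
    proof -
      have "(\<Oplus>i\<in>insert j V. ?a i \<otimes> v i l) = ?a j \<otimes> v j l \<oplus> (\<Oplus>i\<in>V. ?a i \<otimes> v i l)"
        using insert(1,2) vc ac u l s by (intro finsum_insert) auto
      also have "(\<Oplus>i\<in>V. ?a i \<otimes> v i l) = (\<Oplus>i\<in>V. a i \<otimes> w i l \<oplus> (a i \<otimes> v i m) \<otimes> v j l)"
      proof (intro finsum_cong' refl funcsetI)
        fix i assume i: "i \<in> V"
        then have "i \<noteq> j" using insert(2) by blast
        have c: "a i \<in> carrier R" "v i l \<in> carrier R" "v i m \<in> carrier R" "v j l \<in> carrier R"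
          using i l m ac vc by auto
        have "a i \<otimes> u \<otimes> v i l = a i \<otimes> (u \<otimes> v i l \<ominus> v i m \<otimes> v j l) \<oplus> a i \<otimes> v i m \<otimes> v j l"
          using c u(1) by algebra
        then show "?a i \<otimes> v i l = a i \<otimes> w i l \<oplus> (a i \<otimes> v i m) \<otimes> v j l"
          using \<open>i \<noteq> j\<close> by (simp add: w_def)
      qed (use ac wc vc l m in auto)
      also have "\<dots> = (\<Oplus>i\<in>V. a i \<otimes> w i l) \<oplus> (\<Oplus>i\<in>V. (a i \<otimes> v i m) \<otimes> v j l)"
        using ac wc vc l m by (intro finsum_addf) auto
      also have "(\<Oplus>i\<in>V. (a i \<otimes> v i m) \<otimes> v j l) = ?s \<otimes> v j l"
        using ac vc l m insert(1) by (intro finsum_ldistr[symmetric]) auto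
      finally have "(\<Oplus>i\<in>insert j V. ?a i \<otimes> v i l) = \<ominus> ?s \<otimes> v j l \<oplus> ((\<Oplus>i\<in>V. a i \<otimes> w i l) \<oplus> ?s \<otimes> v j l)"
        by simp
      also have "\<dots> = (\<Oplus>i\<in>V. a i \<otimes> w i l)"
      proof -
        have "x \<oplus> (y \<oplus> z) = y" if "x = \<ominus> z" "y \<in> carrier R" "z \<in> carrier R" for x y z
          unfolding that(1) using that(2,3) by algebra
        moreover have "\<ominus> ?s \<otimes> v j l = \<ominus> (?s \<otimes> v j l)" using s vc l by (simp add: l_minus)
        moreover have "(\<Oplus>i\<in>V. a i \<otimes> w i l) \<in> carrier R" using ac wc l by (intro finsum_closed) auto
        ultimately show ?thesis using s vc l by simp
      qed
      finally show ?thesis using aw[OF l] by simp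
    qed
    then have "\<forall>i\<in>insert j V. ?a i \<in> Q" using ac u s by (intro insert(5)) auto
    then have "a i \<otimes> u \<in> Q" if "i \<in> V" for i using that insert(2) by (auto split: if_splits)
    then show "\<forall>i\<in>V. a i \<in> Q" using Q.I_prime ac u by blast
  qed (use wc in blast)
  then obtain t k where t: "t \<in> carrier R" "t \<notin> Q" and k: "k \<in> L \<rightarrow> carrier R"
    and kw: "\<And>i. i \<in> V \<Longrightarrow> dot L k (w i) = t \<otimes> d i" by blast
  have kc: "k l \<in> carrier R" if "l \<in> L" for l using k that by auto
  define D where "D = dot L k (v j)"
  have D: "D \<in> carrier R" unfolding D_def using k vc by (intro dot_closed) auto
  define c where "c = t \<otimes> b j \<ominus> D"
  have c: "c \<in> carrier R" using t bc D by (simp add: c_def)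
  \<comment> \<open>Back substitution. The defect \<open>c\<close> of equation \<open>j\<close> is
    corrected in the pivot column \<open>m\<close>, where all reduced rows vanish, so the reduced
    equations survive. Together with the factors \<open>u\<close> the new denominator is
    \<open>u \<otimes> u \<otimes> t\<close>.\<close>
  define k' where "k' l = u \<otimes> (u \<otimes> k l \<oplus> (if l = m then c else \<zero>))" for l
  have k'v: "dot L k' x = u \<otimes> (u \<otimes> dot L k x \<oplus> c \<otimes> x m)" if x: "x \<in> L \<rightarrow> carrier R" for x
  proof -
    have xc: "x l \<in> carrier R" if "l \<in> L" for l using x that by auto
    have 1: "dot L k' x = (\<Oplus>l\<in>L. u \<otimes> (u \<otimes> (k l \<otimes> x l) \<oplus> (if l = m then c \<otimes> x l else \<zero>)))"
      unfolding dot_def k'_def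
    proof (intro finsum_cong' refl funcsetI)
      fix l assume l: "l \<in> L"
      note cl = kc[OF l] xc[OF l] u(1) c
      have "u \<otimes> (u \<otimes> k l \<oplus> c) \<otimes> x l = u \<otimes> (u \<otimes> (k l \<otimes> x l) \<oplus> c \<otimes> x l)"
        "u \<otimes> (u \<otimes> k l \<oplus> \<zero>) \<otimes> x l = u \<otimes> (u \<otimes> (k l \<otimes> x l) \<oplus> \<zero>)"
        using cl by algebra+
      then show "u \<otimes> (u \<otimes> k l \<oplus> (if l = m then c else \<zero>)) \<otimes> x l
          = u \<otimes> (u \<otimes> (k l \<otimes> x l) \<oplus> (if l = m then c \<otimes> x l else \<zero>))"
        by (cases "l = m") simp_all
      show "u \<otimes> (u \<otimes> (k l \<otimes> x l) \<oplus> (if l = m then c \<otimes> x l else \<zero>)) \<in> carrier R"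
        using cl by (cases "l = m") simp_all
    qed
    have 2: "(\<Oplus>l\<in>L. u \<otimes> (u \<otimes> (k l \<otimes> x l) \<oplus> (if l = m then c \<otimes> x l else \<zero>)))
        = u \<otimes> (\<Oplus>l\<in>L. u \<otimes> (k l \<otimes> x l) \<oplus> (if l = m then c \<otimes> x l else \<zero>))"
      using kc xc u c L by (intro finsum_rdistr[symmetric]) auto
    have 3: "(\<Oplus>l\<in>L. u \<otimes> (k l \<otimes> x l) \<oplus> (if l = m then c \<otimes> x l else \<zero>))
        = (\<Oplus>l\<in>L. u \<otimes> (k l \<otimes> x l)) \<oplus> (\<Oplus>l\<in>L. if l = m then c \<otimes> x l else \<zero>)"
      using kc xc u c by (intro finsum_addf) auto
    have 4: "(\<Oplus>l\<in>L. u \<otimes> (k l \<otimes> x l)) = u \<otimes> dot L k x"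
      unfolding dot_def using kc xc u L by (intro finsum_rdistr[symmetric]) auto
    have 5: "(\<Oplus>l\<in>L. if l = m then c \<otimes> x l else \<zero>) = c \<otimes> x m"
      using xc c L m by (intro add.finprod_singleton_swap) auto
    show ?thesis unfolding 1 2 3 4 5 ..
  qed
  have vi: "v i \<in> L \<rightarrow> carrier R" if "i \<in> insert j V" for i using vc that by blast
  have vj: "dot L k' (v j) = (u \<otimes> u \<otimes> t) \<otimes> b j"
  proof -
    have bj: "b j \<in> carrier R" using bc by simp
    have "u \<otimes> (u \<otimes> D \<oplus> (t \<otimes> b j \<ominus> D) \<otimes> u) = (u \<otimes> u \<otimes> t) \<otimes> b j"
      using u(1) D t(1) bj by algebra
    then show ?thesis using k'v[OF vi[of j]] by (simp add: D_def[symmetric] c_def u_def[symmetric])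
  qed
  moreover have "dot L k' (v i) = (u \<otimes> u \<otimes> t) \<otimes> b i" if i: "i \<in> V" for i
  proof -
    define E where "E = dot L k (v i)"
    have E: "E \<in> carrier R" unfolding E_def using k vi i by (intro dot_closed) auto
    have bi: "b i \<in> carrier R" "b j \<in> carrier R" "v i m \<in> carrier R" using bc vc i m by auto
    have "dot L k (w i) = dot L k (\<lambda>l. u \<otimes> v i l \<oplus> (\<ominus> v i m) \<otimes> v j l)"
      unfolding dot_def using vc i m bi kc u
      by (intro finsum_cong') (auto simp: w_def a_minus_def l_minus)
    also have "\<dots> = dot L k (\<lambda>l. u \<otimes> v i l) \<oplus> dot L k (\<lambda>l. (\<ominus> v i m) \<otimes> v j l)"
      using k vc i u bi by (intro dot_add) auto
    also have "\<dots> = u \<otimes> E \<oplus> (\<ominus> v i m) \<otimes> D"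
      using dot_scale[OF L k vi[of i] u(1)] dot_scale[OF L k vi[of j], of "\<ominus> v i m"] i bi
      by (simp add: E_def D_def)
    finally have "u \<otimes> E \<oplus> (\<ominus> v i m) \<otimes> D = t \<otimes> d i" using kw[OF i] by simp
    then have uE: "u \<otimes> E = t \<otimes> (u \<otimes> b i \<ominus> v i m \<otimes> b j) \<oplus> v i m \<otimes> D"
    proof -
      assume a: "u \<otimes> E \<oplus> (\<ominus> v i m) \<otimes> D = t \<otimes> d i"
      have "u \<otimes> E = (u \<otimes> E \<oplus> (\<ominus> v i m) \<otimes> D) \<oplus> v i m \<otimes> D" using u(1) E D bi by algebra
      then show ?thesis unfolding a d_def .
    qed
    have "dot L k' (v i) = u \<otimes> (u \<otimes> E \<oplus> (t \<otimes> b j \<ominus> D) \<otimes> v i m)"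
      using k'v[OF vi[of i]] i by (simp add: E_def[symmetric] c_def)
    also have "\<dots> = (u \<otimes> u \<otimes> t) \<otimes> b i"
      unfolding uE using u(1) D t(1) bi by algebra
    finally show ?thesis .
  qed
  moreover have "u \<otimes> u \<otimes> t \<notin> Q" using Q.I_prime[of "u \<otimes> u" t] Q.I_prime[of u u] u t by auto
  moreover have "k' \<in> L \<rightarrow> carrier R" using kc u c by (auto simp: k'_def)
  ultimately show ?case using u t by (intro bexI[of _ "u \<otimes> u \<otimes> t"] bexI[of _ k']) auto
qed

end

section \<open>Localization\<close>

lemma (in cring) self_module_simps [simp]:
  "carrier (self_module R) = carrier R" "ring.zero (self_module R) = \<zero>"
  "ring.add (self_module R) = (\<oplus>)" "smult (self_module R) = (\<otimes>)"
  "one (self_module R) = \<one>" "monoid.mult (self_module R) = (\<otimes>)"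
  by (simp_all add: self_module_def)

lemma (in cring) self_module_module: "module R (self_module R)"
proof (rule moduleI)
  show "abelian_group (self_module R)"
    by (rule abelian_groupI) (auto simp: a_assoc intro: a_comm add.l_inv_ex)
qed (auto simp: l_distr r_distr m_assoc intro: is_cring)

locale mult_closed_module = module +
  fixes S
  assumes S_subset: "S \<subseteq> carrier R" and S_one: "\<one> \<in> S"
    and S_mult: "s \<in> S \<Longrightarrow> t \<in> S \<Longrightarrow> s \<otimes> t \<in> S"
begin

abbreviation frac where "frac \<equiv> fraction R S M"
abbreviation loc where "loc \<equiv> localized_module R S M"

lemma S_carrier: "s \<in> S \<Longrightarrow> s \<in> carrier R" using S_subset by blast

lemma smult_swap:
  assumes "a \<in> carrier R" "b \<in> carrier R" "x \<in> carrier M" "y \<in> carrier M" "c \<in> carrier R" "a \<odot>\<^bsub>M\<^esub> x = b \<odot>\<^bsub>M\<^esub> y"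
  shows "(c \<otimes> a) \<odot>\<^bsub>M\<^esub> x = (c \<otimes> b) \<odot>\<^bsub>M\<^esub> y"
  using assms by (simp add: smult_assoc1)

lemma frac_mem_iff:
  assumes "m \<in> carrier M" "s \<in> S"
  shows "(n, t) \<in> frac m s \<longleftrightarrow> n \<in> carrier M \<and> t \<in> S \<and> (\<exists>u\<in>S. (u \<otimes> t) \<odot>\<^bsub>M\<^esub> m = (u \<otimes> s) \<odot>\<^bsub>M\<^esub> n)"
proof -
  have "u \<odot>\<^bsub>M\<^esub> (t \<odot>\<^bsub>M\<^esub> m) = (u \<otimes> t) \<odot>\<^bsub>M\<^esub> m" "u \<odot>\<^bsub>M\<^esub> (s \<odot>\<^bsub>M\<^esub> n) = (u \<otimes> s) \<odot>\<^bsub>M\<^esub> n"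
    if "u \<in> S" "t \<in> S" "n \<in> carrier M" for u
    using that assms S_carrier by (simp_all add: smult_assoc1)
  then show ?thesis unfolding fraction_def by auto
qed

lemma frac_self: "m \<in> carrier M \<Longrightarrow> s \<in> S \<Longrightarrow> (m, s) \<in> frac m s"
  using S_one by (auto simp: frac_mem_iff)

lemma frac_subset:
  assumes m: "m \<in> carrier M" and n: "n \<in> carrier M" and s: "s \<in> S" and t: "t \<in> S" and u: "u \<in> S"
    and eq: "(u \<otimes> t) \<odot>\<^bsub>M\<^esub> m = (u \<otimes> s) \<odot>\<^bsub>M\<^esub> n"
  shows "frac m s \<subseteq> frac n t"
proof clarify
  fix p r assume "(p, r) \<in> frac m s"
  then obtain v where p: "p \<in> carrier M" and r: "r \<in> S" and v: "v \<in> S"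
    and eq': "(v \<otimes> r) \<odot>\<^bsub>M\<^esub> m = (v \<otimes> s) \<odot>\<^bsub>M\<^esub> p" using m s by (auto simp: frac_mem_iff)
  note c = S_carrier[OF s] S_carrier[OF t] S_carrier[OF u] S_carrier[OF v] S_carrier[OF r]
  \<comment> \<open>Transitivity of equality of fractions: the product of both witnesses and of the
    denominator \<open>s\<close> in the middle.\<close>
  let ?w = "u \<otimes> v \<otimes> s"
  have "(?w \<otimes> r) \<odot>\<^bsub>M\<^esub> n = ((v \<otimes> r) \<otimes> (u \<otimes> s)) \<odot>\<^bsub>M\<^esub> n"
    using c by (simp add: m_ac)
  also have "\<dots> = ((v \<otimes> r) \<otimes> (u \<otimes> t)) \<odot>\<^bsub>M\<^esub> m"
    by (rule smult_swap[symmetric]) (use eq c m n in auto)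
  also have "\<dots> = ((u \<otimes> t) \<otimes> (v \<otimes> r)) \<odot>\<^bsub>M\<^esub> m" using c by (simp add: m_comm)
  also have "\<dots> = ((u \<otimes> t) \<otimes> (v \<otimes> s)) \<odot>\<^bsub>M\<^esub> p"
    by (rule smult_swap) (use eq' c m p in auto)
  also have "(u \<otimes> t) \<otimes> (v \<otimes> s) = ?w \<otimes> t" using c by (simp add: m_ac)
  finally show "(p, r) \<in> frac n t"
    using p r n t u v s by (auto simp: frac_mem_iff intro!: bexI[of _ ?w] S_mult)
qed

lemma frac_eq_iff:
  assumes "m \<in> carrier M" "n \<in> carrier M" "s \<in> S" "t \<in> S"
  shows "frac m s = frac n t \<longleftrightarrow> (\<exists>u\<in>S. (u \<otimes> t) \<odot>\<^bsub>M\<^esub> m = (u \<otimes> s) \<odot>\<^bsub>M\<^esub> n)"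
proof
  assume "frac m s = frac n t"
  then have "(n, t) \<in> frac m s" using frac_self assms by blast
  then show "\<exists>u\<in>S. (u \<otimes> t) \<odot>\<^bsub>M\<^esub> m = (u \<otimes> s) \<odot>\<^bsub>M\<^esub> n" using assms by (auto simp: frac_mem_iff)
next
  assume "\<exists>u\<in>S. (u \<otimes> t) \<odot>\<^bsub>M\<^esub> m = (u \<otimes> s) \<odot>\<^bsub>M\<^esub> n"
  then obtain u where "u \<in> S" "(u \<otimes> t) \<odot>\<^bsub>M\<^esub> m = (u \<otimes> s) \<odot>\<^bsub>M\<^esub> n" by blast
  then show "frac m s = frac n t"
    using frac_subset[of m n s t u] frac_subset[of n m t s u] assms by auto
qed

lemma loc_carrier: "carrier loc = {frac m s | m s. m \<in> carrier M \<and> s \<in> S}"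
  by (simp add: localized_module_def)

lemma loc_zero: "\<zero>\<^bsub>loc\<^esub> = frac \<zero>\<^bsub>M\<^esub> \<one>"
  by (simp add: localized_module_def)

lemma loc_add:
  assumes m: "m \<in> carrier M" and n: "n \<in> carrier M" and s: "s \<in> S" and t: "t \<in> S"
  shows "frac m s \<oplus>\<^bsub>loc\<^esub> frac n t = frac (t \<odot>\<^bsub>M\<^esub> m \<oplus>\<^bsub>M\<^esub> s \<odot>\<^bsub>M\<^esub> n) (s \<otimes> t)"
proof -
  have eq: "frac (t' \<odot>\<^bsub>M\<^esub> m' \<oplus>\<^bsub>M\<^esub> s' \<odot>\<^bsub>M\<^esub> n') (s' \<otimes> t') = frac (t \<odot>\<^bsub>M\<^esub> m \<oplus>\<^bsub>M\<^esub> s \<odot>\<^bsub>M\<^esub> n) (s \<otimes> t)"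
    if "(m', s') \<in> frac m s" "(n', t') \<in> frac n t" for m' s' n' t'
  proof -
    from that obtain u v where m': "m' \<in> carrier M" "s' \<in> S" "u \<in> S" "(u \<otimes> s') \<odot>\<^bsub>M\<^esub> m = (u \<otimes> s) \<odot>\<^bsub>M\<^esub> m'"
      and n': "n' \<in> carrier M" "t' \<in> S" "v \<in> S" "(v \<otimes> t') \<odot>\<^bsub>M\<^esub> n = (v \<otimes> t) \<odot>\<^bsub>M\<^esub> n'"
      using m n s t by (auto simp: frac_mem_iff)
    note c = S_carrier[OF s] S_carrier[OF t] S_carrier[OF m'(2)] S_carrier[OF m'(3)]
      S_carrier[OF n'(2)] S_carrier[OF n'(3)]
    let ?w = "u \<otimes> v"
    have w: "?w \<in> carrier R" using c by simp
    have "(?w \<otimes> (s \<otimes> t)) \<odot>\<^bsub>M\<^esub> (t' \<odot>\<^bsub>M\<^esub> m') = ((v \<otimes> t \<otimes> t') \<otimes> (u \<otimes> s)) \<odot>\<^bsub>M\<^esub> m'"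
      using c m' by (simp add: smult_assoc1[symmetric] m_ac)
    also have "\<dots> = ((v \<otimes> t \<otimes> t') \<otimes> (u \<otimes> s')) \<odot>\<^bsub>M\<^esub> m"
      by (rule smult_swap) (use c m m' in auto)
    also have "\<dots> = (?w \<otimes> (s' \<otimes> t')) \<odot>\<^bsub>M\<^esub> (t \<odot>\<^bsub>M\<^esub> m)"
      using c m by (simp add: smult_assoc1[symmetric] m_ac)
    finally have 1: "(?w \<otimes> (s \<otimes> t)) \<odot>\<^bsub>M\<^esub> (t' \<odot>\<^bsub>M\<^esub> m') = (?w \<otimes> (s' \<otimes> t')) \<odot>\<^bsub>M\<^esub> (t \<odot>\<^bsub>M\<^esub> m)" .
    have "(?w \<otimes> (s \<otimes> t)) \<odot>\<^bsub>M\<^esub> (s' \<odot>\<^bsub>M\<^esub> n') = ((u \<otimes> s \<otimes> s') \<otimes> (v \<otimes> t)) \<odot>\<^bsub>M\<^esub> n'"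
      using c n' by (simp add: smult_assoc1[symmetric] m_ac)
    also have "\<dots> = ((u \<otimes> s \<otimes> s') \<otimes> (v \<otimes> t')) \<odot>\<^bsub>M\<^esub> n"
      by (rule smult_swap) (use c n n' in auto)
    also have "\<dots> = (?w \<otimes> (s' \<otimes> t')) \<odot>\<^bsub>M\<^esub> (s \<odot>\<^bsub>M\<^esub> n)"
      using c n by (simp add: smult_assoc1[symmetric] m_ac)
    finally have 2: "(?w \<otimes> (s \<otimes> t)) \<odot>\<^bsub>M\<^esub> (s' \<odot>\<^bsub>M\<^esub> n') = (?w \<otimes> (s' \<otimes> t')) \<odot>\<^bsub>M\<^esub> (s \<odot>\<^bsub>M\<^esub> n)" .
    have "(?w \<otimes> (s \<otimes> t)) \<odot>\<^bsub>M\<^esub> (t' \<odot>\<^bsub>M\<^esub> m' \<oplus>\<^bsub>M\<^esub> s' \<odot>\<^bsub>M\<^esub> n') = (?w \<otimes> (s' \<otimes> t')) \<odot>\<^bsub>M\<^esub> (t \<odot>\<^bsub>M\<^esub> m \<oplus>\<^bsub>M\<^esub> s \<odot>\<^bsub>M\<^esub> n)"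
      using 1 2 c m n m'(1) n'(1) w by (subst (1 2) smult_r_distr) auto
    then show ?thesis
      using c m n m'(1) n'(1) s t m'(2,3) n'(2,3)
      by (subst frac_eq_iff) (auto intro!: S_mult bexI[of _ ?w])
  qed
  have "frac m s \<oplus>\<^bsub>loc\<^esub> frac n t = (\<Union>x\<in>frac m s. \<Union>y\<in>frac n t.
      frac (snd y \<odot>\<^bsub>M\<^esub> fst x \<oplus>\<^bsub>M\<^esub> snd x \<odot>\<^bsub>M\<^esub> fst y) (snd x \<otimes> snd y))"
    by (simp add: localized_module_def case_prod_beta)
  also have "\<dots> = frac (t \<odot>\<^bsub>M\<^esub> m \<oplus>\<^bsub>M\<^esub> s \<odot>\<^bsub>M\<^esub> n) (s \<otimes> t)"
  proof -
    have "(\<Union>y\<in>frac n t. frac (snd y \<odot>\<^bsub>M\<^esub> fst x \<oplus>\<^bsub>M\<^esub> snd x \<odot>\<^bsub>M\<^esub> fst y) (snd x \<otimes> snd y))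
        = frac (t \<odot>\<^bsub>M\<^esub> m \<oplus>\<^bsub>M\<^esub> s \<odot>\<^bsub>M\<^esub> n) (s \<otimes> t)" if "x \<in> frac m s" for x
      using that frac_self[OF n t] eq[of "fst x" "snd x"] by fastforce
    then show ?thesis using frac_self[OF m s] by blast
  qed
  finally show ?thesis .
qed

end

text \<open>The map \<open>m \<mapsto> m / 1\<close> and the structure it induces; all further arguments about localizations
  use only these properties.\<close>

context mult_closed_module
begin

abbreviation (input) A where "A \<equiv> localized_ring R S"
abbreviation (input) rho where "rho r \<equiv> fraction R S (self_module R) r \<one>"
abbreviation (input) mu where "mu m \<equiv> frac m \<one>"

interpretation self: mult_closed_module R "self_module R" S
  using self_module_module S_subset S_one S_mult
  by (intro mult_closed_module.intro mult_closed_module_axioms.intro) auto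

lemma localized_ring_simps:
  "carrier A = carrier (localized_module R S (self_module R))"
  "monoid.mult A = smult (localized_module R S (self_module R))"
  "one A = fraction R S (self_module R) \<one> \<one>"
  "ring.zero A = ring.zero (localized_module R S (self_module R))"
  "ring.add A = ring.add (localized_module R S (self_module R))"
  by (simp_all add: localized_ring_def Let_def)

lemma loc_smult:
  assumes a: "a \<in> carrier R" and m: "m \<in> carrier M" and s: "s \<in> S" and t: "t \<in> S"
  shows "fraction R S (self_module R) a t \<odot>\<^bsub>loc\<^esub> frac m s = frac (a \<odot>\<^bsub>M\<^esub> m) (t \<otimes> s)"
proof -
  have eq: "frac (a' \<odot>\<^bsub>M\<^esub> m') (t' \<otimes> s') = frac (a \<odot>\<^bsub>M\<^esub> m) (t \<otimes> s)"
    if "(a', t') \<in> fraction R S (self_module R) a t" "(m', s') \<in> frac m s" for m' s' a' t'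
  proof -
    from that obtain u v where m': "m' \<in> carrier M" "s' \<in> S" "u \<in> S" "(u \<otimes> s') \<odot>\<^bsub>M\<^esub> m = (u \<otimes> s) \<odot>\<^bsub>M\<^esub> m'"
      and a': "a' \<in> carrier R" "t' \<in> S" "v \<in> S" "(v \<otimes> t') \<otimes> a = (v \<otimes> t) \<otimes> a'"
      using m a s t by (auto simp: frac_mem_iff self.frac_mem_iff)
    note c = S_carrier[OF s] S_carrier[OF t] S_carrier[OF m'(2)] S_carrier[OF m'(3)]
      S_carrier[OF a'(2)] S_carrier[OF a'(3)]
    let ?w = "u \<otimes> v"
    have "(?w \<otimes> (t \<otimes> s)) \<odot>\<^bsub>M\<^esub> (a' \<odot>\<^bsub>M\<^esub> m') = (((v \<otimes> t) \<otimes> a') \<otimes> (u \<otimes> s)) \<odot>\<^bsub>M\<^esub> m'"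
      using c m' a' by (simp add: smult_assoc1[symmetric] m_ac)
    also have "\<dots> = (((v \<otimes> t') \<otimes> a) \<otimes> (u \<otimes> s)) \<odot>\<^bsub>M\<^esub> m'" using a'(4) by simp
    also have "\<dots> = (((v \<otimes> t') \<otimes> a) \<otimes> (u \<otimes> s')) \<odot>\<^bsub>M\<^esub> m"
      by (rule smult_swap) (use c m m' a in auto)
    also have "\<dots> = (?w \<otimes> (t' \<otimes> s')) \<odot>\<^bsub>M\<^esub> (a \<odot>\<^bsub>M\<^esub> m)"
      using c m a by (simp add: smult_assoc1[symmetric] m_ac)
    finally show ?thesis
      using c m a m'(1) a'(1) s t m'(2,3) a'(2,3)
      by (subst frac_eq_iff) (auto intro!: S_mult bexI[of _ ?w])
  qed
  have "fraction R S (self_module R) a t \<odot>\<^bsub>loc\<^esub> frac m s = (\<Union>x\<in>fraction R S (self_module R) a t. \<Union>y\<in>frac m s.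
      frac (fst x \<odot>\<^bsub>M\<^esub> fst y) (snd x \<otimes> snd y))"
    by (simp add: localized_module_def case_prod_beta)
  also have "\<dots> = frac (a \<odot>\<^bsub>M\<^esub> m) (t \<otimes> s)"
  proof -
    have "(\<Union>y\<in>frac m s. frac (fst x \<odot>\<^bsub>M\<^esub> fst y) (snd x \<otimes> snd y)) = frac (a \<odot>\<^bsub>M\<^esub> m) (t \<otimes> s)"
      if "x \<in> fraction R S (self_module R) a t" for x
      using that frac_self[OF m s] eq[of "fst x" "snd x"] by fastforce
    moreover have "(a, t) \<in> fraction R S (self_module R) a t" using self.frac_self a t by simp
    ultimately show ?thesis by blast
  qed
  finally show ?thesis .
qed

end

context mult_closed_module
begin

interpretation self: mult_closed_module R "self_module R" S
  using self_module_module S_subset S_one S_mult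
  by (intro mult_closed_module.intro mult_closed_module_axioms.intro) auto

lemma rho_hom:
  shows "r \<in> carrier R \<Longrightarrow> rho r \<in> carrier A"
    and "a \<in> carrier R \<Longrightarrow> b \<in> carrier R \<Longrightarrow> rho (a \<otimes> b) = rho a \<otimes>\<^bsub>A\<^esub> rho b"
    and "a \<in> carrier R \<Longrightarrow> b \<in> carrier R \<Longrightarrow> rho (a \<oplus> b) = rho a \<oplus>\<^bsub>A\<^esub> rho b"
    and "rho \<in> ring_hom R A"
proof -
  show 1: "r \<in> carrier R \<Longrightarrow> rho r \<in> carrier A" for r
    using S_one by (auto simp: localized_ring_simps self.loc_carrier)
  show 2: "a \<in> carrier R \<Longrightarrow> b \<in> carrier R \<Longrightarrow> rho (a \<otimes> b) = rho a \<otimes>\<^bsub>A\<^esub> rho b" for a b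
    using self.loc_smult[of a b \<one> \<one>] S_one by (simp add: localized_ring_simps)
  show 3: "a \<in> carrier R \<Longrightarrow> b \<in> carrier R \<Longrightarrow> rho (a \<oplus> b) = rho a \<oplus>\<^bsub>A\<^esub> rho b" for a b
    using self.loc_add[of a b \<one> \<one>] S_one by (simp add: localized_ring_simps)
  show "rho \<in> ring_hom R A"
    by (rule ring_hom_memI) (use 1 2 3 in \<open>auto simp: localized_ring_simps\<close>)
qed

lemma rho_unit:
  assumes "s \<in> S"
  shows "\<exists>\<beta>\<in>carrier A. rho s \<otimes>\<^bsub>A\<^esub> \<beta> = \<one>\<^bsub>A\<^esub>"
proof -
  let ?b = "fraction R S (self_module R) \<one> s"
  have "rho s \<otimes>\<^bsub>A\<^esub> ?b = fraction R S (self_module R) (s \<otimes> \<one>) (\<one> \<otimes> s)"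
    using self.loc_smult[of s \<one> s \<one>] S_one assms S_carrier by (simp add: localized_ring_simps)
  also have "\<dots> = \<one>\<^bsub>A\<^esub>"
    unfolding localized_ring_simps using assms S_one S_carrier
    by (subst self.frac_eq_iff) (auto intro!: bexI[of _ \<one>])
  finally show ?thesis using assms by (auto simp: localized_ring_simps self.loc_carrier)
qed

lemma rho_denominator:
  assumes "\<alpha> \<in> carrier A"
  obtains r s where "r \<in> carrier R" "s \<in> S" "rho s \<otimes>\<^bsub>A\<^esub> \<alpha> = rho r"
proof -
  from assms obtain r s where r: "r \<in> carrier R" "s \<in> S" "\<alpha> = fraction R S (self_module R) r s"
    by (auto simp: localized_ring_simps self.loc_carrier)
  have "rho s \<otimes>\<^bsub>A\<^esub> \<alpha> = fraction R S (self_module R) (s \<otimes> r) (\<one> \<otimes> s)"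
    using self.loc_smult[of s r s \<one>] S_one r S_carrier by (simp add: localized_ring_simps)
  also have "\<dots> = rho r"
    using r S_one S_carrier by (subst self.frac_eq_iff) (auto intro!: bexI[of _ \<one>])
  finally show thesis using that r by blast
qed

lemma rho_eq_zero_iff:
  assumes "r \<in> carrier R"
  shows "rho r = \<zero>\<^bsub>A\<^esub> \<longleftrightarrow> (\<exists>u\<in>S. u \<otimes> r = \<zero>)"
  unfolding localized_ring_simps self.loc_zero using assms S_one S_carrier
  by (subst self.frac_eq_iff) auto

lemma mu_closed: "m \<in> carrier M \<Longrightarrow> mu m \<in> carrier loc"
  using S_one by (auto simp: loc_carrier)

lemma mu_add: "m \<in> carrier M \<Longrightarrow> n \<in> carrier M \<Longrightarrow> mu (m \<oplus>\<^bsub>M\<^esub> n) = mu m \<oplus>\<^bsub>loc\<^esub> mu n"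
  using loc_add[of m n \<one> \<one>] S_one by simp

lemma mu_smult: "r \<in> carrier R \<Longrightarrow> m \<in> carrier M \<Longrightarrow> mu (r \<odot>\<^bsub>M\<^esub> m) = rho r \<odot>\<^bsub>loc\<^esub> mu m"
  using loc_smult[of r m \<one> \<one>] S_one by simp

lemma mu_denominator:
  assumes "x \<in> carrier loc"
  obtains m s where "m \<in> carrier M" "s \<in> S" "rho s \<odot>\<^bsub>loc\<^esub> x = mu m"
proof -
  from assms obtain m s where m: "m \<in> carrier M" "s \<in> S" "x = frac m s"
    by (auto simp: loc_carrier)
  have "rho s \<odot>\<^bsub>loc\<^esub> x = frac (s \<odot>\<^bsub>M\<^esub> m) (\<one> \<otimes> s)"
    using loc_smult[of s m s \<one>] S_one m S_carrier by simp
  also have "\<dots> = mu m"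
    using m S_one S_carrier by (subst frac_eq_iff) (auto intro!: bexI[of _ \<one>])
  finally show thesis using that m by blast
qed

end

section \<open>Linear maps\<close>

lemma linear_mapsD:
  assumes "f \<in> linear_maps R M N"
  shows "x \<in> carrier M \<Longrightarrow> f x \<in> carrier N"
    and "x \<in> carrier M \<Longrightarrow> y \<in> carrier M \<Longrightarrow> f (x \<oplus>\<^bsub>M\<^esub> y) = f x \<oplus>\<^bsub>N\<^esub> f y"
    and "r \<in> carrier R \<Longrightarrow> x \<in> carrier M \<Longrightarrow> f (r \<odot>\<^bsub>M\<^esub> x) = r \<odot>\<^bsub>N\<^esub> f x"
  using assms unfolding linear_maps_def by blast+

lemma linear_map_zero:
  assumes "module R M" "module R N" "f \<in> linear_maps R M N"
  shows "f \<zero>\<^bsub>M\<^esub> = \<zero>\<^bsub>N\<^esub>"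
proof -
  interpret M: module R M by fact
  interpret N: module R N by fact
  have "f \<zero>\<^bsub>M\<^esub> = f (\<zero>\<^bsub>R\<^esub> \<odot>\<^bsub>M\<^esub> \<zero>\<^bsub>M\<^esub>)" by simp
  also have "\<dots> = \<zero>\<^bsub>R\<^esub> \<odot>\<^bsub>N\<^esub> f \<zero>\<^bsub>M\<^esub>" by (rule linear_mapsD(3)[OF assms(3)]) simp_all
  also have "\<dots> = \<zero>\<^bsub>N\<^esub>" using linear_mapsD(1)[OF assms(3)] by simp
  finally show ?thesis .
qed

lemma linear_map_finsum:
  assumes "module R M" "module R N" "f \<in> linear_maps R M N" "m \<in> C \<rightarrow> carrier M"
  shows "f (\<Oplus>\<^bsub>M\<^esub>b\<in>C. m b) = (\<Oplus>\<^bsub>N\<^esub>b\<in>C. f (m b))"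
proof -
  interpret M: module R M by fact
  interpret N: module R N by fact
  show ?thesis
    using assms(4)
  proof (induction C rule: infinite_finite_induct)
    case (insert b C)
    have "m b \<in> carrier M" "m \<in> C \<rightarrow> carrier M" using insert(4) by auto
    then show ?case
      using insert linear_mapsD[OF assms(3)]
      by (simp add: M.M.finsum_insert N.M.finsum_insert M.M.finsum_closed Pi_iff)
  qed (use linear_map_zero[OF assms(1-3)] in simp_all)
qed

lemma linear_maps_eqI:
  assumes M: "module R M" and N: "module R N" and f: "f \<in> linear_maps R M N" and g: "g \<in> linear_maps R M N"
    and B: "B \<subseteq> carrier M" "\<forall>x\<in>carrier M. \<exists>c\<in>B \<rightarrow> carrier R. x = (\<Oplus>\<^bsub>M\<^esub>b\<in>B. c b \<odot>\<^bsub>M\<^esub> b)"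
    and eq: "\<And>b. b \<in> B \<Longrightarrow> f b = g b" and x: "x \<in> carrier M"
  shows "f x = g x"
proof -
  interpret M: module R M by fact
  interpret N: module R N by fact
  obtain c where c: "c \<in> B \<rightarrow> carrier R" "x = (\<Oplus>\<^bsub>M\<^esub>b\<in>B. c b \<odot>\<^bsub>M\<^esub> b)" using B x by blast
  have cb: "c b \<in> carrier R" "b \<in> carrier M" if "b \<in> B" for b using c B that by auto
  have *: "h x = (\<Oplus>\<^bsub>N\<^esub>b\<in>B. c b \<odot>\<^bsub>N\<^esub> h b)" if h: "h \<in> linear_maps R M N" for h
  proof -
    have "h x = (\<Oplus>\<^bsub>N\<^esub>b\<in>B. h (c b \<odot>\<^bsub>M\<^esub> b))"
      unfolding c(2) using cb by (intro linear_map_finsum[OF M N h]) auto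
    also have "\<dots> = (\<Oplus>\<^bsub>N\<^esub>b\<in>B. c b \<odot>\<^bsub>N\<^esub> h b)"
      using cb linear_mapsD[OF h] by (intro N.M.finsum_cong') auto
    finally show ?thesis .
  qed
  show ?thesis
    unfolding *[OF f] *[OF g] using cb eq linear_mapsD[OF g] by (intro N.M.finsum_cong') auto
qed

lemma (in cring) finsum_self_module [simp]: "finsum (self_module R) f C = finsum R f C"
  by (simp add: finsum_def finprod_def)

lemma (in cring) dot_scale_left:
  assumes L: "finite L" and k: "k \<in> L \<rightarrow> carrier R" and v: "v \<in> L \<rightarrow> carrier R" and a: "a \<in> carrier R"
  shows "dot L (\<lambda>l. a \<otimes> k l) v = a \<otimes> dot L k v"
proof -
  have c: "k l \<in> carrier R" "v l \<in> carrier R" if "l \<in> L" for l using assms that by auto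
  have "dot L (\<lambda>l. a \<otimes> k l) v = (\<Oplus>l\<in>L. a \<otimes> (k l \<otimes> v l))"
    unfolding dot_def using c a by (intro finsum_cong') (auto simp: m_assoc)
  also have "\<dots> = a \<otimes> dot L k v"
    unfolding dot_def using c L a by (intro finsum_rdistr[symmetric]) auto
  finally show ?thesis .
qed

lemma (in cring) dot_linear:
  assumes M: "module R M" and L: "finite L" and k: "k \<in> L \<rightarrow> carrier R"
    and f: "\<And>l. l \<in> L \<Longrightarrow> f l \<in> linear_maps R M (self_module R)"
  shows "(\<lambda>x. dot L k (\<lambda>l. f l x)) \<in> linear_maps R M (self_module R)"
proof -
  interpret M: module R M by fact
  have fc: "f l x \<in> carrier R" if "l \<in> L" "x \<in> carrier M" for l x
    using linear_mapsD(1)[OF f[OF that(1)] that(2)] by simp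
  have "dot L k (\<lambda>l. f l (x \<oplus>\<^bsub>M\<^esub> y)) = dot L k (\<lambda>l. f l x) \<oplus> dot L k (\<lambda>l. f l y)"
    if "x \<in> carrier M" "y \<in> carrier M" for x y
  proof -
    have "dot L k (\<lambda>l. f l (x \<oplus>\<^bsub>M\<^esub> y)) = dot L k (\<lambda>l. f l x \<oplus> f l y)"
      unfolding dot_def using that fc k linear_mapsD(2)[OF f] by (intro finsum_cong') (auto simp: Pi_iff)
    then show ?thesis using dot_add[OF k] fc that by simp
  qed
  moreover have "dot L k (\<lambda>l. f l (r \<odot>\<^bsub>M\<^esub> x)) = r \<otimes> dot L k (\<lambda>l. f l x)"
    if "r \<in> carrier R" "x \<in> carrier M" for r x
  proof -
    have "dot L k (\<lambda>l. f l (r \<odot>\<^bsub>M\<^esub> x)) = dot L k (\<lambda>l. r \<otimes> f l x)"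
      unfolding dot_def using that fc k linear_mapsD(3)[OF f] by (intro finsum_cong') (auto simp: Pi_iff)
    then show ?thesis using dot_scale[OF L k] fc that by simp
  qed
  ultimately show ?thesis using k fc by (auto simp: linear_maps_def)
qed

lemma (in cring) scale_linear:
  assumes "module R M" "t \<in> carrier R" "f \<in> linear_maps R M (self_module R)"
  shows "(\<lambda>x. t \<otimes> f x) \<in> linear_maps R M (self_module R)"
proof -
  interpret M: module R M by fact
  have f: "f x \<in> carrier R" if "x \<in> carrier M" for x using linear_mapsD(1)[OF assms(3) that] by simp
  have "t \<otimes> f (x \<oplus>\<^bsub>M\<^esub> y) = t \<otimes> f x \<oplus> t \<otimes> f y" if "x \<in> carrier M" "y \<in> carrier M" for x y
    using linear_mapsD(2)[OF assms(3) that] r_distr[OF f[OF that(1)] f[OF that(2)] assms(2)] by simp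
  moreover have "t \<otimes> f (r \<odot>\<^bsub>M\<^esub> x) = r \<otimes> (t \<otimes> f x)" if "r \<in> carrier R" "x \<in> carrier M" for r x
    using linear_mapsD(3)[OF assms(3) that] m_lcomm[OF assms(2) that(1) f[OF that(2)]] by simp
  ultimately show ?thesis using f assms(2) by (simp add: linear_maps_def)
qed

section \<open>Modules that are free locally\<close>

context mult_closed_module
begin

lemma mu_eq_iff:
  assumes "m \<in> carrier M" "n \<in> carrier M"
  shows "mu m = mu n \<longleftrightarrow> (\<exists>u\<in>S. u \<odot>\<^bsub>M\<^esub> m = u \<odot>\<^bsub>M\<^esub> n)"
proof -
  have "(\<exists>u\<in>S. (u \<otimes> \<one>) \<odot>\<^bsub>M\<^esub> m = (u \<otimes> \<one>) \<odot>\<^bsub>M\<^esub> n) \<longleftrightarrow> (\<exists>u\<in>S. u \<odot>\<^bsub>M\<^esub> m = u \<odot>\<^bsub>M\<^esub> n)"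
    by (intro bex_cong refl) (simp add: S_carrier)
  then show ?thesis using frac_eq_iff[OF assms S_one S_one] by blast
qed

lemma common_denominator:
  assumes A: "cring A" and "finite B" "c \<in> B \<rightarrow> carrier A"
  shows "\<exists>s\<in>S. \<exists>a\<in>B \<rightarrow> carrier R. \<forall>b\<in>B. rho s \<otimes>\<^bsub>A\<^esub> c b = rho (a b)"
  using assms(2,3)
proof (induction B rule: finite_induct)
  case empty
  then show ?case using S_one by auto
next
  case (insert b B)
  interpret A: cring A by (rule A)
  have "c \<in> B \<rightarrow> carrier A" and cb: "c b \<in> carrier A" using insert(4) by auto
  then obtain s a where s: "s \<in> S" "a \<in> B \<rightarrow> carrier R" and sa: "\<And>i. i \<in> B \<Longrightarrow> rho s \<otimes>\<^bsub>A\<^esub> c i = rho (a i)"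
    using insert(3) by blast
  obtain r s' where r: "r \<in> carrier R" "s' \<in> S" "rho s' \<otimes>\<^bsub>A\<^esub> c b = rho r" by (rule rho_denominator[OF cb])
  let ?a = "\<lambda>i. if i = b then s \<otimes> r else s' \<otimes> a i"
  note sc = S_carrier[OF s(1)] S_carrier[OF r(2)]
  have "rho (s \<otimes> s') \<otimes>\<^bsub>A\<^esub> c i = rho (?a i)" if i: "i \<in> insert b B" for i
  proof (cases "i = b")
    case True
    have "rho (s \<otimes> s') \<otimes>\<^bsub>A\<^esub> c b = rho s \<otimes>\<^bsub>A\<^esub> (rho s' \<otimes>\<^bsub>A\<^esub> c b)"
      using rho_hom(1)[OF sc(1)] rho_hom(1)[OF sc(2)] cb by (simp add: rho_hom(2)[OF sc] A.m_assoc)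
    then show ?thesis using True r rho_hom(2)[OF sc(1) r(1)] by simp
  next
    case False
    then have iB: "i \<in> B" and ci: "c i \<in> carrier A" and ai: "a i \<in> carrier R" using i insert(4) s(2) by auto
    have "rho (s \<otimes> s') \<otimes>\<^bsub>A\<^esub> c i = rho s' \<otimes>\<^bsub>A\<^esub> (rho s \<otimes>\<^bsub>A\<^esub> c i)"
      using rho_hom(1)[OF sc(1)] rho_hom(1)[OF sc(2)] ci
      by (simp add: rho_hom(2)[OF sc] A.m_assoc A.m_lcomm)
    then show ?thesis using False sa[OF iB] rho_hom(2)[OF sc(2) ai] by simp
  qed
  moreover have "?a \<in> insert b B \<rightarrow> carrier R" using s(2) r(1) sc by (auto simp: Pi_iff)
  ultimately show ?case
    by (intro bexI[of _ "s \<otimes> s'"] bexI[of _ ?a] ballI S_mult s(1) r(2))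
qed

lemma mu_finsum:
  assumes N: "module A loc" and m: "m \<in> C \<rightarrow> carrier M"
  shows "mu (\<Oplus>\<^bsub>M\<^esub>b\<in>C. m b) = (\<Oplus>\<^bsub>loc\<^esub>b\<in>C. mu (m b))"
proof -
  interpret N: module A loc by (rule N)
  show ?thesis using m
  proof (induction C rule: infinite_finite_induct)
    case (insert b C)
    then have "m b \<in> carrier M" "m \<in> C \<rightarrow> carrier M" by auto
    then show ?case
      using insert mu_closed by (simp add: M.finsum_insert N.M.finsum_insert M.finsum_closed Pi_iff mu_add)
  qed (simp_all add: loc_zero)
qed

text \<open>The basis property with denominators cleared. As \<open>G\<close> is finite, only a
  finite part \<open>C\<close> of the basis of the localization matters, and each of its elements is
  replaced by a numerator \<open>m b\<close>, which differs from it by a unit of the localization.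
  Generation and independence are then stated over \<open>R\<close>, up to factors from
  \<open>S\<close>.\<close>

lemma localized_basis:
  assumes basis: "module_basis A loc B" and fin: "finite G" and G: "G \<subseteq> carrier M"
  shows "\<exists>(C :: ('c \<times> 'a) set set) m. finite C \<and> m \<in> C \<rightarrow> carrier M \<and>
    (\<forall>x\<in>G. \<exists>s\<in>S. \<exists>a\<in>C \<rightarrow> carrier R. s \<odot>\<^bsub>M\<^esub> x = (\<Oplus>\<^bsub>M\<^esub>b\<in>C. a b \<odot>\<^bsub>M\<^esub> m b)) \<and>
    (\<forall>a\<in>C \<rightarrow> carrier R. (\<Oplus>\<^bsub>M\<^esub>b\<in>C. a b \<odot>\<^bsub>M\<^esub> m b) = \<zero>\<^bsub>M\<^esub> \<longrightarrow> (\<forall>b\<in>C. \<exists>u\<in>S. u \<otimes> a b = \<zero>))"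
proof -
  interpret N: module_basis A loc B by (rule basis)
  have modN: "module A loc" and crA: "cring A" by (rule N.module_axioms, rule N.is_cring)
  \<comment> \<open>The basis elements that occur in the image of some element of
    \<open>G\<close>.\<close>
  define C where "C = (\<Union>x\<in>G. {b. N.coord (mu x) b \<noteq> \<zero>\<^bsub>A\<^esub>})"
  have muG: "mu x \<in> carrier loc" if "x \<in> G" for x using that G mu_closed by blast
  have C: "finite C" "C \<subseteq> B"
    unfolding C_def using fin muG N.coord_finite N.coord_support_subset by blast+
  have Cl: "b \<in> carrier loc" if "b \<in> C" for b using that C(2) N.basis_subset by blast
  have "\<forall>b\<in>C. \<exists>m s. m \<in> carrier M \<and> s \<in> S \<and> rho s \<odot>\<^bsub>loc\<^esub> b = mu m"
    using mu_denominator[OF Cl] by metis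
  then obtain m s where m: "\<And>b. b \<in> C \<Longrightarrow> m b \<in> carrier M" and s: "\<And>b. b \<in> C \<Longrightarrow> s b \<in> S"
    and ms: "\<And>b. b \<in> C \<Longrightarrow> rho (s b) \<odot>\<^bsub>loc\<^esub> b = mu (m b)" by metis
  have "\<forall>b\<in>C. \<exists>\<beta>\<in>carrier A. rho (s b) \<otimes>\<^bsub>A\<^esub> \<beta> = \<one>\<^bsub>A\<^esub>" using rho_unit s by blast
  \<comment> \<open>\<open>\<beta> b\<close> inverts the denominator \<open>s b\<close>, so that
    \<open>b\<close> is recovered as \<open>\<beta> b\<close> times the image of its numerator
    \<open>m b\<close>.\<close>
  then obtain \<beta> where \<beta>: "\<And>b. b \<in> C \<Longrightarrow> \<beta> b \<in> carrier A" "\<And>b. b \<in> C \<Longrightarrow> rho (s b) \<otimes>\<^bsub>A\<^esub> \<beta> b = \<one>\<^bsub>A\<^esub>" by metis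
  note rhoc = rho_hom(1)
  note sR = S_carrier[OF s]
  have b_eq: "\<beta> b \<odot>\<^bsub>loc\<^esub> mu (m b) = b" if b: "b \<in> C" for b
  proof -
    have "\<beta> b \<odot>\<^bsub>loc\<^esub> mu (m b) = (rho (s b) \<otimes>\<^bsub>A\<^esub> \<beta> b) \<odot>\<^bsub>loc\<^esub> b"
      using ms[OF b] N.smult_assoc1[OF \<beta>(1)[OF b] rhoc[OF sR[OF b]] Cl[OF b]]
        N.m_comm[OF \<beta>(1)[OF b] rhoc[OF sR[OF b]]] by simp
    then show ?thesis using \<beta>(2)[OF b] Cl[OF b] by simp
  qed
  have gen: "\<exists>t\<in>S. \<exists>a\<in>C \<rightarrow> carrier R. t \<odot>\<^bsub>M\<^esub> x = (\<Oplus>\<^bsub>M\<^esub>b\<in>C. a b \<odot>\<^bsub>M\<^esub> m b)" if x: "x \<in> G" for x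
  proof -
    have xM: "x \<in> carrier M" using x G by blast
    let ?c = "N.coord (mu x)"
    have cA: "?c b \<in> carrier A" for b using muG[OF x] by simp
    have "(\<lambda>b. ?c b \<otimes>\<^bsub>A\<^esub> \<beta> b) \<in> C \<rightarrow> carrier A" using cA \<beta>(1) by auto
    from common_denominator[OF crA C(1) this] obtain t a where t: "t \<in> S" and a: "a \<in> C \<rightarrow> carrier R"
      and ta: "\<And>b. b \<in> C \<Longrightarrow> rho t \<otimes>\<^bsub>A\<^esub> (?c b \<otimes>\<^bsub>A\<^esub> \<beta> b) = rho (a b)" by blast
    have ac: "a b \<in> carrier R" if "b \<in> C" for b using a that by auto
    have tR: "t \<in> carrier R" by (rule S_carrier[OF t])
    have "mu (t \<odot>\<^bsub>M\<^esub> x) = rho t \<odot>\<^bsub>loc\<^esub> mu x" by (rule mu_smult[OF tR xM])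
    also have "mu x = (\<Oplus>\<^bsub>loc\<^esub>b\<in>C. ?c b \<odot>\<^bsub>loc\<^esub> b)"
      by (rule N.coord_sum[OF muG[OF x] C]) (use x in \<open>auto simp: C_def\<close>)
    also have "rho t \<odot>\<^bsub>loc\<^esub> (\<Oplus>\<^bsub>loc\<^esub>b\<in>C. ?c b \<odot>\<^bsub>loc\<^esub> b) = (\<Oplus>\<^bsub>loc\<^esub>b\<in>C. rho t \<odot>\<^bsub>loc\<^esub> (?c b \<odot>\<^bsub>loc\<^esub> b))"
      using cA Cl C(1) rhoc[OF tR] by (intro N.finsum_smult_ldistr) auto
    also have "\<dots> = (\<Oplus>\<^bsub>loc\<^esub>b\<in>C. mu (a b \<odot>\<^bsub>M\<^esub> m b))"
    proof (intro N.M.finsum_cong' refl funcsetI)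
      fix b assume b: "b \<in> C"
      show "mu (a b \<odot>\<^bsub>M\<^esub> m b) \<in> carrier loc" using mu_closed ac[OF b] m[OF b] by simp
      have mub: "mu (m b) \<in> carrier loc" by (rule mu_closed[OF m[OF b]])
      have "rho t \<odot>\<^bsub>loc\<^esub> (?c b \<odot>\<^bsub>loc\<^esub> b) = rho t \<odot>\<^bsub>loc\<^esub> (?c b \<odot>\<^bsub>loc\<^esub> (\<beta> b \<odot>\<^bsub>loc\<^esub> mu (m b)))"
        using b_eq[OF b] by simp
      also have "\<dots> = (rho t \<otimes>\<^bsub>A\<^esub> (?c b \<otimes>\<^bsub>A\<^esub> \<beta> b)) \<odot>\<^bsub>loc\<^esub> mu (m b)"
        using cA[of b] \<beta>(1)[OF b] mub rhoc[OF tR] by (simp add: N.smult_assoc1)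
      also have "\<dots> = mu (a b \<odot>\<^bsub>M\<^esub> m b)" using ta[OF b] mu_smult[OF ac[OF b] m[OF b]] by simp
      finally show "rho t \<odot>\<^bsub>loc\<^esub> (?c b \<odot>\<^bsub>loc\<^esub> b) = mu (a b \<odot>\<^bsub>M\<^esub> m b)" .
    qed
    also have "\<dots> = mu (\<Oplus>\<^bsub>M\<^esub>b\<in>C. a b \<odot>\<^bsub>M\<^esub> m b)"
      using ac m by (intro mu_finsum[OF modN, symmetric]) auto
    finally have "mu (t \<odot>\<^bsub>M\<^esub> x) = mu (\<Oplus>\<^bsub>M\<^esub>b\<in>C. a b \<odot>\<^bsub>M\<^esub> m b)" .
    moreover have sumM: "(\<Oplus>\<^bsub>M\<^esub>b\<in>C. a b \<odot>\<^bsub>M\<^esub> m b) \<in> carrier M" using ac m by (intro M.finsum_closed) auto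
    ultimately obtain u where u: "u \<in> S" "u \<odot>\<^bsub>M\<^esub> (t \<odot>\<^bsub>M\<^esub> x) = u \<odot>\<^bsub>M\<^esub> (\<Oplus>\<^bsub>M\<^esub>b\<in>C. a b \<odot>\<^bsub>M\<^esub> m b)"
      using mu_eq_iff tR xM by auto
    have uR: "u \<in> carrier R" by (rule S_carrier[OF u(1)])
    have "(u \<otimes> t) \<odot>\<^bsub>M\<^esub> x = u \<odot>\<^bsub>M\<^esub> (\<Oplus>\<^bsub>M\<^esub>b\<in>C. a b \<odot>\<^bsub>M\<^esub> m b)" using u uR tR xM by (simp add: smult_assoc1)
    also have "\<dots> = (\<Oplus>\<^bsub>M\<^esub>b\<in>C. u \<odot>\<^bsub>M\<^esub> (a b \<odot>\<^bsub>M\<^esub> m b))"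
      using ac m uR C(1) by (intro finsum_smult_ldistr) auto
    also have "\<dots> = (\<Oplus>\<^bsub>M\<^esub>b\<in>C. (u \<otimes> a b) \<odot>\<^bsub>M\<^esub> m b)"
      using ac m uR by (intro M.finsum_cong') (auto simp: smult_assoc1)
    finally show ?thesis using S_mult[OF u(1) t] ac uR
      by (intro bexI[of _ "u \<otimes> t"] bexI[of _ "\<lambda>b. u \<otimes> a b"]) auto
  qed
  have ind: "\<exists>u\<in>S. u \<otimes> a b = \<zero>"
    if a: "a \<in> C \<rightarrow> carrier R" and zero: "(\<Oplus>\<^bsub>M\<^esub>b\<in>C. a b \<odot>\<^bsub>M\<^esub> m b) = \<zero>\<^bsub>M\<^esub>" and b: "b \<in> C" for a b
  proof -
    have ac: "a b \<in> carrier R" if "b \<in> C" for b using a that by auto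
    \<comment> \<open>The image of \<open>m b\<close> is \<open>s b\<close> times \<open>b\<close>,
      so a relation among the numerators is a relation among basis elements with coefficients
      \<open>a b \<otimes> s b\<close>. Comparison with the empty expansion of zero kills these in
      the localization; \<open>s b\<close> is finally absorbed into the factor from
      \<open>S\<close>.\<close>
    let ?d = "\<lambda>b. if b \<in> C then rho (a b \<otimes> s b) else \<zero>\<^bsub>A\<^esub>"
    have dA: "?d b \<in> carrier A" for b using rhoc[of "a b \<otimes> s b"] ac sR by auto
    have "\<zero>\<^bsub>loc\<^esub> = mu (\<Oplus>\<^bsub>M\<^esub>b\<in>C. a b \<odot>\<^bsub>M\<^esub> m b)" using zero by (simp add: loc_zero)
    also have "\<dots> = (\<Oplus>\<^bsub>loc\<^esub>b\<in>C. mu (a b \<odot>\<^bsub>M\<^esub> m b))"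
      using ac m by (intro mu_finsum[OF modN]) auto
    also have "\<dots> = (\<Oplus>\<^bsub>loc\<^esub>b\<in>C. ?d b \<odot>\<^bsub>loc\<^esub> b)"
    proof (intro N.M.finsum_cong' refl funcsetI)
      fix b assume b: "b \<in> C"
      show "?d b \<odot>\<^bsub>loc\<^esub> b \<in> carrier loc" using dA[of b] Cl[OF b] by (rule N.smult_closed)
      have "mu (a b \<odot>\<^bsub>M\<^esub> m b) = rho (a b) \<odot>\<^bsub>loc\<^esub> (rho (s b) \<odot>\<^bsub>loc\<^esub> b)"
        using mu_smult[OF ac[OF b] m[OF b]] ms[OF b] by simp
      also have "\<dots> = ?d b \<odot>\<^bsub>loc\<^esub> b"
        using b rho_hom(2)[OF ac[OF b] sR[OF b]]
          N.smult_assoc1[OF rhoc[OF ac[OF b]] rhoc[OF sR[OF b]] Cl[OF b]] by simp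
      finally show "mu (a b \<odot>\<^bsub>M\<^esub> m b) = ?d b \<odot>\<^bsub>loc\<^esub> b" .
    qed
    finally have "N.coord \<zero>\<^bsub>loc\<^esub> = ?d" using dA by (intro N.coord_eqI[OF C]) auto
    moreover have "N.coord \<zero>\<^bsub>loc\<^esub> = (\<lambda>_. \<zero>\<^bsub>A\<^esub>)" by (rule N.coord_eqI[of "{}"]) auto
    ultimately have "?d = (\<lambda>_. \<zero>\<^bsub>A\<^esub>)" by (rule trans[OF sym])
    from fun_cong[OF this, of b] have "rho (a b \<otimes> s b) = \<zero>\<^bsub>A\<^esub>" using b by simp
    then obtain u where u: "u \<in> S" "u \<otimes> (a b \<otimes> s b) = \<zero>" using rho_eq_zero_iff ac[OF b] sR[OF b] by auto
    have "(u \<otimes> s b) \<otimes> a b = u \<otimes> (a b \<otimes> s b)"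
      using ac[OF b] sR[OF b] S_carrier[OF u(1)] by (simp add: m_ac)
    then have "(u \<otimes> s b) \<otimes> a b = \<zero>" using u(2) by simp
    then show ?thesis using S_mult[OF u(1) s[OF b]] by blast
  qed
  have "m \<in> C \<rightarrow> carrier M" using m by blast
  then show ?thesis
    by (intro exI[of _ C] exI[of _ m] conjI ballI impI C(1) gen ind)
qed

end

lemma (in cring) prime_complement_mult_closed:
  assumes M: "module R M" and Q: "primeideal Q R"
  shows "mult_closed_module R M (carrier R - Q)"
proof -
  interpret M: module R M by fact
  have "\<one> \<notin> Q"
    using primeideal.I_notcarr[OF Q] ideal.one_imp_carrier[OF primeideal.axioms(1)[OF Q]] by blast
  then show ?thesis
    using primeideal.I_prime[OF Q]
    by (intro mult_closed_module.intro mult_closed_module_axioms.intro M) auto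
qed

lemma (in cring) finprod_not_in_prime:
  assumes Q: "primeideal Q R" and "finite B" "s \<in> B \<rightarrow> carrier R - Q"
  shows "finprod R s B \<in> carrier R - Q"
  using assms(2,3)
proof (induction B rule: finite_induct)
  case empty
  have "\<one> \<notin> Q"
    using primeideal.I_notcarr[OF Q] ideal.one_imp_carrier[OF primeideal.axioms(1)[OF Q]] by blast
  then show ?case by simp
next
  case (insert b B)
  then have c: "s b \<in> carrier R" "s b \<notin> Q" "finprod R s B \<in> carrier R" "finprod R s B \<notin> Q"
    "s \<in> B \<rightarrow> carrier R" by auto
  then show ?case
    using insert(1,2) primeideal.I_prime[OF Q c(1) c(3)] by auto
qed

text \<open>Finite generation: the product of the factors for the generators serves all of them, and
  two linear maps that agree on generators agree everywhere.\<close>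

lemma (in cring) linear_maps_locally_eq:
  assumes M: "module R M" and B: "finite B" "B \<subseteq> carrier M"
      "\<forall>x\<in>carrier M. \<exists>c\<in>B \<rightarrow> carrier R. x = (\<Oplus>\<^bsub>M\<^esub>b\<in>B. c b \<odot>\<^bsub>M\<^esub> b)"
    and Q: "primeideal Q R"
    and f: "f \<in> linear_maps R M (self_module R)" and g: "g \<in> linear_maps R M (self_module R)"
    and eq: "\<And>b. b \<in> B \<Longrightarrow> \<exists>s\<in>carrier R - Q. s \<otimes> f b = s \<otimes> g b"
  shows "\<exists>s\<in>carrier R - Q. \<forall>x\<in>carrier M. s \<otimes> f x = s \<otimes> g x"
proof -
  have "\<forall>b\<in>B. \<exists>s. s \<in> carrier R - Q \<and> s \<otimes> f b = s \<otimes> g b" using eq by blast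
  then obtain s where s: "\<And>b. b \<in> B \<Longrightarrow> s b \<in> carrier R - Q" "\<And>b. b \<in> B \<Longrightarrow> s b \<otimes> f b = s b \<otimes> g b"
    by metis
  let ?s = "finprod R s B"
  have sQ: "?s \<in> carrier R - Q" using s(1) by (intro finprod_not_in_prime[OF Q B(1)]) blast
  have sR: "?s \<in> carrier R" using sQ by blast
  have "?s \<otimes> f b = ?s \<otimes> g b" if b: "b \<in> B" for b
  proof -
    have sB: "s \<in> B - {b} \<rightarrow> carrier R" "s b \<in> carrier R" using s(1) b by blast+
    have c: "f b \<in> carrier R" "g b \<in> carrier R"
      using linear_mapsD(1)[OF f] linear_mapsD(1)[OF g] b B(2) by auto
    have p: "finprod R s (B - {b}) \<in> carrier R" by (rule finprod_closed[OF sB(1)])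
    have "?s = s b \<otimes> finprod R s (B - {b})"
      using finprod_insert[of "B - {b}" b s] B(1) sB b by (simp add: insert_absorb)
    then have "?s \<otimes> h = finprod R s (B - {b}) \<otimes> (s b \<otimes> h)" if "h \<in> carrier R" for h
      using that p sB(2) by (simp add: m_ac)
    then show ?thesis using c s(2)[OF b] by simp
  qed
  then have "?s \<otimes> f x = ?s \<otimes> g x" if "x \<in> carrier M" for x
    using that linear_maps_eqI[OF M self_module_module scale_linear[OF M sR f] scale_linear[OF M sR g] B(2,3)] by blast
  with sQ show ?thesis by blast
qed

text \<open>The coefficients \<open>k\<close> solve a linear system: the prescribed values are those
  of \<open>t g\<close> on the numerators of a basis of the localization. The solution carries over
  to the generators up to a factor outside \<open>Q\<close>, since these are combinations of the
  numerators locally, and then to all of \<open>M\<close>.\<close>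

lemma (in cring) free_localization_factors:
  fixes M :: "('a, 'm, 's) module_scheme"
  assumes fg: "finitely_generated_module R M" and Q: "associated_prime R Q"
    and free: "free_module (ring_at R Q) (module_at R Q M)"
    and L: "finite L" and f: "\<And>l. l \<in> L \<Longrightarrow> f l \<in> linear_maps R M (self_module R)"
    and inj: "\<And>x. x \<in> carrier M \<Longrightarrow> (\<And>l. l \<in> L \<Longrightarrow> f l x = \<zero>) \<Longrightarrow> x = \<zero>\<^bsub>M\<^esub>"
    and g: "g \<in> linear_maps R M (self_module R)"
  shows "\<exists>t\<in>carrier R - Q. \<exists>k\<in>L \<rightarrow> carrier R. \<forall>x\<in>carrier M. dot L k (\<lambda>l. f l x) = t \<otimes> g x"
proof -
  from fg obtain G where M: "module R M" and G: "finite G" "G \<subseteq> carrier M"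
    "\<forall>x\<in>carrier M. \<exists>c\<in>G \<rightarrow> carrier R. x = (\<Oplus>\<^bsub>M\<^esub>b\<in>G. c b \<odot>\<^bsub>M\<^esub> b)"
    unfolding finitely_generated_module_def by blast
  from Q obtain z where prime: "primeideal Q R" and z: "z \<in> carrier R" "Q = {r \<in> carrier R. r \<otimes> z = \<zero>}"
    unfolding associated_prime_def by blast
  let ?S = "carrier R - Q"
  interpret M: module R M by (rule M)
  interpret L: mult_closed_module R M ?S by (rule prime_complement_mult_closed[OF M prime])
  obtain B where basis: "module_basis (ring_at R Q) (module_at R Q M) B"
    using free_module_basis[OF free] by blast
  have fR: "f l x \<in> carrier R" if "l \<in> L" "x \<in> carrier M" for l x
    using linear_mapsD(1)[OF f[OF that(1)] that(2)] by simp
  have gR: "g x \<in> carrier R" if "x \<in> carrier M" for x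
    using linear_mapsD(1)[OF g that] by simp
  obtain C :: "('m \<times> 'a) set set" and m where C: "finite C" "m \<in> C \<rightarrow> carrier M"
    and gen: "\<forall>x\<in>G. \<exists>s\<in>?S. \<exists>a\<in>C \<rightarrow> carrier R. s \<odot>\<^bsub>M\<^esub> x = (\<Oplus>\<^bsub>M\<^esub>b\<in>C. a b \<odot>\<^bsub>M\<^esub> m b)"
    and ind: "\<forall>a\<in>C \<rightarrow> carrier R. (\<Oplus>\<^bsub>M\<^esub>b\<in>C. a b \<odot>\<^bsub>M\<^esub> m b) = \<zero>\<^bsub>M\<^esub> \<longrightarrow> (\<forall>b\<in>C. \<exists>u\<in>?S. u \<otimes> a b = \<zero>)"
    using L.localized_basis[OF basis G(1,2)] by (elim exE conjE)
  have mM: "m b \<in> carrier M" if "b \<in> C" for b using C(2) that by blast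
  have "\<exists>t\<in>?S. \<exists>k\<in>L \<rightarrow> carrier R. \<forall>b\<in>C. dot L k (\<lambda>l. f l (m b)) = t \<otimes> g (m b)"
  proof (rule solve_system_modulo_prime[OF prime L C(1)])
    show "f l (m b) \<in> carrier R" if "b \<in> C" "l \<in> L" for b l using fR mM that by simp
    show "(\<lambda>b. g (m b)) \<in> C \<rightarrow> carrier R" using gR mM by blast
    fix a assume a: "a \<in> C \<rightarrow> carrier R" and aQ: "\<And>l. l \<in> L \<Longrightarrow> (\<Oplus>b\<in>C. a b \<otimes> f l (m b)) \<in> Q"
    have ac: "a b \<in> carrier R" if "b \<in> C" for b using a that by blast
    \<comment> \<open>The element \<open>z\<close> with annihilator \<open>Q\<close> turns
      independence in the module into independence modulo \<open>Q\<close>: if the combination has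
      all its values in \<open>Q\<close>, its multiple by \<open>z\<close> is killed by every
      \<open>f l\<close>, so it is zero; then each \<open>z \<otimes> a b\<close> dies locally,
      which means \<open>a b \<in> Q\<close>.\<close>
    let ?y = "\<Oplus>\<^bsub>M\<^esub>b\<in>C. (z \<otimes> a b) \<odot>\<^bsub>M\<^esub> m b"
    have yM: "?y \<in> carrier M" using ac mM z(1) by (intro M.M.finsum_closed) auto
    have "f l ?y = \<zero>" if l: "l \<in> L" for l
    proof -
      have "f l ?y = (\<Oplus>b\<in>C. f l ((z \<otimes> a b) \<odot>\<^bsub>M\<^esub> m b))"
        using linear_map_finsum[OF M self_module_module f[OF l], of "\<lambda>b. (z \<otimes> a b) \<odot>\<^bsub>M\<^esub> m b" C] ac mM z(1)
        by (simp add: Pi_iff)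
      also have "\<dots> = (\<Oplus>b\<in>C. z \<otimes> (a b \<otimes> f l (m b)))"
      proof (intro finsum_cong' refl funcsetI)
        fix b assume b: "b \<in> C"
        show "z \<otimes> (a b \<otimes> f l (m b)) \<in> carrier R" using z(1) ac[OF b] fR[OF l mM[OF b]] by simp
        have "f l ((z \<otimes> a b) \<odot>\<^bsub>M\<^esub> m b) = (z \<otimes> a b) \<otimes> f l (m b)"
          using linear_mapsD(3)[OF f[OF l], of "z \<otimes> a b" "m b"] z(1) ac[OF b] mM[OF b] by simp
        then show "f l ((z \<otimes> a b) \<odot>\<^bsub>M\<^esub> m b) = z \<otimes> (a b \<otimes> f l (m b))"
          using z(1) ac[OF b] fR[OF l mM[OF b]] by (simp add: m_assoc)
      qed
      also have "\<dots> = z \<otimes> (\<Oplus>b\<in>C. a b \<otimes> f l (m b))"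
        using z(1) ac fR[OF l mM] C(1) by (intro finsum_rdistr[symmetric]) auto
      also have "\<dots> = \<zero>" using aQ[OF l] z by (auto simp: m_comm)
      finally show ?thesis .
    qed
    then have y0: "?y = \<zero>\<^bsub>M\<^esub>" by (rule inj[OF yM])
    show "\<forall>b\<in>C. a b \<in> Q"
    proof
      fix b assume b: "b \<in> C"
      have "(\<lambda>b. z \<otimes> a b) \<in> C \<rightarrow> carrier R" using ac z(1) by blast
      from ind[rule_format, OF this y0 b] obtain u where u: "u \<in> carrier R" "u \<notin> Q" "u \<otimes> (z \<otimes> a b) = \<zero>" by blast
      have "(u \<otimes> a b) \<otimes> z = u \<otimes> (z \<otimes> a b)" using u(1) ac[OF b] z(1) by (simp add: m_ac)
      then have "u \<otimes> a b \<in> Q" using u ac[OF b] z(2) by simp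
      then show "a b \<in> Q" using primeideal.I_prime[OF prime u(1) ac[OF b]] u(2) by blast
    qed
  qed
  then obtain t k where t: "t \<in> ?S" and k: "k \<in> L \<rightarrow> carrier R"
    and eq: "\<And>b. b \<in> C \<Longrightarrow> dot L k (\<lambda>l. f l (m b)) = t \<otimes> g (m b)" by blast
  have tR: "t \<in> carrier R" using t by blast
  let ?F = "\<lambda>x. dot L k (\<lambda>l. f l x)" and ?G = "\<lambda>x. t \<otimes> g x"
  have F: "?F \<in> linear_maps R M (self_module R)" by (rule dot_linear[OF M L k f])
  have Gl: "?G \<in> linear_maps R M (self_module R)" by (rule scale_linear[OF M tR g])
  have sum_eq: "h (\<Oplus>\<^bsub>M\<^esub>b\<in>C. a b \<odot>\<^bsub>M\<^esub> m b) = (\<Oplus>b\<in>C. a b \<otimes> h (m b))"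
    if h: "h \<in> linear_maps R M (self_module R)" and a: "a \<in> C \<rightarrow> carrier R" for h a
  proof -
    have ac: "a b \<in> carrier R" if "b \<in> C" for b using a that by blast
    have "h (\<Oplus>\<^bsub>M\<^esub>b\<in>C. a b \<odot>\<^bsub>M\<^esub> m b) = (\<Oplus>b\<in>C. h (a b \<odot>\<^bsub>M\<^esub> m b))"
      using linear_map_finsum[OF M self_module_module h, of "\<lambda>b. a b \<odot>\<^bsub>M\<^esub> m b" C] ac mM
      by (simp add: Pi_iff)
    also have "\<dots> = (\<Oplus>b\<in>C. a b \<otimes> h (m b))"
      using linear_mapsD[OF h] ac mM by (intro finsum_cong') (auto simp: Pi_iff)
    finally show ?thesis .
  qed
  have "\<exists>s\<in>?S. s \<otimes> ?F x = s \<otimes> ?G x" if x: "x \<in> G" for x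
  proof -
    have xM: "x \<in> carrier M" using x G(2) by blast
    from bspec[OF gen x] obtain s a where s: "s \<in> ?S" and a: "a \<in> C \<rightarrow> carrier R"
      and sx: "s \<odot>\<^bsub>M\<^esub> x = (\<Oplus>\<^bsub>M\<^esub>b\<in>C. a b \<odot>\<^bsub>M\<^esub> m b)" by blast
    have sR: "s \<in> carrier R" using s by blast
    have ac: "a b \<in> carrier R" if "b \<in> C" for b using a that by blast
    have "s \<otimes> ?F x = ?F (s \<odot>\<^bsub>M\<^esub> x)" using linear_mapsD(3)[OF F sR xM] by simp
    also have "\<dots> = (\<Oplus>b\<in>C. a b \<otimes> ?F (m b))" unfolding sx by (rule sum_eq[OF F a])
    also have "\<dots> = (\<Oplus>b\<in>C. a b \<otimes> ?G (m b))"
      using eq ac gR mM tR by (intro finsum_cong') auto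
    also have "\<dots> = ?G (s \<odot>\<^bsub>M\<^esub> x)" unfolding sx by (rule sum_eq[OF Gl a, symmetric])
    also have "\<dots> = s \<otimes> ?G x" using linear_mapsD(3)[OF Gl sR xM] by simp
    finally show ?thesis using s by blast
  qed
  from linear_maps_locally_eq[OF M G prime F Gl this] obtain s where s: "s \<in> carrier R" "s \<notin> Q"
    and sFG: "\<And>x. x \<in> carrier M \<Longrightarrow> s \<otimes> ?F x = s \<otimes> ?G x" by blast
  have "dot L (\<lambda>l. s \<otimes> k l) (\<lambda>l. f l x) = (s \<otimes> t) \<otimes> g x" if x: "x \<in> carrier M" for x
    using dot_scale_left[OF L k, of "\<lambda>l. f l x" s] fR sFG[OF x] s tR x gR by (simp add: m_assoc)
  moreover have "s \<otimes> t \<in> ?S" using L.S_mult s t by blast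
  moreover have "(\<lambda>l. s \<otimes> k l) \<in> L \<rightarrow> carrier R" using k s(1) by blast
  ultimately show ?thesis by (intro bexI[of _ "s \<otimes> t"] bexI[of _ "\<lambda>l. s \<otimes> k l"] ballI)
qed

section \<open>Rings of finite injective dimension\<close>

context cring
begin

abbreviation (input) ideal_module :: "'a set \<Rightarrow> ('a, 'a) module"
  where "ideal_module I \<equiv> (self_module R)\<lparr>carrier := I\<rparr>"

text \<open>Baer's criterion for a subset \<open>Z\<close> of \<open>E\<close>, meant for
  submodules. Stating it with the operations of \<open>E\<close> lets kernels and images in the
  resolution be treated without module records of their own.\<close>

definition baer_injective :: "('a, 'e, 's) module_scheme \<Rightarrow> 'e set \<Rightarrow> bool"
  where "baer_injective E Z \<longleftrightarrow> (\<forall>I f. ideal I R \<longrightarrow> f \<in> linear_maps R (ideal_module I) E \<longrightarrow> f ` I \<subseteq> Z \<longrightarrow>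
    (\<exists>z\<in>Z. \<forall>a\<in>I. f a = a \<odot>\<^bsub>E\<^esub> z))"

lemma ideal_map_iff:
  "f \<in> linear_maps R (ideal_module I) E \<longleftrightarrow> f \<in> I \<rightarrow> carrier E \<and>
    (\<forall>a\<in>I. \<forall>b\<in>I. f (a \<oplus> b) = f a \<oplus>\<^bsub>E\<^esub> f b) \<and> (\<forall>r\<in>carrier R. \<forall>a\<in>I. f (r \<otimes> a) = r \<odot>\<^bsub>E\<^esub> f a)"
  by (simp add: linear_maps_def)

text \<open>\<open>injective_module\<close> tests modules on the type \<open>'a + 'e\<close> only;
  this is a copy of an ideal on that type.\<close>

definition sum_copy :: "'a set \<Rightarrow> ('a, 'a + 'e) module"
  where "sum_copy I = \<lparr>carrier = Inl ` I, monoid.mult = undefined, one = undefined, ring.zero = Inl \<zero>,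
    ring.add = (\<lambda>u v. Inl (projl u \<oplus> projl v)), smult = (\<lambda>a u. Inl (a \<otimes> projl u))\<rparr>"

lemma sum_copy_module:
  assumes "ideal I R"
  shows "module R (sum_copy I)"
proof -
  interpret I: ideal I R by fact
  have c: "a \<in> carrier R" if "a \<in> I" for a using that by (rule I.Icarr)
  show ?thesis
  proof (rule moduleI)
    show "abelian_group (sum_copy I)"
    proof (rule abelian_groupI)
      fix u assume "u \<in> carrier (sum_copy I)"
      then obtain a where "a \<in> I" "u = Inl a" by (auto simp: sum_copy_def)
      then show "\<exists>v\<in>carrier (sum_copy I). v \<oplus>\<^bsub>sum_copy I\<^esub> u = \<zero>\<^bsub>sum_copy I\<^esub>"
        using c by (intro bexI[of _ "Inl (\<ominus> a)"]) (auto simp: sum_copy_def l_neg)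
    qed (auto simp: sum_copy_def c a_ac)
  qed (auto simp: sum_copy_def c is_cring I.I_l_closed l_distr r_distr m_assoc)
qed

text \<open>Injectivity is applied to the inclusion of \<open>I\<close> in \<open>R\<close>; the
  value of the extension at one is the element asked for.\<close>

lemma injective_module_baer:
  fixes E :: "('a, 'e) module"
  assumes "injective_module R E"
  shows "baer_injective E (carrier E)"
  unfolding baer_injective_def
proof (intro allI impI)
  fix I f assume I: "ideal I R" and f: "f \<in> linear_maps R (ideal_module I) E"
  interpret I: ideal I R by (rule I)
  interpret E: module R E using assms by (simp add: injective_module_def)
  note fD = f[unfolded ideal_map_iff]
  let ?N = "sum_copy I :: ('a, 'a + 'e) module" and ?N' = "sum_copy (carrier R) :: ('a, 'a + 'e) module"
  have ex: "\<exists>k\<in>linear_maps R N' E. \<forall>u\<in>carrier N. k (j u) = h u"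
    if "module R N" "module R N'" "j \<in> linear_maps R N N'" "inj_on j (carrier N)" "h \<in> linear_maps R N E"
    for N N' :: "('a, 'a + 'e) module" and j h
    using assms[unfolded injective_module_def, THEN conjunct2, rule_format, OF conjI, OF that] .
  have id: "id \<in> linear_maps R ?N ?N'" using I.Icarr by (auto simp: linear_maps_def sum_copy_def)
  have h: "(\<lambda>u. f (projl u)) \<in> linear_maps R ?N E"
    using fD by (auto simp: linear_maps_def sum_copy_def)
  obtain k where k: "k \<in> linear_maps R ?N' E" and kf: "\<forall>u\<in>carrier ?N. k (id u) = f (projl u)"
    using ex[OF sum_copy_module[OF I] sum_copy_module[OF oneideal] id inj_on_id h] by blast
  have "f a = a \<odot>\<^bsub>E\<^esub> k (Inl \<one>)" if a: "a \<in> I" for a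
  proof -
    have aR: "a \<in> carrier R" using a by (rule I.Icarr)
    have "f a = k (Inl a)" using kf a by (auto simp: sum_copy_def)
    also have "Inl a = a \<odot>\<^bsub>?N'\<^esub> Inl \<one>" using aR by (simp add: sum_copy_def)
    also have "k \<dots> = a \<odot>\<^bsub>E\<^esub> k (Inl \<one>)"
      by (rule linear_mapsD(3)[OF k aR]) (simp add: sum_copy_def)
    finally show ?thesis .
  qed
  moreover have "k (Inl \<one>) \<in> carrier E" by (rule linear_mapsD(1)[OF k]) (simp add: sum_copy_def)
  ultimately show "\<exists>z\<in>carrier E. \<forall>a\<in>I. f a = a \<odot>\<^bsub>E\<^esub> z" by blast
qed

end

text \<open>A Noetherian ring with no prime other than \<open>m\<close>, the annihilator of
  \<open>x\<close>. The ideal generated by \<open>x\<close> is then a copy of \<open>R\<close>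
  modulo \<open>m\<close>, and it is killed by \<open>m\<close>.\<close>

locale artinian_socle = cring +
  fixes x m
  assumes noeth: "noetherian_ring R"
    and x: "x \<in> carrier R" and m: "m = {a \<in> carrier R. a \<otimes> x = \<zero>}"
    and primes: "primeideal P R \<Longrightarrow> P = m"
begin

lemma m_ideal: "ideal m R"
proof -
  have "m = colon {\<zero>} x" by (auto simp: m colon_def)
  then show ?thesis using colon_ideal[OF zeroideal x] by simp
qed

lemma m_carrier: "a \<in> m \<Longrightarrow> a \<in> carrier R" by (simp add: m)

lemma m_iff: "a \<in> carrier R \<Longrightarrow> a \<in> m \<longleftrightarrow> a \<otimes> x = \<zero>" by (simp add: m)

text \<open>As \<open>m\<close> is the whole annihilator of \<open>x\<close>, the assignment
  \<open>a x \<mapsto> a z\<close> is well defined on the ideal generated by \<open>x\<close>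
  whenever \<open>m\<close> kills \<open>z\<close>. Its extension to the ring is given by an element
  \<open>w\<close>, and comparison at \<open>x\<close> gives \<open>z = x w\<close>.\<close>

lemma socle_divisible:
  assumes E: "module R E" and Z: "baer_injective E Z" "Z \<subseteq> carrier E"
    and closed: "\<And>a z. a \<in> carrier R \<Longrightarrow> z \<in> Z \<Longrightarrow> a \<odot>\<^bsub>E\<^esub> z \<in> Z"
    and z: "z \<in> Z" and mz: "\<And>a. a \<in> m \<Longrightarrow> a \<odot>\<^bsub>E\<^esub> z = \<zero>\<^bsub>E\<^esub>"
  obtains w where "w \<in> Z" "z = x \<odot>\<^bsub>E\<^esub> w"
proof -
  interpret E: module R E by (rule E)
  have zE: "z \<in> carrier E" using z Z(2) by blast
  have wd: "a \<odot>\<^bsub>E\<^esub> z = b \<odot>\<^bsub>E\<^esub> z" if ab: "a \<in> carrier R" "b \<in> carrier R" "a \<otimes> x = b \<otimes> x" for a b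
  proof -
    have "(a \<ominus> b) \<otimes> x = \<zero>"
      using ab x by (simp add: a_minus_def l_distr l_minus r_neg)
    then have "(a \<ominus> b) \<odot>\<^bsub>E\<^esub> z = \<zero>\<^bsub>E\<^esub>" using ab by (intro mz) (simp add: m)
    moreover have "a = (a \<ominus> b) \<oplus> b" using ab(1,2) by algebra
    then have "a \<odot>\<^bsub>E\<^esub> z = (a \<ominus> b) \<odot>\<^bsub>E\<^esub> z \<oplus>\<^bsub>E\<^esub> b \<odot>\<^bsub>E\<^esub> z"
      using E.smult_l_distr[of "a \<ominus> b" b z] ab zE by simp
    ultimately show ?thesis using ab zE by simp
  qed
  define f where "f y = (SOME a. a \<in> carrier R \<and> y = a \<otimes> x) \<odot>\<^bsub>E\<^esub> z" for y
  have f: "f (a \<otimes> x) = a \<odot>\<^bsub>E\<^esub> z" if a: "a \<in> carrier R" for a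
  proof -
    let ?b = "SOME b. b \<in> carrier R \<and> a \<otimes> x = b \<otimes> x"
    have "?b \<in> carrier R \<and> a \<otimes> x = ?b \<otimes> x" by (rule someI[of _ a]) (use a in simp)
    then show ?thesis unfolding f_def using wd[of ?b a] a by simp
  qed
  have I: "PIdl x = {a \<otimes> x | a. a \<in> carrier R}" by (auto simp: cgenideal_def)
  have "f \<in> linear_maps R (ideal_module (PIdl x)) E"
    unfolding ideal_map_iff
  proof (intro conjI ballI funcsetI)
    fix y assume "y \<in> PIdl x"
    then obtain a where a: "a \<in> carrier R" "y = a \<otimes> x" unfolding I by blast
    show "f y \<in> carrier E" using a zE by (simp add: f)
    show "f (y \<oplus> y') = f y \<oplus>\<^bsub>E\<^esub> f y'" if "y' \<in> PIdl x" for y'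
    proof -
      from that obtain b where b: "b \<in> carrier R" "y' = b \<otimes> x" unfolding I by blast
      have "y \<oplus> y' = (a \<oplus> b) \<otimes> x" using a b x by (simp add: l_distr)
      then show ?thesis using a b zE by (simp add: f E.smult_l_distr)
    qed
    show "f (r \<otimes> y) = r \<odot>\<^bsub>E\<^esub> f y" if r: "r \<in> carrier R" for r
    proof -
      have "r \<otimes> y = (r \<otimes> a) \<otimes> x" using a r x by (simp add: m_assoc)
      then show ?thesis using a r zE by (simp add: f E.smult_assoc1)
    qed
  qed
  moreover have "f ` (PIdl x) \<subseteq> Z"
  proof clarify
    fix y assume "y \<in> PIdl x"
    then obtain a where "a \<in> carrier R" "y = a \<otimes> x" unfolding I by blast
    then show "f y \<in> Z" using f closed[OF _ z] by simp
  qed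
  ultimately have "\<exists>w\<in>Z. \<forall>a\<in>PIdl x. f a = a \<odot>\<^bsub>E\<^esub> w"
    by (rule Z(1)[unfolded baer_injective_def, rule_format, OF cgenideal_ideal[OF x]])
  then obtain w where w: "w \<in> Z" "\<And>a. a \<in> PIdl x \<Longrightarrow> f a = a \<odot>\<^bsub>E\<^esub> w" by blast
  have "z = f (\<one> \<otimes> x)" using f[OF one_closed] zE by simp
  also have "\<dots> = x \<odot>\<^bsub>E\<^esub> w" using w(2)[OF cgenideal_self[OF x]] x by simp
  finally show thesis using that w(1) by blast
qed

text \<open>Maps can be extended to larger and larger ideals as soon as they can be extended from \<open>m\<close> to \<open>R\<close>: if
  \<open>J\<close> is a proper ideal, then \<open>m\<close> is a prime of the form \<open>J : y\<close>.\<close>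

lemma baer_injective_from_m:
  assumes E: "module R E" and Z: "submodule Z R E"
    and ext: "\<And>f. f \<in> linear_maps R (ideal_module m) E \<Longrightarrow> f ` m \<subseteq> Z \<Longrightarrow> \<exists>z\<in>Z. \<forall>a\<in>m. f a = a \<odot>\<^bsub>E\<^esub> z"
  shows "baer_injective E Z"
  unfolding baer_injective_def
proof (intro allI impI)
  fix I f assume I: "ideal I R" and f: "f \<in> linear_maps R (ideal_module I) E" and fZ: "f ` I \<subseteq> Z"
  interpret E: module R E by (rule E)
  note ZE = E.submoduleE[OF Z]
  let ?P = "\<lambda>J g. g \<in> linear_maps R (ideal_module J) E \<and> g ` J \<subseteq> Z \<and> (\<forall>a\<in>I. g a = f a)"
  \<comment> \<open>Only the ideals are ordered, not the extensions: the chain condition gives a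
    maximal \<open>J\<close>, and any extension \<open>g\<close> to it will do.\<close>
  define F where "F = {J. ideal J R \<and> I \<subseteq> J \<and> (\<exists>g. ?P J g)}"
  have "?P I f" using f fZ by simp
  then have "I \<in> F" using I unfolding F_def by blast
  then have ne: "F \<noteq> {}" by blast
  have Fid: "ideal K R" if "K \<in> F" for K using that unfolding F_def by simp
  have "\<exists>J\<in>F. \<forall>K\<in>F. J \<subseteq> K \<longrightarrow> K = J"
    by (rule noetherian_maximal_ideal[OF noeth ne]) (rule Fid)
  then obtain J where J: "J \<in> F" and max: "\<forall>K\<in>F. J \<subseteq> K \<longrightarrow> K = J" by (elim bexE)
  obtain g where g: "g \<in> linear_maps R (ideal_module J) E" "g ` J \<subseteq> Z" "\<forall>a\<in>I. g a = f a"
    and Jid: "ideal J R" and IJ: "I \<subseteq> J" using J unfolding F_def by (elim CollectE conjE exE)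
  interpret J: ideal J R by (rule Jid)
  note gD = g(1)[unfolded ideal_map_iff]
  have gadd: "g (a \<oplus> b) = g a \<oplus>\<^bsub>E\<^esub> g b" if "a \<in> J" "b \<in> J" for a b using gD that by blast
  have gsm: "g (r \<otimes> a) = r \<odot>\<^bsub>E\<^esub> g a" if "r \<in> carrier R" "a \<in> J" for a r using gD that by blast
  have gZ: "g a \<in> Z" if "a \<in> J" for a using g(2) that by blast
  have Jc: "a \<in> carrier R" if "a \<in> J" for a using that by (rule J.Icarr)
  have "J = carrier R"
  proof (rule ccontr)
    assume "J \<noteq> carrier R"
    then have "\<one> \<notin> J" using J.one_imp_carrier by blast
    then obtain y' where "y' \<in> carrier R" "y' \<otimes> \<one> \<notin> J" "primeideal (colon J (y' \<otimes> \<one>)) R"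
      by (rule prime_colon_exists[OF noeth Jid one_closed])
    then obtain y where y: "y \<in> carrier R" "y \<notin> J" "colon J y = m"
      using primes by auto
    have my: "a \<otimes> y \<in> J" if "a \<in> m" for a using that y(3) by (auto simp: colon_def)
    have my': "a \<in> m" if "a \<in> carrier R" "a \<otimes> y \<in> J" for a using that y(3) by (auto simp: colon_def)
    \<comment> \<open>Multiplication by \<open>y\<close> takes \<open>m\<close> into
      \<open>J\<close>, so \<open>g\<close> induces a map on \<open>m\<close>. The element
      \<open>z\<close> provided by \<open>ext\<close> is the value that an extension of
      \<open>g\<close> should take at \<open>y\<close>.\<close>
    have "(\<lambda>a. g (a \<otimes> y)) \<in> linear_maps R (ideal_module m) E"
      unfolding ideal_map_iff
    proof (intro conjI ballI funcsetI)
      fix a assume a: "a \<in> m"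
      show "g (a \<otimes> y) \<in> carrier E" using gZ[OF my[OF a]] ZE(1) by blast
      show "g ((a \<oplus> b) \<otimes> y) = g (a \<otimes> y) \<oplus>\<^bsub>E\<^esub> g (b \<otimes> y)" if b: "b \<in> m" for b
        using gadd[OF my[OF a] my[OF b]] m_carrier[OF a] m_carrier[OF b] y(1) by (simp add: l_distr)
      show "g ((r \<otimes> a) \<otimes> y) = r \<odot>\<^bsub>E\<^esub> g (a \<otimes> y)" if r: "r \<in> carrier R" for r
        using gsm[OF r my[OF a]] m_carrier[OF a] y(1) r by (simp add: m_assoc)
    qed
    moreover have "(\<lambda>a. g (a \<otimes> y)) ` m \<subseteq> Z" using gZ my by blast
    ultimately obtain z where z: "z \<in> Z" and gz: "\<And>a. a \<in> m \<Longrightarrow> g (a \<otimes> y) = a \<odot>\<^bsub>E\<^esub> z"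
      using ext by blast
    have zE: "z \<in> carrier E" using z ZE(1) by blast
    have gE: "g a \<in> carrier E" if "a \<in> J" for a using gZ[OF that] ZE(1) by blast
    \<comment> \<open>\<open>K\<close> is \<open>J + R y\<close>, strictly larger than
      \<open>J\<close>, and \<open>g'\<close> sends \<open>j + a y\<close> to
      \<open>g j + a z\<close>.\<close>
    define K where "K = {c \<in> carrier R. \<exists>j\<in>J. \<exists>a\<in>carrier R. c = j \<oplus> a \<otimes> y}"
    define g' where "g' c = (SOME v. \<exists>j\<in>J. \<exists>a\<in>carrier R. c = j \<oplus> a \<otimes> y \<and> v = g j \<oplus>\<^bsub>E\<^esub> a \<odot>\<^bsub>E\<^esub> z)" for c
    \<comment> \<open>Two representations differ by an \<open>a - a'\<close> with
      \<open>(a - a') y \<in> J\<close>. It lies in \<open>m\<close>, where \<open>z\<close> was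
      chosen to reproduce \<open>g\<close>.\<close>
    have wd: "g j \<oplus>\<^bsub>E\<^esub> a \<odot>\<^bsub>E\<^esub> z = g j' \<oplus>\<^bsub>E\<^esub> a' \<odot>\<^bsub>E\<^esub> z"
      if j: "j \<in> J" "j' \<in> J" and a: "a \<in> carrier R" "a' \<in> carrier R" and eq: "j \<oplus> a \<otimes> y = j' \<oplus> a' \<otimes> y" for j j' a a'
    proof -
      have jc: "j \<in> carrier R" "j' \<in> carrier R" using j Jc by auto
      have "(a \<ominus> a') \<otimes> y = (j \<oplus> a \<otimes> y) \<ominus> j \<ominus> a' \<otimes> y" using jc a y(1) by algebra
      also have "\<dots> = j' \<ominus> j" unfolding eq using jc a y(1) by algebra
      finally have d: "(a \<ominus> a') \<otimes> y = j' \<ominus> j" .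
      have dJ: "(a \<ominus> a') \<otimes> y \<in> J" unfolding d using j by (simp add: a_minus_def)
      have dm: "a \<ominus> a' \<in> m" using a dJ by (intro my') simp_all
      have dz: "(a \<ominus> a') \<odot>\<^bsub>E\<^esub> z \<in> carrier E" "a' \<odot>\<^bsub>E\<^esub> z \<in> carrier E" using a zE by simp_all
      have "j' = j \<oplus> (a \<ominus> a') \<otimes> y" unfolding d using jc by algebra
      then have "g j' = g j \<oplus>\<^bsub>E\<^esub> (a \<ominus> a') \<odot>\<^bsub>E\<^esub> z" using gadd[OF j(1) dJ] gz[OF dm] by simp
      then have "g j' \<oplus>\<^bsub>E\<^esub> a' \<odot>\<^bsub>E\<^esub> z = g j \<oplus>\<^bsub>E\<^esub> ((a \<ominus> a') \<odot>\<^bsub>E\<^esub> z \<oplus>\<^bsub>E\<^esub> a' \<odot>\<^bsub>E\<^esub> z)"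
        using gE[OF j(1)] dz by (simp add: E.M.a_assoc)
      also have "(a \<ominus> a') \<odot>\<^bsub>E\<^esub> z \<oplus>\<^bsub>E\<^esub> a' \<odot>\<^bsub>E\<^esub> z = ((a \<ominus> a') \<oplus> a') \<odot>\<^bsub>E\<^esub> z"
        using E.smult_l_distr[of "a \<ominus> a'" a' z] a zE by simp
      also have "(a \<ominus> a') \<oplus> a' = a" using a by algebra
      finally show ?thesis by simp
    qed
    have g': "g' (j \<oplus> a \<otimes> y) = g j \<oplus>\<^bsub>E\<^esub> a \<odot>\<^bsub>E\<^esub> z" if "j \<in> J" "a \<in> carrier R" for j a
    proof -
      let ?Q = "\<lambda>v. \<exists>j'\<in>J. \<exists>a'\<in>carrier R. j \<oplus> a \<otimes> y = j' \<oplus> a' \<otimes> y \<and> v = g j' \<oplus>\<^bsub>E\<^esub> a' \<odot>\<^bsub>E\<^esub> z"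
      have "?Q (g j \<oplus>\<^bsub>E\<^esub> a \<odot>\<^bsub>E\<^esub> z)" using that by blast
      then have "?Q (g' (j \<oplus> a \<otimes> y))" unfolding g'_def by (rule someI)
      then obtain j' a' where "j' \<in> J" "a' \<in> carrier R" "j \<oplus> a \<otimes> y = j' \<oplus> a' \<otimes> y"
        "g' (j \<oplus> a \<otimes> y) = g j' \<oplus>\<^bsub>E\<^esub> a' \<odot>\<^bsub>E\<^esub> z" by blast
      with wd that show ?thesis by metis
    qed
    have Kmem: "j \<oplus> a \<otimes> y \<in> K" if "j \<in> J" "a \<in> carrier R" for j a
      using that Jc y(1) unfolding K_def by blast
    have Kadd: "(j \<oplus> a \<otimes> y) \<oplus> (j' \<oplus> a' \<otimes> y) = (j \<oplus> j') \<oplus> (a \<oplus> a') \<otimes> y"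
      if "j \<in> J" "j' \<in> J" "a \<in> carrier R" "a' \<in> carrier R" for j j' a a'
      using that(3,4) Jc[OF that(1)] Jc[OF that(2)] y(1) by algebra
    have Ksm: "r \<otimes> (j \<oplus> a \<otimes> y) = (r \<otimes> j) \<oplus> (r \<otimes> a) \<otimes> y"
      if "j \<in> J" "a \<in> carrier R" "r \<in> carrier R" for j a r
      using that(2,3) Jc[OF that(1)] y(1) by algebra
    have JK: "J \<subseteq> K"
    proof
      fix j assume j: "j \<in> J"
      have "j = j \<oplus> \<zero> \<otimes> y" using Jc[OF j] y(1) by simp
      then show "j \<in> K" using Kmem[OF j zero_closed] by simp
    qed
    have Kid: "ideal K R"
    proof (rule idealI[OF ring_axioms])
      show "subgroup K (add_monoid R)"
      proof (rule add.subgroupI)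
        show "K \<subseteq> carrier R" by (auto simp: K_def)
        show "K \<noteq> {}" using JK J.zero_closed by blast
        fix c assume "c \<in> K"
        then obtain j a where c: "j \<in> J" "a \<in> carrier R" "c = j \<oplus> a \<otimes> y" unfolding K_def by blast
        have "\<ominus> c = (\<ominus> j) \<oplus> (\<ominus> a) \<otimes> y" unfolding c(3) using Jc[OF c(1)] c(2) y(1) by algebra
        then show "\<ominus> c \<in> K" using Kmem[of "\<ominus> j" "\<ominus> a"] c(1,2) by simp
        fix c' assume "c' \<in> K"
        then obtain j' a' where c': "j' \<in> J" "a' \<in> carrier R" "c' = j' \<oplus> a' \<otimes> y" unfolding K_def by blast
        show "c \<oplus> c' \<in> K"
          unfolding c(3) c'(3) Kadd[OF c(1) c'(1) c(2) c'(2)] using c c' by (intro Kmem) simp_all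
      qed
      fix c r assume "c \<in> K" and r: "r \<in> carrier R"
      then obtain j a where c: "j \<in> J" "a \<in> carrier R" "c = j \<oplus> a \<otimes> y" unfolding K_def by blast
      show rc: "r \<otimes> c \<in> K"
        unfolding c(3) Ksm[OF c(1,2) r] using c r J.I_l_closed by (intro Kmem) simp_all
      have "c \<in> carrier R" using c Jc y(1) by simp
      then show "c \<otimes> r \<in> K" using rc r by (simp add: m_comm)
    qed
    have "g' \<in> linear_maps R (ideal_module K) E"
      unfolding ideal_map_iff
    proof (intro conjI ballI funcsetI)
      fix c assume "c \<in> K"
      then obtain j a where c: "j \<in> J" "a \<in> carrier R" "c = j \<oplus> a \<otimes> y" unfolding K_def by blast
      show "g' c \<in> carrier E" unfolding c(3) g'[OF c(1,2)] using gE[OF c(1)] c(2) zE by simp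
      show "g' (c \<oplus> c') = g' c \<oplus>\<^bsub>E\<^esub> g' c'" if "c' \<in> K" for c'
      proof -
        from that obtain j' a' where c': "j' \<in> J" "a' \<in> carrier R" "c' = j' \<oplus> a' \<otimes> y" unfolding K_def by blast
        have "g' (c \<oplus> c') = g (j \<oplus> j') \<oplus>\<^bsub>E\<^esub> (a \<oplus> a') \<odot>\<^bsub>E\<^esub> z"
          unfolding c(3) c'(3) Kadd[OF c(1) c'(1) c(2) c'(2)] using c c' by (intro g') simp_all
        also have "\<dots> = (g j \<oplus>\<^bsub>E\<^esub> g j') \<oplus>\<^bsub>E\<^esub> (a \<odot>\<^bsub>E\<^esub> z \<oplus>\<^bsub>E\<^esub> a' \<odot>\<^bsub>E\<^esub> z)"
          using gadd[OF c(1) c'(1)] E.smult_l_distr[OF c(2) c'(2) zE] by simp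
        also have "\<dots> = g' c \<oplus>\<^bsub>E\<^esub> g' c'"
          unfolding c(3) c'(3) g'[OF c(1,2)] g'[OF c'(1,2)]
          using gE[OF c(1)] gE[OF c'(1)] c(2) c'(2) zE by (simp add: E.M.a_ac)
        finally show ?thesis .
      qed
      show "g' (r \<otimes> c) = r \<odot>\<^bsub>E\<^esub> g' c" if r: "r \<in> carrier R" for r
      proof -
        have "g' (r \<otimes> c) = g (r \<otimes> j) \<oplus>\<^bsub>E\<^esub> (r \<otimes> a) \<odot>\<^bsub>E\<^esub> z"
          unfolding c(3) Ksm[OF c(1,2) r] using c r J.I_l_closed by (intro g') simp_all
        also have "\<dots> = r \<odot>\<^bsub>E\<^esub> g' c"
          unfolding c(3) g'[OF c(1,2)] using gE[OF c(1)] c(2) zE r gsm[OF r c(1)]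
          by (simp add: E.smult_r_distr E.smult_assoc1)
        finally show ?thesis .
      qed
    qed
    moreover have g'Z: "g' ` K \<subseteq> Z"
    proof clarify
      fix c assume "c \<in> K"
      then obtain j a where c: "j \<in> J" "a \<in> carrier R" "c = j \<oplus> a \<otimes> y" unfolding K_def by blast
      show "g' c \<in> Z" unfolding c(3) g'[OF c(1,2)] using gZ[OF c(1)] ZE(4)[OF c(2) z] by (rule ZE(5))
    qed
    moreover have "g' a = f a" if a: "a \<in> I" for a
    proof -
      have aJ: "a \<in> J" using a IJ by blast
      have "g' (a \<oplus> \<zero> \<otimes> y) = g a \<oplus>\<^bsub>E\<^esub> \<zero> \<odot>\<^bsub>E\<^esub> z" by (rule g'[OF aJ zero_closed])
      then have "g' a = g a" using Jc[OF aJ] y(1) gE[OF aJ] zE by simp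
      then show ?thesis using g(3) a by simp
    qed
    ultimately have "?P K g'" by blast
    moreover have "I \<subseteq> K" using IJ JK by (rule subset_trans)
    ultimately have "K \<in> F" unfolding F_def using Kid by blast
    then have "K = J" using max JK by blast
    moreover have "\<zero> \<oplus> \<one> \<otimes> y \<in> K" by (rule Kmem) simp_all
    ultimately show False using y by simp
  qed
  then have one: "\<one> \<in> J" by simp
  have "f a = a \<odot>\<^bsub>E\<^esub> g \<one>" if a: "a \<in> I" for a
    using g(3) a gsm[OF Jc one, of a] IJ Jc by auto
  then show "\<exists>z\<in>Z. \<forall>a\<in>I. f a = a \<odot>\<^bsub>E\<^esub> z" using gZ[OF one] by blast
qed

end

context cring
begin

text \<open>Injectivity of the ring as a module over itself, in Baer's form.\<close>

definition self_injective :: bool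
  where "self_injective \<longleftrightarrow> (\<forall>I f. ideal I R \<longrightarrow> f \<in> linear_maps R (ideal_module I) (self_module R) \<longrightarrow>
    (\<exists>z\<in>carrier R. \<forall>a\<in>I. f a = a \<otimes> z))"

end

context artinian_socle
begin

text \<open>By \<open>baer_injective_from_m\<close> only a map \<open>f\<close> from
  \<open>m\<close> to the kernel has to be extended. In \<open>E\<close> it is multiplication by
  some \<open>e\<close>, but \<open>d e\<close> need not vanish. It is killed by \<open>m\<close>,
  however, because \<open>f\<close> takes values in the kernel; \<open>e\<close> is therefore
  corrected by a lift of \<open>d e\<close> that is itself killed by \<open>m\<close>.\<close>

lemma baer_injective_kernel:
  assumes E: "module R E" and E': "module R E'" and d: "d \<in> linear_maps R E E'"
    and bE: "baer_injective E (carrier E)" and bE': "baer_injective E' (d ` carrier E)"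
  shows "baer_injective E {e \<in> carrier E. d e = \<zero>\<^bsub>E'\<^esub>}"
proof -
  interpret E: module R E by (rule E)
  interpret E': module R E' by (rule E')
  let ?Z = "{e \<in> carrier E. d e = \<zero>\<^bsub>E'\<^esub>}"
  have dc: "d e \<in> carrier E'" if "e \<in> carrier E" for e by (rule linear_mapsD(1)[OF d that])
  have dadd: "d (e \<oplus>\<^bsub>E\<^esub> e') = d e \<oplus>\<^bsub>E'\<^esub> d e'" if "e \<in> carrier E" "e' \<in> carrier E" for e e'
    by (rule linear_mapsD(2)[OF d that])
  have dsm: "d (a \<odot>\<^bsub>E\<^esub> e) = a \<odot>\<^bsub>E'\<^esub> d e" if "a \<in> carrier R" "e \<in> carrier E" for a e
    by (rule linear_mapsD(3)[OF d that])
  have dneg: "d (\<ominus>\<^bsub>E\<^esub> e) = \<ominus>\<^bsub>E'\<^esub> d e" if e: "e \<in> carrier E" for e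
  proof -
    have "\<ominus>\<^bsub>E\<^esub> e = (\<ominus> \<one>) \<odot>\<^bsub>E\<^esub> e" using e E.smult_l_minus[OF one_closed e] by simp
    also have "d \<dots> = (\<ominus> \<one>) \<odot>\<^bsub>E'\<^esub> d e" by (rule dsm) (use e in simp_all)
    also have "\<dots> = \<ominus>\<^bsub>E'\<^esub> d e" using dc[OF e] E'.smult_l_minus[OF one_closed dc[OF e]] by simp
    finally show ?thesis .
  qed
  have Z: "submodule ?Z R E"
  proof (rule E.submoduleI)
    show "\<zero>\<^bsub>E\<^esub> \<in> ?Z" using linear_map_zero[OF E E' d] by simp
  qed (auto simp: dadd dneg dsm)
  \<comment> \<open>Such a \<open>z\<close> is \<open>x w\<close> with \<open>w = d e\<close>, and
    \<open>x e\<close> is a lift of \<open>z\<close> that \<open>m\<close> kills, because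
    \<open>m\<close> kills \<open>x\<close>.\<close>
  have socle: "\<exists>e\<in>carrier E. d e = z \<and> (\<forall>a\<in>m. a \<odot>\<^bsub>E\<^esub> e = \<zero>\<^bsub>E\<^esub>)"
    if z: "z \<in> d ` carrier E" and mz: "\<And>a. a \<in> m \<Longrightarrow> a \<odot>\<^bsub>E'\<^esub> z = \<zero>\<^bsub>E'\<^esub>" for z
  proof -
    have sub: "d ` carrier E \<subseteq> carrier E'" using dc by blast
    have cl: "a \<odot>\<^bsub>E'\<^esub> w \<in> d ` carrier E" if a: "a \<in> carrier R" and w: "w \<in> d ` carrier E" for a w
    proof -
      from w obtain e where "e \<in> carrier E" "w = d e" by blast
      then have "a \<odot>\<^bsub>E'\<^esub> w = d (a \<odot>\<^bsub>E\<^esub> e)" "a \<odot>\<^bsub>E\<^esub> e \<in> carrier E" using dsm a by simp_all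
      then show ?thesis by blast
    qed
    obtain w where w: "w \<in> d ` carrier E" "z = x \<odot>\<^bsub>E'\<^esub> w"
      by (rule socle_divisible[OF E' bE' sub cl z mz])
    then obtain e where e: "e \<in> carrier E" "w = d e" by blast
    have "a \<odot>\<^bsub>E\<^esub> (x \<odot>\<^bsub>E\<^esub> e) = \<zero>\<^bsub>E\<^esub>" if a: "a \<in> m" for a
      using E.smult_assoc1[OF m_carrier[OF a] x e(1)] m_iff[OF m_carrier[OF a]] a e(1) by simp
    moreover have "d (x \<odot>\<^bsub>E\<^esub> e) = z" using dsm[OF x e(1)] w e by simp
    ultimately show ?thesis using x e(1) by (intro bexI[of _ "x \<odot>\<^bsub>E\<^esub> e"]) simp_all
  qed
  show ?thesis
  proof (rule baer_injective_from_m[OF E Z])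
    fix f assume f: "f \<in> linear_maps R (ideal_module m) E" and fZ: "f ` m \<subseteq> ?Z"
    have "f ` m \<subseteq> carrier E" using fZ by blast
    then obtain e where e: "e \<in> carrier E" "\<And>a. a \<in> m \<Longrightarrow> f a = a \<odot>\<^bsub>E\<^esub> e"
      using bE[unfolded baer_injective_def, rule_format, OF m_ideal f] by blast
    have "a \<odot>\<^bsub>E'\<^esub> d e = \<zero>\<^bsub>E'\<^esub>" if a: "a \<in> m" for a
    proof -
      have "f a \<in> ?Z" using fZ a by blast
      then have "d (a \<odot>\<^bsub>E\<^esub> e) = \<zero>\<^bsub>E'\<^esub>" using e(2)[OF a] by simp
      then show ?thesis using dsm[OF m_carrier[OF a] e(1)] by simp
    qed
    then obtain e' where e': "e' \<in> carrier E" "d e' = d e" and me': "\<forall>a\<in>m. a \<odot>\<^bsub>E\<^esub> e' = \<zero>\<^bsub>E\<^esub>"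
      using socle[of "d e"] e(1) by blast
    \<comment> \<open>Subtracting \<open>e'\<close> moves \<open>e\<close> into the kernel and
      leaves the products with elements of \<open>m\<close> unchanged.\<close>
    let ?z = "e \<oplus>\<^bsub>E\<^esub> \<ominus>\<^bsub>E\<^esub> e'"
    have "d ?z = \<zero>\<^bsub>E'\<^esub>"
      using dadd[of e "\<ominus>\<^bsub>E\<^esub> e'"] dneg[OF e'(1)] e' e(1) dc[OF e(1)] by (simp add: E'.M.r_neg)
    then have "?z \<in> ?Z" using e(1) e'(1) by simp
    moreover have "f a = a \<odot>\<^bsub>E\<^esub> ?z" if a: "a \<in> m" for a
      using e(2)[OF a] bspec[OF me' a] e(1) e'(1) m_carrier[OF a]
      by (simp add: E.smult_r_distr E.smult_r_minus)
    ultimately show "\<exists>z\<in>?Z. \<forall>a\<in>m. f a = a \<odot>\<^bsub>E\<^esub> z" by blast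
  qed
qed

text \<open>Injectivity descends along the cosyzygies of the resolution, starting from its zero end.\<close>

lemma finite_injective_dimension_self_injective:
  assumes "finite_injective_dimension TYPE('e) R (self_module R)"
  shows self_injective
proof -
  from assms obtain E :: "nat \<Rightarrow> ('a, 'e) module" and \<epsilon> d n where
    inj: "\<And>i. injective_module R (E i)" and zero: "\<And>i. i > n \<Longrightarrow> carrier (E i) = {\<zero>\<^bsub>E i\<^esub>}"
    and \<epsilon>: "\<epsilon> \<in> linear_maps R (self_module R) (E 0)" "inj_on \<epsilon> (carrier R)"
    and d: "\<And>i. d i \<in> linear_maps R (E i) (E (Suc i))"
    and ker0: "a_kernel (E 0) (E (Suc 0)) (d 0) = \<epsilon> ` carrier R"
    and ker: "\<And>i. a_kernel (E (Suc i)) (E (Suc (Suc i))) (d (Suc i)) = d i ` carrier (E i)"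
    unfolding finite_injective_dimension_def self_module_simps by blast
  have E: "module R (E i)" for i using inj by (simp add: injective_module_def)
  \<comment> \<open>The cosyzygies. By exactness \<open>?Z (Suc i)\<close> is also the image of
    \<open>d i\<close>, which is how \<open>baer_injective_kernel\<close> applies from one degree to
    the one below.\<close>
  let ?Z = "\<lambda>i. {e \<in> carrier (E i). d i e = \<zero>\<^bsub>E (Suc i)\<^esub>}"
  have descend: "baer_injective (E i) (?Z i)" if "baer_injective (E (Suc i)) (?Z (Suc i))" for i
  proof (rule baer_injective_kernel[OF E E d injective_module_baer[OF inj]])
    have "?Z (Suc i) = d i ` carrier (E i)" using ker[of i] by (simp add: a_kernel_def')
    then show "baer_injective (E (Suc i)) (d i ` carrier (E i))" using that by simp
  qed
  \<comment> \<open>One degree beyond \<open>n\<close> the module is zero, so every map into it is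
    multiplication by zero.\<close>
  have base: "baer_injective (E (Suc n)) (?Z (Suc n))"
    unfolding baer_injective_def
  proof (intro allI impI)
    fix I f assume I: "ideal I R" and f: "f \<in> linear_maps R (ideal_module I) (E (Suc n))"
    interpret En: module R "E (Suc n)" by (rule E)
    have "f a = a \<odot>\<^bsub>E (Suc n)\<^esub> \<zero>\<^bsub>E (Suc n)\<^esub>" if a: "a \<in> I" for a
    proof -
      have "f a \<in> carrier (E (Suc n))" using f a unfolding ideal_map_iff by blast
      then show ?thesis using zero[of "Suc n"] ideal.Icarr[OF I a] by simp
    qed
    moreover have "\<zero>\<^bsub>E (Suc n)\<^esub> \<in> ?Z (Suc n)" using linear_map_zero[OF E E d] by simp
    ultimately show "\<exists>z\<in>?Z (Suc n). \<forall>a\<in>I. f a = a \<odot>\<^bsub>E (Suc n)\<^esub> z" by blast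
  qed
  \<comment> \<open>Downward induction, with \<open>k\<close> the distance from degree
    \<open>Suc n\<close>; it ends in degree 0, where the kernel is the image of the ring.\<close>
  have "baer_injective (E (Suc n - k)) (?Z (Suc n - k))" if "k \<le> Suc n" for k
    using that
  proof (induction k)
    case 0
    then show ?case using base by simp
  next
    case (Suc k)
    then have "Suc n - k = Suc (Suc n - Suc k)" by simp
    with Suc show ?case using descend[of "Suc n - Suc k"] by simp
  qed
  from this[of "Suc n"] have "baer_injective (E 0) (?Z 0)" by simp
  moreover have "?Z 0 = \<epsilon> ` carrier R" using ker0 by (simp add: a_kernel_def')
  ultimately have b0: "baer_injective (E 0) (\<epsilon> ` carrier R)" by simp
  show ?thesis
    unfolding self_injective_def
  proof (intro allI impI)
    fix I f assume I: "ideal I R" and f: "f \<in> linear_maps R (ideal_module I) (self_module R)"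
    have fc: "f a \<in> carrier R" if "a \<in> I" for a using f that unfolding ideal_map_iff by auto
    note fD = f[unfolded ideal_map_iff self_module_simps]
    have \<epsilon>c: "\<epsilon> a \<in> carrier (E 0)" if "a \<in> carrier R" for a
      using that linear_mapsD(1)[OF \<epsilon>(1)] by simp
    have \<epsilon>D: "\<epsilon> (a \<oplus> b) = \<epsilon> a \<oplus>\<^bsub>E 0\<^esub> \<epsilon> b" "\<epsilon> (a \<otimes> b) = a \<odot>\<^bsub>E 0\<^esub> \<epsilon> b"
      if "a \<in> carrier R" "b \<in> carrier R" for a b
      using that linear_mapsD[OF \<epsilon>(1)] by simp_all
    have "(\<lambda>a. \<epsilon> (f a)) \<in> linear_maps R (ideal_module I) (E 0)"
      unfolding ideal_map_iff using fD fc \<epsilon>c \<epsilon>D by (simp add: Pi_iff)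
    moreover have "(\<lambda>a. \<epsilon> (f a)) ` I \<subseteq> \<epsilon> ` carrier R" using fc by blast
    ultimately obtain w where w: "w \<in> \<epsilon> ` carrier R" "\<forall>a\<in>I. \<epsilon> (f a) = a \<odot>\<^bsub>E 0\<^esub> w"
      using b0[unfolded baer_injective_def, rule_format, OF I] by blast
    from w(1) obtain z where z: "z \<in> carrier R" "w = \<epsilon> z" by blast
    have "f a = a \<otimes> z" if a: "a \<in> I" for a
    proof -
      have aR: "a \<in> carrier R" by (rule ideal.Icarr[OF I a])
      have "\<epsilon> (f a) = \<epsilon> (a \<otimes> z)" using w(2) a z \<epsilon>D(2)[OF aR z(1)] by simp
      then show ?thesis by (rule inj_onD[OF \<epsilon>(2)]) (use fc[OF a] aR z(1) in simp_all)
    qed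
    with z(1) show "\<exists>z\<in>carrier R. \<forall>a\<in>I. f a = a \<otimes> z" by blast
  qed
qed

end

section \<open>Extension of functionals over a self-injective localization\<close>

context mult_closed_module
begin

text \<open>Stands for an \<open>A\<close>-linear functional on the localized module: these
  correspond to maps from \<open>M\<close> to \<open>A\<close> that are linear along
  \<open>rho\<close>.\<close>

definition semilinear :: "('c \<Rightarrow> ('a \<times> 'a) set) \<Rightarrow> bool"
  where "semilinear f \<longleftrightarrow> (\<forall>x\<in>carrier M. f x \<in> carrier A) \<and>
    (\<forall>x\<in>carrier M. \<forall>y\<in>carrier M. f (x \<oplus>\<^bsub>M\<^esub> y) = f x \<oplus>\<^bsub>A\<^esub> f y) \<and>
    (\<forall>r\<in>carrier R. \<forall>x\<in>carrier M. f (r \<odot>\<^bsub>M\<^esub> x) = rho r \<otimes>\<^bsub>A\<^esub> f x)"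

lemma semilinearD:
  assumes "semilinear f"
  shows "x \<in> carrier M \<Longrightarrow> f x \<in> carrier A"
    and "x \<in> carrier M \<Longrightarrow> y \<in> carrier M \<Longrightarrow> f (x \<oplus>\<^bsub>M\<^esub> y) = f x \<oplus>\<^bsub>A\<^esub> f y"
    and "r \<in> carrier R \<Longrightarrow> x \<in> carrier M \<Longrightarrow> f (r \<odot>\<^bsub>M\<^esub> x) = rho r \<otimes>\<^bsub>A\<^esub> f x"
  using assms unfolding semilinear_def by blast+

lemma semilinear_zero:
  assumes A: "cring A" and f: "semilinear f"
  shows "f \<zero>\<^bsub>M\<^esub> = \<zero>\<^bsub>A\<^esub>"
proof -
  interpret A: cring A by (rule A)
  have "f \<zero>\<^bsub>M\<^esub> \<oplus>\<^bsub>A\<^esub> f \<zero>\<^bsub>M\<^esub> = f \<zero>\<^bsub>M\<^esub>" using semilinearD(2)[OF f M.zero_closed M.zero_closed] by simp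
  then show ?thesis using semilinearD(1)[OF f M.zero_closed] A.add.r_cancel_one' by metis
qed

lemma semilinear_minus:
  assumes A: "cring A" and f: "semilinear f" and x: "x \<in> carrier M" and y: "y \<in> carrier M"
    and zero: "f (x \<oplus>\<^bsub>M\<^esub> \<ominus>\<^bsub>M\<^esub> y) = \<zero>\<^bsub>A\<^esub>"
  shows "f x = f y"
proof -
  interpret A: cring A by (rule A)
  have "x = (x \<oplus>\<^bsub>M\<^esub> \<ominus>\<^bsub>M\<^esub> y) \<oplus>\<^bsub>M\<^esub> y" using x y by (simp add: M.a_assoc M.l_neg)
  then have "f x = f (x \<oplus>\<^bsub>M\<^esub> \<ominus>\<^bsub>M\<^esub> y) \<oplus>\<^bsub>A\<^esub> f y"
    using semilinearD(2)[OF f, of "x \<oplus>\<^bsub>M\<^esub> \<ominus>\<^bsub>M\<^esub> y" y] x y by simp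
  then show ?thesis using zero semilinearD(1)[OF f y] by simp
qed

lemma semilinear_diff_zero:
  assumes A: "cring A" and f: "semilinear f" and x: "x \<in> carrier M" and y: "y \<in> carrier M"
    and eq: "f x = f y"
  shows "f (x \<oplus>\<^bsub>M\<^esub> \<ominus>\<^bsub>M\<^esub> y) = \<zero>\<^bsub>A\<^esub>"
proof -
  interpret A: cring A by (rule A)
  have c: "f (x \<oplus>\<^bsub>M\<^esub> \<ominus>\<^bsub>M\<^esub> y) \<in> carrier A" "f y \<in> carrier A" using semilinearD(1)[OF f] x y by simp_all
  have "x = (x \<oplus>\<^bsub>M\<^esub> \<ominus>\<^bsub>M\<^esub> y) \<oplus>\<^bsub>M\<^esub> y" using x y by (simp add: M.a_assoc M.l_neg)
  then have "f x = f (x \<oplus>\<^bsub>M\<^esub> \<ominus>\<^bsub>M\<^esub> y) \<oplus>\<^bsub>A\<^esub> f y"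
    using semilinearD(2)[OF f, of "x \<oplus>\<^bsub>M\<^esub> \<ominus>\<^bsub>M\<^esub> y" y] x y by simp
  then have "f (x \<oplus>\<^bsub>M\<^esub> \<ominus>\<^bsub>M\<^esub> y) \<oplus>\<^bsub>A\<^esub> f y = f y" using eq by simp
  then show ?thesis using c A.add.l_cancel_one' A.add.r_cancel_one by metis
qed

lemma rho_cancel:
  assumes A: "cring A" and s: "s \<in> S" and \<alpha>: "\<alpha> \<in> carrier A" and \<beta>: "\<beta> \<in> carrier A"
    and eq: "rho s \<otimes>\<^bsub>A\<^esub> \<alpha> = rho s \<otimes>\<^bsub>A\<^esub> \<beta>"
  shows "\<alpha> = \<beta>"
proof -
  interpret A: cring A by (rule A)
  have rs: "rho s \<in> carrier A" by (rule rho_hom(1)[OF S_carrier[OF s]])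
  obtain u where u: "u \<in> carrier A" "rho s \<otimes>\<^bsub>A\<^esub> u = \<one>\<^bsub>A\<^esub>" using rho_unit[OF s] by blast
  have *: "\<gamma> = u \<otimes>\<^bsub>A\<^esub> (rho s \<otimes>\<^bsub>A\<^esub> \<gamma>)" if "\<gamma> \<in> carrier A" for \<gamma>
  proof -
    have "u \<otimes>\<^bsub>A\<^esub> (rho s \<otimes>\<^bsub>A\<^esub> \<gamma>) = (rho s \<otimes>\<^bsub>A\<^esub> u) \<otimes>\<^bsub>A\<^esub> \<gamma>"
      using that u(1) rs by (simp add: A.m_assoc A.m_lcomm)
    then show ?thesis using u(2) that by simp
  qed
  show ?thesis using *[OF \<alpha>] *[OF \<beta>] eq by simp
qed

text \<open>One functional: \<open>A\<close>-multiples of the values of \<open>f\<close> on the submodule \<open>V\<close> form an ideal of \<open>A\<close>, on which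
  \<open>f v \<mapsto> g v\<close> is a linear map.\<close>

lemma self_injective_extend_one:
  assumes A: "cring A" and inj: "cring.self_injective A"
    and V: "submodule V R M" and f: "semilinear f" and g: "semilinear g"
    and ker: "\<And>x. x \<in> V \<Longrightarrow> f x = \<zero>\<^bsub>A\<^esub> \<Longrightarrow> g x = \<zero>\<^bsub>A\<^esub>"
  shows "\<exists>w\<in>carrier A. \<forall>x\<in>V. g x = f x \<otimes>\<^bsub>A\<^esub> w"
proof -
  interpret A: cring A by (rule A)
  note VE = submoduleE[OF V]
  have VM: "v \<in> carrier M" if "v \<in> V" for v using VE(1) that by blast
  have fA: "f v \<in> carrier A" and gA: "g v \<in> carrier A" if "v \<in> V" for v
    using semilinearD(1)[OF f VM[OF that]] semilinearD(1)[OF g VM[OF that]] by auto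
  have rA: "rho r \<in> carrier A" if "r \<in> carrier R" for r by (rule rho_hom(1)[OF that])
  have sA: "rho s \<in> carrier A" if "s \<in> S" for s by (rule rA[OF S_carrier[OF that]])
  \<comment> \<open>The graph of \<open>f v / s \<mapsto> g v / s\<close>, as a relation, since an
    element of \<open>A\<close> has many representations of this kind; \<open>Pun\<close> shows that
    it is a function.\<close>
  define P where "P \<alpha> \<gamma> \<longleftrightarrow> \<alpha> \<in> carrier A \<and> \<gamma> \<in> carrier A \<and>
    (\<exists>s\<in>S. \<exists>v\<in>V. rho s \<otimes>\<^bsub>A\<^esub> \<alpha> = f v \<and> rho s \<otimes>\<^bsub>A\<^esub> \<gamma> = g v)" for \<alpha> \<gamma>
  have PI: "P \<alpha> \<gamma>" if "\<alpha> \<in> carrier A" "\<gamma> \<in> carrier A" "s \<in> S" "v \<in> V" "rho s \<otimes>\<^bsub>A\<^esub> \<alpha> = f v" "rho s \<otimes>\<^bsub>A\<^esub> \<gamma> = g v" for \<alpha> \<gamma> s v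
    using that unfolding P_def by blast
  have Padd: "P (\<alpha> \<oplus>\<^bsub>A\<^esub> \<alpha>') (\<gamma> \<oplus>\<^bsub>A\<^esub> \<gamma>')" if "P \<alpha> \<gamma>" "P \<alpha>' \<gamma>'" for \<alpha> \<gamma> \<alpha>' \<gamma>'
  proof -
    from that(1) obtain s v where 1: "\<alpha> \<in> carrier A" "\<gamma> \<in> carrier A" "s \<in> S" "v \<in> V"
      "rho s \<otimes>\<^bsub>A\<^esub> \<alpha> = f v" "rho s \<otimes>\<^bsub>A\<^esub> \<gamma> = g v" unfolding P_def by blast
    from that(2) obtain s' v' where 2: "\<alpha>' \<in> carrier A" "\<gamma>' \<in> carrier A" "s' \<in> S" "v' \<in> V"
      "rho s' \<otimes>\<^bsub>A\<^esub> \<alpha>' = f v'" "rho s' \<otimes>\<^bsub>A\<^esub> \<gamma>' = g v'" unfolding P_def by blast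
    have sR: "s \<in> carrier R" "s' \<in> carrier R" using 1 2 S_carrier by auto
    let ?v = "s' \<odot>\<^bsub>M\<^esub> v \<oplus>\<^bsub>M\<^esub> s \<odot>\<^bsub>M\<^esub> v'"
    have vV: "?v \<in> V" using VE(4,5) 1(4) 2(4) sR by blast
    have *: "rho (s \<otimes> s') \<otimes>\<^bsub>A\<^esub> (a \<oplus>\<^bsub>A\<^esub> b) = h ?v"
      if h: "semilinear h" and ab: "a \<in> carrier A" "b \<in> carrier A" "rho s \<otimes>\<^bsub>A\<^esub> a = h v" "rho s' \<otimes>\<^bsub>A\<^esub> b = h v'" for h a b
    proof -
      have "rho (s \<otimes> s') \<otimes>\<^bsub>A\<^esub> (a \<oplus>\<^bsub>A\<^esub> b) = rho s' \<otimes>\<^bsub>A\<^esub> (rho s \<otimes>\<^bsub>A\<^esub> a) \<oplus>\<^bsub>A\<^esub> rho s \<otimes>\<^bsub>A\<^esub> (rho s' \<otimes>\<^bsub>A\<^esub> b)"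
        using ab(1,2) rA[OF sR(1)] rA[OF sR(2)] by (simp add: rho_hom(2)[OF sR] A.r_distr A.m_assoc A.m_lcomm)
      also have "\<dots> = h ?v"
        unfolding ab(3,4) using semilinearD[OF h] sR VM[OF 1(4)] VM[OF 2(4)] by simp
      finally show ?thesis .
    qed
    show ?thesis
      by (rule PI[OF _ _ S_mult[OF 1(3) 2(3)] vV *[OF f 1(1) 2(1) 1(5) 2(5)] *[OF g 1(2) 2(2) 1(6) 2(6)]])
        (use 1 2 in simp_all)
  qed
  have Psm: "P (\<beta> \<otimes>\<^bsub>A\<^esub> \<alpha>) (\<beta> \<otimes>\<^bsub>A\<^esub> \<gamma>)" if "P \<alpha> \<gamma>" and \<beta>: "\<beta> \<in> carrier A" for \<alpha> \<gamma> \<beta>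
  proof -
    from that(1) obtain s v where 1: "\<alpha> \<in> carrier A" "\<gamma> \<in> carrier A" "s \<in> S" "v \<in> V"
      "rho s \<otimes>\<^bsub>A\<^esub> \<alpha> = f v" "rho s \<otimes>\<^bsub>A\<^esub> \<gamma> = g v" unfolding P_def by blast
    obtain r t where r: "r \<in> carrier R" "t \<in> S" "rho t \<otimes>\<^bsub>A\<^esub> \<beta> = rho r" by (rule rho_denominator[OF \<beta>])
    have sR: "s \<in> carrier R" "t \<in> carrier R" using 1 r S_carrier by auto
    have *: "rho (t \<otimes> s) \<otimes>\<^bsub>A\<^esub> (\<beta> \<otimes>\<^bsub>A\<^esub> a) = h (r \<odot>\<^bsub>M\<^esub> v)"
      if h: "semilinear h" and a: "a \<in> carrier A" "rho s \<otimes>\<^bsub>A\<^esub> a = h v" for h a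
    proof -
      have "rho (t \<otimes> s) \<otimes>\<^bsub>A\<^esub> (\<beta> \<otimes>\<^bsub>A\<^esub> a) = (rho t \<otimes>\<^bsub>A\<^esub> \<beta>) \<otimes>\<^bsub>A\<^esub> (rho s \<otimes>\<^bsub>A\<^esub> a)"
        using a(1) \<beta> rA[OF sR(1)] rA[OF sR(2)] by (simp add: rho_hom(2)[OF sR(2,1)] A.m_assoc A.m_lcomm)
      also have "\<dots> = h (r \<odot>\<^bsub>M\<^esub> v)" unfolding a(2) r(3) using semilinearD(3)[OF h r(1) VM[OF 1(4)]] by simp
      finally show ?thesis .
    qed
    show ?thesis
      by (rule PI[OF _ _ S_mult[OF r(2) 1(3)] VE(4)[OF r(1) 1(4)] *[OF f 1(1) 1(5)] *[OF g 1(2) 1(6)]])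
        (use 1 \<beta> in simp_all)
  qed
  \<comment> \<open>Cross multiplication of two representations gives two elements of
    \<open>V\<close> with the same value of \<open>f\<close>. By \<open>ker\<close> they have the
    same value of \<open>g\<close>, and the factors from \<open>S\<close> cancel in
    \<open>A\<close>.\<close>
  have Pun: "\<gamma> = \<gamma>'" if "P \<alpha> \<gamma>" "P \<alpha> \<gamma>'" for \<alpha> \<gamma> \<gamma>'
  proof -
    from that(1) obtain s v where 1: "\<alpha> \<in> carrier A" "\<gamma> \<in> carrier A" "s \<in> S" "v \<in> V"
      "rho s \<otimes>\<^bsub>A\<^esub> \<alpha> = f v" "rho s \<otimes>\<^bsub>A\<^esub> \<gamma> = g v" unfolding P_def by blast
    from that(2) obtain s' v' where 2: "\<gamma>' \<in> carrier A" "s' \<in> S" "v' \<in> V"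
      "rho s' \<otimes>\<^bsub>A\<^esub> \<alpha> = f v'" "rho s' \<otimes>\<^bsub>A\<^esub> \<gamma>' = g v'" unfolding P_def by blast
    have sR: "s \<in> carrier R" "s' \<in> carrier R" using 1 2 S_carrier by auto
    note rs = rA[OF sR(1)] rA[OF sR(2)]
    let ?x = "s' \<odot>\<^bsub>M\<^esub> v" and ?y = "s \<odot>\<^bsub>M\<^esub> v'"
    have xM: "?x \<in> V" "?y \<in> V" using VE(4) 1(4) 2(3) sR by blast+
    have "f ?x = rho s' \<otimes>\<^bsub>A\<^esub> (rho s \<otimes>\<^bsub>A\<^esub> \<alpha>)" using semilinearD(3)[OF f sR(2) VM[OF 1(4)]] 1(5) by simp
    also have "\<dots> = rho s \<otimes>\<^bsub>A\<^esub> (rho s' \<otimes>\<^bsub>A\<^esub> \<alpha>)" using rs 1(1) by (simp add: A.m_lcomm)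
    also have "\<dots> = f ?y" using semilinearD(3)[OF f sR(1) VM[OF 2(3)]] 2(4) by simp
    finally have "f (?x \<oplus>\<^bsub>M\<^esub> \<ominus>\<^bsub>M\<^esub> ?y) = \<zero>\<^bsub>A\<^esub>" by (rule semilinear_diff_zero[OF A f VM[OF xM(1)] VM[OF xM(2)]])
    then have "g (?x \<oplus>\<^bsub>M\<^esub> \<ominus>\<^bsub>M\<^esub> ?y) = \<zero>\<^bsub>A\<^esub>" using VE(3,5) xM by (intro ker) blast+
    then have "g ?x = g ?y" by (rule semilinear_minus[OF A g VM[OF xM(1)] VM[OF xM(2)]])
    then have "rho s' \<otimes>\<^bsub>A\<^esub> (rho s \<otimes>\<^bsub>A\<^esub> \<gamma>) = rho s \<otimes>\<^bsub>A\<^esub> (rho s' \<otimes>\<^bsub>A\<^esub> \<gamma>')"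
      using semilinearD(3)[OF g sR(2) VM[OF 1(4)]] semilinearD(3)[OF g sR(1) VM[OF 2(3)]] 1(6) 2(5) by simp
    then have "rho s \<otimes>\<^bsub>A\<^esub> (rho s' \<otimes>\<^bsub>A\<^esub> \<gamma>) = rho s \<otimes>\<^bsub>A\<^esub> (rho s' \<otimes>\<^bsub>A\<^esub> \<gamma>')"
      using rs 1(2) by (simp add: A.m_lcomm)
    then have "rho s' \<otimes>\<^bsub>A\<^esub> \<gamma> = rho s' \<otimes>\<^bsub>A\<^esub> \<gamma>'"
      by (rule rho_cancel[OF A 1(3), rotated 2]) (use rs 1(2) 2(1) in simp_all)
    then show ?thesis by (rule rho_cancel[OF A 2(2) 1(2) 2(1)])
  qed
  have PV: "P (f v) (g v)" if v: "v \<in> V" for v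
    by (rule PI[OF fA[OF v] gA[OF v] S_one v]) (use fA[OF v] gA[OF v] rho_hom(4) in \<open>simp_all add: ring_hom_one[OF rho_hom(4)]\<close>)
  define J where "J = {\<alpha>. \<exists>\<gamma>. P \<alpha> \<gamma>}"
  define F where "F \<alpha> = (THE \<gamma>. P \<alpha> \<gamma>)" for \<alpha>
  have F: "F \<alpha> = \<gamma>" if "P \<alpha> \<gamma>" for \<alpha> \<gamma>
    unfolding F_def using that Pun by (intro the_equality) blast+
  have PF: "P \<alpha> (F \<alpha>)" if "\<alpha> \<in> J" for \<alpha> using that F unfolding J_def by auto
  have Pc: "\<alpha> \<in> carrier A" "\<gamma> \<in> carrier A" if "P \<alpha> \<gamma>" for \<alpha> \<gamma> using that unfolding P_def by blast+
  have JI: "\<alpha> \<in> J" if "P \<alpha> \<gamma>" for \<alpha> \<gamma> using that unfolding J_def by blast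
  have V0: "\<zero>\<^bsub>M\<^esub> \<in> V" using VE(2,3,5) M.r_neg VM by (metis ex_in_conv)
  have "ideal J A"
  proof (rule idealI[OF A.ring_axioms])
    show "subgroup J (add_monoid A)"
    proof (rule A.add.subgroupI)
      show "J \<subseteq> carrier A" using Pc unfolding J_def by blast
      show "J \<noteq> {}" using JI[OF PV[OF V0]] by blast
      show "\<alpha> \<oplus>\<^bsub>A\<^esub> \<beta> \<in> J" if "\<alpha> \<in> J" "\<beta> \<in> J" for \<alpha> \<beta>
        by (rule JI[OF Padd[OF PF[OF that(1)] PF[OF that(2)]]])
      fix \<alpha> assume a: "\<alpha> \<in> J"
      have aA: "\<alpha> \<in> carrier A" by (rule Pc(1)[OF PF[OF a]])
      have "\<ominus>\<^bsub>A\<^esub> \<alpha> = (\<ominus>\<^bsub>A\<^esub> \<one>\<^bsub>A\<^esub>) \<otimes>\<^bsub>A\<^esub> \<alpha>" using aA by (simp add: A.l_minus)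
      then show "\<ominus>\<^bsub>A\<^esub> \<alpha> \<in> J" using JI[OF Psm[OF PF[OF a], of "\<ominus>\<^bsub>A\<^esub> \<one>\<^bsub>A\<^esub>"]] by simp
    qed
    fix \<alpha> \<beta> assume a: "\<alpha> \<in> J" and b: "\<beta> \<in> carrier A"
    show ba: "\<beta> \<otimes>\<^bsub>A\<^esub> \<alpha> \<in> J" by (rule JI[OF Psm[OF PF[OF a] b]])
    show "\<alpha> \<otimes>\<^bsub>A\<^esub> \<beta> \<in> J" using ba A.m_comm[OF Pc(1)[OF PF[OF a]] b] by simp
  qed
  moreover have "F \<in> linear_maps A ((self_module A)\<lparr>carrier := J\<rparr>) (self_module A)"
    unfolding A.ideal_map_iff
  proof (intro conjI ballI funcsetI)
    fix \<alpha> assume a: "\<alpha> \<in> J"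
    show "F \<alpha> \<in> carrier (self_module A)" using Pc(2)[OF PF[OF a]] by simp
    show "F (\<alpha> \<oplus>\<^bsub>A\<^esub> \<beta>) = F \<alpha> \<oplus>\<^bsub>self_module A\<^esub> F \<beta>" if "\<beta> \<in> J" for \<beta>
      using F[OF Padd[OF PF[OF a] PF[OF that]]] by simp
    show "F (\<beta> \<otimes>\<^bsub>A\<^esub> \<alpha>) = \<beta> \<odot>\<^bsub>self_module A\<^esub> F \<alpha>" if "\<beta> \<in> carrier A" for \<beta>
      using F[OF Psm[OF PF[OF a] that]] by simp
  qed
  ultimately obtain w where w: "w \<in> carrier A" "\<forall>\<alpha>\<in>J. F \<alpha> = \<alpha> \<otimes>\<^bsub>A\<^esub> w"
    using inj[unfolded A.self_injective_def] by blast
  have "g v = f v \<otimes>\<^bsub>A\<^esub> w" if "v \<in> V" for v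
    using F[OF PV[OF that]] w(2) JI[OF PV[OF that]] by simp
  with w(1) show ?thesis by blast
qed

text \<open>Induction on the number of functionals replaces an extension along the embedding into a
  finite power of \<open>A\<close>. On the common kernel of the old functionals, \<open>g\<close> is
  a multiple of the new one by the case of one functional; after subtraction of that multiple,
  \<open>g\<close> vanishes on this kernel and the induction hypothesis applies.\<close>

lemma self_injective_extend:
  assumes A: "cring A" and inj: "cring.self_injective A" and "finite L"
    and "\<And>l. l \<in> L \<Longrightarrow> semilinear (f l)" and "semilinear g"
    and "\<And>x. x \<in> carrier M \<Longrightarrow> (\<And>l. l \<in> L \<Longrightarrow> f l x = \<zero>\<^bsub>A\<^esub>) \<Longrightarrow> g x = \<zero>\<^bsub>A\<^esub>"
  shows "\<exists>k\<in>L \<rightarrow> carrier A. \<forall>x\<in>carrier M. g x = (\<Oplus>\<^bsub>A\<^esub>l\<in>L. k l \<otimes>\<^bsub>A\<^esub> f l x)"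
  using assms(3-)
proof (induction L arbitrary: g rule: finite_induct)
  case empty
  interpret A: cring A by (rule A)
  show ?case using empty(3) by auto
next
  case (insert j L)
  interpret A: cring A by (rule A)
  have fj: "semilinear (f j)" and fL: "\<And>l. l \<in> L \<Longrightarrow> semilinear (f l)" using insert(4) by auto
  note g = insert(5)
  let ?V = "{x \<in> carrier M. \<forall>l\<in>L. f l x = \<zero>\<^bsub>A\<^esub>}"
  have V: "submodule ?V R M"
  proof (rule submoduleI)
    show "\<zero>\<^bsub>M\<^esub> \<in> ?V" using semilinear_zero[OF A fL] by simp
    have sm: "a \<odot>\<^bsub>M\<^esub> x \<in> ?V" if "a \<in> carrier R" "x \<in> ?V" for a x
      using that semilinearD(3)[OF fL, of _ a x] rho_hom(1)[OF that(1)] by simp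
    show "a \<odot>\<^bsub>M\<^esub> x \<in> ?V" if "a \<in> carrier R" "x \<in> ?V" for a x by (rule sm[OF that])
    show "\<ominus>\<^bsub>M\<^esub> x \<in> ?V" if "x \<in> ?V" for x
      using sm[of "\<ominus> \<one>" x] that smult_l_minus[OF one_closed, of x] by simp
    show "x \<oplus>\<^bsub>M\<^esub> y \<in> ?V" if "x \<in> ?V" "y \<in> ?V" for x y
      using that semilinearD(2)[OF fL, of _ x y] by simp
  qed simp
  have "\<exists>w\<in>carrier A. \<forall>x\<in>?V. g x = f j x \<otimes>\<^bsub>A\<^esub> w"
  proof (rule self_injective_extend_one[OF A inj V fj g])
    fix x assume "x \<in> ?V" "f j x = \<zero>\<^bsub>A\<^esub>"
    then show "g x = \<zero>\<^bsub>A\<^esub>" by (intro insert(6)) auto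
  qed
  then obtain w where w: "w \<in> carrier A" "\<And>x. x \<in> ?V \<Longrightarrow> g x = f j x \<otimes>\<^bsub>A\<^esub> w" by blast
  let ?g = "\<lambda>x. g x \<ominus>\<^bsub>A\<^esub> w \<otimes>\<^bsub>A\<^esub> f j x"
  have gA: "g x \<in> carrier A" and fjA: "f j x \<in> carrier A" if "x \<in> carrier M" for x
    using semilinearD(1)[OF g that] semilinearD(1)[OF fj that] by auto
  have sl: "semilinear ?g"
    unfolding semilinear_def
  proof (intro conjI ballI)
    fix x assume x: "x \<in> carrier M"
    show "?g x \<in> carrier A" using gA[OF x] fjA[OF x] w(1) by simp
    show "?g (x \<oplus>\<^bsub>M\<^esub> y) = ?g x \<oplus>\<^bsub>A\<^esub> ?g y" if y: "y \<in> carrier M" for y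
      unfolding semilinearD(2)[OF g x y] semilinearD(2)[OF fj x y]
      using gA[OF x] gA[OF y] fjA[OF x] fjA[OF y] w(1) by algebra
    show "?g (r \<odot>\<^bsub>M\<^esub> x) = rho r \<otimes>\<^bsub>A\<^esub> ?g x" if r: "r \<in> carrier R" for r
      unfolding semilinearD(3)[OF g r x] semilinearD(3)[OF fj r x]
      using gA[OF x] fjA[OF x] w(1) rho_hom(1)[OF r] by algebra
  qed
  have "\<exists>k\<in>L \<rightarrow> carrier A. \<forall>x\<in>carrier M. ?g x = (\<Oplus>\<^bsub>A\<^esub>l\<in>L. k l \<otimes>\<^bsub>A\<^esub> f l x)"
  proof (rule insert(3)[OF fL sl])
    fix x assume x: "x \<in> carrier M" and z: "\<And>l. l \<in> L \<Longrightarrow> f l x = \<zero>\<^bsub>A\<^esub>"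
    then have "g x = f j x \<otimes>\<^bsub>A\<^esub> w" by (intro w(2)) simp
    then show "?g x = \<zero>\<^bsub>A\<^esub>" using fjA[OF x] w(1) by (simp add: A.m_comm a_minus_def A.r_neg)
  qed
  then obtain k where k: "k \<in> L \<rightarrow> carrier A" and gk: "\<And>x. x \<in> carrier M \<Longrightarrow> ?g x = (\<Oplus>\<^bsub>A\<^esub>l\<in>L. k l \<otimes>\<^bsub>A\<^esub> f l x)"
    by blast
  let ?k = "\<lambda>l. if l = j then w else k l"
  have "g x = (\<Oplus>\<^bsub>A\<^esub>l\<in>insert j L. ?k l \<otimes>\<^bsub>A\<^esub> f l x)" if x: "x \<in> carrier M" for x
  proof -
    have kc: "k l \<in> carrier A" "f l x \<in> carrier A" if "l \<in> L" for l
      using k that semilinearD(1)[OF fL[OF that] x] by auto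
    have "(\<Oplus>\<^bsub>A\<^esub>l\<in>insert j L. ?k l \<otimes>\<^bsub>A\<^esub> f l x) = ?k j \<otimes>\<^bsub>A\<^esub> f j x \<oplus>\<^bsub>A\<^esub> (\<Oplus>\<^bsub>A\<^esub>l\<in>L. ?k l \<otimes>\<^bsub>A\<^esub> f l x)"
      using insert(1,2) kc w(1) fjA[OF x] by (intro A.finsum_insert) auto
    also have "(\<Oplus>\<^bsub>A\<^esub>l\<in>L. ?k l \<otimes>\<^bsub>A\<^esub> f l x) = ?g x"
      unfolding gk[OF x] using insert(2) kc by (intro A.finsum_cong') auto
    also have "?k j \<otimes>\<^bsub>A\<^esub> f j x \<oplus>\<^bsub>A\<^esub> ?g x = w \<otimes>\<^bsub>A\<^esub> f j x \<oplus>\<^bsub>A\<^esub> (g x \<ominus>\<^bsub>A\<^esub> w \<otimes>\<^bsub>A\<^esub> f j x)" by simp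
    also have "\<dots> = g x" using gA[OF x] fjA[OF x] w(1) by algebra
    finally show ?thesis by simp
  qed
  moreover have "?k \<in> insert j L \<rightarrow> carrier A" using k w(1) by auto
  ultimately show ?case by (intro bexI[of _ ?k] ballI)
qed

end

text \<open>A prime of the localization contracts to a prime inside \<open>Q\<close>, which is
  \<open>Q\<close> by minimality. Denominators are units, so membership is decided by numerators and
  the prime is determined by its contraction. Since \<open>Q\<close> annihilates exactly
  \<open>z\<close>, the prime consists of the elements that kill the image of
  \<open>z\<close>.\<close>

lemma (in cring) localization_artinian_socle:
  assumes Q: "minimal_prime R Q" and z: "z \<in> carrier R" "Q = {r \<in> carrier R. r \<otimes> z = \<zero>}"
    and A: "cring (ring_at R Q)" "noetherian_ring (ring_at R Q)"
  shows "\<exists>m. artinian_socle (ring_at R Q) (fraction R (carrier R - Q) (self_module R) z \<one>) m"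
proof -
  let ?S = "carrier R - Q" and ?A = "ring_at R Q"
  let ?rho = "\<lambda>r. fraction R ?S (self_module R) r \<one>"
  have prime: "primeideal Q R" and min: "\<And>P. primeideal P R \<Longrightarrow> P \<subseteq> Q \<Longrightarrow> P = Q"
    using Q by (auto simp: minimal_prime_def)
  interpret L: mult_closed_module R "self_module R" ?S
    by (rule prime_complement_mult_closed[OF self_module_module prime])
  interpret A: cring ?A by (rule A(1))
  note rho = L.rho_hom
  let ?m = "{\<alpha> \<in> carrier ?A. \<alpha> \<otimes>\<^bsub>?A\<^esub> ?rho z = \<zero>\<^bsub>?A\<^esub>}"
  have unit_not: "?rho s \<notin> P" if P: "primeideal P ?A" and s: "s \<in> ?S" for P s
  proof
    assume sP: "?rho s \<in> P"
    interpret P: primeideal P ?A by (rule P)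
    obtain u where "u \<in> carrier ?A" "?rho s \<otimes>\<^bsub>?A\<^esub> u = \<one>\<^bsub>?A\<^esub>" using L.rho_unit[OF s] by blast
    then have "\<one>\<^bsub>?A\<^esub> \<in> P" using P.I_r_closed[OF sP] by metis
    then show False using P.one_imp_carrier P.I_notcarr by blast
  qed
  have Qz: "?rho r \<otimes>\<^bsub>?A\<^esub> ?rho z = \<zero>\<^bsub>?A\<^esub> \<longleftrightarrow> r \<in> Q" if r: "r \<in> carrier R" for r
  proof -
    have "?rho r \<otimes>\<^bsub>?A\<^esub> ?rho z = ?rho (r \<otimes> z)" by (rule rho(2)[symmetric, OF r z(1)])
    then have "?rho r \<otimes>\<^bsub>?A\<^esub> ?rho z = \<zero>\<^bsub>?A\<^esub> \<longleftrightarrow> (\<exists>u\<in>?S. u \<otimes> (r \<otimes> z) = \<zero>)"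
      using L.rho_eq_zero_iff[of "r \<otimes> z"] r z(1) by simp
    also have "\<dots> \<longleftrightarrow> r \<in> Q"
    proof
      assume "\<exists>u\<in>?S. u \<otimes> (r \<otimes> z) = \<zero>"
      then obtain u where u: "u \<in> carrier R" "u \<notin> Q" "u \<otimes> (r \<otimes> z) = \<zero>" by blast
      have "(u \<otimes> r) \<otimes> z = \<zero>" using u r z(1) by (simp add: m_assoc)
      then have "u \<otimes> r \<in> Q" using u(1) r unfolding z(2) by simp
      then show "r \<in> Q" using primeideal.I_prime[OF prime u(1) r] u(2) by blast
    next
      assume "r \<in> Q"
      then have "\<one> \<otimes> (r \<otimes> z) = \<zero>" using z by simp
      then show "\<exists>u\<in>?S. u \<otimes> (r \<otimes> z) = \<zero>" using L.S_one by blast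
    qed
    finally show ?thesis .
  qed
  have "P = ?m" if P: "primeideal P ?A" for P
  proof -
    interpret P: primeideal P ?A by (rule P)
    let ?P = "{r \<in> carrier R. ?rho r \<in> P}"
    have hom: "ring_hom_ring R ?A ?rho" by (rule ring_hom_ringI2[OF ring_axioms A.ring_axioms rho(4)])
    have Pid: "ideal ?P R" by (rule ring_hom_ring.ideal_vimage[OF hom P.is_ideal])
    have Psub: "?P \<subseteq> Q" using unit_not[OF P] by blast
    have "primeideal ?P R"
    proof (rule primeidealI[OF Pid is_cring])
      show "carrier R \<noteq> ?P" using Psub L.S_one by blast
      fix a b assume ab: "a \<in> carrier R" "b \<in> carrier R" "a \<otimes> b \<in> ?P"
      then have "?rho a \<otimes>\<^bsub>?A\<^esub> ?rho b \<in> P" using rho(2)[OF ab(1,2)] by simp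
      then show "a \<in> ?P \<or> b \<in> ?P" using P.I_prime[OF rho(1)[OF ab(1)] rho(1)[OF ab(2)]] ab by blast
    qed
    then have PQ: "?P = Q" using min Psub by blast
    have "\<alpha> \<in> P \<longleftrightarrow> \<alpha> \<otimes>\<^bsub>?A\<^esub> ?rho z = \<zero>\<^bsub>?A\<^esub>" if \<alpha>: "\<alpha> \<in> carrier ?A" for \<alpha>
    proof -
      obtain r s where r: "r \<in> carrier R" "s \<in> ?S" "?rho s \<otimes>\<^bsub>?A\<^esub> \<alpha> = ?rho r"
        by (rule L.rho_denominator[OF \<alpha>])
      have sA: "?rho s \<in> carrier ?A" "?rho z \<in> carrier ?A" using rho(1) r(2) z(1) by auto
      have "\<alpha> \<in> P \<longleftrightarrow> ?rho r \<in> P"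
        unfolding r(3)[symmetric] using P.I_prime[OF sA(1) \<alpha>] P.I_l_closed[OF _ sA(1), of \<alpha>] unit_not[OF P r(2)] by blast
      also have "\<dots> \<longleftrightarrow> r \<in> Q" using PQ r(1) by blast
      also have "\<dots> \<longleftrightarrow> ?rho s \<otimes>\<^bsub>?A\<^esub> (\<alpha> \<otimes>\<^bsub>?A\<^esub> ?rho z) = \<zero>\<^bsub>?A\<^esub>"
        using Qz[OF r(1)] r(3) sA \<alpha> by (simp add: A.m_assoc[symmetric])
      also have "\<dots> \<longleftrightarrow> \<alpha> \<otimes>\<^bsub>?A\<^esub> ?rho z = \<zero>\<^bsub>?A\<^esub>"
      proof
        assume "?rho s \<otimes>\<^bsub>?A\<^esub> (\<alpha> \<otimes>\<^bsub>?A\<^esub> ?rho z) = \<zero>\<^bsub>?A\<^esub>"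
        then have "?rho s \<otimes>\<^bsub>?A\<^esub> (\<alpha> \<otimes>\<^bsub>?A\<^esub> ?rho z) = ?rho s \<otimes>\<^bsub>?A\<^esub> \<zero>\<^bsub>?A\<^esub>" using sA by simp
        then show "\<alpha> \<otimes>\<^bsub>?A\<^esub> ?rho z = \<zero>\<^bsub>?A\<^esub>"
          by (rule L.rho_cancel[OF A(1) r(2), rotated 2]) (use sA \<alpha> in simp_all)
      qed (use sA in simp)
      finally show ?thesis .
    qed
    then show ?thesis using P.Icarr by blast
  qed
  then have "artinian_socle ?A (?rho z) ?m"
    using A rho(1)[OF z(1)] by (intro artinian_socle.intro artinian_socle_axioms.intro) blast+
  then show ?thesis by blast
qed

text \<open>Self-injectivity writes the image of \<open>g\<close> in the localization as a
  combination of the images of the \<open>f l\<close>. Once the coefficients are cleared of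
  denominators, both sides are functionals over \<open>R\<close> with equal images; on finitely many
  generators they become equal after one factor outside \<open>Q\<close>.\<close>

lemma (in cring) gorenstein_localization_factors:
  fixes M :: "('a, 'm, 's) module_scheme"
  assumes fg: "finitely_generated_module R M" and Q: "associated_prime R Q" "minimal_prime R Q"
    and gor: "gorenstein_local_ring TYPE('e) (ring_at R Q)"
    and L: "finite L" and f: "\<And>l. l \<in> L \<Longrightarrow> f l \<in> linear_maps R M (self_module R)"
    and inj: "\<And>x. x \<in> carrier M \<Longrightarrow> (\<And>l. l \<in> L \<Longrightarrow> f l x = \<zero>) \<Longrightarrow> x = \<zero>\<^bsub>M\<^esub>"
    and g: "g \<in> linear_maps R M (self_module R)"
  shows "\<exists>t\<in>carrier R - Q. \<exists>k\<in>L \<rightarrow> carrier R. \<forall>x\<in>carrier M. dot L k (\<lambda>l. f l x) = t \<otimes> g x"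
proof -
  let ?S = "carrier R - Q" and ?A = "ring_at R Q"
  let ?rho = "\<lambda>r. fraction R ?S (self_module R) r \<one>"
  from fg obtain G where M: "module R M" and G: "finite G" "G \<subseteq> carrier M"
    "\<forall>x\<in>carrier M. \<exists>c\<in>G \<rightarrow> carrier R. x = (\<Oplus>\<^bsub>M\<^esub>b\<in>G. c b \<odot>\<^bsub>M\<^esub> b)"
    unfolding finitely_generated_module_def by blast
  from Q(1) obtain z where prime: "primeideal Q R" and z: "z \<in> carrier R" "Q = {r \<in> carrier R. r \<otimes> z = \<zero>}"
    unfolding associated_prime_def by blast
  have A: "cring ?A" "noetherian_ring ?A" and fid: "finite_injective_dimension TYPE('e) ?A (self_module ?A)"
    using gor by (auto simp: gorenstein_local_ring_def local_ring_def)
  interpret M: module R M by (rule M)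
  interpret L: mult_closed_module R M ?S by (rule prime_complement_mult_closed[OF M prime])
  interpret A: cring ?A by (rule A(1))
  note rho = L.rho_hom
  obtain m where "artinian_socle ?A (?rho z) m" using localization_artinian_socle[OF Q(2) z A] by blast
  then have si: "cring.self_injective ?A"
    using fid by (rule artinian_socle.finite_injective_dimension_self_injective)
  have fR: "f l x \<in> carrier R" if "l \<in> L" "x \<in> carrier M" for l x
    using linear_mapsD(1)[OF f[OF that(1)] that(2)] by simp
  have gR: "g x \<in> carrier R" if "x \<in> carrier M" for x
    using linear_mapsD(1)[OF g that] by simp
  have sl: "L.semilinear (\<lambda>x. ?rho (h x))" if h: "h \<in> linear_maps R M (self_module R)" for h
  proof -
    have hR: "h x \<in> carrier R" if "x \<in> carrier M" for x using linear_mapsD(1)[OF h that] by simp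
    show ?thesis
      unfolding L.semilinear_def using linear_mapsD(2,3)[OF h] hR rho(1-3) by simp
  qed
  have "\<exists>k\<in>L \<rightarrow> carrier ?A. \<forall>x\<in>carrier M. ?rho (g x) = (\<Oplus>\<^bsub>?A\<^esub>l\<in>L. k l \<otimes>\<^bsub>?A\<^esub> ?rho (f l x))"
  proof (rule L.self_injective_extend[where f = "\<lambda>l x. ?rho (f l x)" and g = "\<lambda>x. ?rho (g x)",
        OF A(1) si L])
    show "L.semilinear (\<lambda>x. ?rho (f l x))" if "l \<in> L" for l by (rule sl[OF f[OF that]])
    show "L.semilinear (\<lambda>x. ?rho (g x))" by (rule sl[OF g])
    fix x assume x: "x \<in> carrier M" and zero: "\<And>l. l \<in> L \<Longrightarrow> ?rho (f l x) = \<zero>\<^bsub>?A\<^esub>"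
    have "\<exists>u. u \<in> ?S \<and> u \<otimes> f l x = \<zero>" if l: "l \<in> L" for l
      using zero[OF l] L.rho_eq_zero_iff[OF fR[OF l x]] by blast
    then have "\<forall>l\<in>L. \<exists>u. u \<in> ?S \<and> u \<otimes> f l x = \<zero>" by (rule ballI)
    then obtain u where u: "\<And>l. l \<in> L \<Longrightarrow> u l \<in> ?S" "\<And>l. l \<in> L \<Longrightarrow> u l \<otimes> f l x = \<zero>" by metis
    \<comment> \<open>Localization keeps the joint kernel trivial: if all \<open>f l x\<close>
      vanish locally, one common factor moves \<open>x\<close> into the joint kernel over
      \<open>R\<close>, so \<open>x\<close> vanishes locally as well.\<close>
    let ?u = "finprod R u L"
    have uS: "?u \<in> ?S" using u(1) by (intro finprod_not_in_prime[OF prime L]) blast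
    have uR: "?u \<in> carrier R" using uS by blast
    have "f l (?u \<odot>\<^bsub>M\<^esub> x) = \<zero>" if l: "l \<in> L" for l
    proof -
      have c: "u \<in> L - {l} \<rightarrow> carrier R" "u l \<in> carrier R" using u(1) l by blast+
      have p: "finprod R u (L - {l}) \<in> carrier R" by (rule finprod_closed[OF c(1)])
      have "?u = u l \<otimes> finprod R u (L - {l})"
        using finprod_insert[of "L - {l}" l u] L c l by (simp add: insert_absorb)
      then have "?u \<otimes> f l x = finprod R u (L - {l}) \<otimes> (u l \<otimes> f l x)"
        using p c(2) fR[OF l x] by (simp add: m_ac)
      then have "?u \<otimes> f l x = \<zero>" using u(2)[OF l] p by simp
      then show ?thesis using linear_mapsD(3)[OF f[OF l] uR x] by simp
    qed
    then have "?u \<odot>\<^bsub>M\<^esub> x = \<zero>\<^bsub>M\<^esub>" using uR x by (intro inj) simp_all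
    then have "?u \<otimes> g x = \<zero>"
      using linear_mapsD(3)[OF g uR x] linear_map_zero[OF M self_module_module g] by simp
    then show "?rho (g x) = \<zero>\<^bsub>?A\<^esub>" using L.rho_eq_zero_iff[OF gR[OF x]] uS by blast
  qed
  then obtain \<kappa> where \<kappa>: "\<kappa> \<in> L \<rightarrow> carrier ?A"
    and g\<kappa>: "\<And>x. x \<in> carrier M \<Longrightarrow> ?rho (g x) = (\<Oplus>\<^bsub>?A\<^esub>l\<in>L. \<kappa> l \<otimes>\<^bsub>?A\<^esub> ?rho (f l x))" by blast
  from L.common_denominator[OF A(1) L \<kappa>] obtain s k where s: "s \<in> ?S" and k: "k \<in> L \<rightarrow> carrier R"
    and sk: "\<And>l. l \<in> L \<Longrightarrow> ?rho s \<otimes>\<^bsub>?A\<^esub> \<kappa> l = ?rho (k l)" by blast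
  have sR: "s \<in> carrier R" using s by blast
  have kR: "k l \<in> carrier R" if "l \<in> L" for l using k that by blast
  let ?F = "\<lambda>x. dot L k (\<lambda>l. f l x)" and ?G = "\<lambda>x. s \<otimes> g x"
  have F: "?F \<in> linear_maps R M (self_module R)" by (rule dot_linear[OF M L k f])
  have Gl: "?G \<in> linear_maps R M (self_module R)" by (rule scale_linear[OF M sR g])
  interpret self: mult_closed_module R "self_module R" ?S
    by (rule prime_complement_mult_closed[OF self_module_module prime])
  have rho_sum: "?rho (\<Oplus>l\<in>K. h l) = (\<Oplus>\<^bsub>?A\<^esub>l\<in>K. ?rho (h l))" if "finite K" "h \<in> K \<rightarrow> carrier R" for K h
    using that
  proof (induction K rule: finite_induct)
    case empty
    have "?rho \<zero> = \<zero>\<^bsub>?A\<^esub>" by (rule ring_hom_zero[OF rho(4) ring_axioms A.ring_axioms])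
    then show ?case by simp
  next
    case (insert l K)
    then have c: "h l \<in> carrier R" "h \<in> K \<rightarrow> carrier R" by auto
    have "(\<Oplus>l\<in>insert l K. h l) = h l \<oplus> (\<Oplus>l\<in>K. h l)"
      by (rule finsum_insert[OF insert(1,2) c(2,1)])
    moreover have "(\<Oplus>\<^bsub>?A\<^esub>l\<in>insert l K. ?rho (h l)) = ?rho (h l) \<oplus>\<^bsub>?A\<^esub> (\<Oplus>\<^bsub>?A\<^esub>l\<in>K. ?rho (h l))"
      using c rho(1) by (intro A.finsum_insert[OF insert(1,2)]) (auto simp: Pi_iff)
    ultimately show ?case using insert(3)[OF c(2)] rho(3)[OF c(1) finsum_closed[OF c(2)]] by simp
  qed
  have "\<exists>u\<in>?S. u \<otimes> ?F x = u \<otimes> ?G x" if x: "x \<in> G" for x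
  proof -
    have xM: "x \<in> carrier M" using x G(2) by blast
    have \<kappa>A: "\<kappa> l \<in> carrier ?A" "?rho (f l x) \<in> carrier ?A" "?rho (k l) \<in> carrier ?A" if "l \<in> L" for l
      using \<kappa> that rho(1)[OF fR[OF that xM]] rho(1)[OF kR[OF that]] by auto
    have "?rho (?G x) = ?rho s \<otimes>\<^bsub>?A\<^esub> (\<Oplus>\<^bsub>?A\<^esub>l\<in>L. \<kappa> l \<otimes>\<^bsub>?A\<^esub> ?rho (f l x))"
      using rho(2)[OF sR gR[OF xM]] g\<kappa>[OF xM] by simp
    also have "\<dots> = (\<Oplus>\<^bsub>?A\<^esub>l\<in>L. ?rho s \<otimes>\<^bsub>?A\<^esub> (\<kappa> l \<otimes>\<^bsub>?A\<^esub> ?rho (f l x)))"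
      using \<kappa>A rho(1)[OF sR] L by (intro A.finsum_rdistr) auto
    also have "\<dots> = (\<Oplus>\<^bsub>?A\<^esub>l\<in>L. ?rho (k l \<otimes> f l x))"
    proof (intro A.finsum_cong' refl funcsetI)
      fix l assume l: "l \<in> L"
      show "?rho (k l \<otimes> f l x) \<in> carrier ?A" using rho(1) kR[OF l] fR[OF l xM] by simp
      have "?rho s \<otimes>\<^bsub>?A\<^esub> (\<kappa> l \<otimes>\<^bsub>?A\<^esub> ?rho (f l x)) = (?rho s \<otimes>\<^bsub>?A\<^esub> \<kappa> l) \<otimes>\<^bsub>?A\<^esub> ?rho (f l x)"
        using \<kappa>A[OF l] rho(1)[OF sR] by (simp add: A.m_assoc)
      then show "?rho s \<otimes>\<^bsub>?A\<^esub> (\<kappa> l \<otimes>\<^bsub>?A\<^esub> ?rho (f l x)) = ?rho (k l \<otimes> f l x)"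
        using sk[OF l] rho(2)[OF kR[OF l] fR[OF l xM]] by simp
    qed
    also have "\<dots> = ?rho (?F x)"
      unfolding dot_def using kR fR[OF _ xM] by (intro rho_sum[OF L, symmetric]) auto
    finally have "?rho (?F x) = ?rho (?G x)" by simp
    moreover have "?F x \<in> carrier R" "?G x \<in> carrier R"
      using linear_mapsD(1)[OF F xM] linear_mapsD(1)[OF Gl xM] by simp_all
    ultimately show ?thesis using self.mu_eq_iff[of "?F x" "?G x"] by simp
  qed
  from linear_maps_locally_eq[OF M G prime F Gl this] obtain u where u: "u \<in> carrier R" "u \<notin> Q"
    and uFG: "\<And>x. x \<in> carrier M \<Longrightarrow> u \<otimes> ?F x = u \<otimes> ?G x" by blast
  have "dot L (\<lambda>l. u \<otimes> k l) (\<lambda>l. f l x) = (u \<otimes> s) \<otimes> g x" if x: "x \<in> carrier M" for x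
    using dot_scale_left[OF L k, of "\<lambda>l. f l x" u] fR uFG[OF x] u sR x gR by (simp add: m_assoc)
  moreover have "u \<otimes> s \<in> ?S" using L.S_mult u s by blast
  moreover have "(\<lambda>l. u \<otimes> k l) \<in> L \<rightarrow> carrier R" using k u(1) by blast
  ultimately show ?thesis by (intro bexI[of _ "u \<otimes> s"] bexI[of _ "\<lambda>l. u \<otimes> k l"] ballI)
qed

section \<open>Derivations\<close>

context cring
begin

text \<open>The derivation of \<open>R[X\<^sub>i | i \<in> I]\<close> over \<open>R\<close> that sends \<open>X\<^sub>i\<close> to the scalar \<open>c i\<close>.\<close>

definition deriv_by :: "('i \<Rightarrow> 'a) \<Rightarrow> ('i multiset \<Rightarrow> 'a) \<Rightarrow> 'i multiset \<Rightarrow> 'a"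
  where "deriv_by c p v = (\<Oplus>i\<in>{i. p (add_mset i v) \<noteq> \<zero>}. [Suc (count v i)] \<cdot> (c i \<otimes> p (add_mset i v)))"

lemma deriv_by_finite: "p \<in> polys I \<Longrightarrow> finite {i. p (add_mset i v) \<noteq> \<zero>}"
  by (rule finite_imageD[of "\<lambda>i. add_mset i v"])
    (auto simp: inj_on_def intro: finite_subset[OF _ polys_finite_support])

lemma deriv_by_subset: "p \<in> polys I \<Longrightarrow> {i. p (add_mset i v) \<noteq> \<zero>} \<subseteq> I"
  using polys_support by fastforce

lemma deriv_by_superset:
  assumes p: "p \<in> polys I" and c: "c \<in> I \<rightarrow> carrier R"
    and W: "finite W" "{i. p (add_mset i v) \<noteq> \<zero>} \<subseteq> W" "W \<subseteq> I"
  shows "deriv_by c p v = (\<Oplus>i\<in>W. [Suc (count v i)] \<cdot> (c i \<otimes> p (add_mset i v)))"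
  unfolding deriv_by_def
proof (rule add.finprod_mono_neutral_cong_left[OF W(1,2)])
  have ci: "c i \<in> carrier R" if "i \<in> W" for i using c W(3) that by blast
  show "[Suc (count v i)] \<cdot> (c i \<otimes> p (add_mset i v)) = \<zero>" if "i \<in> W - {i. p (add_mset i v) \<noteq> \<zero>}" for i
    using that ci[of i] by simp
  show "(\<lambda>i. [Suc (count v i)] \<cdot> (c i \<otimes> p (add_mset i v))) \<in> W \<rightarrow> carrier R"
    using ci polys_coeff[OF p] by (intro funcsetI add.nat_pow_closed m_closed) auto
qed simp

lemma deriv_by_const: "deriv_by c (indexed_const k) = indexed_const \<zero>"
  by (auto simp: deriv_by_def indexed_const_def)

lemma deriv_by_padd:
  assumes p: "p \<in> polys I" and q: "q \<in> polys I" and c: "c \<in> I \<rightarrow> carrier R"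
  shows "deriv_by c (indexed_padd p q) = indexed_padd (deriv_by c p) (deriv_by c q)"
proof
  fix v
  let ?W = "{i. p (add_mset i v) \<noteq> \<zero>} \<union> {i. q (add_mset i v) \<noteq> \<zero>}"
  have W: "finite ?W" "?W \<subseteq> I" using deriv_by_finite deriv_by_subset p q by blast+
  have ci: "c i \<in> carrier R" if "i \<in> ?W" for i using c W(2) that by blast
  note pc = polys_coeff[OF p] polys_coeff[OF q]
  have pq: "{i. indexed_padd p q (add_mset i v) \<noteq> \<zero>} \<subseteq> ?W" by (auto simp: indexed_padd_def)
  have t: "[Suc (count v i)] \<cdot> (c i \<otimes> p (add_mset i v)) \<in> carrier R" "[Suc (count v i)] \<cdot> (c i \<otimes> q (add_mset i v)) \<in> carrier R"
    if "i \<in> ?W" for i using ci[OF that] pc by (intro add.nat_pow_closed m_closed; simp)+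
  have "deriv_by c (indexed_padd p q) v = (\<Oplus>i\<in>?W. [Suc (count v i)] \<cdot> (c i \<otimes> indexed_padd p q (add_mset i v)))"
    by (rule deriv_by_superset[OF _ c W(1) pq W(2)]) (use p q in simp)
  also have "\<dots> = (\<Oplus>i\<in>?W. [Suc (count v i)] \<cdot> (c i \<otimes> p (add_mset i v)) \<oplus> [Suc (count v i)] \<cdot> (c i \<otimes> q (add_mset i v)))"
  proof (intro finsum_cong' refl funcsetI)
    fix i assume i: "i \<in> ?W"
    show "[Suc (count v i)] \<cdot> (c i \<otimes> p (add_mset i v)) \<oplus> [Suc (count v i)] \<cdot> (c i \<otimes> q (add_mset i v)) \<in> carrier R"
      using t[OF i] by simp
    show "[Suc (count v i)] \<cdot> (c i \<otimes> indexed_padd p q (add_mset i v))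
      = [Suc (count v i)] \<cdot> (c i \<otimes> p (add_mset i v)) \<oplus> [Suc (count v i)] \<cdot> (c i \<otimes> q (add_mset i v))"
      unfolding indexed_padd_def using ci[OF i] pc by (simp only: r_distr add.nat_pow_distrib m_closed)
  qed
  also have "\<dots> = (\<Oplus>i\<in>?W. [Suc (count v i)] \<cdot> (c i \<otimes> p (add_mset i v))) \<oplus> (\<Oplus>i\<in>?W. [Suc (count v i)] \<cdot> (c i \<otimes> q (add_mset i v)))"
    using t by (intro finsum_addf funcsetI)
  also have "\<dots> = indexed_padd (deriv_by c p) (deriv_by c q) v"
    using deriv_by_superset[OF p c W(1) _ W(2)] deriv_by_superset[OF q c W(1) _ W(2)]
    by (simp add: indexed_padd_def)
  finally show "deriv_by c (indexed_padd p q) v = indexed_padd (deriv_by c p) (deriv_by c q) v" .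
qed

lemma deriv_by_pmult:
  assumes p: "p \<in> polys I" and i: "i \<in> I" and c: "c \<in> I \<rightarrow> carrier R"
  shows "deriv_by c (indexed_pmult p i) = indexed_padd (indexed_pmult (deriv_by c p) i) (pscale (c i) p)"
proof
  fix v
  have ci: "c i \<in> carrier R" using c i by blast
  have pi: "indexed_pmult p i \<in> polys I" using p i by simp
  note pc = polys_coeff[OF p]
  show "deriv_by c (indexed_pmult p i) v = indexed_padd (indexed_pmult (deriv_by c p) i) (pscale (c i) p) v"
  proof (cases "i \<in># v")
    case False
    have sub: "{j. indexed_pmult p i (add_mset j v) \<noteq> \<zero>} \<subseteq> {i}"
      using False by (auto simp: indexed_pmult_def split: if_splits)
    have "deriv_by c (indexed_pmult p i) v = (\<Oplus>j\<in>{i}. [Suc (count v j)] \<cdot> (c j \<otimes> indexed_pmult p i (add_mset j v)))"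
      by (rule deriv_by_superset[OF pi c _ sub]) (use i in simp_all)
    also have "\<dots> = c i \<otimes> p v"
      using False ci pc[of v] by (simp add: not_in_iff)
    finally show ?thesis
      using False ci pc[of v] by (simp add: indexed_padd_def pscale_def) (simp add: indexed_pmult_def)
  next
    case True
    then obtain u where v: "v = add_mset i u" by (meson multi_member_split)
    \<comment> \<open>The index \<open>i\<close> is added because the correction term sits there,
      even if its coefficient happens to be zero.\<close>
    let ?W = "insert i {j. p (add_mset j u) \<noteq> \<zero>}"
    have W: "finite ?W" "?W \<subseteq> I" using deriv_by_finite[OF p] deriv_by_subset[OF p, of u] i by auto
    have cW: "c j \<in> carrier R" if "j \<in> ?W" for j using c W(2) that by blast
    have val: "indexed_pmult p i (add_mset j v) = p (add_mset j u)" for j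
      unfolding v by (metis add_mset_commute indexed_pmult_add_mset)
    have sub: "{j. indexed_pmult p i (add_mset j v) \<noteq> \<zero>} \<subseteq> ?W" unfolding val by blast
    have t: "[Suc (count u j)] \<cdot> (c j \<otimes> p (add_mset j u)) \<in> carrier R" if "j \<in> ?W" for j
      using cW[OF that] pc by (intro add.nat_pow_closed m_closed)
    have "deriv_by c (indexed_pmult p i) v = (\<Oplus>j\<in>?W. [Suc (count v j)] \<cdot> (c j \<otimes> p (add_mset j u)))"
      using deriv_by_superset[OF pi c W(1) sub W(2)] unfolding val .
    \<comment> \<open>Passing from \<open>u\<close> to \<open>v = add_mset i u\<close> raises the
      multiplicity only at \<open>i\<close>, by one. The extra summand is the second term of the
      product rule.\<close>
    also have "\<dots> = (\<Oplus>j\<in>?W. [Suc (count u j)] \<cdot> (c j \<otimes> p (add_mset j u)) \<oplus> (if j = i then c i \<otimes> p v else \<zero>))"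
    proof (intro finsum_cong' refl funcsetI)
      fix j assume j: "j \<in> ?W"
      have cp: "c i \<otimes> p v \<in> carrier R" using ci pc by simp
      show "[Suc (count u j)] \<cdot> (c j \<otimes> p (add_mset j u)) \<oplus> (if j = i then c i \<otimes> p v else \<zero>) \<in> carrier R"
        using t[OF j] cp by (cases "j = i") simp_all
      show "[Suc (count v j)] \<cdot> (c j \<otimes> p (add_mset j u))
        = [Suc (count u j)] \<cdot> (c j \<otimes> p (add_mset j u)) \<oplus> (if j = i then c i \<otimes> p v else \<zero>)"
      proof (cases "j = i")
        case True
        have "[Suc (count v i)] \<cdot> (c i \<otimes> p v) = [Suc (Suc (count u i))] \<cdot> (c i \<otimes> p v)" by (simp add: v)
        also have "\<dots> = [Suc (count u i)] \<cdot> (c i \<otimes> p v) \<oplus> c i \<otimes> p v" by (rule add.nat_pow_Suc)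
        finally show ?thesis using True v by simp
      next
        case False
        then have "count v j = count u j" by (simp add: v)
        then show ?thesis using False t[OF j] by simp
      qed
    qed
    also have "\<dots> = (\<Oplus>j\<in>?W. [Suc (count u j)] \<cdot> (c j \<otimes> p (add_mset j u))) \<oplus> (\<Oplus>j\<in>?W. if j = i then c i \<otimes> p v else \<zero>)"
      using t ci pc by (intro finsum_addf funcsetI) simp_all
    also have "(\<Oplus>j\<in>?W. if j = i then c i \<otimes> p v else \<zero>) = c i \<otimes> p v"
      using ci pc W(1) by (intro add.finprod_singleton_swap) auto
    also have "(\<Oplus>j\<in>?W. [Suc (count u j)] \<cdot> (c j \<otimes> p (add_mset j u))) = deriv_by c p u"
      by (rule deriv_by_superset[OF p c W(1) _ W(2), symmetric]) blast
    finally show ?thesis by (simp add: indexed_padd_def pscale_def v)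
  qed
qed

lemma deriv_by_closed:
  assumes p: "p \<in> polys I" and c: "c \<in> I \<rightarrow> carrier R"
  shows "deriv_by c p \<in> polys I"
  using p
proof (induction rule: indexed_pset.induct)
  case (indexed_pmult p i)
  have "c i \<in> carrier R" using c indexed_pmult(2) by blast
  with indexed_pmult show ?case
    unfolding deriv_by_pmult[OF indexed_pmult(1,2) c] by simp
qed (auto simp: deriv_by_const deriv_by_padd[OF _ _ c])

lemma padd_rearrange:
  assumes "a \<in> polys I" "b \<in> polys I" "d \<in> polys I" "e \<in> polys I"
  shows "indexed_padd (indexed_padd a b) (indexed_padd d e) = indexed_padd (indexed_padd a d) (indexed_padd b e)"
    and "indexed_padd (indexed_padd a b) d = indexed_padd (indexed_padd a d) b"
  using assms[THEN polys_coeff] by (auto simp: indexed_padd_def fun_eq_iff a_ac)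

lemma pmult_padd: "indexed_pmult (indexed_padd p q) i = indexed_padd (indexed_pmult p i) (indexed_pmult q i)"
  by (auto simp: indexed_pmult_def indexed_padd_def fun_eq_iff)

lemma deriv_by_pscale:
  assumes p: "p \<in> polys I" and r: "r \<in> carrier R" and c: "c \<in> I \<rightarrow> carrier R"
  shows "deriv_by c (pscale r p) = pscale r (deriv_by c p)"
  using p
proof (induction rule: indexed_pset.induct)
  case (indexed_const k)
  then show ?case using r by (simp add: pscale_const deriv_by_const)
next
  case (indexed_padd p q)
  then show ?case
    using r deriv_by_closed[OF _ c]
    by (simp add: pscale_padd[of r _ I] deriv_by_padd[OF _ _ c])
next
  case (indexed_pmult p i)
  have ci: "c i \<in> carrier R" using c indexed_pmult(2) by blast
  have comm: "pscale (c i) (pscale r p) = pscale r (pscale (c i) p)"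
    using polys_coeff[OF indexed_pmult(1)] ci r by (simp add: pscale_def m_lcomm fun_eq_iff)
  have "deriv_by c (pscale r (indexed_pmult p i)) = deriv_by c (indexed_pmult (pscale r p) i)"
    using r by (simp add: pscale_pmult)
  also have "\<dots> = indexed_padd (indexed_pmult (deriv_by c (pscale r p)) i) (pscale (c i) (pscale r p))"
    by (rule deriv_by_pmult[OF pscale_closed[OF indexed_pmult(1) r] indexed_pmult(2) c])
  also have "\<dots> = indexed_padd (pscale r (indexed_pmult (deriv_by c p) i)) (pscale r (pscale (c i) p))"
    using r by (simp add: indexed_pmult(3) comm pscale_pmult)
  also have "\<dots> = pscale r (deriv_by c (indexed_pmult p i))"
    using deriv_by_pmult[OF indexed_pmult(1,2) c] r ci indexed_pmult(1,2) deriv_by_closed[OF indexed_pmult(1) c]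
    by (simp add: pscale_padd[of r _ I])
  finally show ?case .
qed

text \<open>The values on variables are scalars, so after two derivations the terms in the product
  rule are symmetric in \<open>c\<close> and \<open>d\<close>. Needed to move a derivation past a
  list of others.\<close>

lemma deriv_by_commute:
  assumes p: "p \<in> polys I" and c: "c \<in> I \<rightarrow> carrier R" and d: "d \<in> I \<rightarrow> carrier R"
  shows "deriv_by c (deriv_by d p) = deriv_by d (deriv_by c p)"
  using p
proof (induction rule: indexed_pset.induct)
  case (indexed_const k)
  then show ?case by (simp add: deriv_by_const)
next
  case (indexed_padd p q)
  then show ?case
    using deriv_by_closed[OF _ c] deriv_by_closed[OF _ d]
    by (simp add: deriv_by_padd[OF _ _ c] deriv_by_padd[OF _ _ d])
next
  case (indexed_pmult p i)
  have step: "deriv_by c' (deriv_by d' (indexed_pmult p i)) = indexed_padd (indexed_padd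
      (indexed_pmult (deriv_by c' (deriv_by d' p)) i) (pscale (c' i) (deriv_by d' p))) (pscale (d' i) (deriv_by c' p))"
    if c': "c' \<in> I \<rightarrow> carrier R" and d': "d' \<in> I \<rightarrow> carrier R" for c' d'
  proof -
    have di: "d' i \<in> carrier R" using d' indexed_pmult(2) by blast
    have dp: "deriv_by d' p \<in> polys I" by (rule deriv_by_closed[OF indexed_pmult(1) d'])
    show ?thesis
      unfolding deriv_by_pmult[OF indexed_pmult(1,2) d']
        deriv_by_padd[OF indexed_pmult_closed[OF dp indexed_pmult(2)] pscale_closed[OF indexed_pmult(1) di] c']
        deriv_by_pmult[OF dp indexed_pmult(2) c'] deriv_by_pscale[OF indexed_pmult(1) di c'] ..
  qed
  have ci: "c i \<in> carrier R" "d i \<in> carrier R" using c d indexed_pmult(2) by blast+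
  have cl: "deriv_by c p \<in> polys I" "deriv_by d p \<in> polys I" "deriv_by d (deriv_by c p) \<in> polys I"
    using deriv_by_closed[OF _ c] deriv_by_closed[OF _ d] indexed_pmult(1) by auto
  show ?case
    unfolding step[OF c d] step[OF d c] indexed_pmult(3)
    by (rule padd_rearrange(2)[of _ I]) (use cl ci indexed_pmult(2) in simp_all)
qed

lemma deriv_by_pconv:
  assumes p: "p \<in> polys I" and q: "q \<in> polys I" and c: "c \<in> I \<rightarrow> carrier R"
  shows "deriv_by c (pconv p q) = indexed_padd (pconv (deriv_by c p) q) (pconv p (deriv_by c q))"
  using p
proof (induction rule: indexed_pset.induct)
  case (indexed_const k)
  have dq: "deriv_by c q \<in> polys I" by (rule deriv_by_closed[OF q c])
  have z: "pscale \<zero> q = indexed_const \<zero>" using polys_coeff[OF q] by (simp add: pscale_def indexed_zero_def)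
  have "indexed_padd (indexed_const \<zero>) (pscale k (deriv_by c q)) = pscale k (deriv_by c q)"
    using polys_coeff[OF dq] indexed_const by (auto simp: indexed_padd_def indexed_zero_def pscale_def fun_eq_iff)
  then show ?case
    using indexed_const by (simp add: deriv_by_const pconv_const[OF _ q] pconv_const[OF _ dq] deriv_by_pscale[OF q _ c] z)
next
  case (indexed_padd p p')
  have cl: "deriv_by c q \<in> polys I" "deriv_by c p \<in> polys I" "deriv_by c p' \<in> polys I"
    using deriv_by_closed[OF _ c] q indexed_padd by auto
  show ?case
    unfolding pconv_padd[OF indexed_padd(1,2) q] deriv_by_padd[OF pconv_closed[OF indexed_padd(1) q] pconv_closed[OF indexed_padd(2) q] c]
      indexed_padd(3,4) deriv_by_padd[OF indexed_padd(1,2) c] pconv_padd[OF cl(2,3) q] pconv_padd[OF indexed_padd(1,2) cl(1)]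
    by (rule padd_rearrange(1)[of _ I]) (use cl q indexed_padd in auto)
next
  case (indexed_pmult p i)
  have ci: "c i \<in> carrier R" using c indexed_pmult(2) by blast
  have cl: "deriv_by c q \<in> polys I" "deriv_by c p \<in> polys I"
    using deriv_by_closed[OF _ c] q indexed_pmult(1) by auto
  have sc: "pconv (pscale (c i) p) q = pscale (c i) (pconv p q)"
    unfolding pscale_eq_pconv[OF ci indexed_pmult(1)] pscale_eq_pconv[OF ci pconv_closed[OF indexed_pmult(1) q]]
    by (rule pconv_assoc[OF _ indexed_pmult(1) q]) (use ci in simp)
  have cl2: "indexed_pmult (pconv (deriv_by c p) q) i \<in> polys I" "indexed_pmult (pconv p (deriv_by c q)) i \<in> polys I"
    "pscale (c i) (pconv p q) \<in> polys I" using cl q indexed_pmult ci by auto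
  have "deriv_by c (pconv (indexed_pmult p i) q) = indexed_padd (indexed_padd (indexed_pmult (pconv (deriv_by c p) q) i)
      (indexed_pmult (pconv p (deriv_by c q)) i)) (pscale (c i) (pconv p q))"
    unfolding pconv_pmult[OF indexed_pmult(1) q] deriv_by_pmult[OF pconv_closed[OF indexed_pmult(1) q] indexed_pmult(2) c]
      indexed_pmult(3) pmult_padd ..
  also have "\<dots> = indexed_padd (indexed_padd (indexed_pmult (pconv (deriv_by c p) q) i) (pscale (c i) (pconv p q)))
      (indexed_pmult (pconv p (deriv_by c q)) i)"
    by (rule padd_rearrange(2)[OF cl2 cl2(1)])
  also have "\<dots> = indexed_padd (pconv (deriv_by c (indexed_pmult p i)) q) (pconv (indexed_pmult p i) (deriv_by c q))"
    unfolding deriv_by_pmult[OF indexed_pmult(1,2) c]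
      pconv_padd[OF indexed_pmult_closed[OF cl(2) indexed_pmult(2)] pscale_closed[OF indexed_pmult(1) ci] q]
      pconv_pmult[OF cl(2) q] pconv_pmult[OF indexed_pmult(1) cl(1)] sc ..
  finally show ?case .
qed

text \<open>\<open>deriv_by (unit_coord b)\<close> is the partial derivative with respect to the
  variable \<open>b\<close>.\<close>

definition unit_coord :: "'i \<Rightarrow> 'i \<Rightarrow> 'a"
  where "unit_coord b j = (if j = b then \<one> else \<zero>)"

lemma unit_coord_closed [simp]: "unit_coord b \<in> I \<rightarrow> carrier R"
  by (auto simp: unit_coord_def)

lemma deriv_by_unit_coord:
  assumes p: "p \<in> polys I" and b: "b \<in> I"
  shows "deriv_by (unit_coord b) p v = [Suc (count v b)] \<cdot> p (add_mset b v)"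
proof -
  let ?W = "insert b {i. p (add_mset i v) \<noteq> \<zero>}"
  have W: "finite ?W" "?W \<subseteq> I" using deriv_by_finite[OF p] deriv_by_subset[OF p, of v] b by auto
  have "deriv_by (unit_coord b) p v = (\<Oplus>i\<in>?W. [Suc (count v i)] \<cdot> (unit_coord b i \<otimes> p (add_mset i v)))"
    by (rule deriv_by_superset[OF p unit_coord_closed W(1) _ W(2)]) blast
  also have "\<dots> = (\<Oplus>i\<in>?W. if i = b then [Suc (count v b)] \<cdot> p (add_mset b v) else \<zero>)"
    using polys_coeff[OF p]
    by (intro finsum_cong' refl funcsetI) (auto simp: unit_coord_def)
  also have "\<dots> = [Suc (count v b)] \<cdot> p (add_mset b v)"
    by (rule add.finprod_singleton_swap[OF _ W(1)]) (use polys_coeff[OF p] in auto)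
  finally show ?thesis .
qed

lemma deriv_by_lform:
  assumes c: "\<And>i. c i \<in> carrier R" "finite {i. c i \<noteq> \<zero>}" "{i. c i \<noteq> \<zero>} \<subseteq> I" and b: "b \<in> I"
  shows "deriv_by (unit_coord b) (lform c) = indexed_const (c b)"
proof
  fix v
  show "deriv_by (unit_coord b) (lform c) v = indexed_const (c b) v"
    unfolding deriv_by_unit_coord[OF lform_closed[OF c] b]
    by (cases "v = {#}") (use c(1)[of b] in \<open>simp_all add: indexed_const_def lform_not_single\<close>)
qed

text \<open>Chain rule for the substitution of linear forms: the partial derivative of
  \<open>lform (c x)\<close> at \<open>b\<close> is the scalar \<open>c x b\<close>. Differentiation
  after the substitution thus becomes differentiation of \<open>p\<close> along the coordinate
  functional \<open>b\<close>.\<close>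

lemma peval_deriv_by:
  assumes c: "\<And>x b. x \<in> I \<Longrightarrow> c x b \<in> carrier R" "\<And>x. x \<in> I \<Longrightarrow> finite {b. c x b \<noteq> \<zero>}"
      "\<And>x. x \<in> I \<Longrightarrow> {b. c x b \<noteq> \<zero>} \<subseteq> J"
    and b: "b \<in> J" and p: "p \<in> polys I"
  shows "peval J (\<lambda>x. lform (c x)) (deriv_by (\<lambda>x. c x b) p) = deriv_by (unit_coord b) (peval J (\<lambda>x. lform (c x)) p)"
proof -
  have l: "(\<lambda>x. lform (c x)) \<in> I \<rightarrow> polys J" by (intro funcsetI lform_closed c)
  have cb: "(\<lambda>x. c x b) \<in> I \<rightarrow> carrier R" using c(1) by blast
  let ?E = "peval J (\<lambda>x. lform (c x))"
  have Ec: "?E p \<in> polys J" if "p \<in> polys I" for p by (rule peval_closed[OF that l])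
  from p show ?thesis
  proof (induction rule: indexed_pset.induct)
    case (indexed_const k)
    then show ?case by (simp add: deriv_by_const peval_const)
  next
    case (indexed_padd p q)
    then show ?case using deriv_by_closed[OF _ cb] Ec
      by (simp add: deriv_by_padd[OF _ _ cb] peval_padd[OF l] deriv_by_padd[of _ J])
  next
    case (indexed_pmult p x)
    have cx: "c x b \<in> carrier R" by (rule c(1)[OF indexed_pmult(2)])
    have dp: "deriv_by (\<lambda>x. c x b) p \<in> polys I" by (rule deriv_by_closed[OF indexed_pmult(1) cb])
    have lx: "lform (c x) \<in> polys J" using l indexed_pmult(2) by blast
    have dE: "deriv_by (unit_coord b) (?E p) \<in> polys J" by (rule deriv_by_closed[OF Ec[OF indexed_pmult(1)]]) simp
    have "?E (deriv_by (\<lambda>x. c x b) (indexed_pmult p x))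
        = indexed_padd (pconv (lform (c x)) (deriv_by (unit_coord b) (?E p))) (pscale (c x b) (?E p))"
      unfolding deriv_by_pmult[OF indexed_pmult(1,2) cb]
        peval_padd[OF l indexed_pmult_closed[OF dp indexed_pmult(2)] pscale_closed[OF indexed_pmult(1) cx]]
        peval_pmult[OF l dp indexed_pmult(2)] peval_pscale[OF l indexed_pmult(1) cx] indexed_pmult(3) ..
    also have "\<dots> = indexed_padd (pscale (c x b) (?E p)) (pconv (lform (c x)) (deriv_by (unit_coord b) (?E p)))"
      using polys_coeff[OF pconv_closed[OF lx dE]] polys_coeff[OF pscale_closed[OF Ec[OF indexed_pmult(1)] cx]]
      by (auto simp: indexed_padd_def fun_eq_iff a_comm)
    also have "\<dots> = deriv_by (unit_coord b) (pconv (lform (c x)) (?E p))"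
      unfolding deriv_by_pconv[OF lx Ec[OF indexed_pmult(1)] unit_coord_closed]
        deriv_by_lform[OF c(1)[OF indexed_pmult(2)] c(2)[OF indexed_pmult(2)] c(3)[OF indexed_pmult(2)] b]
        pconv_const[OF cx Ec[OF indexed_pmult(1)]] ..
    also have "\<dots> = deriv_by (unit_coord b) (?E (indexed_pmult p x))"
      unfolding peval_pmult[OF l indexed_pmult(1,2)] ..
    finally show ?case .
  qed
qed

text \<open>Linear forms have no constant term. Iterated derivatives can therefore be compared
  before and after the substitution at \<open>{#}\<close>; reading off constant coefficients takes
  the place of a restriction to homogeneous polynomials.\<close>

lemma peval_lform_const_coeff:
  assumes c: "\<And>x b. x \<in> I \<Longrightarrow> c x b \<in> carrier R" "\<And>x. x \<in> I \<Longrightarrow> finite {b. c x b \<noteq> \<zero>}"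
      "\<And>x. x \<in> I \<Longrightarrow> {b. c x b \<noteq> \<zero>} \<subseteq> J"
    and p: "p \<in> polys I"
  shows "peval J (\<lambda>x. lform (c x)) p {#} = p {#}"
proof -
  have l: "(\<lambda>x. lform (c x)) \<in> I \<rightarrow> polys J" by (intro funcsetI lform_closed c)
  from p show ?thesis
  proof (induction rule: indexed_pset.induct)
    case (indexed_const k)
    then show ?case by (simp add: peval_const) (simp add: indexed_const_def)
  next
    case (indexed_padd p q)
    then show ?case by (simp add: peval_padd[OF l]) (simp add: indexed_padd_def)
  next
    case (indexed_pmult p x)
    have q: "peval J (\<lambda>x. lform (c x)) p {#} \<in> carrier R"
      by (rule polys_coeff[OF peval_closed[OF indexed_pmult(1) l]])
    have "pconv (lform (c x)) (peval J (\<lambda>x. lform (c x)) p) {#} = \<zero>"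
      using q by (simp add: pconv_def lform_not_single)
    then show ?case unfolding peval_pmult[OF l indexed_pmult(1,2)] by (simp add: indexed_pmult_def)
  qed
qed

section \<open>Iterated derivatives and the exchange of functionals\<close>

abbreviation derivs :: "('i \<Rightarrow> 'a) list \<Rightarrow> ('i multiset \<Rightarrow> 'a) \<Rightarrow> 'i multiset \<Rightarrow> 'a"
  where "derivs cs p \<equiv> foldr deriv_by cs p"

lemma derivs_closed:
  assumes "p \<in> polys I" "set cs \<subseteq> I \<rightarrow> carrier R"
  shows "derivs cs p \<in> polys I"
  using assms(2) by (induction cs) (use assms(1) deriv_by_closed in auto)

lemma derivs_commute:
  assumes p: "p \<in> polys I" and cs: "set cs \<subseteq> I \<rightarrow> carrier R" and d: "d \<in> I \<rightarrow> carrier R"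
  shows "derivs cs (deriv_by d p) = deriv_by d (derivs cs p)"
  using cs
proof (induction cs)
  case (Cons c cs)
  then have c: "c \<in> I \<rightarrow> carrier R" and cs: "set cs \<subseteq> I \<rightarrow> carrier R" by auto
  show ?case using Cons.IH[OF cs] deriv_by_commute[OF derivs_closed[OF p cs] c d] by simp
qed simp

text \<open>\<open>x\<close> is the linear part of \<open>p\<close> with each variable read as the
  element of \<open>M\<close> that names it. One derivation, taken at the constant coefficient, sees
  nothing else.\<close>

lemma deriv_by_const_coeff:
  assumes M: "module R M" and p: "p \<in> polys (carrier M)"
  obtains x where "x \<in> carrier M" "\<And>f. f \<in> linear_maps R M (self_module R) \<Longrightarrow> deriv_by f p {#} = f x"
proof -
  interpret M: module R M by (rule M)
  let ?W = "{i. p (add_mset i {#}) \<noteq> \<zero>}"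
  have W: "finite ?W" "?W \<subseteq> carrier M" using deriv_by_finite[OF p] deriv_by_subset[OF p] by auto
  let ?x = "\<Oplus>\<^bsub>M\<^esub>i\<in>?W. p {#i#} \<odot>\<^bsub>M\<^esub> i"
  have iM: "p {#i#} \<odot>\<^bsub>M\<^esub> i \<in> carrier M" "i \<in> carrier M" if "i \<in> ?W" for i
    using W(2) that polys_coeff[OF p] by auto
  have "deriv_by f p {#} = f ?x" if f: "f \<in> linear_maps R M (self_module R)" for f
  proof -
    have fR: "f i \<in> carrier R" if "i \<in> carrier M" for i using linear_mapsD(1)[OF f that] by simp
    have "f ?x = (\<Oplus>i\<in>?W. f (p {#i#} \<odot>\<^bsub>M\<^esub> i))"
      using linear_map_finsum[OF M self_module_module f, of "\<lambda>i. p {#i#} \<odot>\<^bsub>M\<^esub> i" ?W] iM by (simp add: Pi_iff)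
    also have "\<dots> = (\<Oplus>i\<in>?W. [Suc (count {#} i)] \<cdot> (f i \<otimes> p (add_mset i {#})))"
    proof (intro finsum_cong' refl funcsetI)
      fix i assume i: "i \<in> ?W"
      have c: "f i \<in> carrier R" "p {#i#} \<in> carrier R" using fR[OF iM(2)[OF i]] polys_coeff[OF p] by auto
      show "[Suc (count {#} i)] \<cdot> (f i \<otimes> p (add_mset i {#})) \<in> carrier R" using c by simp
      show "f (p {#i#} \<odot>\<^bsub>M\<^esub> i) = [Suc (count {#} i)] \<cdot> (f i \<otimes> p (add_mset i {#}))"
        using linear_mapsD(3)[OF f c(2) iM(2)[OF i]] c by (simp add: m_comm)
    qed
    finally show ?thesis by (simp add: deriv_by_def)
  qed
  moreover have "?x \<in> carrier M" using iM by (intro M.M.finsum_closed) auto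
  ultimately show thesis using that by blast
qed

text \<open>The functionals of a family with trivial joint kernel are exchanged for arbitrary ones one at a
  time: after all other derivations have been applied, the linear part of the polynomial is an
  element of \<open>M\<close>, and it is killed by the whole family.\<close>

lemma derivs_exchange:
  assumes M: "module R M" and \<Phi>: "\<Phi> \<subseteq> linear_maps R M (self_module R)"
    and inj: "\<And>x. x \<in> carrier M \<Longrightarrow> (\<And>f. f \<in> \<Phi> \<Longrightarrow> f x = \<zero>) \<Longrightarrow> x = \<zero>\<^bsub>M\<^esub>"
    and p: "p \<in> polys (carrier M)" and zero: "\<And>fs. set fs \<subseteq> \<Phi> \<Longrightarrow> derivs fs p {#} = \<zero>"
    and gs: "set gs \<subseteq> linear_maps R M (self_module R)"
  shows "derivs gs p {#} = \<zero>"
  using gs p zero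
proof (induction gs arbitrary: p)
  case Nil
  then show ?case using Nil(3)[of "[]"] by simp
next
  case (Cons g gs)
  have lin: "f \<in> carrier M \<rightarrow> carrier R" if "f \<in> linear_maps R M (self_module R)" for f
    using linear_mapsD(1)[OF that] by auto
  have g: "g \<in> linear_maps R M (self_module R)" and gs: "set gs \<subseteq> linear_maps R M (self_module R)"
    using Cons(2) by auto
  have gsc: "set gs \<subseteq> carrier M \<rightarrow> carrier R" using gs lin by blast
  \<comment> \<open>\<open>g\<close> is moved innermost, so that the induction hypothesis, which is
    general in \<open>p\<close>, applies to \<open>deriv_by g p\<close>. What remains is its
    vanishing along lists from the family alone.\<close>
  have "derivs gs (deriv_by g p) {#} = \<zero>"
  proof (rule Cons.IH[OF gs deriv_by_closed[OF Cons(3) lin[OF g]]])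
    fix fs assume fs: "set fs \<subseteq> \<Phi>"
    have fsc: "set fs \<subseteq> carrier M \<rightarrow> carrier R" using fs \<Phi> lin by blast
    let ?r = "derivs fs p"
    have r: "?r \<in> polys (carrier M)" by (rule derivs_closed[OF Cons(3) fsc])
    obtain x where x: "x \<in> carrier M" and rx: "\<And>f. f \<in> linear_maps R M (self_module R) \<Longrightarrow> deriv_by f ?r {#} = f x"
      using deriv_by_const_coeff[OF M r] by metis
    have "x = \<zero>\<^bsub>M\<^esub>"
    proof (rule inj[OF x])
      fix f assume f: "f \<in> \<Phi>"
      then have "f x = derivs (f # fs) p {#}" using rx \<Phi> by auto
      also have "\<dots> = \<zero>" by (rule Cons(4)) (use f fs in simp)
      finally show "f x = \<zero>" .
    qed
    then have "deriv_by g ?r {#} = \<zero>" using rx[OF g] linear_map_zero[OF M self_module_module g] by simp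
    then show "derivs fs (deriv_by g p) {#} = \<zero>" using derivs_commute[OF Cons(3) fsc lin[OF g]] by simp
  qed
  then show ?case using derivs_commute[OF Cons(3) gsc lin[OF g]] by simp
qed

lemma torsion_free_nat:
  assumes "torsion_free_over_int R" "x \<in> carrier R" "[Suc n] \<cdot> x = \<zero>"
  shows "x = \<zero>"
proof -
  have "[int (Suc n)] \<cdot> x = \<zero>"
    using assms(3) by (simp only: add_pow_int_ge[OF of_nat_0_le_iff] nat_int)
  moreover have "int (Suc n) \<noteq> 0" by simp
  ultimately show ?thesis using assms(1,2) unfolding torsion_free_over_int_def by blast
qed

text \<open>Taylor coefficients: each variable \<open>b\<close> stripped from the monomial costs the
  factor \<open>Suc (count v b)\<close>, and torsion freeness cancels it. Only iterated partial
  derivatives at the constant coefficient are left in the end.\<close>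

lemma eq_zero_by_derivs:
  assumes tf: "torsion_free_over_int R" and q: "q \<in> polys J"
    and zero: "\<And>bs. set bs \<subseteq> J \<Longrightarrow> derivs (map unit_coord bs) q {#} = \<zero>"
  shows "q v = \<zero>"
  using q zero
proof (induction v arbitrary: q)
  case empty
  then show ?case using empty(2)[of "[]"] by simp
next
  case (add b v)
  show ?case
  proof (rule ccontr)
    assume nz: "q (add_mset b v) \<noteq> \<zero>"
    then have b: "b \<in> J" using polys_support[OF add(2)] by fastforce
    have "deriv_by (unit_coord b) q v = \<zero>"
    proof (rule add.IH)
      show "deriv_by (unit_coord b) q \<in> polys J" by (rule deriv_by_closed[OF add(2)]) simp
      fix bs assume "set bs \<subseteq> J"
      then show "derivs (map unit_coord bs) (deriv_by (unit_coord b) q) {#} = \<zero>"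
        using add(3)[of "bs @ [b]"] b by simp
    qed
    then have "[Suc (count v b)] \<cdot> q (add_mset b v) = \<zero>" using deriv_by_unit_coord[OF add(2) b] by simp
    then show False using torsion_free_nat[OF tf polys_coeff[OF add(2)]] nz by blast
  qed
qed

lemma peval_derivs:
  assumes c: "\<And>x b. x \<in> I \<Longrightarrow> c x b \<in> carrier R" "\<And>x. x \<in> I \<Longrightarrow> finite {b. c x b \<noteq> \<zero>}"
      "\<And>x. x \<in> I \<Longrightarrow> {b. c x b \<noteq> \<zero>} \<subseteq> J"
    and bs: "set bs \<subseteq> J" and p: "p \<in> polys I"
  shows "peval J (\<lambda>x. lform (c x)) (derivs (map (\<lambda>b x. c x b) bs) p)
    = derivs (map unit_coord bs) (peval J (\<lambda>x. lform (c x)) p)"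
  using bs
proof (induction bs)
  case (Cons b bs)
  then have b: "b \<in> J" and bs: "set bs \<subseteq> J" by auto
  have "set (map (\<lambda>b x. c x b) bs) \<subseteq> I \<rightarrow> carrier R" using c(1) by auto
  then have dp: "derivs (map (\<lambda>b x. c x b) bs) p \<in> polys I" by (rule derivs_closed[OF p])
  show ?case
    using peval_deriv_by[OF c b dp] Cons.IH[OF bs] by simp
qed simp

text \<open>The chain rule turns the hypothesis into the vanishing of all iterated derivatives of
  \<open>p\<close> along the functionals given by \<open>c\<close>. The exchange lemma passes to
  those given by \<open>d\<close>, and the chain rule leads back.\<close>

lemma torsion_free_peval_zero:
  fixes c :: "'m \<Rightarrow> 'j \<Rightarrow> 'a" and d :: "'m \<Rightarrow> 'k \<Rightarrow> 'a"
  assumes tf: "torsion_free_over_int R" and M: "module R M"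
    and c: "\<And>x. x \<in> carrier M \<Longrightarrow> finite {b. c x b \<noteq> \<zero>}" "\<And>x. x \<in> carrier M \<Longrightarrow> {b. c x b \<noteq> \<zero>} \<subseteq> J"
      "\<And>b. (\<lambda>x. c x b) \<in> linear_maps R M (self_module R)"
    and d: "\<And>x. x \<in> carrier M \<Longrightarrow> finite {b. d x b \<noteq> \<zero>}" "\<And>x. x \<in> carrier M \<Longrightarrow> {b. d x b \<noteq> \<zero>} \<subseteq> K"
      "\<And>b. (\<lambda>x. d x b) \<in> linear_maps R M (self_module R)"
    and inj: "\<And>x. x \<in> carrier M \<Longrightarrow> (\<And>b. c x b = \<zero>) \<Longrightarrow> x = \<zero>\<^bsub>M\<^esub>"
    and p: "p \<in> polys (carrier M)" and zero: "peval J (\<lambda>x. lform (c x)) p = indexed_const \<zero>"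
  shows "peval K (\<lambda>x. lform (d x)) p v = \<zero>"
proof -
  have cR: "c x b \<in> carrier R" if "x \<in> carrier M" for x b using linear_mapsD(1)[OF c(3) that] by simp
  have dR: "d x b \<in> carrier R" if "x \<in> carrier M" for x b using linear_mapsD(1)[OF d(3) that] by simp
  have ld: "(\<lambda>x. lform (d x)) \<in> carrier M \<rightarrow> polys K" by (intro funcsetI lform_closed dR d(1,2))
  let ?\<Phi> = "(\<lambda>b x. c x b) ` J"
  have dz: "derivs cs (indexed_const \<zero>) = indexed_const \<zero>" for cs :: "('j \<Rightarrow> 'a) list"
    by (induction cs) (simp_all add: deriv_by_const)
  have all: "derivs gs p {#} = \<zero>" if gs: "set gs \<subseteq> linear_maps R M (self_module R)" for gs
  proof (rule derivs_exchange[OF M _ _ p _ gs])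
    show "?\<Phi> \<subseteq> linear_maps R M (self_module R)" using c(3) by blast
    show "x = \<zero>\<^bsub>M\<^esub>" if x: "x \<in> carrier M" and "\<And>f. f \<in> ?\<Phi> \<Longrightarrow> f x = \<zero>" for x
    proof (rule inj[OF x])
      show "c x b = \<zero>" for b using that(2)[of "\<lambda>x. c x b"] c(2)[OF x] by (cases "b \<in> J") auto
    qed
    fix fs assume "set fs \<subseteq> ?\<Phi>"
    then have "fs \<in> lists ?\<Phi>" by (intro in_listsI) blast
    then obtain bs where bs: "set bs \<subseteq> J" "fs = map (\<lambda>b x. c x b) bs"
      unfolding lists_image by (elim imageE) (simp add: lists_eq_set)
    have "set fs \<subseteq> carrier M \<rightarrow> carrier R" using cR unfolding bs(2) by auto
    then have q: "derivs fs p \<in> polys (carrier M)" by (rule derivs_closed[OF p])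
    have "derivs fs p {#} = peval J (\<lambda>x. lform (c x)) (derivs fs p) {#}"
      by (rule peval_lform_const_coeff[OF cR c(1,2) q, symmetric])
    also have "peval J (\<lambda>x. lform (c x)) (derivs fs p) = derivs (map unit_coord bs) (peval J (\<lambda>x. lform (c x)) p)"
      unfolding bs(2) by (intro peval_derivs[of "carrier M"] cR c(1,2) bs(1) p)
    also have "\<dots> {#} = \<zero>" unfolding zero dz by (simp add: indexed_const_def)
    finally show "derivs fs p {#} = \<zero>" .
  qed
  show ?thesis
  proof (rule eq_zero_by_derivs[OF tf peval_closed[OF p ld]])
    fix bs assume bs: "set bs \<subseteq> K"
    have gs: "set (map (\<lambda>b x. d x b) bs) \<subseteq> linear_maps R M (self_module R)" using d(3) by auto
    have "set (map (\<lambda>b x. d x b) bs) \<subseteq> carrier M \<rightarrow> carrier R" using dR by auto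
    then have dp: "derivs (map (\<lambda>b x. d x b) bs) p \<in> polys (carrier M)" by (rule derivs_closed[OF p])
    have eq: "peval K (\<lambda>x. lform (d x)) (derivs (map (\<lambda>b x. d x b) bs) p)
        = derivs (map unit_coord bs) (peval K (\<lambda>x. lform (d x)) p)"
      by (intro peval_derivs[of "carrier M"] dR d(1,2) bs p)
    have "derivs (map unit_coord bs) (peval K (\<lambda>x. lform (d x)) p) {#}
        = peval K (\<lambda>x. lform (d x)) (derivs (map (\<lambda>b x. d x b) bs) p) {#}"
      by (simp only: eq)
    also have "\<dots> = derivs (map (\<lambda>b x. d x b) bs) p {#}" by (rule peval_lform_const_coeff[OF dR d(1,2) dp])
    also have "\<dots> = \<zero>" by (rule all[OF gs])
    finally show "derivs (map unit_coord bs) (peval K (\<lambda>x. lform (d x)) p) {#} = \<zero>" .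
  qed
qed

end

section \<open>Free modules of finite rank carried by functions\<close>

context cring
begin

text \<open>The copy of a free module with basis indexed by a finite \<open>I\<close> on the type
  over which the intersection ranges. The value zero outside \<open>I\<close> makes equality in the
  module equality of functions.\<close>

definition function_module :: "'i set \<Rightarrow> ('a, 'i \<Rightarrow> 'a) module"
  where "function_module I = \<lparr>carrier = {f. (\<forall>i\<in>I. f i \<in> carrier R) \<and> (\<forall>i. i \<notin> I \<longrightarrow> f i = \<zero>)},
    monoid.mult = undefined, one = undefined, ring.zero = (\<lambda>_. \<zero>),
    ring.add = (\<lambda>f g i. f i \<oplus> g i), smult = (\<lambda>r f i. r \<otimes> f i)\<rparr>"

lemma function_module_simps:
  "f \<in> carrier (function_module I) \<longleftrightarrow> (\<forall>i\<in>I. f i \<in> carrier R) \<and> (\<forall>i. i \<notin> I \<longrightarrow> f i = \<zero>)"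
  "\<zero>\<^bsub>function_module I\<^esub> = (\<lambda>_. \<zero>)"
  "f \<oplus>\<^bsub>function_module I\<^esub> g = (\<lambda>i. f i \<oplus> g i)"
  "r \<odot>\<^bsub>function_module I\<^esub> f = (\<lambda>i. r \<otimes> f i)"
  by (auto simp: function_module_def)

lemma function_module_coeff: "f \<in> carrier (function_module I) \<Longrightarrow> f i \<in> carrier R"
  by (cases "i \<in> I") (auto simp: function_module_simps)

lemma function_module_module:
  fixes I :: "'i set"
  shows "module R (function_module I)"
proof (rule moduleI[OF is_cring])
  show "abelian_group (function_module I)"
  proof (rule abelian_groupI)
    fix f assume f: "f \<in> carrier (function_module I)"
    show "\<exists>g\<in>carrier (function_module I). g \<oplus>\<^bsub>function_module I\<^esub> f = \<zero>\<^bsub>function_module I\<^esub>"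
      using f function_module_coeff[OF f]
      by (intro bexI[of _ "\<lambda>i. \<ominus> f i"]) (auto simp: function_module_simps l_neg)
  next
    fix f g h :: "'i \<Rightarrow> 'a"
    assume fg: "f \<in> carrier (function_module I)" "g \<in> carrier (function_module I)"
    show "f \<oplus>\<^bsub>function_module I\<^esub> g = g \<oplus>\<^bsub>function_module I\<^esub> f"
      using fg[THEN function_module_coeff] by (simp add: function_module_simps a_comm)
    assume h: "h \<in> carrier (function_module I)"
    show "f \<oplus>\<^bsub>function_module I\<^esub> g \<oplus>\<^bsub>function_module I\<^esub> h = f \<oplus>\<^bsub>function_module I\<^esub> (g \<oplus>\<^bsub>function_module I\<^esub> h)"
      using fg[THEN function_module_coeff] function_module_coeff[OF h]
      by (simp add: function_module_simps a_assoc)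
  next
    fix f assume f: "f \<in> carrier (function_module I)"
    show "\<zero>\<^bsub>function_module I\<^esub> \<oplus>\<^bsub>function_module I\<^esub> f = f"
      using function_module_coeff[OF f] by (simp add: function_module_simps)
  qed (auto simp: function_module_simps)
next
  fix f :: "'i \<Rightarrow> 'a" assume f: "f \<in> carrier (function_module I)"
  show "\<one> \<odot>\<^bsub>function_module I\<^esub> f = f"
    using function_module_coeff[OF f] by (simp add: function_module_simps)
next
  fix a b and f g :: "'i \<Rightarrow> 'a"
  assume a: "a \<in> carrier R" and f: "f \<in> carrier (function_module I)"
  note fc = function_module_coeff[OF f]
  show "a \<odot>\<^bsub>function_module I\<^esub> f \<in> carrier (function_module I)"
    using a f by (simp add: function_module_simps)
  show "(a \<oplus> b) \<odot>\<^bsub>function_module I\<^esub> f = a \<odot>\<^bsub>function_module I\<^esub> f \<oplus>\<^bsub>function_module I\<^esub> b \<odot>\<^bsub>function_module I\<^esub> f"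
    "(a \<otimes> b) \<odot>\<^bsub>function_module I\<^esub> f = a \<odot>\<^bsub>function_module I\<^esub> (b \<odot>\<^bsub>function_module I\<^esub> f)"
    if "b \<in> carrier R" using a that fc by (simp_all add: function_module_simps l_distr m_assoc)
  show "a \<odot>\<^bsub>function_module I\<^esub> (f \<oplus>\<^bsub>function_module I\<^esub> g) = a \<odot>\<^bsub>function_module I\<^esub> f \<oplus>\<^bsub>function_module I\<^esub> a \<odot>\<^bsub>function_module I\<^esub> g"
    if "g \<in> carrier (function_module I)"
    using a fc function_module_coeff[OF that] by (simp add: function_module_simps r_distr)
qed

lemma function_module_finsum:
  assumes "finite C" "m \<in> C \<rightarrow> carrier (function_module I)"
  shows "(\<Oplus>\<^bsub>function_module I\<^esub>b\<in>C. m b) i = (\<Oplus>b\<in>C. m b i)"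
  using assms
proof (induction C rule: finite_induct)
  case empty
  interpret F: module R "function_module I" by (rule function_module_module)
  show ?case by (simp add: function_module_simps)
next
  case (insert b C)
  interpret F: module R "function_module I" by (rule function_module_module)
  have c: "m b \<in> carrier (function_module I)" "m \<in> C \<rightarrow> carrier (function_module I)" using insert(4) by auto
  have ci: "(\<lambda>b. m b i) \<in> C \<rightarrow> carrier R"
    using c(2) by (intro funcsetI function_module_coeff) (rule funcset_mem)
  show ?case
    using F.M.finsum_insert[OF insert(1,2) c(2,1)] insert(3)[OF c(2)]
      finsum_insert[OF insert(1,2) ci function_module_coeff[OF c(1)]]
    by (simp add: function_module_simps)
qed

lemma function_module_free:
  fixes I :: "'i set"
  assumes I: "finite I"
  shows "free_module R (function_module I)"
proof (cases "\<one> = \<zero>")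
  \<comment> \<open>Over the zero ring the unit vectors are not told apart, so they cannot be
    indexed by \<open>I\<close>. The module is zero, and the empty set is a basis.\<close>
  case True
  interpret F: module R "function_module I" by (rule function_module_module)
  have R0: "carrier R = {\<zero>}" by (rule one_zeroD[OF True])
  have F0: "f = \<zero>\<^bsub>function_module I\<^esub>" if "f \<in> carrier (function_module I)" for f
    using function_module_coeff[OF that] R0 by (auto simp: function_module_simps)
  show ?thesis
    unfolding free_module_def
  proof (intro conjI exI[of _ "{}"] ballI)
    fix f assume "f \<in> carrier (function_module I)"
    then have f: "f = \<zero>\<^bsub>function_module I\<^esub>" by (rule F0)
    show "\<exists>!c. c \<in> {} \<rightarrow> carrier R \<and> (\<forall>b. b \<notin> {} \<longrightarrow> c b = \<zero>) \<and> finite {b \<in> {}. c b \<noteq> \<zero>} \<and>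
        f = (\<Oplus>\<^bsub>function_module I\<^esub>b\<in>{b \<in> {}. c b \<noteq> \<zero>}. c b \<odot>\<^bsub>function_module I\<^esub> b)"
      by (rule ex1I[of _ "\<lambda>_. \<zero>"]) (auto simp: f)
  qed (use function_module_module in auto)
next
  case False
  interpret F: module R "function_module I" by (rule function_module_module)
  define e where "e i j = (if j = i then \<one> else \<zero>)" for i j :: 'i
  have e_inj: "i = j" if "e i = e j" for i j
  proof (rule ccontr)
    assume "i \<noteq> j"
    then show False using fun_cong[OF that, of i] False by (simp add: e_def)
  qed
  let ?B = "e ` I"
  have B: "finite ?B" "?B \<subseteq> carrier (function_module I)"
    using I by (auto simp: function_module_simps e_def)
  have val: "b i = (if b = e i then \<one> else \<zero>)" if b: "b \<in> ?B" for b i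
  proof -
    from b obtain j where "b = e j" by blast
    then show ?thesis using e_inj[of j i] by (auto simp: e_def)
  qed
  have sum: "(\<Oplus>\<^bsub>function_module I\<^esub>b\<in>{b \<in> ?B. c b \<noteq> \<zero>}. c b \<odot>\<^bsub>function_module I\<^esub> b) i
      = (if i \<in> I then c (e i) else \<zero>)" if c: "c \<in> ?B \<rightarrow> carrier R" for c i
  proof -
    have cb: "c b \<in> carrier R" "b \<in> carrier (function_module I)" if "b \<in> ?B" for b using c B(2) that by auto
    have "(\<Oplus>\<^bsub>function_module I\<^esub>b\<in>{b \<in> ?B. c b \<noteq> \<zero>}. c b \<odot>\<^bsub>function_module I\<^esub> b)
        = (\<Oplus>\<^bsub>function_module I\<^esub>b\<in>?B. c b \<odot>\<^bsub>function_module I\<^esub> b)"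
      using B cb by (intro F.M.add.finprod_mono_neutral_cong_left) auto
    then have "(\<Oplus>\<^bsub>function_module I\<^esub>b\<in>{b \<in> ?B. c b \<noteq> \<zero>}. c b \<odot>\<^bsub>function_module I\<^esub> b) i
        = (\<Oplus>b\<in>?B. (c b \<odot>\<^bsub>function_module I\<^esub> b) i)"
      using function_module_finsum[OF B(1), of "\<lambda>b. c b \<odot>\<^bsub>function_module I\<^esub> b" I i] cb by simp
    also have "\<dots> = (\<Oplus>b\<in>?B. if b = e i then c b else \<zero>)"
    proof (intro finsum_cong' refl funcsetI)
      fix b assume b: "b \<in> ?B"
      show "(if b = e i then c b else \<zero>) \<in> carrier R" using cb(1)[OF b] by (cases "b = e i") simp_all
      show "(c b \<odot>\<^bsub>function_module I\<^esub> b) i = (if b = e i then c b else \<zero>)"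
        using cb(1)[OF b] val[OF b, of i] by (cases "b = e i") (simp_all add: function_module_simps)
    qed
    also have "\<dots> = (if i \<in> I then c (e i) else \<zero>)"
    proof (cases "i \<in> I")
      case True
      then have "(\<Oplus>b\<in>?B. if b = e i then c b else \<zero>) = c (e i)"
        using c B(1) by (intro add.finprod_singleton_swap) auto
      then show ?thesis using True by simp
    next
      case False
      then have "(\<Oplus>b\<in>?B. if b = e i then c b else \<zero>) = (\<Oplus>b\<in>?B. \<zero>)"
        using e_inj by (intro finsum_cong') auto
      then show ?thesis using False by simp
    qed
    finally show ?thesis .
  qed
  have unique: "\<exists>!c. c \<in> ?B \<rightarrow> carrier R \<and> (\<forall>b. b \<notin> ?B \<longrightarrow> c b = \<zero>) \<and> finite {b \<in> ?B. c b \<noteq> \<zero>} \<and>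
        f = (\<Oplus>\<^bsub>function_module I\<^esub>b\<in>{b \<in> ?B. c b \<noteq> \<zero>}. c b \<odot>\<^bsub>function_module I\<^esub> b)"
    if f: "f \<in> carrier (function_module I)" for f
  proof -
    let ?c = "\<lambda>b. if b \<in> ?B then f (inv_into I e b) else \<zero>"
    have inv: "inv_into I e (e i) = i" if "i \<in> I" for i
      using that e_inj by (intro inv_into_f_f) (auto simp: inj_on_def)
    show ?thesis
    proof (rule ex1I[of _ ?c])
      have c: "?c \<in> ?B \<rightarrow> carrier R" using function_module_coeff[OF f] by auto
      have "f i = (\<Oplus>\<^bsub>function_module I\<^esub>b\<in>{b \<in> ?B. ?c b \<noteq> \<zero>}. ?c b \<odot>\<^bsub>function_module I\<^esub> b) i" for i
        unfolding sum[OF c] using f inv by (auto simp: function_module_simps)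
      then have "f = (\<Oplus>\<^bsub>function_module I\<^esub>b\<in>{b \<in> ?B. ?c b \<noteq> \<zero>}. ?c b \<odot>\<^bsub>function_module I\<^esub> b)"
        by (rule ext)
      moreover have "finite {b \<in> ?B. ?c b \<noteq> \<zero>}" using B(1) by simp
      moreover have "\<forall>b. b \<notin> ?B \<longrightarrow> ?c b = \<zero>" by simp
      ultimately show "?c \<in> ?B \<rightarrow> carrier R \<and> (\<forall>b. b \<notin> ?B \<longrightarrow> ?c b = \<zero>) \<and> finite {b \<in> ?B. ?c b \<noteq> \<zero>} \<and>
        f = (\<Oplus>\<^bsub>function_module I\<^esub>b\<in>{b \<in> ?B. ?c b \<noteq> \<zero>}. ?c b \<odot>\<^bsub>function_module I\<^esub> b)"
        using c by (intro conjI)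
    next
      fix c assume c: "c \<in> ?B \<rightarrow> carrier R \<and> (\<forall>b. b \<notin> ?B \<longrightarrow> c b = \<zero>) \<and> finite {b \<in> ?B. c b \<noteq> \<zero>} \<and>
        f = (\<Oplus>\<^bsub>function_module I\<^esub>b\<in>{b \<in> ?B. c b \<noteq> \<zero>}. c b \<odot>\<^bsub>function_module I\<^esub> b)"
      have "c b = ?c b" for b
      proof (cases "b \<in> ?B")
        case True
        then obtain i where i: "i \<in> I" "b = e i" by blast
        have cB: "c \<in> ?B \<rightarrow> carrier R" using c by blast
        have "f i = (\<Oplus>\<^bsub>function_module I\<^esub>b\<in>{b \<in> ?B. c b \<noteq> \<zero>}. c b \<odot>\<^bsub>function_module I\<^esub> b) i"
          using c by (elim conjE) (rule fun_cong)
        also have "\<dots> = c (e i)" unfolding sum[OF cB] using i by simp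
        finally show ?thesis using i inv[OF i(1)] by simp
      next
        case False
        then show ?thesis using c by simp
      qed
      then show "c = ?c" by (rule ext)
    qed
  qed
  show ?thesis
    unfolding free_module_def
    by (intro conjI exI[of _ ?B] ballI function_module_module B(2) unique)
qed

section \<open>Comparison of kernels\<close>

lemma rename_rename:
  assumes "p \<in> polys I" "g \<in> I \<rightarrow> J"
  shows "rename_variables R k (rename_variables R g p) = rename_variables R (\<lambda>x. k (g x)) p"
  using assms(1)
proof (induction rule: indexed_pset.induct)
  case (indexed_const a)
  then show ?case by (simp add: rename_variables_const)
next
  case (indexed_padd p q)
  then show ?case
    using rename_variables_closed[OF _ assms(2)]
    by (simp add: rename_variables_padd[of _ I] rename_variables_padd[of _ J])
next
  case (indexed_pmult p i)
  then show ?case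
    using rename_variables_closed[OF _ assms(2)]
    by (simp add: rename_variables_pmult[of _ I] rename_variables_pmult[of _ J])
qed

lemma rename_cong:
  assumes "p \<in> polys I" "\<And>i. i \<in> I \<Longrightarrow> g i = h i"
  shows "rename_variables R g p = rename_variables R h p"
  using assms(1)
  by (induction rule: indexed_pset.induct)
    (simp_all add: assms(2) rename_variables_const rename_variables_padd[of _ I] rename_variables_pmult[of _ I])

text \<open>Functoriality of \<open>Sym\<close>: a map that factors through \<open>h\<close> kills
  at least what \<open>h\<close> kills.\<close>

lemma rees_kernel_comp:
  assumes M: "module R M" and F: "module R F" and N: "module R N"
    and h: "h \<in> linear_maps R M F" and k: "k \<in> linear_maps R F N" and g: "g \<in> linear_maps R M N"
    and eq: "\<And>x. x \<in> carrier M \<Longrightarrow> k (h x) = g x"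
  shows "rees_kernel R M F h \<subseteq> rees_kernel R M N g"
proof
  fix Y assume Y: "Y \<in> rees_kernel R M F h"
  then have "Y \<in> carrier (Sym R M)" by (simp add: rees_kernel_def a_kernel_def')
  then obtain p where p: "p \<in> polys (carrier M)" "Y = sym_class M p" unfolding Sym_carrier by blast
  have hf: "h \<in> carrier M \<rightarrow> carrier F" using linear_mapsD(1)[OF h] by blast
  have "rename_variables R h p \<in> sym_ideal R F" using Y rees_kernel_iff[OF M F h p(1)] p(2) by simp
  then have "rename_variables R k (rename_variables R h p) \<in> sym_ideal R N"
    by (rule rename_sym_ideal[OF F N k])
  moreover have "rename_variables R (\<lambda>x. k (h x)) p = rename_variables R g p"
    by (rule rename_cong[OF p(1)]) (rule eq)
  ultimately have "rename_variables R g p \<in> sym_ideal R N"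
    using rename_rename[OF p(1) hf, of k] by simp
  then show "Y \<in> rees_kernel R M N g" using rees_kernel_iff[OF M N g p(1)] p(2) by simp
qed

lemma coord_linear:
  assumes N: "module_basis R N B" and g: "g \<in> linear_maps R M N"
  shows "(\<lambda>x. module_basis.coord R N B (g x) b) \<in> linear_maps R M (self_module R)"
proof -
  interpret N: module_basis R N B by (rule N)
  show ?thesis
    using linear_mapsD[OF g] by (simp add: linear_maps_def N.coord_add N.coord_smult)
qed

text \<open>A functional that vanishes on generators vanishes. So only the coordinates that occur on
  the finitely many generators occur at all, and the linear systems become finite.\<close>

lemma finite_coordinate_support:
  fixes c :: "'m \<Rightarrow> 'j \<Rightarrow> 'a"
  assumes fg: "finitely_generated_module R M"
    and c: "\<And>x. x \<in> carrier M \<Longrightarrow> finite {b. c x b \<noteq> \<zero>}" "\<And>x. x \<in> carrier M \<Longrightarrow> {b. c x b \<noteq> \<zero>} \<subseteq> J"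
      "\<And>b. (\<lambda>x. c x b) \<in> linear_maps R M (self_module R)"
  shows "\<exists>L. finite L \<and> L \<subseteq> J \<and> (\<forall>x\<in>carrier M. {b. c x b \<noteq> \<zero>} \<subseteq> L)"
proof -
  from fg obtain G where M: "module R M" and G: "finite G" "G \<subseteq> carrier M"
    "\<forall>x\<in>carrier M. \<exists>a\<in>G \<rightarrow> carrier R. x = (\<Oplus>\<^bsub>M\<^esub>b\<in>G. a b \<odot>\<^bsub>M\<^esub> b)"
    unfolding finitely_generated_module_def by blast
  let ?L = "\<Union>x\<in>G. {b. c x b \<noteq> \<zero>}"
  have "c x b = \<zero>" if x: "x \<in> carrier M" and b: "b \<notin> ?L" for x b
  proof (rule linear_maps_eqI[OF M self_module_module c(3) _ G(2,3) _ x])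
    show "(\<lambda>_. \<zero>) \<in> linear_maps R M (self_module R)" by (simp add: linear_maps_def)
    show "c y b = \<zero>" if "y \<in> G" for y using b that by blast
  qed
  then have "\<forall>x\<in>carrier M. {b. c x b \<noteq> \<zero>} \<subseteq> ?L" by blast
  moreover have "finite ?L" "?L \<subseteq> J" using G(1,2) c(1,2) by blast+
  ultimately show ?thesis by blast
qed

lemma finsum_lform:
  assumes C: "finite C" and K: "finite K" "K \<subseteq> J"
    and a: "a \<in> C \<rightarrow> carrier R" and e: "\<And>b j. b \<in> C \<Longrightarrow> e b j \<in> carrier R" "\<And>b. b \<in> C \<Longrightarrow> {j. e b j \<noteq> \<zero>} \<subseteq> K"
  shows "(\<Oplus>\<^bsub>polynomial_algebra R J\<^esub>b\<in>C. pscale (a b) (lform (e b))) = lform (\<lambda>j. \<Oplus>b\<in>C. a b \<otimes> e b j)"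
  using C a e
proof (induction C rule: finite_induct)
  case empty
  interpret P: cring "polynomial_algebra R J" by (rule polynomial_algebra_cring)
  show ?case by (simp add: lform_zero)
next
  case (insert b C)
  interpret P: cring "polynomial_algebra R J" by (rule polynomial_algebra_cring)
  have ab: "a x \<in> carrier R" if "x \<in> insert b C" for x using insert(4) that by blast
  have cl: "pscale (a x) (lform (e x)) \<in> carrier (polynomial_algebra R J)" if x: "x \<in> insert b C" for x
  proof -
    have "lform (e x) \<in> polys J"
      using insert(5)[OF x] finite_subset[OF insert(6)[OF x] K(1)] subset_trans[OF insert(6)[OF x] K(2)]
      by (rule lform_closed)
    then show ?thesis using ab[OF x] by simp
  qed
  have t: "a x \<otimes> e x j \<in> carrier R" if "x \<in> insert b C" for x j using ab[OF that] insert(5)[OF that] by simp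
  have "(\<Oplus>\<^bsub>polynomial_algebra R J\<^esub>x\<in>insert b C. pscale (a x) (lform (e x)))
      = indexed_padd (pscale (a b) (lform (e b))) (\<Oplus>\<^bsub>polynomial_algebra R J\<^esub>x\<in>C. pscale (a x) (lform (e x)))"
    using P.finsum_insert[OF insert(1,2), of "\<lambda>x. pscale (a x) (lform (e x))"] cl by simp
  also have "(\<Oplus>\<^bsub>polynomial_algebra R J\<^esub>x\<in>C. pscale (a x) (lform (e x))) = lform (\<lambda>j. \<Oplus>x\<in>C. a x \<otimes> e x j)"
    using insert(4-6) by (intro insert(3)) auto
  also have "indexed_padd (pscale (a b) (lform (e b))) \<dots> = lform (\<lambda>j. a b \<otimes> e b j \<oplus> (\<Oplus>x\<in>C. a x \<otimes> e x j))"
    using ab by (simp add: lform_pscale lform_add)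
  also have "(\<lambda>j. a b \<otimes> e b j \<oplus> (\<Oplus>x\<in>C. a x \<otimes> e x j)) = (\<lambda>j. \<Oplus>x\<in>insert b C. a x \<otimes> e x j)"
    using t by (intro ext finsum_insert[OF insert(1,2), symmetric]) auto
  finally show ?case .
qed

text \<open>The factorizations of the single functionals \<open>d x j\<close> come with their own
  factors \<open>t j\<close>. The product of these over the finite set \<open>K\<close> makes one
  substitution \<open>\<kappa>\<close> out of them, to which \<open>peval_factor\<close>
  applies.\<close>

lemma locally_factoring_peval_zero:
  fixes c :: "'m \<Rightarrow> 'j \<Rightarrow> 'a" and d :: "'m \<Rightarrow> 'k \<Rightarrow> 'a"
  assumes Q: "primeideal Q R" and L: "finite L" "L \<subseteq> J" and K: "finite K" "K \<subseteq> H"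
    and c: "\<And>x b. x \<in> I \<Longrightarrow> c x b \<in> carrier R" "\<And>x. x \<in> I \<Longrightarrow> {b. c x b \<noteq> \<zero>} \<subseteq> L"
    and d: "\<And>x b. x \<in> I \<Longrightarrow> d x b \<in> carrier R" "\<And>x. x \<in> I \<Longrightarrow> {b. d x b \<noteq> \<zero>} \<subseteq> K"
    and fac: "\<And>j. j \<in> K \<Longrightarrow> \<exists>t\<in>carrier R - Q. \<exists>k\<in>L \<rightarrow> carrier R. \<forall>x\<in>I. dot L k (c x) = t \<otimes> d x j"
    and p: "p \<in> polys I" and zero: "peval J (\<lambda>x. lform (c x)) p = indexed_const \<zero>"
  shows "\<exists>t\<in>carrier R - Q. t [^] size v \<otimes> peval H (\<lambda>x. lform (d x)) p v = \<zero>"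
proof -
  have "\<exists>t k. t \<in> carrier R - Q \<and> k \<in> L \<rightarrow> carrier R \<and> (\<forall>x\<in>I. dot L k (c x) = t \<otimes> d x j)" if "j \<in> K" for j
    using fac[OF that] by blast
  then have "\<forall>j\<in>K. \<exists>t k. t \<in> carrier R - Q \<and> k \<in> L \<rightarrow> carrier R \<and> (\<forall>x\<in>I. dot L k (c x) = t \<otimes> d x j)" by blast
  then obtain t where "\<forall>j\<in>K. \<exists>k. t j \<in> carrier R - Q \<and> k \<in> L \<rightarrow> carrier R \<and> (\<forall>x\<in>I. dot L k (c x) = t j \<otimes> d x j)"
    by (rule bchoice[THEN exE])
  then obtain k where tk: "\<forall>j\<in>K. t j \<in> carrier R - Q \<and> k j \<in> L \<rightarrow> carrier R \<and> (\<forall>x\<in>I. dot L (k j) (c x) = t j \<otimes> d x j)"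
    by (rule bchoice[THEN exE])
  let ?t = "finprod R t K"
  have tQ: "?t \<in> carrier R - Q" using tk by (intro finprod_not_in_prime[OF Q K(1)]) blast
  have tR: "?t \<in> carrier R" using tQ by blast
  \<comment> \<open>The cofactor of \<open>t j\<close> in the common factor \<open>?t\<close>; it
    rescales the coefficients of the \<open>j\<close>-th factorization.\<close>
  let ?u = "\<lambda>j. finprod R t (K - {j})"
  have u: "?u j \<in> carrier R" "?t = ?u j \<otimes> t j" if j: "j \<in> K" for j
  proof -
    have s: "t \<in> K - {j} \<rightarrow> carrier R" "t j \<in> carrier R" using tk j by blast+
    show uj: "?u j \<in> carrier R" by (rule finprod_closed[OF s(1)])
    have "?t = t j \<otimes> ?u j"
      using finprod_insert[of "K - {j}" j t] K(1) s j by (simp add: insert_absorb)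
    then show "?t = ?u j \<otimes> t j" using uj s(2) by (simp add: m_comm)
  qed
  \<comment> \<open>The matrix that expresses the multiples \<open>?t \<otimes> d x j\<close> by the
    \<open>c x b\<close>; row \<open>b\<close> becomes the linear form substituted for the variable
    \<open>b\<close>.\<close>
  define e where "e b j = (if j \<in> K then ?u j \<otimes> k j b else \<zero>)" for b j
  have kR: "k j b \<in> carrier R" if "j \<in> K" "b \<in> L" for j b using tk that by blast
  have eR: "e b j \<in> carrier R" if "b \<in> L" for b j using kR[OF _ that] u by (simp add: e_def)
  have eK: "{j. e b j \<noteq> \<zero>} \<subseteq> K" for b by (auto simp: e_def)
  have le: "lform (e b) \<in> polys H" if "b \<in> L" for b
    using eR[OF that] finite_subset[OF eK K(1)] subset_trans[OF eK K(2)] by (rule lform_closed)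
  define \<kappa> where "\<kappa> b = (if b \<in> L then lform (e b) else indexed_const \<zero>)" for b
  have \<kappa>: "\<kappa> \<in> J \<rightarrow> polys H" using le by (auto simp: \<kappa>_def)
  have eq: "(\<Oplus>\<^bsub>polynomial_algebra R H\<^esub>b\<in>{b. c x b \<noteq> \<zero>}. pscale (c x b) (\<kappa> b)) = pscale ?t (lform (d x))" if x: "x \<in> I" for x
  proof -
    interpret P: cring "polynomial_algebra R H" by (rule polynomial_algebra_cring)
    let ?C = "{b. c x b \<noteq> \<zero>}"
    have CL: "?C \<subseteq> L" and fC: "finite ?C" using c(2)[OF x] finite_subset L(1) by auto
    have "(\<Oplus>\<^bsub>polynomial_algebra R H\<^esub>b\<in>?C. pscale (c x b) (\<kappa> b)) = (\<Oplus>\<^bsub>polynomial_algebra R H\<^esub>b\<in>?C. pscale (c x b) (lform (e b)))"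
      using CL le c(1)[OF x] by (intro P.finsum_cong') (auto simp: \<kappa>_def)
    also have "\<dots> = lform (\<lambda>j. \<Oplus>b\<in>?C. c x b \<otimes> e b j)"
      using CL eR eK c(1)[OF x] by (intro finsum_lform[OF fC K]) auto
    also have "(\<lambda>j. \<Oplus>b\<in>?C. c x b \<otimes> e b j) = (\<lambda>j. ?t \<otimes> d x j)"
    proof
      fix j
      show "(\<Oplus>b\<in>?C. c x b \<otimes> e b j) = ?t \<otimes> d x j"
      proof (cases "j \<in> K")
        case True
        have kj: "k j \<in> L \<rightarrow> carrier R" using tk True by blast
        have cx: "c x \<in> L \<rightarrow> carrier R" using c(1)[OF x] by blast
        have tj: "t j \<in> carrier R" using tk True by blast
        have "(\<Oplus>b\<in>?C. c x b \<otimes> e b j) = (\<Oplus>b\<in>L. c x b \<otimes> e b j)"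
          using CL L(1) eR c(1)[OF x] by (intro add.finprod_mono_neutral_cong_left) auto
        also have "\<dots> = (\<Oplus>b\<in>L. (?u j \<otimes> k j b) \<otimes> c x b)"
          using True kR u(1) c(1)[OF x] by (intro finsum_cong') (auto simp: e_def m_comm)
        also have "\<dots> = ?u j \<otimes> dot L (k j) (c x)"
          using dot_scale_left[OF L(1) kj cx u(1)[OF True]] by (simp add: dot_def)
        also have "dot L (k j) (c x) = t j \<otimes> d x j" using tk True x by blast
        also have "?u j \<otimes> (t j \<otimes> d x j) = ?t \<otimes> d x j"
          unfolding u(2)[OF True] by (rule m_assoc[symmetric, OF u(1)[OF True] tj d(1)[OF x]])
        finally show ?thesis .
      next
        case False
        then have "d x j = \<zero>" using d(2)[OF x] by blast
        moreover have "(\<Oplus>b\<in>?C. c x b \<otimes> e b j) = (\<Oplus>b\<in>?C. \<zero>)"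
          using False c(1)[OF x] by (intro finsum_cong') (auto simp: e_def)
        ultimately show ?thesis using tR by simp
      qed
    qed
    also have "lform (\<lambda>j. ?t \<otimes> d x j) = pscale ?t (lform (d x))" by (rule lform_pscale[symmetric, OF tR])
    finally show ?thesis .
  qed
  have "?t [^] size v \<otimes> peval H (\<lambda>x. lform (d x)) p v = \<zero>"
  proof (rule peval_factor[OF c(1) _ _ d(1) _ _ tR \<kappa> eq p zero])
    fix x assume x: "x \<in> I"
    show "finite {b. c x b \<noteq> \<zero>}" "{b. c x b \<noteq> \<zero>} \<subseteq> J" "finite {b. d x b \<noteq> \<zero>}" "{b. d x b \<noteq> \<zero>} \<subseteq> H"
      using c(2)[OF x] d(2)[OF x] L K finite_subset by blast+
  qed
  with tQ show ?thesis by blast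
qed

lemma associated_prime_factors:
  fixes M :: "('a, 'm, 's) module_scheme"
  assumes fg: "finitely_generated_module R M" and Q: "associated_prime R Q"
    and hyp: "unmixed R \<and> generically_gorenstein TYPE('e) R
      \<or> (\<forall>Q. associated_prime R Q \<longrightarrow> free_module (ring_at R Q) (module_at R Q M))"
    and L: "finite L" and f: "\<And>l. l \<in> L \<Longrightarrow> f l \<in> linear_maps R M (self_module R)"
    and inj: "\<And>x. x \<in> carrier M \<Longrightarrow> (\<And>l. l \<in> L \<Longrightarrow> f l x = \<zero>) \<Longrightarrow> x = \<zero>\<^bsub>M\<^esub>"
    and g: "g \<in> linear_maps R M (self_module R)"
  shows "\<exists>t\<in>carrier R - Q. \<exists>k\<in>L \<rightarrow> carrier R. \<forall>x\<in>carrier M. dot L k (\<lambda>l. f l x) = t \<otimes> g x"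
  using hyp
proof (elim disjE conjE)
  assume "unmixed R" "generically_gorenstein TYPE('e) R"
  then have min: "minimal_prime R Q" and gor: "gorenstein_local_ring TYPE('e) (ring_at R Q)"
    using Q by (auto simp: unmixed_def generically_gorenstein_def)
  show ?thesis by (rule gorenstein_localization_factors[OF fg Q min gor L f inj g])
next
  assume "\<forall>Q. associated_prime R Q \<longrightarrow> free_module (ring_at R Q) (module_at R Q M)"
  then have free: "free_module (ring_at R Q) (module_at R Q M)" using Q by blast
  show ?thesis by (rule free_localization_factors[OF fg Q free L f inj g])
qed

text \<open>Injectivity of \<open>g\<close> enters as \<open>c_inj\<close>: the coordinate
  functionals of \<open>g\<close> have trivial joint kernel on \<open>M\<close>.\<close>

lemma rees_kernel_embedding_minimal:
  fixes M :: "('a, 'm, 's) module_scheme"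
  assumes noeth: "noetherian_ring R" and fg: "finitely_generated_module R M"
    and hyp: "torsion_free_over_int R
      \<or> unmixed R \<and> generically_gorenstein TYPE('e) R
      \<or> (\<forall>Q. associated_prime R Q \<longrightarrow> free_module (ring_at R Q) (module_at R Q M))"
    and G: "free_module R G" and g: "g \<in> linear_maps R M G" and g_inj: "inj_on g (carrier M)"
    and F: "free_module R F" and h: "h \<in> linear_maps R M F"
  shows "rees_kernel R M G g \<subseteq> rees_kernel R M F h"
proof
  fix Y assume Y: "Y \<in> rees_kernel R M G g"
  have M: "module R M" using fg by (simp add: finitely_generated_module_def)
  interpret M: module R M by (rule M)
  obtain B where "module_basis R G B" using free_module_basis[OF G] by blast
  then interpret G: module_basis R G B .
  obtain B' where "module_basis R F B'" using free_module_basis[OF F] by blast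
  then interpret F: module_basis R F B' .
  from Y have "Y \<in> carrier (Sym R M)" by (simp add: rees_kernel_def a_kernel_def')
  then obtain p where p: "p \<in> polys (carrier M)" "Y = sym_class M p" unfolding Sym_carrier by blast
  let ?c = "\<lambda>x. G.coord (g x)" and ?d = "\<lambda>x. F.coord (h x)"
  let ?E = "peval (carrier F) (\<lambda>x. lform (?d x)) p"
  have gG: "g x \<in> carrier G" and hF: "h x \<in> carrier F" if "x \<in> carrier M" for x
    using linear_mapsD(1)[OF g that] linear_mapsD(1)[OF h that] by auto
  have zero: "peval (carrier G) (\<lambda>x. lform (?c x)) p = indexed_const \<zero>"
    using Y rees_kernel_free_iff[OF M G.module_basis_axioms g p(1)] p(2) by simp
  have c: "finite {b. ?c x b \<noteq> \<zero>}" "{b. ?c x b \<noteq> \<zero>} \<subseteq> carrier G" "?c x b \<in> carrier R" if "x \<in> carrier M" for x b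
    using G.coord_finite[OF gG[OF that]] G.coord_support_subset[OF gG[OF that]] G.basis_subset
      G.coord_closed[OF gG[OF that]] by auto
  have d: "finite {b. ?d x b \<noteq> \<zero>}" "{b. ?d x b \<noteq> \<zero>} \<subseteq> carrier F" "?d x b \<in> carrier R" if "x \<in> carrier M" for x b
    using F.coord_finite[OF hF[OF that]] F.coord_support_subset[OF hF[OF that]] F.basis_subset
      F.coord_closed[OF hF[OF that]] by auto
  have c_lin: "(\<lambda>x. ?c x b) \<in> linear_maps R M (self_module R)" for b
    by (rule coord_linear[OF G.module_basis_axioms g])
  have d_lin: "(\<lambda>x. ?d x b) \<in> linear_maps R M (self_module R)" for b
    by (rule coord_linear[OF F.module_basis_axioms h])
  have c_inj: "x = \<zero>\<^bsub>M\<^esub>" if x: "x \<in> carrier M" and z: "\<And>b. ?c x b = \<zero>" for x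
  proof -
    have "G.coord \<zero>\<^bsub>G\<^esub> b = \<zero>" for b
      using linear_mapsD(3)[OF c_lin zero_closed M.M.zero_closed] linear_map_zero[OF M G.module_axioms g]
        c(3)[OF M.M.zero_closed, of b] by simp
    then have "g x = g \<zero>\<^bsub>M\<^esub>"
      unfolding linear_map_zero[OF M G.module_axioms g]
      using z by (intro G.coord_inject gG x) simp_all
    then show ?thesis by (rule inj_onD[OF g_inj]) (use x in simp_all)
  qed
  have E: "?E \<in> polys (carrier F)"
    by (intro peval_closed[OF p(1)] funcsetI lform_closed d)
  have "?E v = \<zero>" for v
  \<comment> \<open>Torsion freeness permits a global argument. Otherwise \<open>hyp\<close> leaves
    the two local hypotheses, which share everything from here on except the factorization at an
    associated prime.\<close>
  proof (cases "torsion_free_over_int R")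
    case True
    show ?thesis
      by (rule torsion_free_peval_zero[OF True M c(1,2) c_lin d(1,2) d_lin c_inj p(1) zero])
  next
    case False
    obtain L where L: "finite L" "L \<subseteq> carrier G" and cL: "\<forall>x\<in>carrier M. {b. ?c x b \<noteq> \<zero>} \<subseteq> L"
      using finite_coordinate_support[OF fg c(1,2) c_lin] by blast
    obtain K where K: "finite K" "K \<subseteq> carrier F" and dK: "\<forall>x\<in>carrier M. {b. ?d x b \<noteq> \<zero>} \<subseteq> K"
      using finite_coordinate_support[OF fg d(1,2) d_lin] by blast
    have L_inj: "x = \<zero>\<^bsub>M\<^esub>" if x: "x \<in> carrier M" and z: "\<And>l. l \<in> L \<Longrightarrow> ?c x l = \<zero>" for x
    proof (rule c_inj[OF x])
      show "?c x b = \<zero>" for b using z[of b] cL x by blast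
    qed
    show ?thesis
    proof (rule eq_zero_by_associated_primes[OF noeth polys_coeff[OF E]])
      fix Q assume Q: "associated_prime R Q"
      then have prime: "primeideal Q R" by (simp add: associated_prime_def)
      have fac: "\<exists>t\<in>carrier R - Q. \<exists>k\<in>L \<rightarrow> carrier R. \<forall>x\<in>carrier M. dot L k (?c x) = t \<otimes> ?d x j" for j
      proof (rule associated_prime_factors[where f = "\<lambda>l x. ?c x l" and g = "\<lambda>x. ?d x j", OF fg Q _ L(1)])
        show "unmixed R \<and> generically_gorenstein TYPE('e) R
            \<or> (\<forall>Q. associated_prime R Q \<longrightarrow> free_module (ring_at R Q) (module_at R Q M))"
          using hyp False by blast
      qed (rule c_lin L_inj d_lin; assumption)+
      have "\<exists>t\<in>carrier R - Q. t [^] size v \<otimes> ?E v = \<zero>"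
        using cL dK by (intro locally_factoring_peval_zero[OF prime L K c(3) _ d(3) _ fac p(1) zero]) blast+
      then show "\<exists>t\<in>carrier R - Q. \<exists>n :: nat. t [^] n \<otimes> ?E v = \<zero>" by blast
    qed
  qed
  then have "?E = indexed_const \<zero>" unfolding indexed_zero_def by (rule ext)
  then show "Y \<in> rees_kernel R M F h"
    using rees_kernel_free_iff[OF M F.module_basis_axioms h p(1)] p(2) by simp
qed

text \<open>A finitely generated module maps into a finite part of a basis, so the free modules carried by
  functions on an infinite type suffice.\<close>

lemma rees_kernel_function_module:
  fixes M :: "('a, 'm, 's) module_scheme" and G :: "('a, 'g, 't) module_scheme"
  assumes fg: "finitely_generated_module R M" and G: "free_module R G" and g: "g \<in> linear_maps R M G"
  shows "\<exists>(I :: 'i::infinite set) h. finite I \<and> h \<in> linear_maps R M (function_module I) \<and>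
    rees_kernel R M (function_module I) h \<subseteq> rees_kernel R M G g"
proof -
  have M: "module R M" using fg by (simp add: finitely_generated_module_def)
  interpret M: module R M by (rule M)
  obtain B where "module_basis R G B" using free_module_basis[OF G] by blast
  then interpret G: module_basis R G B .
  let ?c = "\<lambda>x. G.coord (g x)"
  have gG: "g x \<in> carrier G" if "x \<in> carrier M" for x using linear_mapsD(1)[OF g that] .
  have c_lin: "(\<lambda>x. ?c x b) \<in> linear_maps R M (self_module R)" for b
    by (rule coord_linear[OF G.module_basis_axioms g])
  have cR: "?c x b \<in> carrier R" if "x \<in> carrier M" for x b using G.coord_closed[OF gG[OF that]] .
  obtain L where L: "finite L" "L \<subseteq> B" and cL: "\<forall>x\<in>carrier M. {b. ?c x b \<noteq> \<zero>} \<subseteq> L"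
    using finite_coordinate_support[OF fg G.coord_finite[OF gG] G.coord_support_subset[OF gG] c_lin] by blast
  have LG: "b \<in> carrier G" if "b \<in> L" for b using that L(2) G.basis_subset by blast
  \<comment> \<open>Labels the finitely many relevant basis elements by elements of
    \<open>'i\<close>, which is possible because \<open>'i\<close> is infinite.\<close>
  obtain e :: "'g \<Rightarrow> 'i" where e: "inj_on e L" using arb_inj_on_finite_infinite[OF L(1)] by blast
  let ?I = "e ` L" and ?b = "inv_into L e"
  have I: "finite ?I" using L(1) by simp
  have be: "?b (e l) = l" if "l \<in> L" for l using e that by simp
  let ?F = "function_module ?I"
  interpret F: module R ?F by (rule function_module_module)
  define h where "h x i = (if i \<in> ?I then ?c x (?b i) else \<zero>)" for x i
  have h: "h \<in> linear_maps R M ?F"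
    unfolding linear_maps_def using cR linear_mapsD(2,3)[OF c_lin]
    by (auto simp: h_def function_module_simps fun_eq_iff)
  \<comment> \<open>Sends the labelled unit vectors back to the basis elements, so that
    \<open>g\<close> is \<open>h\<close> followed by \<open>k\<close>.\<close>
  define k where "k f = (\<Oplus>\<^bsub>G\<^esub>l\<in>L. f (e l) \<odot>\<^bsub>G\<^esub> l)" for f
  have fc: "f i \<in> carrier R" if "f \<in> carrier ?F" for f i by (rule function_module_coeff[OF that])
  have k: "k \<in> linear_maps R ?F G"
    unfolding linear_maps_def
  proof (intro CollectI conjI ballI funcsetI)
    fix f assume f: "f \<in> carrier ?F"
    show "k f \<in> carrier G" unfolding k_def using fc[OF f] LG by (intro G.M.finsum_closed) auto
    show "k (f \<oplus>\<^bsub>?F\<^esub> f') = k f \<oplus>\<^bsub>G\<^esub> k f'" if f': "f' \<in> carrier ?F" for f'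
    proof -
      have "k (f \<oplus>\<^bsub>?F\<^esub> f') = (\<Oplus>\<^bsub>G\<^esub>l\<in>L. f (e l) \<odot>\<^bsub>G\<^esub> l \<oplus>\<^bsub>G\<^esub> f' (e l) \<odot>\<^bsub>G\<^esub> l)"
        unfolding k_def function_module_simps using fc[OF f] fc[OF f'] LG
        by (intro G.M.finsum_cong') (auto simp: G.smult_l_distr)
      also have "\<dots> = k f \<oplus>\<^bsub>G\<^esub> k f'"
        unfolding k_def using fc[OF f] fc[OF f'] LG by (intro G.M.finsum_addf) auto
      finally show ?thesis .
    qed
    show "k (r \<odot>\<^bsub>?F\<^esub> f) = r \<odot>\<^bsub>G\<^esub> k f" if r: "r \<in> carrier R" for r
    proof -
      have "k (r \<odot>\<^bsub>?F\<^esub> f) = (\<Oplus>\<^bsub>G\<^esub>l\<in>L. r \<odot>\<^bsub>G\<^esub> (f (e l) \<odot>\<^bsub>G\<^esub> l))"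
        unfolding k_def function_module_simps using fc[OF f] LG r
        by (intro G.M.finsum_cong') (auto simp: G.smult_assoc1)
      also have "\<dots> = r \<odot>\<^bsub>G\<^esub> k f"
        unfolding k_def using fc[OF f] LG r L(1) by (intro G.finsum_smult_ldistr[symmetric]) auto
      finally show ?thesis .
    qed
  qed
  have kh: "k (h x) = g x" if x: "x \<in> carrier M" for x
  proof -
    have "k (h x) = (\<Oplus>\<^bsub>G\<^esub>l\<in>L. ?c x l \<odot>\<^bsub>G\<^esub> l)"
      unfolding k_def using be cR[OF x] LG by (intro G.M.finsum_cong') (auto simp: h_def)
    also have "\<dots> = g x" using G.coord_sum[OF gG[OF x] L] cL x by simp
    finally show ?thesis .
  qed
  have "rees_kernel R M ?F h \<subseteq> rees_kernel R M G g"
    by (rule rees_kernel_comp[OF M F.module_axioms G.module_axioms h k g]) (rule kh)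
  with I h show ?thesis by blast
qed

end

theorem theorem0p2:
  fixes R :: "('a, 'r) ring_scheme"
    and M :: "('a, 'm, 's) module_scheme"
    and G :: "('a, 'g, 't) module_scheme"
    and g :: "'m \<Rightarrow> 'g"
  assumes "cring R" and "noetherian_ring R"
    and "module R M" and "finitely_generated_module R M"
    and "torsion_free_over_int R
      \<or> unmixed R \<and> generically_gorenstein TYPE('e) R
      \<or> (\<forall>Q. associated_prime R Q \<longrightarrow> free_module (ring_at R Q) (module_at R Q M))"
    and "free_module R G"
    and "g \<in> linear_maps R M G" and "inj_on g (carrier M)"
  shows "graded_algebra_isos R (rees_algebra TYPE('i::infinite \<Rightarrow> 'a) R M) (rees_algebra_map R M G g) \<noteq> {}"
proof -
  interpret cring R by fact
  let ?K = "{rees_kernel R M F h | (F :: ('a, 'i \<Rightarrow> 'a) module) h. free_module R F \<and> h \<in> linear_maps R M F}"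
  have G: "module R G" using assms(6) by (simp add: free_module_def)
  \<comment> \<open>The kernel of \<open>Sym(g)\<close> itself need not be listed in
    \<open>?K\<close>, since \<open>G\<close> may live on another type; a smaller kernel that is
    listed suffices.\<close>
  obtain I :: "'i set" and h where I: "finite I" and h: "h \<in> linear_maps R M (function_module I)"
    and sub: "rees_kernel R M (function_module I) h \<subseteq> rees_kernel R M G g"
    using rees_kernel_function_module[OF assms(4,6,7)] by blast
  have "rees_kernel R M (function_module I) h \<in> ?K" using function_module_free[OF I] h by blast
  then have "\<Inter>?K \<subseteq> rees_kernel R M G g" using sub by blast
  moreover have "rees_kernel R M G g \<subseteq> \<Inter>?K"
  proof (rule Inter_greatest)
    fix L assume "L \<in> ?K"
    then obtain F :: "('a, 'i \<Rightarrow> 'a) module" and h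
      where "L = rees_kernel R M F h" "free_module R F" "h \<in> linear_maps R M F" by blast
    then show "rees_kernel R M G g \<subseteq> L"
      using rees_kernel_embedding_minimal[OF assms(2,4,5,6,7,8)] by simp
  qed
  ultimately have "\<Inter>?K = rees_kernel R M G g" by (rule subset_antisym)
  then show ?thesis
    unfolding rees_algebra_def using rees_kernel_iso[OF assms(3) G assms(7)] by auto
qed
end
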